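(* Let $(A,\Delta)$ be an algebraic quantum group with non-zero left invariant functional $\varphi$ and modular element $\delta$, and let $(X,\alpha)$ be a right $A$-Galois object. Then there exists a faithful $\delta$-invariant functional $\varphi_X$ on $X$ such that $(\iota\otimes\varphi)(\alpha(x))=\varphi_X(x)1$ for all $x\in X$.
   Context: Conventions: $k$ is a field; all algebras are $k$-algebras, non-zero, possibly without unit, and non-degenerate ($ab=0$ for all $b$ implies $a=0$, and $ab=0$ for all $a$ implies $b=0$). $M(X)$ is the multiplier algebra of $X$, with $X\subseteq M(X)$ and $k=k\cdot 1\subseteq M(X)$; $\otimes$ is over $k$; $\iota$ is the identity map; homomorphism means algebra homomorphism, and functionals are linear. A regular multiplier Hopf algebra is a pair $(A,\Delta)$ with $A$ an algebra and $\Delta:A\to M(A\otimes A)$ a coassociative homomorphism which is non-degenerate ($\Delta(A)(A\otimes A)=A\otimes A=(A\otimes A)\Delta(A)$) and such that the maps sending $a\otimes b$ to $\Delta(a)(1\otimes b)$, $(a\otimes 1)\Delta(b)$, $\Delta(a)(b\otimes 1)$, $(1\otimes a)\Delta(b)$ are all bijections of $A\otimes A$ onto $A\otimes A$; it has a unique counit $\varepsilon$ and a unique antipode $S$. An algebraic quantum group is a regular multiplier Hopf algebra with a non-zero functional $\varphi$ (left invariant functional; it is faithful and unique up to scalar) such that $(\iota\otimes\varphi)(\Delta(a)(b\otimes 1))=\varphi(a)b$ for all $a,b\in A$. Its modular element is the multiplier $\delta\in M(A)$ with $(\varphi\otimes\iota)(\Delta(a)(1\otimes b))=\varphi(a)\delta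 b$ and $(\varphi\otimes\iota)((1\otimes b)\Delta(a))=\varphi(a)b\delta$. A right coaction of $A$ on an algebra $X$ is an injective homomorphism $\alpha:X\to M(X\otimes A)$ with $\alpha(X)(1\otimes A)\subseteq X\otimes A$, $(1\otimes A)\alpha(X)\subseteq X\otimes A$ and $(\alpha\otimes\iota)\alpha=(\iota\otimes\Delta)\alpha$; it extends canonically to $M(X)\to M(X\otimes A)$. It is reduced if also $(X\otimes 1)\alpha(X)\subseteq X\otimes A$ (then also $\alpha(X)(X\otimes 1)\subseteq X\otimes A$). The coinvariants are the $f\in M(X)$ with $\alpha(f)=f\otimes 1$. $(X,\alpha)$ is a right $A$-Galois object if $\alpha$ is a reduced right coaction, the algebra of coinvariants is $k$, and $V:X\otimes X\to X\otimes A$, $x\otimes y\mapsto (x\otimes 1)\alpha(y)$, is bijective. For a functional $\omega$ on $X$, $(\omega\otimes\iota)\alpha(x)$ is interpreted as a multiplier of $A$; similarly $(\iota\otimes\varphi)(\alpha(x))$ is interpreted as a multiplier of $X$. $\omega$ is $\delta$-invariant if $(\omega\otimes\iota)\alpha(x)=\omega(x)\delta$ for all $x\in X$. $\omega$ is faithful if $\omega(xy)=0$ for all $y$ implies $x=0$, and $\omega(yx)=0$ for all $y$ implies $x=0$. *)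

theory Defs
  imports "HOL-Algebra.Module" "HOL-Algebra.QuotRing"
begin

section \<open>Algebras without unit\<close>

text \<open>
  An algebra over \<open>K\<close> is a record of the library type \<open>module\<close>. Its \<open>one\<close> field carries no
  meaning: no axiom mentions it, so algebras need not have a unit.
\<close>

locale nonunital_algebra = field K + module K X
  for K (structure) and X (structure) +
  assumes amult_closed:
      "\<lbrakk>x \<in> carrier X; y \<in> carrier X\<rbrakk> \<Longrightarrow> x \<otimes>\<^bsub>X\<^esub> y \<in> carrier X"
    and amult_assoc:
      "\<lbrakk>x \<in> carrier X; y \<in> carrier X; z \<in> carrier X\<rbrakk> \<Longrightarrow>
        (x \<otimes>\<^bsub>X\<^esub> y) \<otimes>\<^bsub>X\<^esub> z = x \<otimes>\<^bsub>X\<^esub> (y \<otimes>\<^bsub>X\<^esub> z)"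
    and amult_l_distr:
      "\<lbrakk>x \<in> carrier X; y \<in> carrier X; z \<in> carrier X\<rbrakk> \<Longrightarrow>
        (x \<oplus>\<^bsub>X\<^esub> y) \<otimes>\<^bsub>X\<^esub> z = x \<otimes>\<^bsub>X\<^esub> z \<oplus>\<^bsub>X\<^esub> y \<otimes>\<^bsub>X\<^esub> z"
    and amult_r_distr:
      "\<lbrakk>x \<in> carrier X; y \<in> carrier X; z \<in> carrier X\<rbrakk> \<Longrightarrow>
        x \<otimes>\<^bsub>X\<^esub> (y \<oplus>\<^bsub>X\<^esub> z) = x \<otimes>\<^bsub>X\<^esub> y \<oplus>\<^bsub>X\<^esub> x \<otimes>\<^bsub>X\<^esub> z"
    and amult_smult_l:
      "\<lbrakk>c \<in> carrier K; x \<in> carrier X; y \<in> carrier X\<rbrakk> \<Longrightarrow>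
        (c \<odot>\<^bsub>X\<^esub> x) \<otimes>\<^bsub>X\<^esub> y = c \<odot>\<^bsub>X\<^esub> (x \<otimes>\<^bsub>X\<^esub> y)"
    and amult_smult_r:
      "\<lbrakk>c \<in> carrier K; x \<in> carrier X; y \<in> carrier X\<rbrakk> \<Longrightarrow>
        x \<otimes>\<^bsub>X\<^esub> (c \<odot>\<^bsub>X\<^esub> y) = c \<odot>\<^bsub>X\<^esub> (x \<otimes>\<^bsub>X\<^esub> y)"

locale nondegenerate_algebra = nonunital_algebra +
  assumes nonzero: "carrier X \<noteq> {\<zero>\<^bsub>X\<^esub>}"
    and nondegenerate_l:
      "\<lbrakk>x \<in> carrier X; \<And>y. y \<in> carrier X \<Longrightarrow> x \<otimes>\<^bsub>X\<^esub> y = \<zero>\<^bsub>X\<^esub>\<rbrakk> \<Longrightarrow> x = \<zero>\<^bsub>X\<^esub>"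
    and nondegenerate_r:
      "\<lbrakk>y \<in> carrier X; \<And>x. x \<in> carrier X \<Longrightarrow> x \<otimes>\<^bsub>X\<^esub> y = \<zero>\<^bsub>X\<^esub>\<rbrakk> \<Longrightarrow> y = \<zero>\<^bsub>X\<^esub>"

definition linear_map ::
  "('k, 'r) ring_scheme \<Rightarrow> ('k, 'v, 'm) module_scheme \<Rightarrow> ('k, 'w, 'n) module_scheme \<Rightarrow> ('v \<Rightarrow> 'w) set"
  where "linear_map K V W =
    {f \<in> carrier V \<rightarrow> carrier W.
      (\<forall>x\<in>carrier V. \<forall>y\<in>carrier V. f (x \<oplus>\<^bsub>V\<^esub> y) = f x \<oplus>\<^bsub>W\<^esub> f y) \<and>
      (\<forall>c\<in>carrier K. \<forall>x\<in>carrier V. f (c \<odot>\<^bsub>V\<^esub> x) = c \<odot>\<^bsub>W\<^esub> f x)}"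

definition algebra_hom ::
  "('k, 'r) ring_scheme \<Rightarrow> ('k, 'v, 'm) module_scheme \<Rightarrow> ('k, 'w, 'n) module_scheme \<Rightarrow> ('v \<Rightarrow> 'w) set"
  where "algebra_hom K X Y =
    {f \<in> linear_map K X Y.
      \<forall>x\<in>carrier X. \<forall>y\<in>carrier X. f (x \<otimes>\<^bsub>X\<^esub> y) = f x \<otimes>\<^bsub>Y\<^esub> f y}"

definition linear_functional ::
  "('k, 'r) ring_scheme \<Rightarrow> ('k, 'v, 'm) module_scheme \<Rightarrow> ('v \<Rightarrow> 'k) set"
  where "linear_functional K V =
    {f \<in> carrier V \<rightarrow> carrier K.
      (\<forall>x\<in>carrier V. \<forall>y\<in>carrier V. f (x \<oplus>\<^bsub>V\<^esub> y) = f x \<oplus>\<^bsub>K\<^esub> f y) \<and>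
      (\<forall>c\<in>carrier K. \<forall>x\<in>carrier V. f (c \<odot>\<^bsub>V\<^esub> x) = c \<otimes>\<^bsub>K\<^esub> f x)}"

definition faithful_functional ::
  "('k, 'r) ring_scheme \<Rightarrow> ('k, 'x, 'm) module_scheme \<Rightarrow> ('x \<Rightarrow> 'k) \<Rightarrow> bool"
  where "faithful_functional K X f \<longleftrightarrow>
    (\<forall>x\<in>carrier X. (\<forall>y\<in>carrier X. f (x \<otimes>\<^bsub>X\<^esub> y) = \<zero>\<^bsub>K\<^esub>) \<longrightarrow> x = \<zero>\<^bsub>X\<^esub>) \<and>
    (\<forall>x\<in>carrier X. (\<forall>y\<in>carrier X. f (y \<otimes>\<^bsub>X\<^esub> x) = \<zero>\<^bsub>K\<^esub>) \<longrightarrow> x = \<zero>\<^bsub>X\<^esub>)"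

definition linear_span ::
  "('k, 'r) ring_scheme \<Rightarrow> ('k, 'v, 'm) module_scheme \<Rightarrow> 'v set \<Rightarrow> 'v set"
  where "linear_span K V S = \<Inter>{N. submodule N K V \<and> S \<subseteq> N}"


section \<open>Tensor products\<close>

definition singleton_fun :: "('k, 'r) ring_scheme \<Rightarrow> 's \<Rightarrow> 's \<Rightarrow> 'k"
  where "singleton_fun K s = (\<lambda>t. if t = s then \<one>\<^bsub>K\<^esub> else \<zero>\<^bsub>K\<^esub>)"

text \<open>
  The free \<open>K\<close>-module on the underlying set of \<open>G\<close>, with the convolution product.
\<close>

definition semigroup_algebra ::
  "('k, 'r) ring_scheme \<Rightarrow> ('s, 'm) monoid_scheme \<Rightarrow> ('k, 's \<Rightarrow> 'k) module"
  where "semigroup_algebra K G =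
    \<lparr>carrier = {f. f \<in> carrier G \<rightarrow> carrier K \<and> (\<forall>s. s \<notin> carrier G \<longrightarrow> f s = \<zero>\<^bsub>K\<^esub>) \<and>
                   finite {s. f s \<noteq> \<zero>\<^bsub>K\<^esub>}},
     mult = (\<lambda>f g s. \<Oplus>\<^bsub>K\<^esub>p\<in>{(q, r). f q \<noteq> \<zero>\<^bsub>K\<^esub> \<and> g r \<noteq> \<zero>\<^bsub>K\<^esub> \<and> q \<otimes>\<^bsub>G\<^esub> r = s}.
                        f (fst p) \<otimes>\<^bsub>K\<^esub> g (snd p)),
     one = singleton_fun K \<one>\<^bsub>G\<^esub>,
     zero = (\<lambda>s. \<zero>\<^bsub>K\<^esub>),
     add = (\<lambda>f g s. f s \<oplus>\<^bsub>K\<^esub> g s),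
     smult = (\<lambda>c f s. c \<otimes>\<^bsub>K\<^esub> f s)\<rparr>"

definition tensor_relations ::
  "('k, 'r) ring_scheme \<Rightarrow> ('k, 'x, 'm) module_scheme \<Rightarrow> ('k, 'y, 'n) module_scheme \<Rightarrow>
    ('x \<times> 'y \<Rightarrow> 'k) set"
  where "tensor_relations K X Y =
    (let F = semigroup_algebra K (X \<times>\<times> Y); e = (\<lambda>x y. singleton_fun K (x, y)) in
     linear_span K F
      ({e (x \<oplus>\<^bsub>X\<^esub> x') y \<ominus>\<^bsub>F\<^esub> (e x y \<oplus>\<^bsub>F\<^esub> e x' y) | x x' y.
          x \<in> carrier X \<and> x' \<in> carrier X \<and> y \<in> carrier Y} \<union>
       {e x (y \<oplus>\<^bsub>Y\<^esub> y') \<ominus>\<^bsub>F\<^esub> (e x y \<oplus>\<^bsub>F\<^esub> e x y') | x y y'.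
          x \<in> carrier X \<and> y \<in> carrier Y \<and> y' \<in> carrier Y} \<union>
       {e (c \<odot>\<^bsub>X\<^esub> x) y \<ominus>\<^bsub>F\<^esub> c \<odot>\<^bsub>F\<^esub> e x y | c x y.
          c \<in> carrier K \<and> x \<in> carrier X \<and> y \<in> carrier Y} \<union>
       {e x (c \<odot>\<^bsub>Y\<^esub> y) \<ominus>\<^bsub>F\<^esub> c \<odot>\<^bsub>F\<^esub> e x y | c x y.
          c \<in> carrier K \<and> x \<in> carrier X \<and> y \<in> carrier Y}))"

definition tensor ::
  "('k, 'r) ring_scheme \<Rightarrow> ('k, 'x, 'm) module_scheme \<Rightarrow> ('k, 'y, 'n) module_scheme \<Rightarrow>
    ('k, ('x \<times> 'y \<Rightarrow> 'k) set) module"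
  where "tensor K X Y =
    (let F = semigroup_algebra K (X \<times>\<times> Y); N = tensor_relations K X Y in
     \<lparr>carrier = a_rcosets\<^bsub>F\<^esub> N,
      mult = rcoset_mult F N,
      one = N +>\<^bsub>F\<^esub> \<one>\<^bsub>F\<^esub>,
      zero = N,
      add = set_add F,
      smult = (\<lambda>c U. \<Union>u\<in>U. N +>\<^bsub>F\<^esub> (c \<odot>\<^bsub>F\<^esub> u))\<rparr>)"

definition tens ::
  "('k, 'r) ring_scheme \<Rightarrow> ('k, 'x, 'm) module_scheme \<Rightarrow> ('k, 'y, 'n) module_scheme \<Rightarrow>
    'x \<Rightarrow> 'y \<Rightarrow> ('x \<times> 'y \<Rightarrow> 'k) set"
  where "tens K X Y x y =
    tensor_relations K X Y +>\<^bsub>semigroup_algebra K (X \<times>\<times> Y)\<^esub> singleton_fun K (x, y)"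

text \<open>
  The linear map on the tensor product induced by a bilinear map \<open>b\<close>. For bilinear \<open>b\<close> the value
  does not depend on the choice of the representative \<open>u\<close>.
\<close>

definition tensor_lift ::
  "('k, 'r) ring_scheme \<Rightarrow> ('k, 'x, 'm) module_scheme \<Rightarrow> ('k, 'y, 'n) module_scheme \<Rightarrow>
    ('k, 'z, 'l) module_scheme \<Rightarrow> ('x \<Rightarrow> 'y \<Rightarrow> 'z) \<Rightarrow> ('x \<times> 'y \<Rightarrow> 'k) set \<Rightarrow> 'z"
  where "tensor_lift K X Y Z b =
    (\<lambda>U\<in>carrier (tensor K X Y).
      let u = (SOME u. u \<in> U) in
      \<Oplus>\<^bsub>Z\<^esub>p\<in>{p. u p \<noteq> \<zero>\<^bsub>K\<^esub>}. u p \<odot>\<^bsub>Z\<^esub> b (fst p) (snd p))"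

definition tensor_map ::
  "('k, 'r) ring_scheme \<Rightarrow> ('k, 'x, 'm) module_scheme \<Rightarrow> ('k, 'y, 'n) module_scheme \<Rightarrow>
    ('x \<Rightarrow> 'x) \<Rightarrow> ('y \<Rightarrow> 'y) \<Rightarrow> ('x \<times> 'y \<Rightarrow> 'k) set \<Rightarrow> ('x \<times> 'y \<Rightarrow> 'k) set"
  where "tensor_map K X Y f g =
    tensor_lift K X Y (tensor K X Y) (\<lambda>x y. tens K X Y (f x) (g y))"

definition tensor_assoc ::
  "('k, 'r) ring_scheme \<Rightarrow> ('k, 'x, 'm) module_scheme \<Rightarrow> ('k, 'y, 'n) module_scheme \<Rightarrow>
    ('k, 'z, 'l) module_scheme \<Rightarrow>
    ('x \<times> ('y \<times> 'z \<Rightarrow> 'k) set \<Rightarrow> 'k) set \<Rightarrow> (('x \<times> 'y \<Rightarrow> 'k) set \<times> 'z \<Rightarrow> 'k) set"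
  where "tensor_assoc K X Y Z =
    tensor_lift K X (tensor K Y Z) (tensor K (tensor K X Y) Z)
      (\<lambda>x. tensor_lift K Y Z (tensor K (tensor K X Y) Z)
        (\<lambda>y z. tens K (tensor K X Y) Z (tens K X Y x y) z))"

text \<open>
  The slice maps \<open>\<iota> \<otimes> \<phi>\<close> and \<open>\<omega> \<otimes> \<iota>\<close> on the algebraic tensor product.
\<close>

definition slice_snd ::
  "('k, 'r) ring_scheme \<Rightarrow> ('k, 'x, 'm) module_scheme \<Rightarrow> ('k, 'y, 'n) module_scheme \<Rightarrow>
    ('y \<Rightarrow> 'k) \<Rightarrow> ('x \<times> 'y \<Rightarrow> 'k) set \<Rightarrow> 'x"
  where "slice_snd K X Y \<phi> = tensor_lift K X Y X (\<lambda>x y. \<phi> y \<odot>\<^bsub>X\<^esub> x)"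

definition slice_fst ::
  "('k, 'r) ring_scheme \<Rightarrow> ('k, 'x, 'm) module_scheme \<Rightarrow> ('k, 'y, 'n) module_scheme \<Rightarrow>
    ('x \<Rightarrow> 'k) \<Rightarrow> ('x \<times> 'y \<Rightarrow> 'k) set \<Rightarrow> 'y"
  where "slice_fst K X Y \<omega> = tensor_lift K X Y Y (\<lambda>x y. \<omega> x \<odot>\<^bsub>Y\<^esub> y)"


section \<open>Multipliers\<close>

text \<open>
  A multiplier \<open>m\<close> of \<open>X\<close> is the pair of maps \<open>x \<mapsto> m x\<close> and \<open>x \<mapsto> x m\<close>, made
  \<open>undefined\<close> outside the carrier so that equal multipliers are equal in HOL.
\<close>

type_synonym 'x multiplier = "('x \<Rightarrow> 'x) \<times> ('x \<Rightarrow> 'x)"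

definition multiplier_algebra ::
  "('k, 'r) ring_scheme \<Rightarrow> ('k, 'x, 'm) module_scheme \<Rightarrow> ('k, 'x multiplier) module"
  where "multiplier_algebra K X =
    \<lparr>carrier = {(l, r).
        l \<in> extensional (carrier X) \<inter> linear_map K X X \<and>
        r \<in> extensional (carrier X) \<inter> linear_map K X X \<and>
        (\<forall>x\<in>carrier X. \<forall>y\<in>carrier X.
          l (x \<otimes>\<^bsub>X\<^esub> y) = l x \<otimes>\<^bsub>X\<^esub> y \<and>
          r (x \<otimes>\<^bsub>X\<^esub> y) = x \<otimes>\<^bsub>X\<^esub> r y \<and>
          r x \<otimes>\<^bsub>X\<^esub> y = x \<otimes>\<^bsub>X\<^esub> l y)},
     mult = (\<lambda>m n. (compose (carrier X) (fst m) (fst n), compose (carrier X) (snd n) (snd m))),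
     one = (\<lambda>x\<in>carrier X. x, \<lambda>x\<in>carrier X. x),
     zero = (\<lambda>x\<in>carrier X. \<zero>\<^bsub>X\<^esub>, \<lambda>x\<in>carrier X. \<zero>\<^bsub>X\<^esub>),
     add = (\<lambda>m n. (\<lambda>x\<in>carrier X. fst m x \<oplus>\<^bsub>X\<^esub> fst n x,
                   \<lambda>x\<in>carrier X. snd m x \<oplus>\<^bsub>X\<^esub> snd n x)),
     smult = (\<lambda>c m. (\<lambda>x\<in>carrier X. c \<odot>\<^bsub>X\<^esub> fst m x, \<lambda>x\<in>carrier X. c \<odot>\<^bsub>X\<^esub> snd m x))\<rparr>"

definition as_multiplier :: "('k, 'x, 'm) module_scheme \<Rightarrow> 'x \<Rightarrow> 'x multiplier"
  where "as_multiplier X x = (\<lambda>y\<in>carrier X. x \<otimes>\<^bsub>X\<^esub> y, \<lambda>y\<in>carrier X. y \<otimes>\<^bsub>X\<^esub> x)"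

text \<open>
  The image of \<open>X\<close> in its multiplier algebra and, for a multiplier lying in that image, the
  element of \<open>X\<close> it comes from; the embedding is injective for non-degenerate \<open>X\<close>.
\<close>

definition embedded :: "('k, 'x, 'm) module_scheme \<Rightarrow> 'x multiplier set"
  where "embedded X = as_multiplier X ` carrier X"

definition element_of :: "('k, 'x, 'm) module_scheme \<Rightarrow> 'x multiplier \<Rightarrow> 'x"
  where "element_of X = the_inv_into (carrier X) (as_multiplier X)"

definition multiplier_tens ::
  "('k, 'r) ring_scheme \<Rightarrow> ('k, 'x, 'm) module_scheme \<Rightarrow> ('k, 'y, 'n) module_scheme \<Rightarrow>
    'x multiplier \<Rightarrow> 'y multiplier \<Rightarrow> ('x \<times> 'y \<Rightarrow> 'k) set multiplier"
  where "multiplier_tens K X Y m n =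
    (tensor_map K X Y (fst m) (fst n), tensor_map K X Y (snd m) (snd n))"

text \<open>The multipliers \<open>x \<otimes> 1\<close> and \<open>1 \<otimes> y\<close>.\<close>

definition in_fst ::
  "('k, 'r) ring_scheme \<Rightarrow> ('k, 'x, 'm) module_scheme \<Rightarrow> ('k, 'y, 'n) module_scheme \<Rightarrow>
    'x \<Rightarrow> ('x \<times> 'y \<Rightarrow> 'k) set multiplier"
  where "in_fst K X Y x =
    multiplier_tens K X Y (as_multiplier X x) \<one>\<^bsub>multiplier_algebra K Y\<^esub>"

definition in_snd ::
  "('k, 'r) ring_scheme \<Rightarrow> ('k, 'x, 'm) module_scheme \<Rightarrow> ('k, 'y, 'n) module_scheme \<Rightarrow>
    'y \<Rightarrow> ('x \<times> 'y \<Rightarrow> 'k) set multiplier"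
  where "in_snd K X Y y =
    multiplier_tens K X Y \<one>\<^bsub>multiplier_algebra K X\<^esub> (as_multiplier Y y)"

definition transport_multiplier ::
  "('k, 'x, 'm) module_scheme \<Rightarrow> ('k, 'y, 'n) module_scheme \<Rightarrow> ('x \<Rightarrow> 'y) \<Rightarrow>
    'x multiplier \<Rightarrow> 'y multiplier"
  where "transport_multiplier X Y \<theta> m =
    (\<lambda>y\<in>carrier Y. \<theta> (fst m (the_inv_into (carrier X) \<theta> y)),
     \<lambda>y\<in>carrier Y. \<theta> (snd m (the_inv_into (carrier X) \<theta> y)))"

text \<open>
  The canonical extension of a homomorphism \<open>h\<close> from \<open>X\<close> to the multipliers of \<open>Y\<close> to the
  multipliers of \<open>X\<close>: it sends \<open>m\<close> to the multiplier \<open>n\<close> determined by \<open>n h(x) = h(m x)\<close> and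
  \<open>h(x) n = h(x m)\<close>. Existence and uniqueness hold in particular for non-degenerate \<open>h\<close>.
\<close>

definition multiplier_extension ::
  "('k, 'r) ring_scheme \<Rightarrow> ('k, 'x, 'm) module_scheme \<Rightarrow> ('k, 'y, 'n) module_scheme \<Rightarrow>
    ('x \<Rightarrow> 'y multiplier) \<Rightarrow> 'x multiplier \<Rightarrow> 'y multiplier"
  where "multiplier_extension K X Y h m =
    (THE n. n \<in> carrier (multiplier_algebra K Y) \<and>
      (\<forall>x\<in>carrier X. n \<otimes>\<^bsub>multiplier_algebra K Y\<^esub> h x = h (fst m x) \<and>
                     h x \<otimes>\<^bsub>multiplier_algebra K Y\<^esub> n = h (snd m x)))"

text \<open>
  For \<open>\<alpha>\<close> from \<open>X\<close> to the multipliers of \<open>X \<otimes> A\<close> and \<open>\<Delta>\<close> from \<open>A\<close> to the multipliers of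
  \<open>A \<otimes> A\<close>, the maps \<open>\<alpha> \<otimes> \<iota>\<close> and \<open>\<iota> \<otimes> \<Delta>\<close> from \<open>X \<otimes> A\<close> to the multipliers of
  \<open>(X \<otimes> A) \<otimes> A\<close>. The latter is moved from \<open>X \<otimes> (A \<otimes> A)\<close> along the associativity isomorphism.
\<close>

definition coaction_tens_id ::
  "('k, 'r) ring_scheme \<Rightarrow> ('k, 'x, 'm) module_scheme \<Rightarrow> ('k, 'a, 'n) module_scheme \<Rightarrow>
    ('x \<Rightarrow> ('x \<times> 'a \<Rightarrow> 'k) set multiplier) \<Rightarrow>
    ('x \<times> 'a \<Rightarrow> 'k) set \<Rightarrow> (('x \<times> 'a \<Rightarrow> 'k) set \<times> 'a \<Rightarrow> 'k) set multiplier"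
  where "coaction_tens_id K X A \<alpha> =
    tensor_lift K X A (multiplier_algebra K (tensor K (tensor K X A) A))
      (\<lambda>x a. multiplier_tens K (tensor K X A) A (\<alpha> x) (as_multiplier A a))"

definition id_tens_comult ::
  "('k, 'r) ring_scheme \<Rightarrow> ('k, 'x, 'm) module_scheme \<Rightarrow> ('k, 'a, 'n) module_scheme \<Rightarrow>
    ('a \<Rightarrow> ('a \<times> 'a \<Rightarrow> 'k) set multiplier) \<Rightarrow>
    ('x \<times> 'a \<Rightarrow> 'k) set \<Rightarrow> (('x \<times> 'a \<Rightarrow> 'k) set \<times> 'a \<Rightarrow> 'k) set multiplier"
  where "id_tens_comult K X A \<Delta> =
    tensor_lift K X A (multiplier_algebra K (tensor K (tensor K X A) A))
      (\<lambda>x a. transport_multiplier (tensor K X (tensor K A A)) (tensor K (tensor K X A) A)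
        (tensor_assoc K X A A)
        (multiplier_tens K X (tensor K A A) (as_multiplier X x) (\<Delta> a)))"


section \<open>Algebraic quantum groups\<close>

locale regular_multiplier_hopf_algebra = nondegenerate_algebra K A
  for K (structure) and A (structure) +
  fixes \<Delta>
  assumes comult_hom:
      "\<Delta> \<in> algebra_hom K A (multiplier_algebra K (tensor K A A))"
    and comult_nondegenerate_l:
      "linear_span K (tensor K A A)
        {fst (\<Delta> a) w | a w. a \<in> carrier A \<and> w \<in> carrier (tensor K A A)} = carrier (tensor K A A)"
    and comult_nondegenerate_r:
      "linear_span K (tensor K A A)
        {snd (\<Delta> a) w | a w. a \<in> carrier A \<and> w \<in> carrier (tensor K A A)} = carrier (tensor K A A)"
    and comult_coassoc:
      "a \<in> carrier A \<Longrightarrow>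
        multiplier_extension K (tensor K A A) (tensor K (tensor K A A) A)
          (coaction_tens_id K A A \<Delta>) (\<Delta> a) =
        multiplier_extension K (tensor K A A) (tensor K (tensor K A A) A)
          (id_tens_comult K A A \<Delta>) (\<Delta> a)"
    and bij_comult_in_snd:
      "bij_betw
        (tensor_lift K A A (multiplier_algebra K (tensor K A A))
          (\<lambda>a b. \<Delta> a \<otimes>\<^bsub>multiplier_algebra K (tensor K A A)\<^esub> in_snd K A A b))
        (carrier (tensor K A A)) (embedded (tensor K A A))"
    and bij_in_fst_comult:
      "bij_betw
        (tensor_lift K A A (multiplier_algebra K (tensor K A A))
          (\<lambda>a b. in_fst K A A a \<otimes>\<^bsub>multiplier_algebra K (tensor K A A)\<^esub> \<Delta> b))
        (carrier (tensor K A A)) (embedded (tensor K A A))"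
    and bij_comult_in_fst:
      "bij_betw
        (tensor_lift K A A (multiplier_algebra K (tensor K A A))
          (\<lambda>a b. \<Delta> a \<otimes>\<^bsub>multiplier_algebra K (tensor K A A)\<^esub> in_fst K A A b))
        (carrier (tensor K A A)) (embedded (tensor K A A))"
    and bij_in_snd_comult:
      "bij_betw
        (tensor_lift K A A (multiplier_algebra K (tensor K A A))
          (\<lambda>a b. in_snd K A A a \<otimes>\<^bsub>multiplier_algebra K (tensor K A A)\<^esub> \<Delta> b))
        (carrier (tensor K A A)) (embedded (tensor K A A))"

locale algebraic_quantum_group = regular_multiplier_hopf_algebra +
  fixes \<phi>
  assumes left_functional: "\<phi> \<in> linear_functional K A"
    and left_functional_nonzero: "\<exists>a\<in>carrier A. \<phi> a \<noteq> \<zero>\<^bsub>K\<^esub>"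
    and left_invariant:
      "\<lbrakk>a \<in> carrier A; b \<in> carrier A\<rbrakk> \<Longrightarrow>
        slice_snd K A A \<phi> (element_of (tensor K A A)
          (\<Delta> a \<otimes>\<^bsub>multiplier_algebra K (tensor K A A)\<^esub> in_fst K A A b)) = \<phi> a \<odot>\<^bsub>A\<^esub> b"

definition modular_element ::
  "('k, 'r) ring_scheme \<Rightarrow> ('k, 'a, 'n) module_scheme \<Rightarrow>
    ('a \<Rightarrow> ('a \<times> 'a \<Rightarrow> 'k) set multiplier) \<Rightarrow> ('a \<Rightarrow> 'k) \<Rightarrow> 'a multiplier \<Rightarrow> bool"
  where "modular_element K A \<Delta> \<phi> \<delta> \<longleftrightarrow>
    \<delta> \<in> carrier (multiplier_algebra K A) \<and>
    (\<forall>a\<in>carrier A. \<forall>b\<in>carrier A.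
      slice_fst K A A \<phi> (element_of (tensor K A A)
        (\<Delta> a \<otimes>\<^bsub>multiplier_algebra K (tensor K A A)\<^esub> in_snd K A A b)) = \<phi> a \<odot>\<^bsub>A\<^esub> fst \<delta> b \<and>
      slice_fst K A A \<phi> (element_of (tensor K A A)
        (in_snd K A A b \<otimes>\<^bsub>multiplier_algebra K (tensor K A A)\<^esub> \<Delta> a)) = \<phi> a \<odot>\<^bsub>A\<^esub> snd \<delta> b)"


section \<open>Coactions and Galois objects\<close>

text \<open>
  In the identity \<open>(\<alpha> \<otimes> \<iota>)\<alpha> = (\<iota> \<otimes> \<Delta>)\<alpha>\<close> the map \<open>\<iota> \<otimes> \<Delta>\<close> extends to multipliers because
  \<open>\<Delta>\<close> is non-degenerate. No non-degeneracy is assumed of \<open>\<alpha>\<close>; the multiplier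
  \<open>(\<alpha> \<otimes> \<iota>)(\<alpha>(x))\<close> is the one determined by
  \<open>(\<alpha> \<otimes> \<iota>)(\<alpha>(x)) (1 \<otimes> 1 \<otimes> a) = (\<alpha> \<otimes> \<iota>)(\<alpha>(x)(1 \<otimes> a))\<close> and
  \<open>(1 \<otimes> 1 \<otimes> a) (\<alpha> \<otimes> \<iota>)(\<alpha>(x)) = (\<alpha> \<otimes> \<iota>)((1 \<otimes> a)\<alpha>(x))\<close>, where the arguments on the right lie
  in \<open>X \<otimes> A\<close>.
\<close>

locale right_coaction =
  regular_multiplier_hopf_algebra K A \<Delta> + X: nondegenerate_algebra K X
  for K (structure) and A (structure) and \<Delta> and X (structure) +
  fixes \<alpha>
  assumes coaction_hom:
      "\<alpha> \<in> algebra_hom K X (multiplier_algebra K (tensor K X A))"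
    and coaction_inj: "inj_on \<alpha> (carrier X)"
    and coaction_in_snd:
      "\<lbrakk>x \<in> carrier X; a \<in> carrier A\<rbrakk> \<Longrightarrow>
        \<alpha> x \<otimes>\<^bsub>multiplier_algebra K (tensor K X A)\<^esub> in_snd K X A a \<in> embedded (tensor K X A)"
    and in_snd_coaction:
      "\<lbrakk>x \<in> carrier X; a \<in> carrier A\<rbrakk> \<Longrightarrow>
        in_snd K X A a \<otimes>\<^bsub>multiplier_algebra K (tensor K X A)\<^esub> \<alpha> x \<in> embedded (tensor K X A)"
    and coaction_coassoc_l:
      "\<lbrakk>x \<in> carrier X; a \<in> carrier A\<rbrakk> \<Longrightarrow>
        coaction_tens_id K X A \<alpha> (element_of (tensor K X A)
          (\<alpha> x \<otimes>\<^bsub>multiplier_algebra K (tensor K X A)\<^esub> in_snd K X A a)) =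
        multiplier_extension K (tensor K X A) (tensor K (tensor K X A) A)
            (id_tens_comult K X A \<Delta>) (\<alpha> x)
          \<otimes>\<^bsub>multiplier_algebra K (tensor K (tensor K X A) A)\<^esub> in_snd K (tensor K X A) A a"
    and coaction_coassoc_r:
      "\<lbrakk>x \<in> carrier X; a \<in> carrier A\<rbrakk> \<Longrightarrow>
        coaction_tens_id K X A \<alpha> (element_of (tensor K X A)
          (in_snd K X A a \<otimes>\<^bsub>multiplier_algebra K (tensor K X A)\<^esub> \<alpha> x)) =
        in_snd K (tensor K X A) A a \<otimes>\<^bsub>multiplier_algebra K (tensor K (tensor K X A) A)\<^esub>
          multiplier_extension K (tensor K X A) (tensor K (tensor K X A) A)
            (id_tens_comult K X A \<Delta>) (\<alpha> x)"

locale reduced_right_coaction = right_coaction +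
  assumes in_fst_coaction:
      "\<lbrakk>x \<in> carrier X; y \<in> carrier X\<rbrakk> \<Longrightarrow>
        in_fst K X A x \<otimes>\<^bsub>multiplier_algebra K (tensor K X A)\<^esub> \<alpha> y \<in> embedded (tensor K X A)"

definition coinvariants ::
  "('k, 'r) ring_scheme \<Rightarrow> ('k, 'a, 'n) module_scheme \<Rightarrow> ('k, 'x, 'm) module_scheme \<Rightarrow>
    ('x \<Rightarrow> ('x \<times> 'a \<Rightarrow> 'k) set multiplier) \<Rightarrow> 'x multiplier set"
  where "coinvariants K A X \<alpha> =
    {f \<in> carrier (multiplier_algebra K X).
      multiplier_extension K X (tensor K X A) \<alpha> f =
        multiplier_tens K X A f \<one>\<^bsub>multiplier_algebra K A\<^esub>}"

locale galois_object = reduced_right_coaction +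
  assumes coinvariants_trivial:
      "coinvariants K A X \<alpha> =
        {c \<odot>\<^bsub>multiplier_algebra K X\<^esub> \<one>\<^bsub>multiplier_algebra K X\<^esub> | c. c \<in> carrier K}"
    and galois_bij:
      "bij_betw
        (tensor_lift K X X (multiplier_algebra K (tensor K X A))
          (\<lambda>x y. in_fst K X A x \<otimes>\<^bsub>multiplier_algebra K (tensor K X A)\<^esub> \<alpha> y))
        (carrier (tensor K X X)) (embedded (tensor K X A))"

text \<open>
  The slices \<open>(\<omega> \<otimes> \<iota>)(m)\<close> and \<open>(\<iota> \<otimes> \<phi>)(m)\<close> of a multiplier \<open>m\<close> of \<open>X \<otimes> A\<close>, as multipliers
  of \<open>A\<close> and of \<open>X\<close>: the product of \<open>(\<omega> \<otimes> \<iota>)(m)\<close> with \<open>a\<close> is \<open>(\<omega> \<otimes> \<iota>)(m(1 \<otimes> a))\<close>, and so on.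
\<close>

definition multiplier_slice_fst ::
  "('k, 'r) ring_scheme \<Rightarrow> ('k, 'x, 'm) module_scheme \<Rightarrow> ('k, 'a, 'n) module_scheme \<Rightarrow>
    ('x \<Rightarrow> 'k) \<Rightarrow> ('x \<times> 'a \<Rightarrow> 'k) set multiplier \<Rightarrow> 'a multiplier"
  where "multiplier_slice_fst K X A \<omega> m =
    (\<lambda>a\<in>carrier A. slice_fst K X A \<omega> (element_of (tensor K X A)
        (m \<otimes>\<^bsub>multiplier_algebra K (tensor K X A)\<^esub> in_snd K X A a)),
     \<lambda>a\<in>carrier A. slice_fst K X A \<omega> (element_of (tensor K X A)
        (in_snd K X A a \<otimes>\<^bsub>multiplier_algebra K (tensor K X A)\<^esub> m)))"

definition multiplier_slice_snd ::
  "('k, 'r) ring_scheme \<Rightarrow> ('k, 'x, 'm) module_scheme \<Rightarrow> ('k, 'a, 'n) module_scheme \<Rightarrow>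
    ('a \<Rightarrow> 'k) \<Rightarrow> ('x \<times> 'a \<Rightarrow> 'k) set multiplier \<Rightarrow> 'x multiplier"
  where "multiplier_slice_snd K X A \<phi> m =
    (\<lambda>x\<in>carrier X. slice_snd K X A \<phi> (element_of (tensor K X A)
        (m \<otimes>\<^bsub>multiplier_algebra K (tensor K X A)\<^esub> in_fst K X A x)),
     \<lambda>x\<in>carrier X. slice_snd K X A \<phi> (element_of (tensor K X A)
        (in_fst K X A x \<otimes>\<^bsub>multiplier_algebra K (tensor K X A)\<^esub> m)))"

definition invariant_functional ::
  "('k, 'r) ring_scheme \<Rightarrow> ('k, 'a, 'n) module_scheme \<Rightarrow> ('k, 'x, 'm) module_scheme \<Rightarrow>
    ('x \<Rightarrow> ('x \<times> 'a \<Rightarrow> 'k) set multiplier) \<Rightarrow> 'a multiplier \<Rightarrow> ('x \<Rightarrow> 'k) \<Rightarrow> bool"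
  where "invariant_functional K A X \<alpha> \<delta> \<omega> \<longleftrightarrow>
    (\<forall>x\<in>carrier X. multiplier_slice_fst K X A \<omega> (\<alpha> x) = \<omega> x \<odot>\<^bsub>multiplier_algebra K A\<^esub> \<delta>)"

end

theory Submission
  imports Defs
begin

text \<open>
Write \<open>\<alpha>(x) = x\<^sub>0 \<otimes> x\<^sub>1\<close>. The functional is found by averaging: the multiplier
\<open>(\<iota> \<otimes> \<phi>)\<alpha>(x) = x\<^sub>0 \<phi>(x\<^sub>1)\<close> of \<open>X\<close> is coinvariant, because \<open>\<phi>\<close> is left invariant, so it is a scalar
\<open>\<phi>_X(x)\<close>. Applying \<open>\<phi>\<close> to the middle leg of the coassociativity identity turns the defining property
of the modular element into \<open>\<delta>\<close>-invariance of \<open>\<phi>_X\<close> (\<open>modular_slices\<close>). These are the ideas; what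
makes the proof long is that the multiplier \<open>x\<^sub>0 \<phi>(x\<^sub>1)\<close> has to exist; the argument uses neither counit nor
antipode, only the bijectivity of the canonical maps.

For \<open>x\<^sub>0 \<phi>(x\<^sub>1)\<close> to act from the right one needs \<open>(X \<otimes> 1)\<alpha>(X) \<subseteq> X \<otimes> A\<close>, which is part of the definition
of a reduced coaction. For it to act from the left one needs \<open>\<alpha>(X)(X \<otimes> 1) \<subseteq> X \<otimes> A\<close>
(\<open>coaction_in_fst\<close>). This is usually derived with the antipode. Here it comes from \<open>\<phi>\<close>: if
\<open>z = y\<^sub>0 \<phi>(y\<^sub>1 q)\<close>, then left invariance of \<open>\<phi>\<close> gives
\<open>\<alpha>(x)(z \<otimes> 1) = x\<^sub>0 y\<^sub>0 \<otimes> x\<^sub>1 y\<^sub>1 q\<^sub>1 \<phi>(y\<^sub>2 q\<^sub>2)\<close>, where only products with a covering factor occur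
(\<open>as_cov\<close>). That every element \<open>z\<close> of \<open>X\<close> is a sum of such elements is \<open>act_slices_span\<close>. It rests on
a similar identity (\<open>r_slice\<close>), which writes \<open>z \<otimes> b\<close> as a sum of terms \<open>\<alpha>(z')(1 \<otimes> b')\<close> with all \<open>z'\<close> of the
form above. It follows that every \<open>\<alpha>(x)(1 \<otimes> b)\<close> is such a sum, and injectivity of
\<open>x \<otimes> b \<mapsto> \<alpha>(x)(1 \<otimes> b)\<close> (\<open>r_hat_injective\<close>) transfers this to \<open>x\<close>.

Two facts about \<open>\<phi>\<close> are used throughout. First, \<open>\<phi>\<close> is faithful (\<open>\<phi>_faithful_r\<close>, \<open>\<phi>_faithful_l\<close>):
the radical \<open>N\<close> of elements with \<open>\<phi>(n A) = 0\<close> is described by slices of the coproduct, and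
coassociativity shows that the preimage of \<open>n \<otimes> b\<close> under a canonical map has all its slices in
\<open>N\<close> again; evaluating \<open>\<phi>\<close> on it gives \<open>\<phi>(b d) n = 0\<close>. Second, functionals \<open>\<phi>(\<cdot> q)\<close> therefore
separate tensors, by the elimination lemma \<open>slice_elimination\<close>.

Faithfulness of \<open>\<phi>_X\<close> reduces to that of \<open>\<phi>\<close>. If \<open>\<phi>_X(X x) = 0\<close>, then \<open>(\<iota> \<otimes> \<phi>)\<close> kills
\<open>(X \<otimes> 1)\<alpha>(X)\<alpha>(x)\<close>, which is \<open>(X \<otimes> A)\<alpha>(x)\<close> by the Galois condition; so \<open>(1 \<otimes> A)\<alpha>(x) = 0\<close> and
\<open>x = 0\<close>. If \<open>\<phi>_X(x X) = 0\<close>, then \<open>(\<iota> \<otimes> \<phi>)\<close> kills \<open>\<alpha>(x)\<alpha>(X)(X \<otimes> 1)\<close>, whose span contains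
\<open>\<alpha>(x)\<alpha>(X)(1 \<otimes> A)\<close> (\<open>W_spans\<close>), so \<open>\<alpha>(x X)(1 \<otimes> A) = 0\<close> and again \<open>x = 0\<close>.

All products such as \<open>\<alpha>(x)(1 \<otimes> a)\<close> are handled as elements of the tensor product, by the maps
\<open>act_r\<close>, \<open>act_l\<close>, \<open>gal\<close> and \<open>gal'\<close>, and every identity between multipliers is replaced by an identity
between these covered products (\<open>covered_coassoc\<close>).
\<close>

section \<open>Linear maps, spans and free modules\<close>

lemma linear_mapI:
  assumes "\<And>x. x \<in> carrier V \<Longrightarrow> f x \<in> carrier W"
    and "\<And>x y. x \<in> carrier V \<Longrightarrow> y \<in> carrier V \<Longrightarrow> f (x \<oplus>\<^bsub>V\<^esub> y) = f x \<oplus>\<^bsub>W\<^esub> f y"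
    and "\<And>c x. c \<in> carrier K \<Longrightarrow> x \<in> carrier V \<Longrightarrow> f (c \<odot>\<^bsub>V\<^esub> x) = c \<odot>\<^bsub>W\<^esub> f x"
  shows "f \<in> linear_map K V W"
  using assms by (auto simp: linear_map_def)

lemma
  assumes "f \<in> linear_map K V W"
  shows lin_closed: "x \<in> carrier V \<Longrightarrow> f x \<in> carrier W"
    and lin_add: "x \<in> carrier V \<Longrightarrow> y \<in> carrier V \<Longrightarrow> f (x \<oplus>\<^bsub>V\<^esub> y) = f x \<oplus>\<^bsub>W\<^esub> f y"
    and lin_smult: "c \<in> carrier K \<Longrightarrow> x \<in> carrier V \<Longrightarrow> f (c \<odot>\<^bsub>V\<^esub> x) = c \<odot>\<^bsub>W\<^esub> f x"
  using assms by (auto simp: linear_map_def)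

lemma
  assumes "module K V"
  shows mod_add_closed: "x \<in> carrier V \<Longrightarrow> y \<in> carrier V \<Longrightarrow> x \<oplus>\<^bsub>V\<^esub> y \<in> carrier V"
    and mod_zero_closed: "\<zero>\<^bsub>V\<^esub> \<in> carrier V"
    and mod_smult_closed: "c \<in> carrier K \<Longrightarrow> x \<in> carrier V \<Longrightarrow> c \<odot>\<^bsub>V\<^esub> x \<in> carrier V"
    and mod_minus_closed: "x \<in> carrier V \<Longrightarrow> y \<in> carrier V \<Longrightarrow> x \<ominus>\<^bsub>V\<^esub> y \<in> carrier V"
    and mod_inv_closed: "x \<in> carrier V \<Longrightarrow> \<ominus>\<^bsub>V\<^esub> x \<in> carrier V"
proof -
  interpret module K V by fact
  show "x \<in> carrier V \<Longrightarrow> y \<in> carrier V \<Longrightarrow> x \<oplus>\<^bsub>V\<^esub> y \<in> carrier V"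
    "\<zero>\<^bsub>V\<^esub> \<in> carrier V"
    "c \<in> carrier K \<Longrightarrow> x \<in> carrier V \<Longrightarrow> c \<odot>\<^bsub>V\<^esub> x \<in> carrier V"
    "x \<in> carrier V \<Longrightarrow> y \<in> carrier V \<Longrightarrow> x \<ominus>\<^bsub>V\<^esub> y \<in> carrier V"
    "x \<in> carrier V \<Longrightarrow> \<ominus>\<^bsub>V\<^esub> x \<in> carrier V"
    by auto
qed

lemma mod_diff_zero:
  assumes "module K V" "x \<in> carrier V" "y \<in> carrier V"
  shows "x \<ominus>\<^bsub>V\<^esub> y = \<zero>\<^bsub>V\<^esub> \<longleftrightarrow> x = y"
proof -
  interpret module K V by fact
  show ?thesis using assms M.minus_equality[of x "\<ominus>\<^bsub>V\<^esub> y"] by (auto simp: a_minus_def M.r_neg)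
qed

lemma mod_minus_smult:
  assumes "module K V" "x \<in> carrier V"
  shows "\<ominus>\<^bsub>V\<^esub> x = (\<ominus>\<^bsub>K\<^esub> \<one>\<^bsub>K\<^esub>) \<odot>\<^bsub>V\<^esub> x"
proof -
  interpret module K V by fact
  show ?thesis using assms by (simp add: smult_l_minus)
qed

lemma lin_zero:
  assumes "module K V" "module K W" "f \<in> linear_map K V W"
  shows "f \<zero>\<^bsub>V\<^esub> = \<zero>\<^bsub>W\<^esub>"
proof -
  interpret V: module K V by fact
  interpret W: module K W by fact
  have "f (\<zero>\<^bsub>K\<^esub> \<odot>\<^bsub>V\<^esub> \<zero>\<^bsub>V\<^esub>) = \<zero>\<^bsub>K\<^esub> \<odot>\<^bsub>W\<^esub> f \<zero>\<^bsub>V\<^esub>"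
    by (rule lin_smult[OF assms(3)]) auto
  then show ?thesis using lin_closed[OF assms(3)] by simp
qed

lemma lin_inv:
  assumes "module K V" "module K W" "f \<in> linear_map K V W" "x \<in> carrier V"
  shows "f (\<ominus>\<^bsub>V\<^esub> x) = \<ominus>\<^bsub>W\<^esub> f x"
proof -
  interpret V: module K V by fact
  show ?thesis
    using assms mod_minus_smult[OF assms(1,4)] mod_minus_smult[OF assms(2) lin_closed[OF assms(3,4)]]
      lin_smult[OF assms(3)] by simp
qed

lemma lin_minus:
  assumes "module K V" "module K W" "f \<in> linear_map K V W" "x \<in> carrier V" "y \<in> carrier V"
  shows "f (x \<ominus>\<^bsub>V\<^esub> y) = f x \<ominus>\<^bsub>W\<^esub> f y"
  using assms by (simp add: a_minus_def lin_add lin_inv mod_inv_closed)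

lemma submodI:
  assumes "module K V" "H \<subseteq> carrier V" "\<zero>\<^bsub>V\<^esub> \<in> H"
    and "\<And>a b. a \<in> H \<Longrightarrow> b \<in> H \<Longrightarrow> a \<oplus>\<^bsub>V\<^esub> b \<in> H"
    and "\<And>c a. c \<in> carrier K \<Longrightarrow> a \<in> H \<Longrightarrow> c \<odot>\<^bsub>V\<^esub> a \<in> H"
  shows "submodule H K V"
proof -
  interpret module K V by fact
  show ?thesis
  proof (rule submoduleI)
    fix a assume "a \<in> H"
    then show "\<ominus>\<^bsub>V\<^esub> a \<in> H"
      using mod_minus_smult[OF assms(1)] assms(2) assms(5)[of "\<ominus>\<^bsub>K\<^esub> \<one>\<^bsub>K\<^esub>" a] by auto
  qed (use assms in auto)
qed

lemma
  assumes "module K V" "submodule H K V"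
  shows submod_subset: "H \<subseteq> carrier V"
    and submod_zero: "\<zero>\<^bsub>V\<^esub> \<in> H"
    and submod_add: "a \<in> H \<Longrightarrow> b \<in> H \<Longrightarrow> a \<oplus>\<^bsub>V\<^esub> b \<in> H"
    and submod_smult: "c \<in> carrier K \<Longrightarrow> a \<in> H \<Longrightarrow> c \<odot>\<^bsub>V\<^esub> a \<in> H"
    and submod_minus: "a \<in> H \<Longrightarrow> b \<in> H \<Longrightarrow> a \<ominus>\<^bsub>V\<^esub> b \<in> H"
proof -
  interpret module K V by fact
  note E = submoduleE[OF assms(2)]
  show "H \<subseteq> carrier V" by (rule E)
  show "\<zero>\<^bsub>V\<^esub> \<in> H" using subgroup.one_closed[OF submodule.axioms(1)[OF assms(2)]] by simp
  show "a \<in> H \<Longrightarrow> b \<in> H \<Longrightarrow> a \<oplus>\<^bsub>V\<^esub> b \<in> H" by (rule E)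
  show "c \<in> carrier K \<Longrightarrow> a \<in> H \<Longrightarrow> c \<odot>\<^bsub>V\<^esub> a \<in> H" by (rule E)
  show "a \<in> H \<Longrightarrow> b \<in> H \<Longrightarrow> a \<ominus>\<^bsub>V\<^esub> b \<in> H" by (simp add: a_minus_def E)
qed

lemma zero_submod: "module K V \<Longrightarrow> submodule {\<zero>\<^bsub>V\<^esub>} K V"
  by (rule submodI) (auto simp: module.axioms abelian_group.axioms abelian_monoid.l_zero
      abelian_monoid.zero_closed module.smult_r_null)

lemma vimage_submod:
  assumes "module K V" "module K W" "f \<in> linear_map K V W" "submodule T K W"
  shows "submodule {x \<in> carrier V. f x \<in> T} K V"
  by (rule submodI) (use assms in \<open>auto simp: lin_add lin_smult lin_zero mod_add_closed mod_zero_closed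
     mod_smult_closed submod_zero submod_add submod_smult\<close>)

lemma image_submod:
  assumes "module K V" "module K W" "f \<in> linear_map K V W" "submodule T K V"
  shows "submodule (f ` T) K W"
proof (rule submodI[OF assms(2)])
  note sub = subsetD[OF submod_subset[OF assms(1,4)]]
  show "f ` T \<subseteq> carrier W" using lin_closed[OF assms(3)] sub by auto
  show "\<zero>\<^bsub>W\<^esub> \<in> f ` T" using lin_zero[OF assms(1-3)] submod_zero[OF assms(1,4)] by (metis imageI)
  show "a \<oplus>\<^bsub>W\<^esub> b \<in> f ` T" if ab: "a \<in> f ` T" "b \<in> f ` T" for a b
  proof -
    from ab obtain x y where "x \<in> T" "y \<in> T" "a = f x" "b = f y" by auto
    then show ?thesis using lin_add[OF assms(3), of x y] sub submod_add[OF assms(1,4), of x y]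
      by (metis imageI)
  qed
  show "c \<odot>\<^bsub>W\<^esub> a \<in> f ` T" if "c \<in> carrier K" and a: "a \<in> f ` T" for c a
  proof -
    from a obtain x where "x \<in> T" "a = f x" by auto
    then show ?thesis using lin_smult[OF assms(3), of c x] sub submod_smult[OF assms(1,4), of c x] that(1)
      by (metis imageI)
  qed
qed

lemma linear_span_submod:
  assumes "module K V" "S \<subseteq> carrier V"
  shows "submodule (linear_span K V S) K V"
proof (rule submodI[OF assms(1)])
  interpret module K V by fact
  have "submodule (carrier V) K V" by (rule carrier_is_submodule)
  then show "linear_span K V S \<subseteq> carrier V" using assms(2) by (auto simp: linear_span_def)
qed (auto simp: linear_span_def submod_zero[OF assms(1)] submod_add[OF assms(1)] submod_smult[OF assms(1)])

lemma linear_span_superset: "S \<subseteq> linear_span K V S"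
  by (auto simp: linear_span_def)

lemma linear_span_least: "submodule T K V \<Longrightarrow> S \<subseteq> T \<Longrightarrow> linear_span K V S \<subseteq> T"
  by (auto simp: linear_span_def)

lemma lin_cong:
  assumes "f \<in> linear_map K V W" "\<And>x. x \<in> carrier V \<Longrightarrow> g x = f x" "module K V"
  shows "g \<in> linear_map K V W"
  by (rule linear_mapI) (use assms in \<open>auto simp: lin_closed lin_add lin_smult mod_add_closed mod_smult_closed\<close>)


locale free_module = field K for K :: "('k, 'r) ring_scheme" (structure) +
  fixes G :: "('s, 'm) monoid_scheme"
begin

abbreviation "F \<equiv> semigroup_algebra K G"

lemma free_simps:
  "\<zero>\<^bsub>F\<^esub> = (\<lambda>s. \<zero>\<^bsub>K\<^esub>)" "f \<oplus>\<^bsub>F\<^esub> g = (\<lambda>s. f s \<oplus>\<^bsub>K\<^esub> g s)" "c \<odot>\<^bsub>F\<^esub> f = (\<lambda>s. c \<otimes>\<^bsub>K\<^esub> f s)"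
  by (simp_all add: semigroup_algebra_def)

lemma free_carrier:
  "f \<in> carrier F \<longleftrightarrow> (\<forall>s. f s \<in> carrier K) \<and> (\<forall>s. s \<notin> carrier G \<longrightarrow> f s = \<zero>\<^bsub>K\<^esub>) \<and> finite {s. f s \<noteq> \<zero>\<^bsub>K\<^esub>}"
  by (auto simp: semigroup_algebra_def Pi_iff)

lemma free_add_closed:
  assumes "f \<in> carrier F" "g \<in> carrier F" shows "f \<oplus>\<^bsub>F\<^esub> g \<in> carrier F"
proof -
  have "{s. f s \<oplus> g s \<noteq> \<zero>} \<subseteq> {s. f s \<noteq> \<zero>} \<union> {s. g s \<noteq> \<zero>}" by auto
  then have "finite {s. f s \<oplus> g s \<noteq> \<zero>}"
    using assms by (auto simp: free_carrier intro: finite_subset)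
  then show ?thesis using assms by (simp add: free_carrier free_simps)
qed

lemma free_smult_closed:
  assumes "f \<in> carrier F" "c \<in> carrier K" shows "c \<odot>\<^bsub>F\<^esub> f \<in> carrier F"
proof -
  have "{s. c \<otimes> f s \<noteq> \<zero>} \<subseteq> {s. f s \<noteq> \<zero>}" using assms by auto
  then have "finite {s. c \<otimes> f s \<noteq> \<zero>}"
    using assms by (auto simp: free_carrier intro: finite_subset)
  then show ?thesis using assms by (simp add: free_carrier free_simps)
qed

lemma free_is_module: "module K F"
proof (rule moduleI)
  show "cring K" ..
  show "abelian_group F"
  proof (rule abelian_groupI)
    fix f assume f: "f \<in> carrier F"
    show "\<exists>y\<in>carrier F. y \<oplus>\<^bsub>F\<^esub> f = \<zero>\<^bsub>F\<^esub>"
    proof (rule bexI[of _ "(\<ominus> \<one>) \<odot>\<^bsub>F\<^esub> f"])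
      show "(\<ominus> \<one>) \<odot>\<^bsub>F\<^esub> f \<oplus>\<^bsub>F\<^esub> f = \<zero>\<^bsub>F\<^esub>"
        using f by (auto simp: free_carrier free_simps l_minus l_neg)
      show "(\<ominus> \<one>) \<odot>\<^bsub>F\<^esub> f \<in> carrier F" using f by (simp add: free_smult_closed)
    qed
  next
    show "\<zero>\<^bsub>F\<^esub> \<in> carrier F" by (simp add: free_carrier free_simps)
  qed (auto simp: free_add_closed, auto simp: free_carrier free_simps a_ac)
qed (auto simp: free_smult_closed, auto simp: free_carrier free_simps l_distr r_distr m_assoc)

lemma single_closed: "s \<in> carrier G \<Longrightarrow> singleton_fun K s \<in> carrier F"
  by (auto simp: free_carrier singleton_fun_def)

lemma free_induct:
  assumes T: "submodule T K F" and single: "\<And>s. s \<in> carrier G \<Longrightarrow> singleton_fun K s \<in> T"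
    and u: "u \<in> carrier F"
  shows "u \<in> T"
proof -
  note FM = free_is_module
  have "finite S \<Longrightarrow> S = {s. u s \<noteq> \<zero>} \<Longrightarrow> u \<in> carrier F \<Longrightarrow> u \<in> T" for S u
  proof (induction S arbitrary: u rule: finite_induct)
    case empty
    then have "u = \<zero>\<^bsub>F\<^esub>" by (auto simp: free_simps)
    then show ?case using submod_zero[OF FM T] by simp
  next
    case (insert s S)
    define u' where "u' = u(s := \<zero>)"
    have sub: "{s. u' s \<noteq> \<zero>} \<subseteq> {s. u s \<noteq> \<zero>}" by (auto simp: u'_def)
    have u': "u' \<in> carrier F"
      using insert.prems(2) finite_subset[OF sub] by (auto simp: free_carrier u'_def)
    have "S = {s. u' s \<noteq> \<zero>}" using insert by (auto simp: u'_def)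
    then have 1: "u' \<in> T" using insert.IH u' by blast
    have s: "s \<in> carrier G" "u s \<in> carrier K" using insert.prems by (auto simp: free_carrier)
    have "u = u' \<oplus>\<^bsub>F\<^esub> u s \<odot>\<^bsub>F\<^esub> singleton_fun K s"
      using insert.prems(2) by (auto simp: free_simps u'_def singleton_fun_def free_carrier)
    then show ?case using submod_add[OF FM T 1 submod_smult[OF FM T s(2) single[OF s(1)]]] by simp
  qed
  then show ?thesis using u by (auto simp: free_carrier)
qed

text \<open>
  The linear extension of \<open>b\<close> to the free module; it represents the value that \<open>tensor_lift\<close> computes
  from a representative.
\<close>

definition comb :: "('k, 'z, 'l) module_scheme \<Rightarrow> ('s \<Rightarrow> 'z) \<Rightarrow> ('s \<Rightarrow> 'k) \<Rightarrow> 'z"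
  where "comb Z b u = (\<Oplus>\<^bsub>Z\<^esub>p\<in>{p. u p \<noteq> \<zero>\<^bsub>K\<^esub>}. u p \<odot>\<^bsub>Z\<^esub> b p)"

lemma comb_superset:
  assumes "module K Z" "b \<in> carrier G \<rightarrow> carrier Z" "u \<in> carrier F"
    "finite S" "{p. u p \<noteq> \<zero>} \<subseteq> S" "S \<subseteq> carrier G"
  shows "comb Z b u = (\<Oplus>\<^bsub>Z\<^esub>p\<in>S. u p \<odot>\<^bsub>Z\<^esub> b p)"
proof -
  interpret Z: module K Z by fact
  show ?thesis unfolding comb_def
    by (rule Z.add.finprod_mono_neutral_cong_left)
      (use assms in \<open>auto simp: free_carrier Pi_iff subset_iff\<close>)
qed

lemma comb_linear:
  assumes "module K Z" "b \<in> carrier G \<rightarrow> carrier Z"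
  shows "comb Z b \<in> linear_map K F Z"
proof (rule linear_mapI)
  interpret Z: module K Z by fact
  have fin: "finite {s. f s \<noteq> \<zero>}" "{s. f s \<noteq> \<zero>} \<subseteq> carrier G" "f s \<in> carrier K"
    if "f \<in> carrier F" for f s using that by (auto simp: free_carrier)
  have cl: "(\<lambda>p. f p \<odot>\<^bsub>Z\<^esub> b p) \<in> S \<rightarrow> carrier Z" if "f \<in> carrier F" "S \<subseteq> carrier G" for f S
    using fin[OF that(1)] assms(2) that(2) by (auto simp: Pi_iff subset_iff)
  show "comb Z b f \<in> carrier Z" if f: "f \<in> carrier F" for f
    unfolding comb_def by (rule Z.finsum_closed) (rule cl[OF f fin(2)[OF f]])
  show "comb Z b (f \<oplus>\<^bsub>F\<^esub> g) = comb Z b f \<oplus>\<^bsub>Z\<^esub> comb Z b g" if f: "f \<in> carrier F" and g: "g \<in> carrier F" for f g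
  proof -
    let ?S = "{s. f s \<noteq> \<zero>} \<union> {s. g s \<noteq> \<zero>}"
    have S: "finite ?S" "?S \<subseteq> carrier G" using fin(1,2)[OF f] fin(1,2)[OF g] by auto
    have fg: "f \<oplus>\<^bsub>F\<^esub> g \<in> carrier F" by (rule free_add_closed[OF f g])
    have "comb Z b (f \<oplus>\<^bsub>F\<^esub> g) = (\<Oplus>\<^bsub>Z\<^esub>p\<in>?S. (f p \<oplus> g p) \<odot>\<^bsub>Z\<^esub> b p)"
    proof -
      have "{p. (f \<oplus>\<^bsub>F\<^esub> g) p \<noteq> \<zero>} \<subseteq> ?S" unfolding free_simps by auto
      from comb_superset[OF assms fg S(1) this S(2)] show ?thesis unfolding free_simps .
    qed
    also have "\<dots> = (\<Oplus>\<^bsub>Z\<^esub>p\<in>?S. f p \<odot>\<^bsub>Z\<^esub> b p \<oplus>\<^bsub>Z\<^esub> g p \<odot>\<^bsub>Z\<^esub> b p)"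
      by (rule Z.finsum_cong') (use assms(2) fin[OF f] fin[OF g] S in \<open>auto simp: Z.smult_l_distr Pi_iff subset_iff\<close>)
    also have "\<dots> = (\<Oplus>\<^bsub>Z\<^esub>p\<in>?S. f p \<odot>\<^bsub>Z\<^esub> b p) \<oplus>\<^bsub>Z\<^esub> (\<Oplus>\<^bsub>Z\<^esub>p\<in>?S. g p \<odot>\<^bsub>Z\<^esub> b p)"
      by (rule Z.finsum_addf) (rule cl[OF f S(2)], rule cl[OF g S(2)])
    also have "\<dots> = comb Z b f \<oplus>\<^bsub>Z\<^esub> comb Z b g"
      using comb_superset[OF assms f S(1) _ S(2)] comb_superset[OF assms g S(1) _ S(2)] by auto
    finally show ?thesis .
  qed
  show "comb Z b (c \<odot>\<^bsub>F\<^esub> f) = c \<odot>\<^bsub>Z\<^esub> comb Z b f" if c: "c \<in> carrier K" and f: "f \<in> carrier F" for c f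
  proof -
    let ?S = "{s. f s \<noteq> \<zero>}"
    have S: "finite ?S" "?S \<subseteq> carrier G" using fin(1,2)[OF f] by auto
    have cf: "c \<odot>\<^bsub>F\<^esub> f \<in> carrier F" by (rule free_smult_closed[OF f c])
    have "comb Z b (c \<odot>\<^bsub>F\<^esub> f) = (\<Oplus>\<^bsub>Z\<^esub>p\<in>?S. (c \<otimes> f p) \<odot>\<^bsub>Z\<^esub> b p)"
    proof -
      have "{p. (c \<odot>\<^bsub>F\<^esub> f) p \<noteq> \<zero>} \<subseteq> ?S" unfolding free_simps using c by auto
      from comb_superset[OF assms cf S(1) this S(2)] show ?thesis unfolding free_simps .
    qed
    also have "\<dots> = (\<Oplus>\<^bsub>Z\<^esub>p\<in>?S. c \<odot>\<^bsub>Z\<^esub> (f p \<odot>\<^bsub>Z\<^esub> b p))"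
      by (rule Z.finsum_cong') (use assms(2) fin[OF f] c S in \<open>auto simp: Z.smult_assoc1 Pi_iff subset_iff\<close>)
    also have "\<dots> = c \<odot>\<^bsub>Z\<^esub> comb Z b f"
      unfolding comb_def by (rule Z.finsum_smult_ldistr[symmetric]) (rule S(1), rule c, rule cl[OF f S(2)])
    finally show ?thesis .
  qed
qed

lemma comb_single:
  assumes "module K Z" "b \<in> carrier G \<rightarrow> carrier Z" "s \<in> carrier G"
  shows "comb Z b (singleton_fun K s) = b s"
proof -
  interpret Z: module K Z by fact
  have "comb Z b (singleton_fun K s) = (\<Oplus>\<^bsub>Z\<^esub>p\<in>{s}. singleton_fun K s p \<odot>\<^bsub>Z\<^esub> b p)"
    by (rule comb_superset[OF assms(1,2) single_closed[OF assms(3)]]) (use assms in \<open>auto simp: singleton_fun_def\<close>)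
  also have "\<dots> = singleton_fun K s s \<odot>\<^bsub>Z\<^esub> b s"
    using assms(2,3) by (subst Z.finsum_insert) (auto simp: singleton_fun_def Pi_iff)
  also have "\<dots> = b s" using assms(2,3) by (auto simp: singleton_fun_def Pi_iff)
  finally show ?thesis .
qed

end

section \<open>Tensor products\<close>

definition bilinear_map ::
  "('k, 'r) ring_scheme \<Rightarrow> ('k, 'v, 'm) module_scheme \<Rightarrow> ('k, 'w, 'n) module_scheme \<Rightarrow>
    ('k, 'z, 'l) module_scheme \<Rightarrow> ('v \<Rightarrow> 'w \<Rightarrow> 'z) set"
  where "bilinear_map K V W Z =
    {b. (\<forall>v\<in>carrier V. b v \<in> linear_map K W Z) \<and> (\<forall>w\<in>carrier W. (\<lambda>v. b v w) \<in> linear_map K V Z)}"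

lemma bilinear_mapI:
  assumes "\<And>v. v \<in> carrier V \<Longrightarrow> (\<lambda>w. b v w) \<in> linear_map K W Z"
    and "\<And>w. w \<in> carrier W \<Longrightarrow> (\<lambda>v. b v w) \<in> linear_map K V Z"
  shows "b \<in> bilinear_map K V W Z"
  using assms by (auto simp: bilinear_map_def)

lemma
  assumes "b \<in> bilinear_map K V W Z"
  shows bilin_r: "v \<in> carrier V \<Longrightarrow> (\<lambda>w. b v w) \<in> linear_map K W Z"
    and bilin_l: "w \<in> carrier W \<Longrightarrow> (\<lambda>v. b v w) \<in> linear_map K V Z"
    and bilin_closed: "v \<in> carrier V \<Longrightarrow> w \<in> carrier W \<Longrightarrow> b v w \<in> carrier Z"
  using assms by (auto simp: bilinear_map_def linear_map_def)

locale tensor_space = field K + V: module K V + W: module K W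
  for K :: "('k, 'r) ring_scheme" (structure)
    and V :: "('k, 'v, 'm) module_scheme" (structure)
    and W :: "('k, 'w, 'n) module_scheme" (structure)
begin

lemmas V_module = V.module_axioms
lemmas W_module = W.module_axioms

sublocale fr: free_module K "V \<times>\<times> W" ..

abbreviation "N \<equiv> tensor_relations K V W"
abbreviation "VW \<equiv> tensor K V W"
abbreviation "t \<equiv> tens K V W"

lemma relations_submod: "submodule N K fr.F"
proof -
  interpret FM: module K fr.F by (rule fr.free_is_module)
  have e: "singleton_fun K (x, y) \<in> carrier fr.F" if "x \<in> carrier V" "y \<in> carrier W" for x y
    by (rule fr.single_closed) (simp add: that)
  show ?thesis
    unfolding tensor_relations_def Let_def
    by (rule linear_span_submod[OF fr.free_is_module], safe)
      (simp_all add: e FM.M.minus_closed)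
qed

sublocale FM: module K fr.F
  by (rule fr.free_is_module)

sublocale N: abelian_subgroup N fr.F
proof (rule abelian_subgroupI3)
  show "additive_subgroup N fr.F"
    by (rule additive_subgroupI) (rule submodule.axioms(1)[OF relations_submod])
  show "abelian_group fr.F" ..
qed

abbreviation cls where "cls f \<equiv> N +>\<^bsub>fr.F\<^esub> f"

lemma cls_eq: "f \<in> carrier fr.F \<Longrightarrow> g \<in> carrier fr.F \<Longrightarrow> f \<ominus>\<^bsub>fr.F\<^esub> g \<in> N \<Longrightarrow> cls f = cls g"
  using N.a_repr_independence'[of f g] N.a_rcos_module_rev[of g f] by (simp add: a_minus_def)

lemma tensor_carrier: "carrier VW = {cls f | f. f \<in> carrier fr.F}"
  unfolding tensor_def Let_def module.simps partial_object.simps A_RCOSETS_def RCOSETS_def a_r_coset_def[symmetric]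
  by auto

lemma tensor_zero: "\<zero>\<^bsub>VW\<^esub> = cls \<zero>\<^bsub>fr.F\<^esub>"
  by (simp add: tensor_def Let_def FM.M.a_coset_add_zero N.a_subset)

lemma tensor_add:
  "f \<in> carrier fr.F \<Longrightarrow> g \<in> carrier fr.F \<Longrightarrow> cls f \<oplus>\<^bsub>VW\<^esub> cls g = cls (f \<oplus>\<^bsub>fr.F\<^esub> g)"
  by (simp add: tensor_def Let_def N.a_rcos_sum)

lemma cls_memD: "f \<in> carrier fr.F \<Longrightarrow> u \<in> cls f \<Longrightarrow> u \<in> carrier fr.F \<and> u \<ominus>\<^bsub>fr.F\<^esub> f \<in> N"
  using N.a_elemrcos_carrier[of f u] N.a_rcos_module_imp[of f u] by (auto simp: a_minus_def)

lemma tensor_smult: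
  assumes "f \<in> carrier fr.F" "c \<in> carrier K"
  shows "c \<odot>\<^bsub>VW\<^esub> cls f = cls (c \<odot>\<^bsub>fr.F\<^esub> f)"
proof -
  have "cls (c \<odot>\<^bsub>fr.F\<^esub> u) = cls (c \<odot>\<^bsub>fr.F\<^esub> f)" if "u \<in> cls f" for u
  proof (rule cls_eq)
    note u = cls_memD[OF assms(1) that]
    have "c \<odot>\<^bsub>fr.F\<^esub> u \<ominus>\<^bsub>fr.F\<^esub> c \<odot>\<^bsub>fr.F\<^esub> f = c \<odot>\<^bsub>fr.F\<^esub> (u \<ominus>\<^bsub>fr.F\<^esub> f)"
      using u assms by (simp add: a_minus_def FM.smult_r_distr FM.smult_r_minus)
    then show "c \<odot>\<^bsub>fr.F\<^esub> u \<ominus>\<^bsub>fr.F\<^esub> c \<odot>\<^bsub>fr.F\<^esub> f \<in> N"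
      using submod_smult[OF FM.module_axioms relations_submod assms(2)] u by auto
  qed (use cls_memD[OF assms(1) that] assms in auto)
  then have "(\<Union>u\<in>cls f. cls (c \<odot>\<^bsub>fr.F\<^esub> u)) = (\<Union>u\<in>cls f. cls (c \<odot>\<^bsub>fr.F\<^esub> f))" by (rule SUP_cong[OF refl])
  also have "\<dots> = cls (c \<odot>\<^bsub>fr.F\<^esub> f)" using N.a_rcos_self[OF assms(1)] by blast
  finally show ?thesis unfolding tensor_def Let_def module.simps .
qed

lemma cls_closed: "f \<in> carrier fr.F \<Longrightarrow> cls f \<in> carrier VW"
  by (auto simp: tensor_carrier)

lemma tensor_cases:
  assumes "x \<in> carrier VW" obtains f where "x = cls f" "f \<in> carrier fr.F"
  using assms by (auto simp: tensor_carrier)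

lemma tensor_module: "module K VW"
proof (rule moduleI)
  show "cring K" ..
  show "abelian_group VW"
  proof (rule abelian_groupI)
    show "x \<oplus>\<^bsub>VW\<^esub> y \<in> carrier VW" if "x \<in> carrier VW" "y \<in> carrier VW" for x y
      using that by (elim tensor_cases) (simp add: tensor_add cls_closed)
    show "x \<oplus>\<^bsub>VW\<^esub> y \<oplus>\<^bsub>VW\<^esub> z = x \<oplus>\<^bsub>VW\<^esub> (y \<oplus>\<^bsub>VW\<^esub> z)"
      if "x \<in> carrier VW" "y \<in> carrier VW" "z \<in> carrier VW" for x y z
      using that by (elim tensor_cases) (simp add: tensor_add FM.M.a_assoc)
    show "x \<oplus>\<^bsub>VW\<^esub> y = y \<oplus>\<^bsub>VW\<^esub> x" if "x \<in> carrier VW" "y \<in> carrier VW" for x y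
      using that by (elim tensor_cases) (simp add: tensor_add FM.M.a_comm)
    show "\<zero>\<^bsub>VW\<^esub> \<oplus>\<^bsub>VW\<^esub> x = x" if "x \<in> carrier VW" for x
      using that by (elim tensor_cases) (simp add: tensor_add tensor_zero)
    show "\<exists>y\<in>carrier VW. y \<oplus>\<^bsub>VW\<^esub> x = \<zero>\<^bsub>VW\<^esub>" if x: "x \<in> carrier VW" for x
    proof -
      obtain f where f: "x = cls f" "f \<in> carrier fr.F" using x by (rule tensor_cases)
      show ?thesis
        by (rule bexI[of _ "cls (\<ominus>\<^bsub>fr.F\<^esub> f)"])
          (use f in \<open>simp_all add: tensor_add tensor_zero FM.M.l_neg cls_closed\<close>)
    qed
  qed (simp add: tensor_zero cls_closed)
  fix x assume x: "x \<in> carrier VW"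
  show "a \<odot>\<^bsub>VW\<^esub> x \<in> carrier VW" if "a \<in> carrier K" for a
    using that x by (elim tensor_cases) (simp add: tensor_smult cls_closed)
  show "(a \<oplus>\<^bsub>K\<^esub> b) \<odot>\<^bsub>VW\<^esub> x = a \<odot>\<^bsub>VW\<^esub> x \<oplus>\<^bsub>VW\<^esub> b \<odot>\<^bsub>VW\<^esub> x"
    if "a \<in> carrier K" "b \<in> carrier K" for a b
    using that x by (elim tensor_cases) (simp add: tensor_smult tensor_add FM.smult_l_distr)
  show "a \<odot>\<^bsub>VW\<^esub> (x \<oplus>\<^bsub>VW\<^esub> y) = a \<odot>\<^bsub>VW\<^esub> x \<oplus>\<^bsub>VW\<^esub> a \<odot>\<^bsub>VW\<^esub> y"
    if "a \<in> carrier K" "y \<in> carrier VW" for a y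
    using that x by (elim tensor_cases) (simp add: tensor_smult tensor_add FM.smult_r_distr)
  show "(a \<otimes>\<^bsub>K\<^esub> b) \<odot>\<^bsub>VW\<^esub> x = a \<odot>\<^bsub>VW\<^esub> (b \<odot>\<^bsub>VW\<^esub> x)"
    if "a \<in> carrier K" "b \<in> carrier K" for a b
    using that x by (elim tensor_cases) (simp add: tensor_smult FM.smult_assoc1)
  show "\<one>\<^bsub>K\<^esub> \<odot>\<^bsub>VW\<^esub> x = x"
    using x by (elim tensor_cases) (simp add: tensor_smult)
qed

sublocale T: module K VW
  by (rule tensor_module)

lemma tens_closed [simp, intro]: "v \<in> carrier V \<Longrightarrow> w \<in> carrier W \<Longrightarrow> t v w \<in> carrier VW"
  unfolding tens_def by (rule cls_closed) (simp add: fr.single_closed)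

lemma tensor_induct:
  assumes T: "submodule T K VW" and pure: "\<And>v w. v \<in> carrier V \<Longrightarrow> w \<in> carrier W \<Longrightarrow> t v w \<in> T"
    and u: "u \<in> carrier VW"
  shows "u \<in> T"
proof -
  have lin: "cls \<in> linear_map K fr.F VW"
    by (rule linear_mapI) (simp_all add: cls_closed tensor_add tensor_smult)
  obtain f where f: "u = cls f" "f \<in> carrier fr.F" using u by (auto simp: tensor_carrier)
  have "f \<in> {f \<in> carrier fr.F. cls f \<in> T}"
  proof (rule fr.free_induct[OF vimage_submod[OF FM.module_axioms tensor_module lin T] _ f(2)])
    fix s assume "s \<in> carrier (V \<times>\<times> W)"
    then show "singleton_fun K s \<in> {f \<in> carrier fr.F. cls f \<in> T}"
      using pure[of "fst s" "snd s"] fr.single_closed[of s] by (auto simp: tens_def)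
  qed
  then show ?thesis using f by auto
qed

lemma tensor_lin_eq:
  assumes "module K Z" "f \<in> linear_map K VW Z" "g \<in> linear_map K VW Z"
    and "\<And>v w. v \<in> carrier V \<Longrightarrow> w \<in> carrier W \<Longrightarrow> f (t v w) = g (t v w)" and u: "u \<in> carrier VW"
  shows "f u = g u"
proof -
  interpret Z: module K Z by fact
  have "u \<in> {u \<in> carrier VW. f u = g u}"
  proof (rule tensor_induct[OF _ _ u])
    show "submodule {u \<in> carrier VW. f u = g u} K VW"
      by (rule submodI) (use assms in \<open>auto simp: tensor_module lin_add lin_smult lin_zero[OF tensor_module assms(1)]\<close>)
  qed (use assms in auto)
  then show ?thesis by simp
qed

lemma tens_bilinear: "t \<in> bilinear_map K V W VW"
proof (rule bilinear_mapI)
  have rel: "S \<subseteq> linear_span K fr.F S" for S by (rule linear_span_superset)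
  let ?e = "\<lambda>x y. singleton_fun K (x, y)"
  have e: "?e v w \<in> carrier fr.F" if "v \<in> carrier V" "w \<in> carrier W" for v w
    by (rule fr.single_closed) (use that in auto)
  note rels = subsetD[OF rel]
  have 1: "?e (v \<oplus>\<^bsub>V\<^esub> v') w \<ominus>\<^bsub>fr.F\<^esub> (?e v w \<oplus>\<^bsub>fr.F\<^esub> ?e v' w) \<in> N"
    if "v \<in> carrier V" "v' \<in> carrier V" "w \<in> carrier W" for v v' w
    unfolding tensor_relations_def Let_def by (rule rels) (use that in blast)
  have 2: "?e v (w \<oplus>\<^bsub>W\<^esub> w') \<ominus>\<^bsub>fr.F\<^esub> (?e v w \<oplus>\<^bsub>fr.F\<^esub> ?e v w') \<in> N"
    if "v \<in> carrier V" "w \<in> carrier W" "w' \<in> carrier W" for v w w'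
    unfolding tensor_relations_def Let_def by (rule rels) (use that in blast)
  have 3: "?e (c \<odot>\<^bsub>V\<^esub> v) w \<ominus>\<^bsub>fr.F\<^esub> c \<odot>\<^bsub>fr.F\<^esub> ?e v w \<in> N"
    if "c \<in> carrier K" "v \<in> carrier V" "w \<in> carrier W" for c v w
    unfolding tensor_relations_def Let_def by (rule rels) (use that in blast)
  have 4: "?e v (c \<odot>\<^bsub>W\<^esub> w) \<ominus>\<^bsub>fr.F\<^esub> c \<odot>\<^bsub>fr.F\<^esub> ?e v w \<in> N"
    if "c \<in> carrier K" "v \<in> carrier V" "w \<in> carrier W" for c v w
    unfolding tensor_relations_def Let_def by (rule rels) (use that in blast)
  show "(\<lambda>w. t v w) \<in> linear_map K W VW" if v: "v \<in> carrier V" for v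
    by (rule linear_mapI) (use v in \<open>simp_all add: tens_def tensor_add tensor_smult e cls_closed cls_eq 2 4\<close>)
  show "(\<lambda>v. t v w) \<in> linear_map K V VW" if w: "w \<in> carrier W" for w
    by (rule linear_mapI) (use w in \<open>simp_all add: tens_def tensor_add tensor_smult e cls_closed cls_eq 1 3\<close>)
qed

lemmas tens_r = bilin_r[OF tens_bilinear] and tens_l = bilin_l[OF tens_bilinear]

lemma tens_zero_l [simp]: "w \<in> carrier W \<Longrightarrow> t \<zero>\<^bsub>V\<^esub> w = \<zero>\<^bsub>VW\<^esub>"
  by (rule lin_zero[OF V_module tensor_module tens_l])

lemma tens_zero_r [simp]: "v \<in> carrier V \<Longrightarrow> t v \<zero>\<^bsub>W\<^esub> = \<zero>\<^bsub>VW\<^esub>"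
  by (rule lin_zero[OF W_module tensor_module tens_r])

context
  fixes Z :: "('k, 'z, 'l) module_scheme" and b
  assumes Z: "module K Z" and b: "b \<in> bilinear_map K V W Z"
begin

interpretation Z: module K Z by (rule Z)

abbreviation "bb \<equiv> \<lambda>p. b (fst p) (snd p)"

lemma bb: "bb \<in> carrier (V \<times>\<times> W) \<rightarrow> carrier Z"
  using bilin_closed[OF b] by auto

text \<open>
  Bilinearity of \<open>b\<close> says exactly that its linear extension kills the generators of the relations;
  hence \<open>tensor_lift\<close> does not depend on the chosen representative.
\<close>

lemma comb_kernel: "f \<in> N \<Longrightarrow> fr.comb Z bb f = \<zero>\<^bsub>Z\<^esub>"
proof -
  note lin = fr.comb_linear[OF Z bb]
  let ?T = "{f \<in> carrier fr.F. fr.comb Z bb f \<in> {\<zero>\<^bsub>Z\<^esub>}}"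
  have sub: "submodule ?T K fr.F"
    by (rule vimage_submod[OF FM.module_axioms Z lin zero_submod[OF Z]])
  have e: "singleton_fun K (x, y) \<in> carrier fr.F" if "x \<in> carrier V" "y \<in> carrier W" for x y
    by (rule fr.single_closed) (simp add: that)
  have ce: "fr.comb Z bb (singleton_fun K (x, y)) = b x y" if "x \<in> carrier V" "y \<in> carrier W" for x y
    using fr.comb_single[OF Z bb, of "(x, y)"] that by simp
  have diff: "f \<ominus>\<^bsub>fr.F\<^esub> g \<in> ?T" if "f \<in> carrier fr.F" "g \<in> carrier fr.F" "fr.comb Z bb f = fr.comb Z bb g" for f g
    using that lin_minus[OF FM.module_axioms Z lin that(1,2)] lin_closed[OF lin that(2)] mod_diff_zero[OF Z]
      FM.M.minus_closed[OF that(1,2)] by simp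
  note ls = lin_add[OF lin] lin_smult[OF lin] ce e
    lin_add[OF bilin_r[OF b]] lin_add[OF bilin_l[OF b]] lin_smult[OF bilin_r[OF b]] lin_smult[OF bilin_l[OF b]]
  have "N \<subseteq> ?T"
    unfolding tensor_relations_def Let_def
    by (rule linear_span_least[OF sub], intro Un_least subsetI; elim CollectE exE conjE; hypsubst; rule diff)
      (simp_all add: ls)
  then show "f \<in> N \<Longrightarrow> fr.comb Z bb f = \<zero>\<^bsub>Z\<^esub>" by auto
qed

lemma lift_cls:
  assumes f: "f \<in> carrier fr.F"
  shows "tensor_lift K V W Z b (cls f) = fr.comb Z bb f"
proof -
  note lin = fr.comb_linear[OF Z bb]
  define u where "u = (SOME u. u \<in> cls f)"
  have "u \<in> cls f" unfolding u_def by (rule someI[of "\<lambda>u. u \<in> cls f", OF N.a_rcos_self[OF f]])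
  note u = cls_memD[OF f this]
  have "tensor_lift K V W Z b (cls f) = fr.comb Z bb u"
    using cls_closed[OF f] unfolding tensor_lift_def fr.comb_def Let_def u_def by simp
  also have "\<dots> = fr.comb Z bb f"
    using u f comb_kernel lin_minus[OF FM.module_axioms Z lin, of u f]
      mod_diff_zero[OF Z lin_closed[OF lin] lin_closed[OF lin], of u f] by simp
  finally show ?thesis .
qed

lemma lift_linear: "tensor_lift K V W Z b \<in> linear_map K VW Z"
proof (rule linear_mapI)
  note lin = fr.comb_linear[OF Z bb]
  let ?L = "tensor_lift K V W Z b"
  fix x assume x: "x \<in> carrier VW"
  show "?L x \<in> carrier Z" using x by (elim tensor_cases) (simp add: lift_cls lin_closed[OF lin])
  show "?L (x \<oplus>\<^bsub>VW\<^esub> y) = ?L x \<oplus>\<^bsub>Z\<^esub> ?L y" if "y \<in> carrier VW" for y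
    using x that by (elim tensor_cases) (simp add: tensor_add lift_cls lin_add[OF lin])
  show "?L (c \<odot>\<^bsub>VW\<^esub> x) = c \<odot>\<^bsub>Z\<^esub> ?L x" if "c \<in> carrier K" for c
    using x that by (elim tensor_cases) (simp add: tensor_smult lift_cls lin_smult[OF lin])
qed

lemma lift_tens: "v \<in> carrier V \<Longrightarrow> w \<in> carrier W \<Longrightarrow> tensor_lift K V W Z b (t v w) = b v w"
  unfolding tens_def by (subst lift_cls) (auto simp: fr.comb_single[OF Z bb] fr.single_closed)

end

lemma lift_extensional: "tensor_lift K V W Z b \<in> extensional (carrier VW)"
  by (simp add: tensor_lift_def)

end

section \<open>Linear functionals and slices\<close>

lemma
  assumes "h \<in> linear_functional K V"
  shows fun_closed: "x \<in> carrier V \<Longrightarrow> h x \<in> carrier K"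
    and fun_add: "x \<in> carrier V \<Longrightarrow> y \<in> carrier V \<Longrightarrow> h (x \<oplus>\<^bsub>V\<^esub> y) = h x \<oplus>\<^bsub>K\<^esub> h y"
    and fun_smult: "c \<in> carrier K \<Longrightarrow> x \<in> carrier V \<Longrightarrow> h (c \<odot>\<^bsub>V\<^esub> x) = c \<otimes>\<^bsub>K\<^esub> h x"
  using assms by (auto simp: linear_functional_def)

lemma linear_functionalI:
  assumes "\<And>x. x \<in> carrier V \<Longrightarrow> h x \<in> carrier K"
    and "\<And>x y. x \<in> carrier V \<Longrightarrow> y \<in> carrier V \<Longrightarrow> h (x \<oplus>\<^bsub>V\<^esub> y) = h x \<oplus>\<^bsub>K\<^esub> h y"
    and "\<And>c x. c \<in> carrier K \<Longrightarrow> x \<in> carrier V \<Longrightarrow> h (c \<odot>\<^bsub>V\<^esub> x) = c \<otimes>\<^bsub>K\<^esub> h x"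
  shows "h \<in> linear_functional K V"
  using assms by (auto simp: linear_functional_def)

lemma fun_zero:
  assumes "module K V" "h \<in> linear_functional K V"
  shows "h \<zero>\<^bsub>V\<^esub> = \<zero>\<^bsub>K\<^esub>"
proof -
  interpret V: module K V by fact
  have "h (\<zero>\<^bsub>K\<^esub> \<odot>\<^bsub>V\<^esub> \<zero>\<^bsub>V\<^esub>) = \<zero>\<^bsub>K\<^esub> \<otimes>\<^bsub>K\<^esub> h \<zero>\<^bsub>V\<^esub>"
    by (rule fun_smult[OF assms(2)]) auto
  then show ?thesis using fun_closed[OF assms(2)] by simp
qed

lemma fun_comp: "f \<in> linear_map K U V \<Longrightarrow> h \<in> linear_functional K V \<Longrightarrow> (\<lambda>u. h (f u)) \<in> linear_functional K U"
  by (rule linear_functionalI) (auto simp: lin_closed lin_add lin_smult fun_closed fun_add fun_smult)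

lemma lin_comp: "f \<in> linear_map K U V \<Longrightarrow> g \<in> linear_map K V W \<Longrightarrow> (\<lambda>u. g (f u)) \<in> linear_map K U W"
  by (rule linear_mapI) (auto simp: lin_closed lin_add lin_smult)

lemma lin_id: "(\<lambda>u. u) \<in> linear_map K U U"
  by (rule linear_mapI) auto

lemma lin_fun_scale:
  assumes "module K V" "h \<in> linear_functional K U" "v \<in> carrier V"
  shows "(\<lambda>u. h u \<odot>\<^bsub>V\<^esub> v) \<in> linear_map K U V"
proof -
  interpret V: module K V by fact
  show ?thesis
    by (rule linear_mapI)
      (use assms in \<open>simp_all add: fun_closed[OF assms(2)] fun_add[OF assms(2)] fun_smult[OF assms(2)] V.smult_l_distr V.smult_assoc1\<close>)
qed

lemma lin_scale:
  assumes "module K V" "f \<in> linear_map K U V" "c \<in> carrier K"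
  shows "(\<lambda>u. c \<odot>\<^bsub>V\<^esub> f u) \<in> linear_map K U V"
proof -
  interpret V: module K V by fact
  show ?thesis
  proof (rule linear_mapI)
    fix d x assume d: "d \<in> carrier K" and x: "x \<in> carrier U"
    have "c \<odot>\<^bsub>V\<^esub> (d \<odot>\<^bsub>V\<^esub> f x) = (c \<otimes>\<^bsub>K\<^esub> d) \<odot>\<^bsub>V\<^esub> f x" "d \<odot>\<^bsub>V\<^esub> (c \<odot>\<^bsub>V\<^esub> f x) = (c \<otimes>\<^bsub>K\<^esub> d) \<odot>\<^bsub>V\<^esub> f x"
      using assms(3) d lin_closed[OF assms(2) x] by (simp_all add: V.smult_assoc1[symmetric] V.R.m_comm)
    then show "c \<odot>\<^bsub>V\<^esub> f (d \<odot>\<^bsub>U\<^esub> x) = d \<odot>\<^bsub>V\<^esub> (c \<odot>\<^bsub>V\<^esub> f x)"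
      by (simp add: lin_smult[OF assms(2) d x])
  qed (use assms in \<open>simp_all add: lin_closed[OF assms(2)] lin_add[OF assms(2)] V.smult_r_distr\<close>)
qed

lemma lin_sum:
  assumes "module K V" "f \<in> linear_map K U V" "g \<in> linear_map K U V"
  shows "(\<lambda>u. f u \<oplus>\<^bsub>V\<^esub> g u) \<in> linear_map K U V"
proof -
  interpret V: module K V by fact
  show ?thesis
    by (rule linear_mapI)
      (use lin_closed[OF assms(2)] lin_closed[OF assms(3)] in
        \<open>simp_all add: lin_add[OF assms(2)] lin_add[OF assms(3)] lin_smult[OF assms(2)] lin_smult[OF assms(3)]
          V.smult_r_distr V.M.a_ac\<close>)
qed

lemma lin_diff:
  assumes "module K U" "module K V" "f \<in> linear_map K U V" "g \<in> linear_map K U V"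
  shows "(\<lambda>u. f u \<ominus>\<^bsub>V\<^esub> g u) \<in> linear_map K U V"
proof (rule lin_cong[OF _ _ assms(1)])
  interpret V: module K V by fact
  show "(\<lambda>u. f u \<oplus>\<^bsub>V\<^esub> (\<ominus>\<^bsub>K\<^esub> \<one>\<^bsub>K\<^esub>) \<odot>\<^bsub>V\<^esub> g u) \<in> linear_map K U V"
    by (rule lin_sum[OF assms(2,3) lin_scale[OF assms(2,4)]]) simp
  show "f u \<ominus>\<^bsub>V\<^esub> g u = f u \<oplus>\<^bsub>V\<^esub> (\<ominus>\<^bsub>K\<^esub> \<one>\<^bsub>K\<^esub>) \<odot>\<^bsub>V\<^esub> g u" if "u \<in> carrier U" for u
    using mod_minus_smult[OF assms(2) lin_closed[OF assms(4) that]] by (simp add: a_minus_def)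
qed

text \<open>
  By Zorn's lemma there is a submodule \<open>M\<close> maximal among those that avoid \<open>v\<close>. Then every \<open>x\<close> is
  congruent modulo \<open>M\<close> to a unique multiple of \<open>v\<close>, whose coefficient is the value of the functional.
\<close>

lemma separating_functional:
  fixes K (structure) and V (structure)
  assumes "field K" "module K V" "v \<in> carrier V" "v \<noteq> \<zero>\<^bsub>V\<^esub>"
  shows "\<exists>h\<in>linear_functional K V. h v = \<one>\<^bsub>K\<^esub>"
proof -
  interpret field K by fact
  interpret V: module K V by fact
  note VM = assms(2)
  let ?C = "{N. submodule N K V \<and> v \<notin> N}"
  have "\<exists>M\<in>?C. \<forall>N\<in>?C. M \<subseteq> N \<longrightarrow> N = M"
  proof (rule subset_Zorn_nonempty)
    show "?C \<noteq> {}" using zero_submod[OF VM] assms(4) by blast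
    fix \<C> assume ne: "\<C> \<noteq> {}" and ch: "subset.chain ?C \<C>"
    have sub: "submodule N K V" if "N \<in> \<C>" for N using that ch by (auto simp: subset.chain_def)
    have "submodule (\<Union>\<C>) K V"
    proof (rule submodI[OF VM])
      show "\<Union>\<C> \<subseteq> carrier V" using submod_subset[OF VM sub] by blast
      show "\<zero>\<^bsub>V\<^esub> \<in> \<Union>\<C>" using submod_zero[OF VM sub] ne by blast
      show "a \<oplus>\<^bsub>V\<^esub> b \<in> \<Union>\<C>" if ab: "a \<in> \<Union>\<C>" "b \<in> \<Union>\<C>" for a b
      proof -
        from ab obtain N N' where N: "N \<in> \<C>" "N' \<in> \<C>" "a \<in> N" "b \<in> N'" by blast
        from ch N(1,2) have "N \<subseteq> N' \<or> N' \<subseteq> N" by (auto simp: subset.chain_def)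
        then show ?thesis using N submod_add[OF VM sub] by blast
      qed
      show "c \<odot>\<^bsub>V\<^esub> a \<in> \<Union>\<C>" if "c \<in> carrier K" "a \<in> \<Union>\<C>" for c a
        using that submod_smult[OF VM sub] by blast
    qed
    then show "\<Union>\<C> \<in> ?C" using ch by (auto simp: subset.chain_def)
  qed
  then obtain M where M: "submodule M K V" "v \<notin> M"
    and max: "\<And>N. submodule N K V \<Longrightarrow> v \<notin> N \<Longrightarrow> M \<subseteq> N \<Longrightarrow> N = M" by blast
  note Msub = subsetD[OF submod_subset[OF VM M(1)]]
  have ex: "\<exists>c\<in>carrier K. x \<ominus>\<^bsub>V\<^esub> c \<odot>\<^bsub>V\<^esub> v \<in> M" if x: "x \<in> carrier V" for x
  proof (cases "x \<in> M")
    case True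
    then show ?thesis using x assms(3) by (intro bexI[of _ "\<zero>\<^bsub>K\<^esub>"]) (simp_all add: a_minus_def V.M.minus_equality[of "\<zero>\<^bsub>V\<^esub>" "\<zero>\<^bsub>V\<^esub>"])
  next
    case False
    let ?N = "{m \<oplus>\<^bsub>V\<^esub> c \<odot>\<^bsub>V\<^esub> x | m c. m \<in> M \<and> c \<in> carrier K}"
    have "submodule ?N K V"
    proof (rule submodI[OF VM])
      show "?N \<subseteq> carrier V" using Msub x by auto
      show "\<zero>\<^bsub>V\<^esub> \<in> ?N"
        using submod_zero[OF VM M(1)] x by (intro CollectI exI[of _ "\<zero>\<^bsub>V\<^esub>"] exI[of _ "\<zero>\<^bsub>K\<^esub>"]) auto
      show "a \<oplus>\<^bsub>V\<^esub> b \<in> ?N" if ab: "a \<in> ?N" "b \<in> ?N" for a b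
      proof -
        from ab obtain m c m' c' where m: "m \<in> M" "c \<in> carrier K" "a = m \<oplus>\<^bsub>V\<^esub> c \<odot>\<^bsub>V\<^esub> x"
          "m' \<in> M" "c' \<in> carrier K" "b = m' \<oplus>\<^bsub>V\<^esub> c' \<odot>\<^bsub>V\<^esub> x" by blast
        then have "a \<oplus>\<^bsub>V\<^esub> b = (m \<oplus>\<^bsub>V\<^esub> m') \<oplus>\<^bsub>V\<^esub> (c \<oplus>\<^bsub>K\<^esub> c') \<odot>\<^bsub>V\<^esub> x"
          using Msub x by (simp add: V.smult_l_distr V.M.a_ac)
        then show ?thesis using m submod_add[OF VM M(1)] by blast
      qed
      show "d \<odot>\<^bsub>V\<^esub> a \<in> ?N" if d: "d \<in> carrier K" and a: "a \<in> ?N" for d a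
      proof -
        from a obtain m c where m: "m \<in> M" "c \<in> carrier K" "a = m \<oplus>\<^bsub>V\<^esub> c \<odot>\<^bsub>V\<^esub> x" by blast
        then have "d \<odot>\<^bsub>V\<^esub> a = d \<odot>\<^bsub>V\<^esub> m \<oplus>\<^bsub>V\<^esub> (d \<otimes>\<^bsub>K\<^esub> c) \<odot>\<^bsub>V\<^esub> x"
          using Msub x d by (simp add: V.smult_r_distr V.smult_assoc1)
        then show ?thesis using m d submod_smult[OF VM M(1)] by blast
      qed
    qed
    moreover have "M \<subseteq> ?N"
    proof
      fix m assume "m \<in> M"
      then show "m \<in> ?N" using x Msub by (intro CollectI exI[of _ m] exI[of _ "\<zero>\<^bsub>K\<^esub>"]) auto
    qed
    moreover have "x \<in> ?N"
      using x submod_zero[OF VM M(1)] by (intro CollectI exI[of _ "\<zero>\<^bsub>V\<^esub>"] exI[of _ "\<one>\<^bsub>K\<^esub>"]) auto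
    ultimately have "v \<in> ?N" using max[of ?N] False by blast
    then obtain m c where m: "m \<in> M" "c \<in> carrier K" "v = m \<oplus>\<^bsub>V\<^esub> c \<odot>\<^bsub>V\<^esub> x" by blast
    have c: "c \<noteq> \<zero>\<^bsub>K\<^esub>" using m M(2) x Msub by auto
    let ?d = "inv\<^bsub>K\<^esub> c"
    have d: "?d \<in> carrier K" "?d \<otimes>\<^bsub>K\<^esub> c = \<one>\<^bsub>K\<^esub>" using m(2) c field_Units by auto
    have "?d \<odot>\<^bsub>V\<^esub> v = ?d \<odot>\<^bsub>V\<^esub> m \<oplus>\<^bsub>V\<^esub> x"
      using m d x Msub by (simp add: V.smult_r_distr V.smult_assoc1[symmetric])
    then have "x \<ominus>\<^bsub>V\<^esub> ?d \<odot>\<^bsub>V\<^esub> v = \<ominus>\<^bsub>V\<^esub> (?d \<odot>\<^bsub>V\<^esub> m)"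
      using x d m Msub by (simp add: a_minus_def V.M.minus_add V.M.a_ac V.M.r_neg2 V.M.r_neg1)
    then have "x \<ominus>\<^bsub>V\<^esub> ?d \<odot>\<^bsub>V\<^esub> v \<in> M"
      using V.submoduleE(3)[OF M(1)] submod_smult[OF VM M(1) d(1) m(1)] by simp
    then show ?thesis using d(1) by blast
  qed
  have uniq: "c = c'" if c: "c \<in> carrier K" "c' \<in> carrier K" "x \<ominus>\<^bsub>V\<^esub> c \<odot>\<^bsub>V\<^esub> v \<in> M" "x \<ominus>\<^bsub>V\<^esub> c' \<odot>\<^bsub>V\<^esub> v \<in> M"
    and x: "x \<in> carrier V" for x c c'
  proof (rule ccontr)
    assume ne: "c \<noteq> c'"
    have e: "(x \<ominus>\<^bsub>V\<^esub> c' \<odot>\<^bsub>V\<^esub> v) \<ominus>\<^bsub>V\<^esub> (x \<ominus>\<^bsub>V\<^esub> c \<odot>\<^bsub>V\<^esub> v) = (c \<ominus>\<^bsub>K\<^esub> c') \<odot>\<^bsub>V\<^esub> v"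
      using c x assms(3) by (simp add: a_minus_def V.smult_l_distr V.M.minus_add V.M.a_ac V.M.r_neg2 V.M.r_neg1 V.smult_l_minus V.M.r_neg)
    have "(c \<ominus>\<^bsub>K\<^esub> c') \<odot>\<^bsub>V\<^esub> v \<in> M" using submod_minus[OF VM M(1) c(4) c(3)] unfolding e .
    moreover have d: "c \<ominus>\<^bsub>K\<^esub> c' \<noteq> \<zero>\<^bsub>K\<^esub>" "c \<ominus>\<^bsub>K\<^esub> c' \<in> carrier K"
      using c ne minus_equality[of c "\<ominus>\<^bsub>K\<^esub> c'"] by (auto simp: a_minus_def)
    ultimately have "inv\<^bsub>K\<^esub> (c \<ominus>\<^bsub>K\<^esub> c') \<odot>\<^bsub>V\<^esub> ((c \<ominus>\<^bsub>K\<^esub> c') \<odot>\<^bsub>V\<^esub> v) \<in> M"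
      using submod_smult[OF VM M(1)] field_Units by auto
    then show False using d assms(3) M(2) field_Units by (simp add: V.smult_assoc1[symmetric])
  qed
  define h where "h x = (THE c. c \<in> carrier K \<and> x \<ominus>\<^bsub>V\<^esub> c \<odot>\<^bsub>V\<^esub> v \<in> M)" for x
  have h: "h x = c" if "c \<in> carrier K" "x \<ominus>\<^bsub>V\<^esub> c \<odot>\<^bsub>V\<^esub> v \<in> M" "x \<in> carrier V" for x c
    unfolding h_def by (rule the_equality) (use that uniq in blast)+
  have h': "h x \<in> carrier K \<and> x \<ominus>\<^bsub>V\<^esub> h x \<odot>\<^bsub>V\<^esub> v \<in> M" if "x \<in> carrier V" for x
    using ex[OF that] h that by blast
  have "h \<in> linear_functional K V"
  proof (rule linear_functionalI)
    fix x assume x: "x \<in> carrier V"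
    note hx = h'[OF x]
    show "h (x \<oplus>\<^bsub>V\<^esub> y) = h x \<oplus>\<^bsub>K\<^esub> h y" if y: "y \<in> carrier V" for y
    proof -
      note hy = h'[OF y]
      have "(x \<oplus>\<^bsub>V\<^esub> y) \<ominus>\<^bsub>V\<^esub> (h x \<oplus>\<^bsub>K\<^esub> h y) \<odot>\<^bsub>V\<^esub> v = (x \<ominus>\<^bsub>V\<^esub> h x \<odot>\<^bsub>V\<^esub> v) \<oplus>\<^bsub>V\<^esub> (y \<ominus>\<^bsub>V\<^esub> h y \<odot>\<^bsub>V\<^esub> v)"
        using hx hy x y assms(3) by (simp add: a_minus_def V.smult_l_distr V.M.minus_add V.M.a_ac)
      then show ?thesis
        using hx hy submod_add[OF VM M(1)] x y by (intro h) auto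
    qed
    show "h (c \<odot>\<^bsub>V\<^esub> x) = c \<otimes>\<^bsub>K\<^esub> h x" if c: "c \<in> carrier K" for c
    proof -
      have "(c \<odot>\<^bsub>V\<^esub> x) \<ominus>\<^bsub>V\<^esub> (c \<otimes>\<^bsub>K\<^esub> h x) \<odot>\<^bsub>V\<^esub> v = c \<odot>\<^bsub>V\<^esub> (x \<ominus>\<^bsub>V\<^esub> h x \<odot>\<^bsub>V\<^esub> v)"
        using hx x c assms(3) by (simp add: a_minus_def V.smult_r_distr V.smult_assoc1 V.smult_r_minus)
      then show ?thesis
        using hx c submod_smult[OF VM M(1)] x by (intro h) auto
    qed
  qed (use h' in blast)
  moreover have "h v = \<one>\<^bsub>K\<^esub>"
    using assms(3) submod_zero[OF VM M(1)] by (intro h) (auto simp: a_minus_def V.M.r_neg)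
  ultimately show ?thesis by blast
qed

context tensor_space
begin

lemma tens_lin_l: "f \<in> linear_map K U V \<Longrightarrow> w \<in> carrier W \<Longrightarrow> (\<lambda>u. t (f u) w) \<in> linear_map K U VW"
  by (rule lin_comp[OF _ tens_l])

lemma tens_lin_r: "f \<in> linear_map K U W \<Longrightarrow> v \<in> carrier V \<Longrightarrow> (\<lambda>u. t v (f u)) \<in> linear_map K U VW"
  by (rule lin_comp[OF _ tens_r])

lemma lift_lin_arg:
  "module K Z \<Longrightarrow> b \<in> bilinear_map K V W Z \<Longrightarrow> f \<in> linear_map K U VW \<Longrightarrow>
    (\<lambda>u. tensor_lift K V W Z b (f u)) \<in> linear_map K U Z"
  by (rule lin_comp[OF _ lift_linear])

lemma lift_closed: "module K Z \<Longrightarrow> b \<in> bilinear_map K V W Z \<Longrightarrow> x \<in> carrier VW \<Longrightarrow>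
    tensor_lift K V W Z b x \<in> carrier Z"
  by (rule lin_closed[OF lift_linear])

lemma lift_unique:
  assumes "module K Z" "b \<in> bilinear_map K V W Z" "g \<in> linear_map K VW Z"
    "\<And>v w. v \<in> carrier V \<Longrightarrow> w \<in> carrier W \<Longrightarrow> g (t v w) = b v w" "x \<in> carrier VW"
  shows "tensor_lift K V W Z b x = g x"
  by (rule tensor_lin_eq[OF assms(1) lift_linear[OF assms(1,2)] assms(3) _ assms(5)])
     (simp add: lift_tens assms)

lemma lift_cong:
  assumes "module K Z" "b \<in> bilinear_map K V W Z" "b' \<in> bilinear_map K V W Z"
    "\<And>v w. v \<in> carrier V \<Longrightarrow> w \<in> carrier W \<Longrightarrow> b v w = b' v w" "x \<in> carrier VW"
  shows "tensor_lift K V W Z b x = tensor_lift K V W Z b' x"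
  by (rule lift_unique[OF assms(1,2) lift_linear[OF assms(1,3)] _ assms(5)])
     (simp add: lift_tens assms)

lemma bilin_comp:
  "b \<in> bilinear_map K V W Z \<Longrightarrow> g \<in> linear_map K Z Z' \<Longrightarrow> (\<lambda>v w. g (b v w)) \<in> bilinear_map K V W Z'"
  by (rule bilinear_mapI) (auto intro: lin_comp bilin_l bilin_r)

lemma lift_push:
  assumes "module K Z" "module K Z'" "b \<in> bilinear_map K V W Z" "g \<in> linear_map K Z Z'" "x \<in> carrier VW"
  shows "g (tensor_lift K V W Z b x) = tensor_lift K V W Z' (\<lambda>v w. g (b v w)) x"
  by (rule lift_unique[symmetric, OF assms(2) bilin_comp[OF assms(3,4)] lin_comp[OF lift_linear[OF assms(1,3)] assms(4)] _ assms(5)])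
     (simp add: lift_tens assms)

text \<open>
  Linearity of an iterated lift in a parameter on which the bilinear map depends. This is what makes
  comparison on pure tensors available for nested lifts.
\<close>

lemma lift_lin_par:
  assumes Z: "module K Z" and b: "\<And>u. u \<in> carrier U \<Longrightarrow> b u \<in> bilinear_map K V W Z"
    and l: "\<And>v w. v \<in> carrier V \<Longrightarrow> w \<in> carrier W \<Longrightarrow> (\<lambda>u. b u v w) \<in> linear_map K U Z"
    and U: "module K U" and x: "x \<in> carrier VW"
  shows "(\<lambda>u. tensor_lift K V W Z (b u) x) \<in> linear_map K U Z"
proof (rule linear_mapI)
  interpret Z: module K Z by (rule Z)
  interpret U: module K U by (rule U)
  show "tensor_lift K V W Z (b u) x \<in> carrier Z" if "u \<in> carrier U" for u
    by (rule lift_closed[OF Z b[OF that] x])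
  show "tensor_lift K V W Z (b (u \<oplus>\<^bsub>U\<^esub> u')) x = tensor_lift K V W Z (b u) x \<oplus>\<^bsub>Z\<^esub> tensor_lift K V W Z (b u') x"
    if u: "u \<in> carrier U" "u' \<in> carrier U" for u u'
    by (rule lift_unique[OF Z b lin_sum[OF Z lift_linear[OF Z b] lift_linear[OF Z b]] _ x])
      (use u in \<open>simp_all add: lift_tens[OF Z b] lin_add[OF l]\<close>)
  show "tensor_lift K V W Z (b (c \<odot>\<^bsub>U\<^esub> u)) x = c \<odot>\<^bsub>Z\<^esub> tensor_lift K V W Z (b u) x"
    if u: "c \<in> carrier K" "u \<in> carrier U" for u c
    by (rule lift_unique[OF Z b lin_scale[OF Z lift_linear[OF Z b]] _ x])
      (use u in \<open>simp_all add: lift_tens[OF Z b] lin_smult[OF l]\<close>)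
qed

lemma slice_snd_bilinear: "h \<in> linear_functional K W \<Longrightarrow> (\<lambda>x y. h y \<odot>\<^bsub>V\<^esub> x) \<in> bilinear_map K V W V"
  by (intro bilinear_mapI lin_fun_scale[OF V_module]) (auto intro: lin_scale[OF V_module lin_id] fun_closed)

lemma slice_fst_bilinear: "h \<in> linear_functional K V \<Longrightarrow> (\<lambda>x y. h x \<odot>\<^bsub>W\<^esub> y) \<in> bilinear_map K V W W"
  by (intro bilinear_mapI lin_fun_scale[OF W_module]) (auto intro: lin_scale[OF W_module lin_id] fun_closed)

lemma slice_snd_linear: "h \<in> linear_functional K W \<Longrightarrow> slice_snd K V W h \<in> linear_map K VW V"
  unfolding slice_snd_def by (rule lift_linear[OF V_module slice_snd_bilinear])

lemma slice_fst_linear: "h \<in> linear_functional K V \<Longrightarrow> slice_fst K V W h \<in> linear_map K VW W"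
  unfolding slice_fst_def by (rule lift_linear[OF W_module slice_fst_bilinear])

lemma slice_snd_tens: "h \<in> linear_functional K W \<Longrightarrow> v \<in> carrier V \<Longrightarrow> w \<in> carrier W \<Longrightarrow>
    slice_snd K V W h (t v w) = h w \<odot>\<^bsub>V\<^esub> v"
  unfolding slice_snd_def by (rule lift_tens[OF V_module slice_snd_bilinear])

lemma slice_fst_tens: "h \<in> linear_functional K V \<Longrightarrow> v \<in> carrier V \<Longrightarrow> w \<in> carrier W \<Longrightarrow>
    slice_fst K V W h (t v w) = h v \<odot>\<^bsub>W\<^esub> w"
  unfolding slice_fst_def by (rule lift_tens[OF W_module slice_fst_bilinear])

text \<open>
  Sums of \<open>n\<close> pure tensors. Tensors are classes of functions, so the number of summands serves as
  the induction measure for elimination arguments.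
\<close>

primrec rank_le :: "nat \<Rightarrow> ('v \<times> 'w \<Rightarrow> 'k) set set" where
  "rank_le 0 = {\<zero>\<^bsub>VW\<^esub>}"
| "rank_le (Suc n) = {u \<oplus>\<^bsub>VW\<^esub> t v w | u v w. u \<in> rank_le n \<and> v \<in> carrier V \<and> w \<in> carrier W}"

lemma rank_le_carrier: "rank_le n \<subseteq> carrier VW"
  by (induction n) auto

lemma rank_le_add: "u \<in> rank_le m \<Longrightarrow> u' \<in> rank_le n \<Longrightarrow> u \<oplus>\<^bsub>VW\<^esub> u' \<in> rank_le (m + n)"
proof (induction n arbitrary: u')
  case 0
  then show ?case using subsetD[OF rank_le_carrier, of u m] by simp
next
  case (Suc n)
  from Suc.prems(2) obtain u1 v w where u1: "u' = u1 \<oplus>\<^bsub>VW\<^esub> t v w" "u1 \<in> rank_le n" "v \<in> carrier V" "w \<in> carrier W"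
    by auto
  have c: "u \<in> carrier VW" "u1 \<in> carrier VW" using Suc.prems(1) u1(2) rank_le_carrier by auto
  have "u \<oplus>\<^bsub>VW\<^esub> u' = (u \<oplus>\<^bsub>VW\<^esub> u1) \<oplus>\<^bsub>VW\<^esub> t v w"
    using c u1 by (simp add: T.M.a_assoc)
  then show ?case using Suc.IH[OF Suc.prems(1) u1(2)] u1 by auto
qed

lemma rank_le_map:
  assumes "L \<in> linear_map K VW VW"
    "\<And>v w. v \<in> carrier V \<Longrightarrow> w \<in> carrier W \<Longrightarrow> \<exists>v'\<in>carrier V. \<exists>w'\<in>carrier W. L (t v w) = t v' w'"
  shows "u \<in> rank_le n \<Longrightarrow> L u \<in> rank_le n"
proof (induction n arbitrary: u)
  case 0
  then show ?case using lin_zero[OF tensor_module tensor_module assms(1)] by simp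
next
  case (Suc n)
  from Suc.prems obtain u1 v w where u1: "u = u1 \<oplus>\<^bsub>VW\<^esub> t v w" "u1 \<in> rank_le n" "v \<in> carrier V" "w \<in> carrier W"
    by auto
  have "L u = L u1 \<oplus>\<^bsub>VW\<^esub> L (t v w)" using u1 lin_add[OF assms(1)] subsetD[OF rank_le_carrier, of u1 n] by simp
  moreover obtain v' w' where "v'\<in>carrier V" "w'\<in>carrier W" "L (t v w) = t v' w'" using assms(2) u1 by blast
  ultimately show ?case using Suc.IH[OF u1(2)] by auto
qed

lemma tensor_finite_rank:
  assumes "u \<in> carrier VW" obtains n where "u \<in> rank_le n"
proof -
  have "u \<in> {u. \<exists>n. u \<in> rank_le n}"
  proof (rule tensor_induct[OF _ _ assms])
    show "submodule {u. \<exists>n. u \<in> rank_le n} K VW"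
    proof (rule submodI[OF tensor_module])
      show "{u. \<exists>n. u \<in> rank_le n} \<subseteq> carrier VW" using rank_le_carrier by auto
      show "\<zero>\<^bsub>VW\<^esub> \<in> {u. \<exists>n. u \<in> rank_le n}" using rank_le.simps(1) by blast
      show "a \<oplus>\<^bsub>VW\<^esub> b \<in> {u. \<exists>n. u \<in> rank_le n}" if "a \<in> {u. \<exists>n. u \<in> rank_le n}" "b \<in> {u. \<exists>n. u \<in> rank_le n}" for a b
        using that rank_le_add by blast
      show "c \<odot>\<^bsub>VW\<^esub> a \<in> {u. \<exists>n. u \<in> rank_le n}" if c: "c \<in> carrier K" and a: "a \<in> {u. \<exists>n. u \<in> rank_le n}" for c a
      proof -
        have "\<exists>v'\<in>carrier V. \<exists>w'\<in>carrier W. c \<odot>\<^bsub>VW\<^esub> t v w = t v' w'" if "v \<in> carrier V" "w \<in> carrier W" for v w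
          using that c lin_smult[OF tens_l[OF that(2)] c that(1)] V.smult_closed by metis
        then show ?thesis using rank_le_map[OF lin_scale[OF tensor_module lin_id c]] a by blast
      qed
    qed
    show "t v w \<in> {u. \<exists>n. u \<in> rank_le n}" if "v \<in> carrier V" "w \<in> carrier W" for v w
    proof -
      have "t v w = \<zero>\<^bsub>VW\<^esub> \<oplus>\<^bsub>VW\<^esub> t v w" using that by simp
      then have "t v w \<in> rank_le (Suc 0)" unfolding rank_le.simps using that by blast
      then show ?thesis by blast
    qed
  qed
  then show thesis using that by blast
qed

text \<open>
  If the slices of \<open>u\<close> along a family of functionals lie in \<open>Y\<close>, then \<open>u\<close> lies in
  \<open>Y \<otimes> W + V \<otimes> W\<^sub>0\<close>, where \<open>W\<^sub>0\<close> is the common kernel of the family. Proof by elimination: a pure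
  summand \<open>v \<otimes> w\<close> with \<open>h w = 1\<close> is removed from \<open>u\<close> by subtracting \<open>s \<otimes> w\<close>, \<open>s\<close> being the
  slice of \<open>u\<close> along \<open>h\<close>.
\<close>

lemma slice_elimination:
  assumes H: "H \<subseteq> linear_functional K W" and Y: "submodule Y K V" and S: "submodule S K VW"
    and YS: "\<And>y w. y \<in> Y \<Longrightarrow> w \<in> carrier W \<Longrightarrow> t y w \<in> S"
    and NS: "\<And>v w. v \<in> carrier V \<Longrightarrow> w \<in> carrier W \<Longrightarrow> \<forall>h\<in>H. h w = \<zero>\<^bsub>K\<^esub> \<Longrightarrow> t v w \<in> S"
    and u: "u \<in> carrier VW" and sl: "\<And>h. h \<in> H \<Longrightarrow> slice_snd K V W h u \<in> Y"
  shows "u \<in> S"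
proof -
  have "u \<in> rank_le n \<Longrightarrow> \<forall>h\<in>H. slice_snd K V W h u \<in> Y \<Longrightarrow> u \<in> S" for n u
  proof (induction n arbitrary: u)
    case 0
    then show ?case using submod_zero[OF tensor_module S] by simp
  next
    case (Suc n)
    from Suc.prems(1) obtain u1 v w where u: "u = u1 \<oplus>\<^bsub>VW\<^esub> t v w" "u1 \<in> rank_le n"
      and v: "v \<in> carrier V" and w: "w \<in> carrier W" by auto
    have uc: "u1 \<in> carrier VW" "u \<in> carrier VW"
      using subsetD[OF rank_le_carrier u(2)] subsetD[OF rank_le_carrier Suc.prems(1)] by simp_all
    note sadd = lin_add[OF slice_snd_linear] and sclosed = lin_closed[OF slice_snd_linear]
    show ?case
    proof (cases "\<forall>h\<in>H. h w = \<zero>\<^bsub>K\<^esub>")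
      case True
      have "slice_snd K V W h u1 \<in> Y" if h: "h \<in> H" for h
      proof -
        have "h \<in> linear_functional K W" using h H by auto
        then have "slice_snd K V W h u = slice_snd K V W h u1"
          using bspec[OF True h] u(1) uc v w by (simp add: sadd slice_snd_tens sclosed)
        then show ?thesis using Suc.prems(2) h by auto
      qed
      then show ?thesis using Suc.IH[OF u(2)] NS[OF v w True] submod_add[OF tensor_module S] u(1) by blast
    next
      case False
      then obtain h where h: "h \<in> H" "h w \<noteq> \<zero>\<^bsub>K\<^esub>" by blast
      then have hl: "h \<in> linear_functional K W" using H by auto
      let ?c = "h w"
      have c: "?c \<in> carrier K" "inv ?c \<in> carrier K" "inv ?c \<otimes> ?c = \<one>"
        using h fun_closed[OF hl w] field_Units by auto
      define w' where "w' = inv ?c \<odot>\<^bsub>W\<^esub> w"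
      have w': "w' \<in> carrier W" "h w' = \<one>" using c w by (auto simp: w'_def fun_smult[OF hl])
      have cw': "?c \<odot>\<^bsub>W\<^esub> w' = w" using c w by (simp add: w'_def W.smult_assoc1[symmetric] m_comm)
      \<comment> \<open>Subtracting the slice along \<open>h\<close> makes \<open>D\<close> kill the summand \<open>v \<otimes> w\<close>, so it lowers the rank.\<close>
      define D where "D x = x \<ominus>\<^bsub>VW\<^esub> t (slice_snd K V W h x) w'" for x
      have Dl: "D \<in> linear_map K VW VW" unfolding D_def
        by (rule lin_diff[OF tensor_module tensor_module lin_id tens_lin_l[OF slice_snd_linear[OF hl] w'(1)]])
      have Dt: "D (t x y) = t x (y \<ominus>\<^bsub>W\<^esub> h y \<odot>\<^bsub>W\<^esub> w')" if xy: "x \<in> carrier V" "y \<in> carrier W" for x y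
        using xy w' fun_closed[OF hl xy(2)]
        by (simp add: D_def slice_snd_tens[OF hl] lin_smult[OF tens_l] lin_smult[OF tens_r]
            lin_minus[OF W_module tensor_module tens_r])
      have "t v w = ?c \<odot>\<^bsub>VW\<^esub> t v w'" using lin_smult[OF tens_r[OF v] c(1) w'(1)] cw' by simp
      then have "D (t v w) = \<zero>\<^bsub>VW\<^esub>"
        using v w' c by (simp add: lin_smult[OF Dl] Dt a_minus_def W.M.r_neg)
      then have "D u = D u1" using u(1) uc v w lin_add[OF Dl] lin_closed[OF Dl] by simp
      moreover have "D u1 \<in> rank_le n"
        by (rule rank_le_map[OF Dl _ u(2)])
          (use Dt w' fun_closed[OF hl] in \<open>meson W.M.minus_closed W.smult_closed\<close>)
      ultimately have Du: "D u \<in> rank_le n" by simp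
      have su: "slice_snd K V W h u \<in> Y" "slice_snd K V W h u \<in> carrier V"
        using Suc.prems(2) h sclosed[OF hl uc(2)] by auto
      have "slice_snd K V W g (D u) \<in> Y" if g: "g \<in> H" for g
      proof -
        have gl: "g \<in> linear_functional K W" using g H by auto
        have "slice_snd K V W g (D u) = slice_snd K V W g u \<ominus>\<^bsub>V\<^esub> g w' \<odot>\<^bsub>V\<^esub> slice_snd K V W h u"
          unfolding D_def using uc(2) su w'
          by (simp add: lin_minus[OF tensor_module V_module slice_snd_linear[OF gl]] slice_snd_tens[OF gl])
        then show ?thesis
          using submod_minus[OF V_module Y] submod_smult[OF V_module Y fun_closed[OF gl w'(1)] su(1)]
            Suc.prems(2) g by simp
      qed
      then have DS: "D u \<in> S" using Suc.IH[OF Du] by blast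
      have "u = D u \<oplus>\<^bsub>VW\<^esub> t (slice_snd K V W h u) w'"
        unfolding D_def a_minus_def using uc(2) su w' by (simp add: T.M.a_assoc T.M.l_neg)
      then show ?thesis using submod_add[OF tensor_module S DS YS[OF su(1) w'(1)]] by simp
    qed
  qed
  then show ?thesis using tensor_finite_rank[OF u] sl by metis
qed

lemma tensor_eqI_snd:
  assumes H: "H \<subseteq> linear_functional K W" and sep: "\<And>w. w \<in> carrier W \<Longrightarrow> \<forall>h\<in>H. h w = \<zero>\<^bsub>K\<^esub> \<Longrightarrow> w = \<zero>\<^bsub>W\<^esub>"
    and u: "u \<in> carrier VW" and sl: "\<And>h. h \<in> H \<Longrightarrow> slice_snd K V W h u = \<zero>\<^bsub>V\<^esub>"
  shows "u = \<zero>\<^bsub>VW\<^esub>"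
proof -
  have "u \<in> {\<zero>\<^bsub>VW\<^esub>}"
    by (rule slice_elimination[OF H zero_submod[OF V_module] zero_submod[OF tensor_module] _ _ u])
      (use sep sl tens_zero_l tens_zero_r in \<open>(blast | simp)+\<close>)
  then show ?thesis by simp
qed

abbreviation flip :: "('v \<times> 'w \<Rightarrow> 'k) set \<Rightarrow> ('w \<times> 'v \<Rightarrow> 'k) set"
  where "flip \<equiv> tensor_lift K V W (tensor K W V) (\<lambda>v w. tens K W V w v)"

text \<open>
  The statement for slices in the other leg with \<open>Y = 0\<close>, carried over by the flip.
\<close>

lemma slice_elimination_fst:
  assumes H: "H \<subseteq> linear_functional K V" and S: "submodule S K VW"
    and NS: "\<And>v w. v \<in> carrier V \<Longrightarrow> w \<in> carrier W \<Longrightarrow> \<forall>h\<in>H. h v = \<zero>\<^bsub>K\<^esub> \<Longrightarrow> t v w \<in> S"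
    and u: "u \<in> carrier VW" and sl: "\<And>h. h \<in> H \<Longrightarrow> slice_fst K V W h u = \<zero>\<^bsub>W\<^esub>"
  shows "u \<in> S"
proof -
  interpret WV: tensor_space K W V ..
  have b: "(\<lambda>v w. tens K W V w v) \<in> bilinear_map K V W WV.VW"
    by (rule bilinear_mapI) (auto intro: WV.tens_l WV.tens_r)
  have b': "(\<lambda>w v. t v w) \<in> bilinear_map K W V VW"
    by (rule bilinear_mapI) (auto intro: tens_l tens_r)
  note fl = lift_linear[OF WV.tensor_module b] and fl' = WV.lift_linear[OF tensor_module b']
  define unflip where "unflip = tensor_lift K W V VW (\<lambda>w v. t v w)"
  have fc: "flip u \<in> carrier WV.VW" by (rule lin_closed[OF fl u])
  have bf: "unflip (flip u) = u" unfolding unflip_def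
    by (rule tensor_lin_eq[OF tensor_module lin_comp[OF fl fl'] lin_id _ u])
      (simp add: lift_tens[OF WV.tensor_module b] WV.lift_tens[OF tensor_module b'])
  have "flip u \<in> {x \<in> carrier WV.VW. unflip x \<in> S}"
  proof (rule WV.slice_elimination[OF H zero_submod[OF W_module] vimage_submod[OF WV.tensor_module tensor_module _ S] _ _ fc])
    show "unflip \<in> linear_map K WV.VW VW" unfolding unflip_def by (rule fl')
    have bt: "unflip (tens K W V w v) = t v w" if "v \<in> carrier V" "w \<in> carrier W" for v w
      unfolding unflip_def using that by (simp add: WV.lift_tens[OF tensor_module b'])
    show "tens K W V y v \<in> {x \<in> carrier WV.VW. unflip x \<in> S}" if "y \<in> {\<zero>\<^bsub>W\<^esub>}" "v \<in> carrier V" for y v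
      using that lin_zero[OF WV.tensor_module tensor_module fl'] submod_zero[OF tensor_module S]
      by (simp add: unflip_def)
    show "tens K W V w v \<in> {x \<in> carrier WV.VW. unflip x \<in> S}"
      if "w \<in> carrier W" "v \<in> carrier V" "\<forall>h\<in>H. h v = \<zero>\<^bsub>K\<^esub>" for v w
      using that NS by (simp add: bt)
    show "slice_snd K W V h (flip u) \<in> {\<zero>\<^bsub>W\<^esub>}" if h: "h \<in> H" for h
    proof -
      have hl: "h \<in> linear_functional K V" using h H by auto
      have "slice_snd K W V h (flip u) = slice_fst K V W h u"
        by (rule tensor_lin_eq[OF W_module lin_comp[OF fl WV.slice_snd_linear[OF hl]] slice_fst_linear[OF hl] _ u])
          (simp add: lift_tens[OF WV.tensor_module b] WV.slice_snd_tens[OF hl] slice_fst_tens[OF hl])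
      then show ?thesis using sl[OF h] by simp
    qed
  qed
  then show ?thesis using bf by simp
qed

lemma tensor_eqI_fst:
  assumes H: "H \<subseteq> linear_functional K V" and sep: "\<And>v. v \<in> carrier V \<Longrightarrow> \<forall>h\<in>H. h v = \<zero>\<^bsub>K\<^esub> \<Longrightarrow> v = \<zero>\<^bsub>V\<^esub>"
    and u: "u \<in> carrier VW" and sl: "\<And>h. h \<in> H \<Longrightarrow> slice_fst K V W h u = \<zero>\<^bsub>W\<^esub>"
  shows "u = \<zero>\<^bsub>VW\<^esub>"
proof -
  have "u \<in> {\<zero>\<^bsub>VW\<^esub>}"
    by (rule slice_elimination_fst[OF H zero_submod[OF tensor_module] _ u])
      (use sep sl tens_zero_l in \<open>(blast | simp)+\<close>)
  then show ?thesis by simp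
qed

end

section \<open>The algebra structure of a tensor product\<close>

locale tensor_algebra = tensor_space K V W + V: nonunital_algebra K V + W: nonunital_algebra K W
  for K :: "('k, 'r) ring_scheme" (structure)
    and V :: "('k, 'v, 'm) module_scheme" (structure)
    and W :: "('k, 'w, 'n) module_scheme" (structure)
begin

abbreviation "G \<equiv> V \<times>\<times> W"

lemma G_closed: "p \<in> carrier G \<Longrightarrow> q \<in> carrier G \<Longrightarrow> p \<otimes>\<^bsub>G\<^esub> q \<in> carrier G"
  by (auto simp: mult_DirProd' V.amult_closed W.amult_closed)

lemma conv_def: "(f \<otimes>\<^bsub>fr.F\<^esub> g) s =
    (\<Oplus>\<^bsub>K\<^esub>p\<in>{(q, r). f q \<noteq> \<zero>\<^bsub>K\<^esub> \<and> g r \<noteq> \<zero>\<^bsub>K\<^esub> \<and> q \<otimes>\<^bsub>G\<^esub> r = s}. f (fst p) \<otimes>\<^bsub>K\<^esub> g (snd p))"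
  by (simp add: semigroup_algebra_def)

lemma conv_superset:
  assumes f: "f \<in> carrier fr.F" and g: "g \<in> carrier fr.F"
    and Q: "finite Q" "{p. f p \<noteq> \<zero>} \<subseteq> Q" and R: "finite R" "{p. g p \<noteq> \<zero>} \<subseteq> R"
  shows "(f \<otimes>\<^bsub>fr.F\<^esub> g) s = (\<Oplus>\<^bsub>K\<^esub>p\<in>Q \<times> R. if fst p \<otimes>\<^bsub>G\<^esub> snd p = s then f (fst p) \<otimes> g (snd p) else \<zero>)"
  unfolding conv_def
proof (rule add.finprod_mono_neutral_cong_left)
  have c: "f p \<in> carrier K" "g p \<in> carrier K" for p using f g unfolding fr.free_carrier by blast+
  show "finite (Q \<times> R)" using Q R by simp
  show "{(q, r). f q \<noteq> \<zero> \<and> g r \<noteq> \<zero> \<and> q \<otimes>\<^bsub>G\<^esub> r = s} \<subseteq> Q \<times> R" using Q R by auto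
  show "(if fst p \<otimes>\<^bsub>G\<^esub> snd p = s then f (fst p) \<otimes> g (snd p) else \<zero>) = \<zero>"
    if "p \<in> Q \<times> R - {(q, r). f q \<noteq> \<zero> \<and> g r \<noteq> \<zero> \<and> q \<otimes>\<^bsub>G\<^esub> r = s}" for p
  proof -
    have "f (fst p) = \<zero> \<or> g (snd p) = \<zero> \<or> fst p \<otimes>\<^bsub>G\<^esub> snd p \<noteq> s" using that by (cases p) auto
    then show ?thesis using c(1)[of "fst p"] c(2)[of "snd p"] by (elim disjE) simp_all
  qed
  show "f (fst p) \<otimes> g (snd p) = (if fst p \<otimes>\<^bsub>G\<^esub> snd p = s then f (fst p) \<otimes> g (snd p) else \<zero>)"
    if "p \<in> {(q, r). f q \<noteq> \<zero> \<and> g r \<noteq> \<zero> \<and> q \<otimes>\<^bsub>G\<^esub> r = s}" for p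
    using that by (cases p) simp
  show "(\<lambda>p. if fst p \<otimes>\<^bsub>G\<^esub> snd p = s then f (fst p) \<otimes> g (snd p) else \<zero>) \<in> Q \<times> R \<rightarrow> carrier K"
    using c by auto
qed

lemma conv_closed:
  assumes f: "f \<in> carrier fr.F" and g: "g \<in> carrier fr.F"
  shows "f \<otimes>\<^bsub>fr.F\<^esub> g \<in> carrier fr.F"
proof -
  have c: "f p \<in> carrier K" "g p \<in> carrier K" for p using f g unfolding fr.free_carrier by blast+
  have fin: "finite {p. f p \<noteq> \<zero>}" "finite {p. g p \<noteq> \<zero>}" using f g by (auto simp: fr.free_carrier)
  have z: "(f \<otimes>\<^bsub>fr.F\<^esub> g) s = \<zero>" if s: "s \<notin> (\<lambda>p. fst p \<otimes>\<^bsub>G\<^esub> snd p) ` ({p. f p \<noteq> \<zero>} \<times> {p. g p \<noteq> \<zero>})" for s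
  proof -
    have "{(q, r). f q \<noteq> \<zero> \<and> g r \<noteq> \<zero> \<and> q \<otimes>\<^bsub>G\<^esub> r = s} = {}"
    proof (rule ccontr)
      assume "{(q, r). f q \<noteq> \<zero> \<and> g r \<noteq> \<zero> \<and> q \<otimes>\<^bsub>G\<^esub> r = s} \<noteq> {}"
      then obtain q r where "f q \<noteq> \<zero>" "g r \<noteq> \<zero>" "q \<otimes>\<^bsub>G\<^esub> r = s" by auto
      then have "(q, r) \<in> {p. f p \<noteq> \<zero>} \<times> {p. g p \<noteq> \<zero>}" "s = fst (q, r) \<otimes>\<^bsub>G\<^esub> snd (q, r)" by auto
      then show False using s by blast
    qed
    then show ?thesis unfolding conv_def by (simp only: finsum_empty)
  qed
  show ?thesis unfolding fr.free_carrier
  proof (intro conjI allI impI)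
    show "(f \<otimes>\<^bsub>fr.F\<^esub> g) s \<in> carrier K" for s
      unfolding conv_superset[OF f g fin(1) subset_refl fin(2) subset_refl]
      by (rule finsum_closed) (use c in auto)
    show "(f \<otimes>\<^bsub>fr.F\<^esub> g) s = \<zero>" if "s \<notin> carrier G" for s
    proof (rule z)
      have "{p. f p \<noteq> \<zero>} \<subseteq> carrier G" "{p. g p \<noteq> \<zero>} \<subseteq> carrier G"
        using f g by (auto simp: fr.free_carrier simp del: carrier_DirProd)
      note sub = this
      show "s \<notin> (\<lambda>p. fst p \<otimes>\<^bsub>G\<^esub> snd p) ` ({p. f p \<noteq> \<zero>} \<times> {p. g p \<noteq> \<zero>})"
      proof
        assume "s \<in> (\<lambda>p. fst p \<otimes>\<^bsub>G\<^esub> snd p) ` ({p. f p \<noteq> \<zero>} \<times> {p. g p \<noteq> \<zero>})"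
        then obtain p where p: "s = fst p \<otimes>\<^bsub>G\<^esub> snd p" "p \<in> {p. f p \<noteq> \<zero>} \<times> {p. g p \<noteq> \<zero>}" by (rule imageE)
        have "fst p \<in> carrier G" "snd p \<in> carrier G"
          using sub p(2) unfolding mem_Times_iff by blast+
        then show False using G_closed p(1) that by blast
      qed
    qed
    have "{s. (f \<otimes>\<^bsub>fr.F\<^esub> g) s \<noteq> \<zero>} \<subseteq> (\<lambda>p. fst p \<otimes>\<^bsub>G\<^esub> snd p) ` ({p. f p \<noteq> \<zero>} \<times> {p. g p \<noteq> \<zero>})"
      using z by blast
    then show "finite {s. (f \<otimes>\<^bsub>fr.F\<^esub> g) s \<noteq> \<zero>}" by (rule finite_subset) (use fin in simp)
  qed
qed

lemma conv_bilinear: "(\<otimes>\<^bsub>fr.F\<^esub>) \<in> bilinear_map K fr.F fr.F fr.F"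
proof -
  let ?S = "\<lambda>f. {p. f p \<noteq> \<zero>}"
  let ?I = "\<lambda>f g s p. if fst p \<otimes>\<^bsub>G\<^esub> snd p = s then f (fst p) \<otimes> g (snd p) else \<zero>"
  have fin: "finite (?S f)" "f p \<in> carrier K" if "f \<in> carrier fr.F" for f p
    using that unfolding fr.free_carrier by blast+
  have I: "?I f g s \<in> A \<rightarrow> carrier K" if "f \<in> carrier fr.F" "g \<in> carrier fr.F" for f g s A
    using fin(2)[OF that(1)] fin(2)[OF that(2)] by auto
  have sum: "(\<Oplus>\<^bsub>K\<^esub>p\<in>A. h p) = (\<Oplus>\<^bsub>K\<^esub>p\<in>A. u p) \<oplus> (\<Oplus>\<^bsub>K\<^esub>p\<in>A. v p)"
    if "u \<in> A \<rightarrow> carrier K" "v \<in> A \<rightarrow> carrier K" "\<And>p. h p = u p \<oplus> v p" for h u v :: "_ \<Rightarrow> 'k" and A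
    using that by (simp add: finsum_addf)
  have scale: "(\<Oplus>\<^bsub>K\<^esub>p\<in>A. h p) = c \<otimes> (\<Oplus>\<^bsub>K\<^esub>p\<in>A. u p)"
    if "finite A" "u \<in> A \<rightarrow> carrier K" "c \<in> carrier K" "\<And>p. h p = c \<otimes> u p" for h u :: "_ \<Rightarrow> 'k" and A c
    using that by (simp add: finsum_rdistr)
  show ?thesis
  proof (rule bilinear_mapI)
    fix f assume f: "f \<in> carrier fr.F"
    note cf = fin(2)[OF f]
    show "(\<lambda>g. f \<otimes>\<^bsub>fr.F\<^esub> g) \<in> linear_map K fr.F fr.F"
    proof (rule linear_mapI)
      show "f \<otimes>\<^bsub>fr.F\<^esub> g \<in> carrier fr.F" if "g \<in> carrier fr.F" for g by (rule conv_closed[OF f that])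
      show "f \<otimes>\<^bsub>fr.F\<^esub> (g \<oplus>\<^bsub>fr.F\<^esub> g') = f \<otimes>\<^bsub>fr.F\<^esub> g \<oplus>\<^bsub>fr.F\<^esub> f \<otimes>\<^bsub>fr.F\<^esub> g'"
        if g: "g \<in> carrier fr.F" and g': "g' \<in> carrier fr.F" for g g'
      proof
        fix s
        let ?R = "?S g \<union> ?S g'"
        have R: "finite ?R" "?S g \<subseteq> ?R" "?S g' \<subseteq> ?R" using fin(1)[OF g] fin(1)[OF g'] by auto
        have R': "?S (g \<oplus>\<^bsub>fr.F\<^esub> g') \<subseteq> ?R" unfolding fr.free_simps by auto
        show "(f \<otimes>\<^bsub>fr.F\<^esub> (g \<oplus>\<^bsub>fr.F\<^esub> g')) s = (f \<otimes>\<^bsub>fr.F\<^esub> g \<oplus>\<^bsub>fr.F\<^esub> f \<otimes>\<^bsub>fr.F\<^esub> g') s"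
          unfolding conv_superset[OF f FM.M.a_closed[OF g g'] fin(1)[OF f] subset_refl R(1) R']
            fr.free_simps(2)[of "f \<otimes>\<^bsub>fr.F\<^esub> g"]
            conv_superset[OF f g fin(1)[OF f] subset_refl R(1) R(2)]
            conv_superset[OF f g' fin(1)[OF f] subset_refl R(1) R(3)]
          by (rule sum[OF I[OF f g] I[OF f g']])
            (simp add: fr.free_simps cf fin(2)[OF g] fin(2)[OF g'] r_distr)
      qed
      show "f \<otimes>\<^bsub>fr.F\<^esub> (c \<odot>\<^bsub>fr.F\<^esub> g) = c \<odot>\<^bsub>fr.F\<^esub> (f \<otimes>\<^bsub>fr.F\<^esub> g)"
        if c: "c \<in> carrier K" and g: "g \<in> carrier fr.F" for c g
      proof
        fix s
        have R': "?S (c \<odot>\<^bsub>fr.F\<^esub> g) \<subseteq> ?S g" unfolding fr.free_simps using c by auto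
        show "(f \<otimes>\<^bsub>fr.F\<^esub> (c \<odot>\<^bsub>fr.F\<^esub> g)) s = (c \<odot>\<^bsub>fr.F\<^esub> (f \<otimes>\<^bsub>fr.F\<^esub> g)) s"
          unfolding conv_superset[OF f FM.smult_closed[OF c g] fin(1)[OF f] subset_refl fin(1)[OF g] R']
            fr.free_simps(3)[of c "f \<otimes>\<^bsub>fr.F\<^esub> g"]
            conv_superset[OF f g fin(1)[OF f] subset_refl fin(1)[OF g] subset_refl]
          by (rule scale[OF _ I[OF f g] c]) (simp_all add: fr.free_simps cf fin(1)[OF f] fin[OF g] c m_lcomm)
      qed
    qed
    show "(\<lambda>g. g \<otimes>\<^bsub>fr.F\<^esub> f) \<in> linear_map K fr.F fr.F"
    proof (rule linear_mapI)
      show "g \<otimes>\<^bsub>fr.F\<^esub> f \<in> carrier fr.F" if "g \<in> carrier fr.F" for g by (rule conv_closed[OF that f])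
      show "(g \<oplus>\<^bsub>fr.F\<^esub> g') \<otimes>\<^bsub>fr.F\<^esub> f = g \<otimes>\<^bsub>fr.F\<^esub> f \<oplus>\<^bsub>fr.F\<^esub> g' \<otimes>\<^bsub>fr.F\<^esub> f"
        if g: "g \<in> carrier fr.F" and g': "g' \<in> carrier fr.F" for g g'
      proof
        fix s
        let ?R = "?S g \<union> ?S g'"
        have R: "finite ?R" "?S g \<subseteq> ?R" "?S g' \<subseteq> ?R" using fin(1)[OF g] fin(1)[OF g'] by auto
        have R': "?S (g \<oplus>\<^bsub>fr.F\<^esub> g') \<subseteq> ?R" unfolding fr.free_simps by auto
        show "((g \<oplus>\<^bsub>fr.F\<^esub> g') \<otimes>\<^bsub>fr.F\<^esub> f) s = (g \<otimes>\<^bsub>fr.F\<^esub> f \<oplus>\<^bsub>fr.F\<^esub> g' \<otimes>\<^bsub>fr.F\<^esub> f) s"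
          unfolding conv_superset[OF FM.M.a_closed[OF g g'] f R(1) R' fin(1)[OF f] subset_refl]
            fr.free_simps(2)[of "g \<otimes>\<^bsub>fr.F\<^esub> f"]
            conv_superset[OF g f R(1) R(2) fin(1)[OF f] subset_refl]
            conv_superset[OF g' f R(1) R(3) fin(1)[OF f] subset_refl]
          by (rule sum[OF I[OF g f] I[OF g' f]])
            (simp add: fr.free_simps cf fin(2)[OF g] fin(2)[OF g'] l_distr)
      qed
      show "(c \<odot>\<^bsub>fr.F\<^esub> g) \<otimes>\<^bsub>fr.F\<^esub> f = c \<odot>\<^bsub>fr.F\<^esub> (g \<otimes>\<^bsub>fr.F\<^esub> f)"
        if c: "c \<in> carrier K" and g: "g \<in> carrier fr.F" for c g
      proof
        fix s
        have R': "?S (c \<odot>\<^bsub>fr.F\<^esub> g) \<subseteq> ?S g" unfolding fr.free_simps using c by auto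
        show "((c \<odot>\<^bsub>fr.F\<^esub> g) \<otimes>\<^bsub>fr.F\<^esub> f) s = (c \<odot>\<^bsub>fr.F\<^esub> (g \<otimes>\<^bsub>fr.F\<^esub> f)) s"
          unfolding conv_superset[OF FM.smult_closed[OF c g] f fin(1)[OF g] R' fin(1)[OF f] subset_refl]
            fr.free_simps(3)[of c "g \<otimes>\<^bsub>fr.F\<^esub> f"]
            conv_superset[OF g f fin(1)[OF g] subset_refl fin(1)[OF f] subset_refl]
          by (rule scale[OF _ I[OF g f] c]) (simp_all add: fr.free_simps cf fin(1)[OF f] fin[OF g] c m_assoc)
      qed
    qed
  qed
qed

lemma conv_single:
  assumes "p \<in> carrier G" "q \<in> carrier G"
  shows "singleton_fun K p \<otimes>\<^bsub>fr.F\<^esub> singleton_fun K q = singleton_fun K (p \<otimes>\<^bsub>G\<^esub> q)"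
proof
  fix s
  have "(singleton_fun K p \<otimes>\<^bsub>fr.F\<^esub> singleton_fun K q) s =
    (\<Oplus>\<^bsub>K\<^esub>x\<in>{p} \<times> {q}. if fst x \<otimes>\<^bsub>G\<^esub> snd x = s then singleton_fun K p (fst x) \<otimes> singleton_fun K q (snd x) else \<zero>)"
    by (rule conv_superset) (use assms in \<open>simp_all add: fr.single_closed del: carrier_DirProd\<close>, auto simp: singleton_fun_def)
  also have "\<dots> = singleton_fun K (p \<otimes>\<^bsub>G\<^esub> q) s"
    by (simp add: singleton_fun_def finsum_insert)
  finally show "(singleton_fun K p \<otimes>\<^bsub>fr.F\<^esub> singleton_fun K q) s = singleton_fun K (p \<otimes>\<^bsub>G\<^esub> q) s" .
qed

lemma cls_linear: "cls \<in> linear_map K fr.F VW"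
  by (rule linear_mapI) (simp_all add: cls_closed tensor_add tensor_smult)

lemma free_lin_eq:
  assumes "module K Z" "f \<in> linear_map K fr.F Z" "g \<in> linear_map K fr.F Z"
    and "\<And>v w. v \<in> carrier V \<Longrightarrow> w \<in> carrier W \<Longrightarrow> f (singleton_fun K (v, w)) = g (singleton_fun K (v, w))"
    and u: "u \<in> carrier fr.F"
  shows "f u = g u"
proof -
  interpret Z: module K Z by fact
  have "u \<in> {u \<in> carrier fr.F. f u = g u}"
  proof (rule fr.free_induct[OF _ _ u])
    show "submodule {u \<in> carrier fr.F. f u = g u} K fr.F"
      by (rule submodI) (use assms in \<open>auto simp: fr.free_is_module lin_add lin_smult lin_zero[OF fr.free_is_module assms(1)]\<close>)
    show "singleton_fun K s \<in> {u \<in> carrier fr.F. f u = g u}" if "s \<in> carrier G" for s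
      using that assms(4)[of "fst s" "snd s"] by (auto simp: fr.single_closed)
  qed
  then show ?thesis by simp
qed

text \<open>
  The relations form a two-sided ideal of the convolution algebra: multiplying a pure tensor by a fixed
  pure tensor is bilinear. Hence the product of cosets is computed on representatives.
\<close>

lemma conv_relations:
  assumes n: "n \<in> N" and f: "f \<in> carrier fr.F"
  shows "cls (n \<otimes>\<^bsub>fr.F\<^esub> f) = \<zero>\<^bsub>VW\<^esub>" "cls (f \<otimes>\<^bsub>fr.F\<^esub> n) = \<zero>\<^bsub>VW\<^esub>"
proof -
  have nc: "n \<in> carrier fr.F" using n N.a_subset by auto
  note lr = lin_comp[OF bilin_r[OF conv_bilinear] cls_linear] and ll = lin_comp[OF bilin_l[OF conv_bilinear] cls_linear]
  have zl: "(\<lambda>_. \<zero>\<^bsub>VW\<^esub>) \<in> linear_map K fr.F VW" by (rule linear_mapI) auto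
  have e: "singleton_fun K (x, y) \<in> carrier fr.F" if "x \<in> carrier V" "y \<in> carrier W" for x y
    by (rule fr.single_closed) (simp add: that)
  note mults = V.amult_l_distr V.amult_r_distr V.amult_smult_l V.amult_smult_r V.amult_closed
    W.amult_l_distr W.amult_r_distr W.amult_smult_l W.amult_smult_r W.amult_closed
  have Vl: "(\<lambda>x. x \<otimes>\<^bsub>V\<^esub> a) \<in> linear_map K V V" "(\<lambda>x. a \<otimes>\<^bsub>V\<^esub> x) \<in> linear_map K V V" if "a \<in> carrier V" for a
    using that by (auto intro!: linear_mapI simp: mults)
  have Wl: "(\<lambda>x. x \<otimes>\<^bsub>W\<^esub> a) \<in> linear_map K W W" "(\<lambda>x. a \<otimes>\<^bsub>W\<^esub> x) \<in> linear_map K W W" if "a \<in> carrier W" for a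
    using that by (auto intro!: linear_mapI simp: mults)
  show "cls (n \<otimes>\<^bsub>fr.F\<^esub> f) = \<zero>\<^bsub>VW\<^esub>"
  proof (rule free_lin_eq[OF tensor_module lr[OF nc] zl _ f])
    fix a b assume ab: "a \<in> carrier V" "b \<in> carrier W"
    let ?b = "\<lambda>x y. t (x \<otimes>\<^bsub>V\<^esub> a) (y \<otimes>\<^bsub>W\<^esub> b)"
    have b: "?b \<in> bilinear_map K V W VW"
      by (rule bilinear_mapI) (use ab in \<open>auto intro!: tens_lin_l tens_lin_r Vl Wl V.amult_closed W.amult_closed\<close>)
    have bf: "(\<lambda>p. ?b (fst p) (snd p)) \<in> carrier G \<rightarrow> carrier VW" by (rule bb[OF tensor_module b])
    have "cls (n \<otimes>\<^bsub>fr.F\<^esub> singleton_fun K (a, b)) = fr.comb VW (\<lambda>p. ?b (fst p) (snd p)) n"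
    proof (rule free_lin_eq[OF tensor_module ll[OF e[OF ab]] fr.comb_linear[OF tensor_module bf] _ nc])
      fix v w assume vw: "v \<in> carrier V" "w \<in> carrier W"
      show "cls (singleton_fun K (v, w) \<otimes>\<^bsub>fr.F\<^esub> singleton_fun K (a, b)) = fr.comb VW (\<lambda>p. ?b (fst p) (snd p)) (singleton_fun K (v, w))"
        using fr.comb_single[OF tensor_module bf, of "(v, w)"] vw ab by (simp add: conv_single tens_def)
    qed
    then show "cls (n \<otimes>\<^bsub>fr.F\<^esub> singleton_fun K (a, b)) = \<zero>\<^bsub>VW\<^esub>"
      using comb_kernel[OF tensor_module b n] by simp
  qed
  show "cls (f \<otimes>\<^bsub>fr.F\<^esub> n) = \<zero>\<^bsub>VW\<^esub>"
  proof (rule free_lin_eq[OF tensor_module ll[OF nc] zl _ f])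
    fix a b assume ab: "a \<in> carrier V" "b \<in> carrier W"
    let ?b = "\<lambda>x y. t (a \<otimes>\<^bsub>V\<^esub> x) (b \<otimes>\<^bsub>W\<^esub> y)"
    have b: "?b \<in> bilinear_map K V W VW"
      by (rule bilinear_mapI) (use ab in \<open>auto intro!: tens_lin_l tens_lin_r Vl Wl V.amult_closed W.amult_closed\<close>)
    have bf: "(\<lambda>p. ?b (fst p) (snd p)) \<in> carrier G \<rightarrow> carrier VW" by (rule bb[OF tensor_module b])
    have "cls (singleton_fun K (a, b) \<otimes>\<^bsub>fr.F\<^esub> n) = fr.comb VW (\<lambda>p. ?b (fst p) (snd p)) n"
    proof (rule free_lin_eq[OF tensor_module lr[OF e[OF ab]] fr.comb_linear[OF tensor_module bf] _ nc])
      fix v w assume vw: "v \<in> carrier V" "w \<in> carrier W"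
      show "cls (singleton_fun K (a, b) \<otimes>\<^bsub>fr.F\<^esub> singleton_fun K (v, w)) = fr.comb VW (\<lambda>p. ?b (fst p) (snd p)) (singleton_fun K (v, w))"
        using fr.comb_single[OF tensor_module bf, of "(v, w)"] vw ab by (simp add: conv_single tens_def)
    qed
    then show "cls (singleton_fun K (a, b) \<otimes>\<^bsub>fr.F\<^esub> n) = \<zero>\<^bsub>VW\<^esub>"
      using comb_kernel[OF tensor_module b n] by simp
  qed
qed

lemma tensor_mult:
  assumes f: "f \<in> carrier fr.F" and g: "g \<in> carrier fr.F"
  shows "cls f \<otimes>\<^bsub>VW\<^esub> cls g = cls (f \<otimes>\<^bsub>fr.F\<^esub> g)"
proof -
  note ll = lin_comp[OF bilin_l[OF conv_bilinear] cls_linear] and lr = lin_comp[OF bilin_r[OF conv_bilinear] cls_linear]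
  have eq: "cls (a \<otimes>\<^bsub>fr.F\<^esub> b) = cls (f \<otimes>\<^bsub>fr.F\<^esub> g)" if a: "a \<in> cls f" and b: "b \<in> cls g" for a b
  proof -
    note a' = cls_memD[OF f a] and b' = cls_memD[OF g b]
    have "cls (a \<otimes>\<^bsub>fr.F\<^esub> b) = cls (f \<otimes>\<^bsub>fr.F\<^esub> b)"
      using lin_minus[OF FM.module_axioms tensor_module ll[of b], of a f] conv_relations(1)[of "a \<ominus>\<^bsub>fr.F\<^esub> f" b] a' b' f
        mod_diff_zero[OF tensor_module lin_closed[OF ll[of b], of a] lin_closed[OF ll[of b], of f]] by simp
    also have "\<dots> = cls (f \<otimes>\<^bsub>fr.F\<^esub> g)"
      using lin_minus[OF FM.module_axioms tensor_module lr[of f], of b g] conv_relations(2)[of "b \<ominus>\<^bsub>fr.F\<^esub> g" f] b' f g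
        mod_diff_zero[OF tensor_module lin_closed[OF lr[of f], of b] lin_closed[OF lr[of f], of g]] by simp
    finally show ?thesis .
  qed
  have "cls f \<otimes>\<^bsub>VW\<^esub> cls g = (\<Union>a\<in>cls f. \<Union>b\<in>cls g. cls (a \<otimes>\<^bsub>fr.F\<^esub> b))"
    by (simp add: tensor_def Let_def rcoset_mult_def)
  also have "\<dots> = (\<Union>a\<in>cls f. \<Union>b\<in>cls g. cls (f \<otimes>\<^bsub>fr.F\<^esub> g))"
    by (intro SUP_cong refl) (rule eq)
  also have "\<dots> = cls (f \<otimes>\<^bsub>fr.F\<^esub> g)" using N.a_rcos_self[OF f] N.a_rcos_self[OF g] by blast
  finally show ?thesis .
qed

lemma tensor_mult_bilinear: "(\<otimes>\<^bsub>VW\<^esub>) \<in> bilinear_map K VW VW VW"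
proof (rule bilinear_mapI)
  note cb = conv_closed and lr = bilin_r[OF conv_bilinear] and ll = bilin_l[OF conv_bilinear]
  fix x assume x: "x \<in> carrier VW"
  show "(\<lambda>y. x \<otimes>\<^bsub>VW\<^esub> y) \<in> linear_map K VW VW"
  proof (rule linear_mapI)
    fix y assume y: "y \<in> carrier VW"
    show "x \<otimes>\<^bsub>VW\<^esub> y \<in> carrier VW" using x y by (elim tensor_cases) (simp add: tensor_mult cls_closed cb)
    show "x \<otimes>\<^bsub>VW\<^esub> (y \<oplus>\<^bsub>VW\<^esub> z) = x \<otimes>\<^bsub>VW\<^esub> y \<oplus>\<^bsub>VW\<^esub> x \<otimes>\<^bsub>VW\<^esub> z" if "z \<in> carrier VW" for z
      using x y that by (elim tensor_cases) (simp add: tensor_mult tensor_add cb lin_add[OF lr])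
    show "x \<otimes>\<^bsub>VW\<^esub> (c \<odot>\<^bsub>VW\<^esub> y) = c \<odot>\<^bsub>VW\<^esub> (x \<otimes>\<^bsub>VW\<^esub> y)" if "c \<in> carrier K" for c
      using x y that by (elim tensor_cases) (simp add: tensor_mult tensor_smult cb lin_smult[OF lr])
  qed
  show "(\<lambda>y. y \<otimes>\<^bsub>VW\<^esub> x) \<in> linear_map K VW VW"
  proof (rule linear_mapI)
    fix y assume y: "y \<in> carrier VW"
    show "y \<otimes>\<^bsub>VW\<^esub> x \<in> carrier VW" using x y by (elim tensor_cases) (simp add: tensor_mult cls_closed cb)
    show "(y \<oplus>\<^bsub>VW\<^esub> z) \<otimes>\<^bsub>VW\<^esub> x = y \<otimes>\<^bsub>VW\<^esub> x \<oplus>\<^bsub>VW\<^esub> z \<otimes>\<^bsub>VW\<^esub> x" if "z \<in> carrier VW" for z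
      using x y that by (elim tensor_cases) (simp add: tensor_mult tensor_add cb lin_add[OF ll])
    show "(c \<odot>\<^bsub>VW\<^esub> y) \<otimes>\<^bsub>VW\<^esub> x = c \<odot>\<^bsub>VW\<^esub> (y \<otimes>\<^bsub>VW\<^esub> x)" if "c \<in> carrier K" for c
      using x y that by (elim tensor_cases) (simp add: tensor_mult tensor_smult cb lin_smult[OF ll])
  qed
qed

lemma tens_mult [simp]:
  "v \<in> carrier V \<Longrightarrow> w \<in> carrier W \<Longrightarrow> v' \<in> carrier V \<Longrightarrow> w' \<in> carrier W \<Longrightarrow>
    t v w \<otimes>\<^bsub>VW\<^esub> t v' w' = t (v \<otimes>\<^bsub>V\<^esub> v') (w \<otimes>\<^bsub>W\<^esub> w')"
  by (simp add: tens_def tensor_mult fr.single_closed conv_single)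

lemma tensor_nonunital_algebra: "nonunital_algebra K VW"
proof (intro nonunital_algebra.intro nonunital_algebra_axioms.intro)
  note lr = bilin_r[OF tensor_mult_bilinear] and ll = bilin_l[OF tensor_mult_bilinear]
  show "field K" ..
  show "module K VW" by (rule tensor_module)
  fix x y assume x: "x \<in> carrier VW" and y: "y \<in> carrier VW"
  show "x \<otimes>\<^bsub>VW\<^esub> y \<in> carrier VW" by (rule bilin_closed[OF tensor_mult_bilinear x y])
  show "(c \<odot>\<^bsub>VW\<^esub> x) \<otimes>\<^bsub>VW\<^esub> y = c \<odot>\<^bsub>VW\<^esub> (x \<otimes>\<^bsub>VW\<^esub> y)" if "c \<in> carrier K" for c
    by (rule lin_smult[OF ll[OF y] that x])
  show "x \<otimes>\<^bsub>VW\<^esub> (c \<odot>\<^bsub>VW\<^esub> y) = c \<odot>\<^bsub>VW\<^esub> (x \<otimes>\<^bsub>VW\<^esub> y)" if "c \<in> carrier K" for c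
    by (rule lin_smult[OF lr[OF x] that y])
  fix z assume z: "z \<in> carrier VW"
  show "(x \<oplus>\<^bsub>VW\<^esub> y) \<otimes>\<^bsub>VW\<^esub> z = x \<otimes>\<^bsub>VW\<^esub> z \<oplus>\<^bsub>VW\<^esub> y \<otimes>\<^bsub>VW\<^esub> z"
    by (rule lin_add[OF ll[OF z] x y])
  show "x \<otimes>\<^bsub>VW\<^esub> (y \<oplus>\<^bsub>VW\<^esub> z) = x \<otimes>\<^bsub>VW\<^esub> y \<oplus>\<^bsub>VW\<^esub> x \<otimes>\<^bsub>VW\<^esub> z"
    by (rule lin_add[OF lr[OF x] y z])
  note mc = bilin_closed[OF tensor_mult_bilinear]
  show "x \<otimes>\<^bsub>VW\<^esub> y \<otimes>\<^bsub>VW\<^esub> z = x \<otimes>\<^bsub>VW\<^esub> (y \<otimes>\<^bsub>VW\<^esub> z)"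
  proof (rule tensor_lin_eq[OF tensor_module lin_comp[OF ll[OF y] ll[OF z]] ll[OF mc[OF y z]] _ x])
    fix v w assume vw: "v \<in> carrier V" "w \<in> carrier W"
    then have p: "t v w \<in> carrier VW" by simp
    show "t v w \<otimes>\<^bsub>VW\<^esub> y \<otimes>\<^bsub>VW\<^esub> z = t v w \<otimes>\<^bsub>VW\<^esub> (y \<otimes>\<^bsub>VW\<^esub> z)"
    proof (rule tensor_lin_eq[OF tensor_module lin_comp[OF lr[OF p] ll[OF z]] lin_comp[OF ll[OF z] lr[OF p]] _ y])
      fix v' w' assume vw': "v' \<in> carrier V" "w' \<in> carrier W"
      then have p': "t v' w' \<in> carrier VW" by simp
      show "t v w \<otimes>\<^bsub>VW\<^esub> t v' w' \<otimes>\<^bsub>VW\<^esub> z = t v w \<otimes>\<^bsub>VW\<^esub> (t v' w' \<otimes>\<^bsub>VW\<^esub> z)"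
      proof (rule tensor_lin_eq[OF tensor_module lr[OF mc[OF p p']] lin_comp[OF lr[OF p'] lr[OF p]] _ z])
        fix v'' w'' assume "v'' \<in> carrier V" "w'' \<in> carrier W"
        then show "t v w \<otimes>\<^bsub>VW\<^esub> t v' w' \<otimes>\<^bsub>VW\<^esub> t v'' w'' = t v w \<otimes>\<^bsub>VW\<^esub> (t v' w' \<otimes>\<^bsub>VW\<^esub> t v'' w'')"
          using vw vw' by (simp add: V.amult_closed W.amult_closed V.amult_assoc W.amult_assoc)
      qed
    qed
  qed
qed

end

section \<open>Multiplier algebras\<close>

context nonunital_algebra
begin

abbreviation "MX \<equiv> multiplier_algebra K X"

lemma X_module: "module K X" ..

lemma mult_lin_r: "x \<in> carrier X \<Longrightarrow> (\<lambda>y. x \<otimes>\<^bsub>X\<^esub> y) \<in> linear_map K X X"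
  by (rule linear_mapI) (simp_all add: amult_closed amult_r_distr amult_smult_r)

lemma mult_lin_l: "x \<in> carrier X \<Longrightarrow> (\<lambda>y. y \<otimes>\<^bsub>X\<^esub> x) \<in> linear_map K X X"
  by (rule linear_mapI) (simp_all add: amult_closed amult_l_distr amult_smult_l)

lemma mult_zero [simp]:
  "x \<in> carrier X \<Longrightarrow> x \<otimes>\<^bsub>X\<^esub> \<zero>\<^bsub>X\<^esub> = \<zero>\<^bsub>X\<^esub>" "x \<in> carrier X \<Longrightarrow> \<zero>\<^bsub>X\<^esub> \<otimes>\<^bsub>X\<^esub> x = \<zero>\<^bsub>X\<^esub>"
  using lin_zero[OF X_module X_module mult_lin_r] lin_zero[OF X_module X_module mult_lin_l] by auto

lemma mult_carrier: "m \<in> carrier MX \<longleftrightarrow>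
    fst m \<in> extensional (carrier X) \<inter> linear_map K X X \<and> snd m \<in> extensional (carrier X) \<inter> linear_map K X X \<and>
    (\<forall>x\<in>carrier X. \<forall>y\<in>carrier X.
      fst m (x \<otimes>\<^bsub>X\<^esub> y) = fst m x \<otimes>\<^bsub>X\<^esub> y \<and> snd m (x \<otimes>\<^bsub>X\<^esub> y) = x \<otimes>\<^bsub>X\<^esub> snd m y \<and> snd m x \<otimes>\<^bsub>X\<^esub> y = x \<otimes>\<^bsub>X\<^esub> fst m y)"
  by (cases m) (simp add: multiplier_algebra_def)

lemma
  assumes "m \<in> carrier MX"
  shows fst_linear: "fst m \<in> linear_map K X X" and snd_linear: "snd m \<in> linear_map K X X"
    and fst_ext: "fst m \<in> extensional (carrier X)" and snd_ext: "snd m \<in> extensional (carrier X)"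
    and fst_closed [simp, intro]: "x \<in> carrier X \<Longrightarrow> fst m x \<in> carrier X"
    and snd_closed [simp, intro]: "x \<in> carrier X \<Longrightarrow> snd m x \<in> carrier X"
    and fst_mult: "x \<in> carrier X \<Longrightarrow> y \<in> carrier X \<Longrightarrow> fst m (x \<otimes>\<^bsub>X\<^esub> y) = fst m x \<otimes>\<^bsub>X\<^esub> y"
    and snd_mult: "x \<in> carrier X \<Longrightarrow> y \<in> carrier X \<Longrightarrow> snd m (x \<otimes>\<^bsub>X\<^esub> y) = x \<otimes>\<^bsub>X\<^esub> snd m y"
    and snd_fst: "x \<in> carrier X \<Longrightarrow> y \<in> carrier X \<Longrightarrow> snd m x \<otimes>\<^bsub>X\<^esub> y = x \<otimes>\<^bsub>X\<^esub> fst m y"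
  using assms unfolding mult_carrier by (auto simp: lin_closed)

lemma multI:
  assumes "l \<in> linear_map K X X" "r \<in> linear_map K X X" "l \<in> extensional (carrier X)" "r \<in> extensional (carrier X)"
    "\<And>x y. x \<in> carrier X \<Longrightarrow> y \<in> carrier X \<Longrightarrow> l (x \<otimes>\<^bsub>X\<^esub> y) = l x \<otimes>\<^bsub>X\<^esub> y"
    "\<And>x y. x \<in> carrier X \<Longrightarrow> y \<in> carrier X \<Longrightarrow> r (x \<otimes>\<^bsub>X\<^esub> y) = x \<otimes>\<^bsub>X\<^esub> r y"
    "\<And>x y. x \<in> carrier X \<Longrightarrow> y \<in> carrier X \<Longrightarrow> r x \<otimes>\<^bsub>X\<^esub> y = x \<otimes>\<^bsub>X\<^esub> l y"
  shows "(l, r) \<in> carrier MX"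
  unfolding mult_carrier using assms by auto

lemma mult_eqI:
  assumes "m \<in> carrier MX" "n \<in> carrier MX" "\<And>x. x \<in> carrier X \<Longrightarrow> fst m x = fst n x"
    "\<And>x. x \<in> carrier X \<Longrightarrow> snd m x = snd n x"
  shows "m = n"
proof (rule prod_eqI)
  show "fst m = fst n" by (rule extensionalityI[OF fst_ext fst_ext]) (use assms in auto)
  show "snd m = snd n" by (rule extensionalityI[OF snd_ext snd_ext]) (use assms in auto)
qed

lemma mult_apply [simp]:
  "x \<in> carrier X \<Longrightarrow> fst (m \<otimes>\<^bsub>MX\<^esub> n) x = fst m (fst n x)"
  "x \<in> carrier X \<Longrightarrow> snd (m \<otimes>\<^bsub>MX\<^esub> n) x = snd n (snd m x)"
  "x \<in> carrier X \<Longrightarrow> fst (m \<oplus>\<^bsub>MX\<^esub> n) x = fst m x \<oplus>\<^bsub>X\<^esub> fst n x"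
  "x \<in> carrier X \<Longrightarrow> snd (m \<oplus>\<^bsub>MX\<^esub> n) x = snd m x \<oplus>\<^bsub>X\<^esub> snd n x"
  "x \<in> carrier X \<Longrightarrow> fst (c \<odot>\<^bsub>MX\<^esub> m) x = c \<odot>\<^bsub>X\<^esub> fst m x"
  "x \<in> carrier X \<Longrightarrow> snd (c \<odot>\<^bsub>MX\<^esub> m) x = c \<odot>\<^bsub>X\<^esub> snd m x"
  "x \<in> carrier X \<Longrightarrow> fst \<zero>\<^bsub>MX\<^esub> x = \<zero>\<^bsub>X\<^esub>"
  "x \<in> carrier X \<Longrightarrow> snd \<zero>\<^bsub>MX\<^esub> x = \<zero>\<^bsub>X\<^esub>"
  "x \<in> carrier X \<Longrightarrow> fst \<one>\<^bsub>MX\<^esub> x = x"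
  "x \<in> carrier X \<Longrightarrow> snd \<one>\<^bsub>MX\<^esub> x = x"
  by (simp_all add: multiplier_algebra_def compose_def)

lemma mult_ext_ops:
  "fst (m \<otimes>\<^bsub>MX\<^esub> n) \<in> extensional (carrier X)" "snd (m \<otimes>\<^bsub>MX\<^esub> n) \<in> extensional (carrier X)"
  "fst (m \<oplus>\<^bsub>MX\<^esub> n) \<in> extensional (carrier X)" "snd (m \<oplus>\<^bsub>MX\<^esub> n) \<in> extensional (carrier X)"
  "fst (c \<odot>\<^bsub>MX\<^esub> m) \<in> extensional (carrier X)" "snd (c \<odot>\<^bsub>MX\<^esub> m) \<in> extensional (carrier X)"
  "fst \<zero>\<^bsub>MX\<^esub> \<in> extensional (carrier X)" "snd \<zero>\<^bsub>MX\<^esub> \<in> extensional (carrier X)"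
  "fst \<one>\<^bsub>MX\<^esub> \<in> extensional (carrier X)" "snd \<one>\<^bsub>MX\<^esub> \<in> extensional (carrier X)"
  by (simp_all add: multiplier_algebra_def compose_def)

lemma fst_snd_linI:
  assumes "f \<in> linear_map K X X" "\<And>x. x \<in> carrier X \<Longrightarrow> g x = f x" shows "g \<in> linear_map K X X"
  by (rule lin_cong[OF assms X_module])

lemma mult_closed [simp, intro]:
  assumes m: "m \<in> carrier MX" and n: "n \<in> carrier MX" shows "m \<otimes>\<^bsub>MX\<^esub> n \<in> carrier MX"
proof -
  have "fst (m \<otimes>\<^bsub>MX\<^esub> n) \<in> linear_map K X X"
    by (rule fst_snd_linI[OF lin_comp[OF fst_linear[OF n] fst_linear[OF m]]]) simp
  moreover have "snd (m \<otimes>\<^bsub>MX\<^esub> n) \<in> linear_map K X X"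
    by (rule fst_snd_linI[OF lin_comp[OF snd_linear[OF m] snd_linear[OF n]]]) simp
  ultimately show ?thesis
    unfolding mult_carrier using m n
    by (simp add: mult_ext_ops amult_closed fst_mult snd_mult snd_fst)
qed

lemma mult_add_closed:
  assumes m: "m \<in> carrier MX" and n: "n \<in> carrier MX" shows "m \<oplus>\<^bsub>MX\<^esub> n \<in> carrier MX"
proof -
  have "fst (m \<oplus>\<^bsub>MX\<^esub> n) \<in> linear_map K X X"
    by (rule fst_snd_linI[OF lin_sum[OF X_module fst_linear[OF m] fst_linear[OF n]]]) simp
  moreover have "snd (m \<oplus>\<^bsub>MX\<^esub> n) \<in> linear_map K X X"
    by (rule fst_snd_linI[OF lin_sum[OF X_module snd_linear[OF m] snd_linear[OF n]]]) simp
  ultimately show ?thesis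
    unfolding mult_carrier using m n
    by (simp add: mult_ext_ops amult_closed fst_mult snd_mult snd_fst amult_l_distr amult_r_distr)
qed

lemma mult_smult_closed:
  assumes m: "m \<in> carrier MX" and c: "c \<in> carrier K" shows "c \<odot>\<^bsub>MX\<^esub> m \<in> carrier MX"
proof -
  have "fst (c \<odot>\<^bsub>MX\<^esub> m) \<in> linear_map K X X"
    by (rule fst_snd_linI[OF lin_scale[OF X_module fst_linear[OF m] c]]) simp
  moreover have "snd (c \<odot>\<^bsub>MX\<^esub> m) \<in> linear_map K X X"
    by (rule fst_snd_linI[OF lin_scale[OF X_module snd_linear[OF m] c]]) simp
  ultimately show ?thesis
    unfolding mult_carrier using m c
    by (simp add: mult_ext_ops amult_closed fst_mult snd_mult snd_fst amult_smult_l amult_smult_r)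
qed

lemma mult_zero_closed: "\<zero>\<^bsub>MX\<^esub> \<in> carrier MX"
proof -
  have z: "(\<lambda>_. \<zero>\<^bsub>X\<^esub>) \<in> linear_map K X X" by (rule linear_mapI) auto
  show ?thesis unfolding mult_carrier
    by (simp add: mult_ext_ops amult_closed fst_snd_linI[OF z])
qed

lemma mult_one_closed [simp, intro]: "\<one>\<^bsub>MX\<^esub> \<in> carrier MX"
  unfolding mult_carrier by (simp add: mult_ext_ops amult_closed fst_snd_linI[OF lin_id])

lemma mult_module: "module K MX"
proof (rule moduleI)
  note cl = mult_add_closed mult_smult_closed mult_zero_closed
  show "cring K" ..
  show "abelian_group MX"
  proof (rule abelian_groupI)
    show "\<exists>n\<in>carrier MX. n \<oplus>\<^bsub>MX\<^esub> m = \<zero>\<^bsub>MX\<^esub>" if m: "m \<in> carrier MX" for m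
    proof
      have c: "\<ominus> \<one> \<in> carrier K" by simp
      note e = mod_minus_smult[OF X_module, symmetric]
      show "(\<ominus> \<one>) \<odot>\<^bsub>MX\<^esub> m \<oplus>\<^bsub>MX\<^esub> m = \<zero>\<^bsub>MX\<^esub>"
        by (rule mult_eqI) (use m c in \<open>simp_all add: cl e M.l_neg\<close>)
      show "(\<ominus> \<one>) \<odot>\<^bsub>MX\<^esub> m \<in> carrier MX" using m c by (simp add: cl)
    qed
  qed (simp_all add: cl, (rule mult_eqI; simp add: cl fst_closed snd_closed M.a_ac)+)
qed (simp_all add: mult_add_closed mult_smult_closed,
     (rule mult_eqI; simp add: mult_add_closed mult_smult_closed fst_closed snd_closed smult_l_distr smult_r_distr smult_assoc1)+)

lemma mult_assoc:
  "m \<in> carrier MX \<Longrightarrow> n \<in> carrier MX \<Longrightarrow> p \<in> carrier MX \<Longrightarrow> m \<otimes>\<^bsub>MX\<^esub> n \<otimes>\<^bsub>MX\<^esub> p = m \<otimes>\<^bsub>MX\<^esub> (n \<otimes>\<^bsub>MX\<^esub> p)"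
  by (rule mult_eqI) simp_all

lemma mult_bilinear: "(\<otimes>\<^bsub>MX\<^esub>) \<in> bilinear_map K MX MX MX"
  by (intro bilinear_mapI linear_mapI mult_eqI)
    (simp_all add: mult_add_closed mult_smult_closed lin_add[OF fst_linear] lin_add[OF snd_linear]
      lin_smult[OF fst_linear] lin_smult[OF snd_linear])

lemma fst_apply_linear: "x \<in> carrier X \<Longrightarrow> (\<lambda>m. fst m x) \<in> linear_map K MX X"
  by (rule linear_mapI) auto

lemma snd_apply_linear: "x \<in> carrier X \<Longrightarrow> (\<lambda>m. snd m x) \<in> linear_map K MX X"
  by (rule linear_mapI) auto

lemma as_multiplier_apply [simp]:
  "y \<in> carrier X \<Longrightarrow> fst (as_multiplier X x) y = x \<otimes>\<^bsub>X\<^esub> y"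
  "y \<in> carrier X \<Longrightarrow> snd (as_multiplier X x) y = y \<otimes>\<^bsub>X\<^esub> x"
  by (simp_all add: as_multiplier_def)

lemma as_multiplier_closed [simp, intro]: "x \<in> carrier X \<Longrightarrow> as_multiplier X x \<in> carrier MX"
  unfolding mult_carrier
  by (simp add: amult_closed amult_assoc fst_snd_linI[OF mult_lin_r] fst_snd_linI[OF mult_lin_l])
     (simp add: as_multiplier_def)

lemma as_multiplier_linear: "as_multiplier X \<in> linear_map K X MX"
  by (intro linear_mapI mult_eqI)
    (simp_all add: mult_add_closed mult_smult_closed amult_l_distr amult_r_distr amult_smult_l amult_smult_r)

lemma as_multiplier_ideal:
  "m \<in> carrier MX \<Longrightarrow> x \<in> carrier X \<Longrightarrow> m \<otimes>\<^bsub>MX\<^esub> as_multiplier X x = as_multiplier X (fst m x)"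
  "m \<in> carrier MX \<Longrightarrow> x \<in> carrier X \<Longrightarrow> as_multiplier X x \<otimes>\<^bsub>MX\<^esub> m = as_multiplier X (snd m x)"
  by (rule mult_eqI; simp add: fst_mult snd_fst amult_closed)
     (rule mult_eqI; simp add: snd_mult snd_fst amult_closed)

end

context nondegenerate_algebra
begin

lemma nondeg_l: "x \<in> carrier X \<Longrightarrow> x' \<in> carrier X \<Longrightarrow> (\<And>y. y \<in> carrier X \<Longrightarrow> x \<otimes>\<^bsub>X\<^esub> y = x' \<otimes>\<^bsub>X\<^esub> y) \<Longrightarrow> x = x'"
  using nondegenerate_l[of "x \<ominus>\<^bsub>X\<^esub> x'"] mod_diff_zero[OF X_module] lin_minus[OF X_module X_module mult_lin_l]
  by (simp add: amult_closed)

lemma nondeg_r: "x \<in> carrier X \<Longrightarrow> x' \<in> carrier X \<Longrightarrow> (\<And>y. y \<in> carrier X \<Longrightarrow> y \<otimes>\<^bsub>X\<^esub> x = y \<otimes>\<^bsub>X\<^esub> x') \<Longrightarrow> x = x'"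
  using nondegenerate_r[of "x \<ominus>\<^bsub>X\<^esub> x'"] mod_diff_zero[OF X_module] lin_minus[OF X_module X_module mult_lin_r]
  by (simp add: amult_closed)

lemma mult_eqI_fst:
  assumes "m \<in> carrier MX" "n \<in> carrier MX" "\<And>x. x \<in> carrier X \<Longrightarrow> fst m x = fst n x"
  shows "m = n"
proof (rule mult_eqI[OF assms])
  fix x assume x: "x \<in> carrier X"
  show "snd m x = snd n x" by (rule nondeg_l) (use x assms in \<open>auto simp: snd_fst\<close>)
qed

lemma mult_eqI_snd:
  assumes "m \<in> carrier MX" "n \<in> carrier MX" "\<And>x. x \<in> carrier X \<Longrightarrow> snd m x = snd n x"
  shows "m = n"
proof (rule mult_eqI_fst[OF assms(1,2)])
  fix x assume x: "x \<in> carrier X"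
  show "fst m x = fst n x" by (rule nondeg_r) (use x assms in \<open>auto simp: snd_fst[symmetric]\<close>)
qed

lemma as_multiplier_inj: "inj_on (as_multiplier X) (carrier X)"
proof (rule inj_onI)
  fix x y assume xy: "x \<in> carrier X" "y \<in> carrier X" and e: "as_multiplier X x = as_multiplier X y"
  show "x = y"
  proof (rule nondeg_l[OF xy])
    show "x \<otimes>\<^bsub>X\<^esub> z = y \<otimes>\<^bsub>X\<^esub> z" if "z \<in> carrier X" for z
      using arg_cong[OF e, of "\<lambda>m. fst m z"] that by simp
  qed
qed

lemma element_of_as_multiplier [simp]: "x \<in> carrier X \<Longrightarrow> element_of X (as_multiplier X x) = x"
  unfolding element_of_def by (rule the_inv_into_f_f[OF as_multiplier_inj])

lemma embeddedD:
  assumes "m \<in> embedded X"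
  shows "element_of X m \<in> carrier X" "as_multiplier X (element_of X m) = m"
  using assms by (auto simp: embedded_def)

lemma embeddedI: "x \<in> carrier X \<Longrightarrow> as_multiplier X x \<in> embedded X"
  by (simp add: embedded_def)

end

section \<open>Multipliers of tensor products\<close>

locale tensor_nondegenerate = tensor_algebra K V W + V: nondegenerate_algebra K V + W: nondegenerate_algebra K W
  for K :: "('k, 'r) ring_scheme" (structure)
    and V :: "('k, 'v, 'm) module_scheme" (structure)
    and W :: "('k, 'w, 'n) module_scheme" (structure)

sublocale tensor_algebra \<subseteq> T: nonunital_algebra K VW
  by (rule tensor_nonunital_algebra)

context tensor_algebra
begin

lemma bilinear_tens_comp: "f \<in> linear_map K V V \<Longrightarrow> g \<in> linear_map K W W \<Longrightarrow>
   (\<lambda>v w. t (f v) (g w)) \<in> bilinear_map K V W VW"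
  by (rule bilinear_mapI) (auto intro!: tens_lin_l tens_lin_r simp: lin_closed)

lemma tensor_map_linear: "f \<in> linear_map K V V \<Longrightarrow> g \<in> linear_map K W W \<Longrightarrow> tensor_map K V W f g \<in> linear_map K VW VW"
  unfolding tensor_map_def by (rule lift_linear[OF tensor_module bilinear_tens_comp])

lemma tensor_map_tens: "f \<in> linear_map K V V \<Longrightarrow> g \<in> linear_map K W W \<Longrightarrow> v \<in> carrier V \<Longrightarrow> w \<in> carrier W \<Longrightarrow>
    tensor_map K V W f g (t v w) = t (f v) (g w)"
  unfolding tensor_map_def by (rule lift_tens[OF tensor_module bilinear_tens_comp])

lemma tensor_bilin_eq:
  assumes Z: "module K Z" and B: "B \<in> bilinear_map K VW VW Z" "B' \<in> bilinear_map K VW VW Z"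
    and e: "\<And>v w v' w'. v \<in> carrier V \<Longrightarrow> w \<in> carrier W \<Longrightarrow> v' \<in> carrier V \<Longrightarrow> w' \<in> carrier W \<Longrightarrow>
       B (t v w) (t v' w') = B' (t v w) (t v' w')"
    and x: "x \<in> carrier VW" and y: "y \<in> carrier VW"
  shows "B x y = B' x y"
proof (rule tensor_lin_eq[OF Z bilin_l[OF B(1) y] bilin_l[OF B(2) y] _ x])
  fix v w assume vw: "v \<in> carrier V" "w \<in> carrier W"
  then have p: "t v w \<in> carrier VW" by simp
  show "B (t v w) y = B' (t v w) y"
    by (rule tensor_lin_eq[OF Z bilin_r[OF B(1) p] bilin_r[OF B(2) p] _ y]) (rule e[OF vw])
qed

lemma bilin_comp_args:
  "B \<in> bilinear_map K U U' Z \<Longrightarrow> f \<in> linear_map K Y U \<Longrightarrow> g \<in> linear_map K Y' U' \<Longrightarrow>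
    (\<lambda>x y. B (f x) (g y)) \<in> bilinear_map K Y Y' Z"
  by (rule bilinear_mapI)
    (rule lin_comp[OF _ bilin_r], assumption+, rule lin_closed, assumption+,
     rule lin_comp[OF _ bilin_l], assumption+, rule lin_closed, assumption+)

lemma bilin_post:
  "b \<in> bilinear_map K U U' Z \<Longrightarrow> g \<in> linear_map K Z Z' \<Longrightarrow> (\<lambda>x y. g (b x y)) \<in> bilinear_map K U U' Z'"
  by (rule bilinear_mapI) (rule lin_comp[OF bilin_r], assumption+, rule lin_comp[OF bilin_l], assumption+)

lemma multiplier_tens_closed:
  assumes m: "m \<in> carrier V.MX" and n: "n \<in> carrier W.MX"
  shows "multiplier_tens K V W m n \<in> carrier T.MX"
proof -
  let ?l = "tensor_map K V W (fst m) (fst n)" and ?r = "tensor_map K V W (snd m) (snd n)"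
  note fl = V.fst_linear[OF m] W.fst_linear[OF n] and sl = V.snd_linear[OF m] W.snd_linear[OF n]
  note l = tensor_map_linear[OF fl] and r = tensor_map_linear[OF sl]
  note tl = tensor_map_tens[OF fl] and tr = tensor_map_tens[OF sl]
  note B = tensor_mult_bilinear
  have "(?l, ?r) \<in> carrier T.MX"
  proof (rule T.multI[OF l r])
    show "?l \<in> extensional (carrier VW)" "?r \<in> extensional (carrier VW)"
      by (simp_all add: tensor_map_def lift_extensional)
    fix x y assume x: "x \<in> carrier VW" and y: "y \<in> carrier VW"
    show "?l (x \<otimes>\<^bsub>VW\<^esub> y) = ?l x \<otimes>\<^bsub>VW\<^esub> y"
      by (rule tensor_bilin_eq[OF tensor_module bilin_post[OF B l] bilin_comp_args[OF B l lin_id] _ x y])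
        (use m n in \<open>simp add: tl V.fst_mult W.fst_mult V.amult_closed W.amult_closed\<close>)
    show "?r (x \<otimes>\<^bsub>VW\<^esub> y) = x \<otimes>\<^bsub>VW\<^esub> ?r y"
      by (rule tensor_bilin_eq[OF tensor_module bilin_post[OF B r] bilin_comp_args[OF B lin_id r] _ x y])
        (use m n in \<open>simp add: tr V.snd_mult W.snd_mult V.amult_closed W.amult_closed\<close>)
    show "?r x \<otimes>\<^bsub>VW\<^esub> y = x \<otimes>\<^bsub>VW\<^esub> ?l y"
      by (rule tensor_bilin_eq[OF tensor_module bilin_comp_args[OF B r lin_id] bilin_comp_args[OF B lin_id l] _ x y])
        (use m n in \<open>simp add: tl tr V.snd_fst W.snd_fst V.amult_closed W.amult_closed\<close>)
  qed
  then show ?thesis by (simp add: multiplier_tens_def)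
qed

lemma multiplier_tens_apply:
  assumes "m \<in> carrier V.MX" "n \<in> carrier W.MX" "v \<in> carrier V" "w \<in> carrier W"
  shows "fst (multiplier_tens K V W m n) (t v w) = t (fst m v) (fst n w)"
    "snd (multiplier_tens K V W m n) (t v w) = t (snd m v) (snd n w)"
  using assms by (simp_all add: multiplier_tens_def tensor_map_tens V.fst_linear V.snd_linear W.fst_linear W.snd_linear)

lemma in_fst_closed [simp, intro]: "v \<in> carrier V \<Longrightarrow> in_fst K V W v \<in> carrier T.MX"
  unfolding in_fst_def by (rule multiplier_tens_closed) auto

lemma in_snd_closed [simp, intro]: "w \<in> carrier W \<Longrightarrow> in_snd K V W w \<in> carrier T.MX"
  unfolding in_snd_def by (rule multiplier_tens_closed) auto

lemma in_fst_apply [simp]: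
  assumes "a \<in> carrier V" "v \<in> carrier V" "w \<in> carrier W"
  shows "fst (in_fst K V W a) (t v w) = t (a \<otimes>\<^bsub>V\<^esub> v) w" "snd (in_fst K V W a) (t v w) = t (v \<otimes>\<^bsub>V\<^esub> a) w"
  using assms by (simp_all add: in_fst_def multiplier_tens_apply)

lemma in_snd_apply [simp]:
  assumes "b \<in> carrier W" "v \<in> carrier V" "w \<in> carrier W"
  shows "fst (in_snd K V W b) (t v w) = t v (b \<otimes>\<^bsub>W\<^esub> w)" "snd (in_snd K V W b) (t v w) = t v (w \<otimes>\<^bsub>W\<^esub> b)"
  using assms by (simp_all add: in_snd_def multiplier_tens_apply)

lemma mult_eq_on_pure:
  assumes "m \<in> carrier T.MX" "n \<in> carrier T.MX"
    "\<And>v w. v \<in> carrier V \<Longrightarrow> w \<in> carrier W \<Longrightarrow> fst m (t v w) = fst n (t v w)"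
    "\<And>v w. v \<in> carrier V \<Longrightarrow> w \<in> carrier W \<Longrightarrow> snd m (t v w) = snd n (t v w)"
  shows "m = n"
  by (rule T.mult_eqI[OF assms(1,2)])
    (rule tensor_lin_eq[OF tensor_module]; simp add: assms T.fst_linear T.snd_linear)+

lemma in_fst_linear: "in_fst K V W \<in> linear_map K V T.MX"
  by (intro linear_mapI mult_eq_on_pure)
    (simp_all add: T.mult_add_closed T.mult_smult_closed V.amult_l_distr V.amult_r_distr V.amult_smult_l
      V.amult_smult_r V.amult_closed lin_add[OF tens_l] lin_smult[OF tens_l])

lemma in_snd_linear: "in_snd K V W \<in> linear_map K W T.MX"
  by (intro linear_mapI mult_eq_on_pure)
    (simp_all add: T.mult_add_closed T.mult_smult_closed W.amult_l_distr W.amult_r_distr W.amult_smult_l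
      W.amult_smult_r W.amult_closed lin_add[OF tens_r] lin_smult[OF tens_r])

end

context tensor_nondegenerate
begin

lemma slice_snd_mult:
  assumes h: "h \<in> linear_functional K W" and v: "v \<in> carrier V" and w: "w \<in> carrier W" and u: "u \<in> carrier VW"
  shows "slice_snd K V W h (u \<otimes>\<^bsub>VW\<^esub> t v w) = slice_snd K V W (\<lambda>y. h (y \<otimes>\<^bsub>W\<^esub> w)) u \<otimes>\<^bsub>V\<^esub> v"
    "slice_snd K V W h (t v w \<otimes>\<^bsub>VW\<^esub> u) = v \<otimes>\<^bsub>V\<^esub> slice_snd K V W (\<lambda>y. h (w \<otimes>\<^bsub>W\<^esub> y)) u"
proof -
  have hl: "(\<lambda>y. h (y \<otimes>\<^bsub>W\<^esub> w)) \<in> linear_functional K W" by (rule fun_comp[OF W.mult_lin_l[OF w] h])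
  have hr: "(\<lambda>y. h (w \<otimes>\<^bsub>W\<^esub> y)) \<in> linear_functional K W" by (rule fun_comp[OF W.mult_lin_r[OF w] h])
  show "slice_snd K V W h (u \<otimes>\<^bsub>VW\<^esub> t v w) = slice_snd K V W (\<lambda>y. h (y \<otimes>\<^bsub>W\<^esub> w)) u \<otimes>\<^bsub>V\<^esub> v"
    by (rule tensor_lin_eq[OF V_module lin_comp[OF T.mult_lin_l slice_snd_linear[OF h]] lin_comp[OF slice_snd_linear[OF hl] V.mult_lin_l[OF v]] _ u])
      (use v w in \<open>simp_all add: slice_snd_tens[OF h] slice_snd_tens[OF hl] V.amult_closed W.amult_closed V.amult_smult_l fun_closed[OF h]\<close>)
  show "slice_snd K V W h (t v w \<otimes>\<^bsub>VW\<^esub> u) = v \<otimes>\<^bsub>V\<^esub> slice_snd K V W (\<lambda>y. h (w \<otimes>\<^bsub>W\<^esub> y)) u"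
    by (rule tensor_lin_eq[OF V_module lin_comp[OF T.mult_lin_r slice_snd_linear[OF h]] lin_comp[OF slice_snd_linear[OF hr] V.mult_lin_r[OF v]] _ u])
      (use v w in \<open>simp_all add: slice_snd_tens[OF h] slice_snd_tens[OF hr] V.amult_closed W.amult_closed V.amult_smult_r fun_closed[OF h]\<close>)
qed

lemma functional_zero: "module K U \<Longrightarrow> u \<in> carrier U \<Longrightarrow> (\<And>h. h \<in> linear_functional K U \<Longrightarrow> h u = \<zero>) \<Longrightarrow> u = \<zero>\<^bsub>U\<^esub>"
  using separating_functional[OF field_axioms, of U u] by fastforce

text \<open>
  Testing \<open>u (v \<otimes> w) = 0\<close> with a functional \<open>k\<close> on the second leg shows that the slices of \<open>u\<close> along
  \<open>k(\<cdot> w)\<close> vanish, by non-degeneracy of \<open>V\<close>. By non-degeneracy of \<open>W\<close> these functionals have no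
  common zero, so \<open>u = 0\<close>.
\<close>

lemma tensor_nondegenerate_algebra: "nondegenerate_algebra K VW"
proof (intro nondegenerate_algebra.intro nondegenerate_algebra_axioms.intro tensor_nonunital_algebra)
  obtain v where v: "v \<in> carrier V" "v \<noteq> \<zero>\<^bsub>V\<^esub>" using V.nonzero V.M.zero_closed by blast
  obtain w where w: "w \<in> carrier W" "w \<noteq> \<zero>\<^bsub>W\<^esub>" using W.nonzero W.M.zero_closed by blast
  obtain h where h: "h \<in> linear_functional K W" "h w = \<one>" using separating_functional[OF field_axioms W_module w] by blast
  have "t v w \<noteq> \<zero>\<^bsub>VW\<^esub>"
    using slice_snd_tens[OF h(1) v(1) w(1)] h(2) v lin_zero[OF tensor_module V_module slice_snd_linear[OF h(1)]] by auto
  then show "carrier VW \<noteq> {\<zero>\<^bsub>VW\<^esub>}" using tens_closed[OF v(1) w(1)] by blast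
next
  fix u assume u: "u \<in> carrier VW" and z: "\<And>y. y \<in> carrier VW \<Longrightarrow> u \<otimes>\<^bsub>VW\<^esub> y = \<zero>\<^bsub>VW\<^esub>"
  let ?H = "{\<lambda>y. h (y \<otimes>\<^bsub>W\<^esub> w) | h w. h \<in> linear_functional K W \<and> w \<in> carrier W}"
  have fc: "(\<lambda>y. h (y \<otimes>\<^bsub>W\<^esub> w)) \<in> linear_functional K W" if "h \<in> linear_functional K W" "w \<in> carrier W" for h w
    by (rule fun_comp[OF W.mult_lin_l[OF that(2)] that(1)])
  show "u = \<zero>\<^bsub>VW\<^esub>"
  proof (rule tensor_eqI_snd[of ?H, OF _ _ u])
    show "?H \<subseteq> linear_functional K W" using fc by blast
    show "w = \<zero>\<^bsub>W\<^esub>" if w: "w \<in> carrier W" and h: "\<forall>h\<in>?H. h w = \<zero>" for w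
    proof (rule W.nondegenerate_l[OF w])
      fix y assume y: "y \<in> carrier W"
      show "w \<otimes>\<^bsub>W\<^esub> y = \<zero>\<^bsub>W\<^esub>"
      proof (rule functional_zero[OF W_module W.amult_closed[OF w y]])
        fix k assume "k \<in> linear_functional K W"
        then have "(\<lambda>z. k (z \<otimes>\<^bsub>W\<^esub> y)) \<in> ?H" using y by blast
        from bspec[OF h this] show "k (w \<otimes>\<^bsub>W\<^esub> y) = \<zero>" .
      qed
    qed
    show "slice_snd K V W g u = \<zero>\<^bsub>V\<^esub>" if "g \<in> ?H" for g
    proof -
      from CollectD[OF that] obtain h w where g: "g = (\<lambda>y. h (y \<otimes>\<^bsub>W\<^esub> w))" "h \<in> linear_functional K W" "w \<in> carrier W" by (elim exE conjE)
      have gl: "g \<in> linear_functional K W" unfolding g(1) by (rule fc[OF g(2,3)])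
      show ?thesis
      proof (rule V.nondegenerate_l[OF lin_closed[OF slice_snd_linear[OF gl] u]])
        fix v assume v: "v \<in> carrier V"
        show "slice_snd K V W g u \<otimes>\<^bsub>V\<^esub> v = \<zero>\<^bsub>V\<^esub>"
          unfolding g(1) slice_snd_mult(1)[OF g(2) v g(3) u, symmetric]
          using z[OF tens_closed[OF v g(3)]] lin_zero[OF tensor_module V_module slice_snd_linear[OF g(2)]] by simp
      qed
    qed
  qed
next
  fix u assume u: "u \<in> carrier VW" and z: "\<And>y. y \<in> carrier VW \<Longrightarrow> y \<otimes>\<^bsub>VW\<^esub> u = \<zero>\<^bsub>VW\<^esub>"
  let ?H = "{\<lambda>y. h (w \<otimes>\<^bsub>W\<^esub> y) | h w. h \<in> linear_functional K W \<and> w \<in> carrier W}"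
  have fc: "(\<lambda>y. h (w \<otimes>\<^bsub>W\<^esub> y)) \<in> linear_functional K W" if "h \<in> linear_functional K W" "w \<in> carrier W" for h w
    by (rule fun_comp[OF W.mult_lin_r[OF that(2)] that(1)])
  show "u = \<zero>\<^bsub>VW\<^esub>"
  proof (rule tensor_eqI_snd[of ?H, OF _ _ u])
    show "?H \<subseteq> linear_functional K W" using fc by blast
    show "w = \<zero>\<^bsub>W\<^esub>" if w: "w \<in> carrier W" and h: "\<forall>h\<in>?H. h w = \<zero>" for w
    proof (rule W.nondegenerate_r[OF w])
      fix y assume y: "y \<in> carrier W"
      show "y \<otimes>\<^bsub>W\<^esub> w = \<zero>\<^bsub>W\<^esub>"
      proof (rule functional_zero[OF W_module W.amult_closed[OF y w]])
        fix k assume "k \<in> linear_functional K W"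
        then have "(\<lambda>z. k (y \<otimes>\<^bsub>W\<^esub> z)) \<in> ?H" using y by blast
        from bspec[OF h this] show "k (y \<otimes>\<^bsub>W\<^esub> w) = \<zero>" .
      qed
    qed
    show "slice_snd K V W g u = \<zero>\<^bsub>V\<^esub>" if "g \<in> ?H" for g
    proof -
      from CollectD[OF that] obtain h w where g: "g = (\<lambda>y. h (w \<otimes>\<^bsub>W\<^esub> y))" "h \<in> linear_functional K W" "w \<in> carrier W" by (elim exE conjE)
      have gl: "g \<in> linear_functional K W" unfolding g(1) by (rule fc[OF g(2,3)])
      show ?thesis
      proof (rule V.nondegenerate_r[OF lin_closed[OF slice_snd_linear[OF gl] u]])
        fix v assume v: "v \<in> carrier V"
        show "v \<otimes>\<^bsub>V\<^esub> slice_snd K V W g u = \<zero>\<^bsub>V\<^esub>"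
          unfolding g(1) slice_snd_mult(2)[OF g(2) v g(3) u, symmetric]
          using z[OF tens_closed[OF v g(3)]] lin_zero[OF tensor_module V_module slice_snd_linear[OF g(2)]] by simp
      qed
    qed
  qed
qed

end

sublocale tensor_nondegenerate \<subseteq> T: nondegenerate_algebra K VW
  by (rule tensor_nondegenerate_algebra)

section \<open>Extension of non-degenerate homomorphisms\<close>

lemma
  assumes "h \<in> algebra_hom K X Y"
  shows algebra_hom_linear: "h \<in> linear_map K X Y"
    and algebra_hom_closed: "x \<in> carrier X \<Longrightarrow> h x \<in> carrier Y"
    and algebra_hom_mult: "x \<in> carrier X \<Longrightarrow> y \<in> carrier X \<Longrightarrow> h (x \<otimes>\<^bsub>X\<^esub> y) = h x \<otimes>\<^bsub>Y\<^esub> h y"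
  using assms by (auto simp: algebra_hom_def lin_closed)

lemma span_carrier_subset:
  assumes "linear_span K C S = carrier C" "submodule T K C" "S \<subseteq> T" shows "c \<in> carrier C \<Longrightarrow> c \<in> T"
  using linear_span_least[OF assms(2,3)] assms(1) by auto

lemma equalizer_submod:
  assumes "module K V" "module K W" "f \<in> linear_map K V W" "g \<in> linear_map K V W"
  shows "submodule {x \<in> carrier V. f x = g x} K V"
  by (rule submodI[OF assms(1)])
    (simp_all add: subset_iff lin_add[OF assms(3)] lin_add[OF assms(4)] lin_smult[OF assms(3)] lin_smult[OF assms(4)]
      lin_zero[OF assms(1-3)] lin_zero[OF assms(1,2,4)] mod_add_closed[OF assms(1)] mod_zero_closed[OF assms(1)]
      mod_smult_closed[OF assms(1)])

text \<open>
  Reduces the solvability of a family of linear equations with right-hand side depending linearly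
  on \<open>u\<close> to vectors \<open>u\<close> from a spanning set.
\<close>

lemma solvable_submod:
  assumes C: "module K C" and F: "\<And>i. i \<in> I \<Longrightarrow> F i \<in> linear_map K C C" and G: "\<And>i. i \<in> I \<Longrightarrow> G i \<in> linear_map K C C"
  shows "submodule {u \<in> carrier C. \<exists>v\<in>carrier C. \<forall>i\<in>I. F i v = G i u} K C" (is "submodule ?T K C")
proof (rule submodI[OF C])
  show "?T \<subseteq> carrier C" by blast
  have "\<forall>i\<in>I. F i \<zero>\<^bsub>C\<^esub> = G i \<zero>\<^bsub>C\<^esub>" using lin_zero[OF C C F] lin_zero[OF C C G] by simp
  then show "\<zero>\<^bsub>C\<^esub> \<in> ?T" using mod_zero_closed[OF C] by blast
  show "a \<oplus>\<^bsub>C\<^esub> b \<in> ?T" if "a \<in> ?T" "b \<in> ?T" for a b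
  proof -
    from that obtain v w where v: "a \<in> carrier C" "v \<in> carrier C" "\<forall>i\<in>I. F i v = G i a"
      and w: "b \<in> carrier C" "w \<in> carrier C" "\<forall>i\<in>I. F i w = G i b" by blast
    have "\<forall>i\<in>I. F i (v \<oplus>\<^bsub>C\<^esub> w) = G i (a \<oplus>\<^bsub>C\<^esub> b)"
      using v w lin_add[OF F] lin_add[OF G] by simp
    then show ?thesis using v w mod_add_closed[OF C] by blast
  qed
  show "c \<odot>\<^bsub>C\<^esub> a \<in> ?T" if c: "c \<in> carrier K" and a: "a \<in> ?T" for c a
  proof -
    from a obtain v where v: "a \<in> carrier C" "v \<in> carrier C" "\<forall>i\<in>I. F i v = G i a" by blast
    have "\<forall>i\<in>I. F i (c \<odot>\<^bsub>C\<^esub> v) = G i (c \<odot>\<^bsub>C\<^esub> a)"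
      using v c lin_smult[OF F] lin_smult[OF G] by simp
    then show ?thesis using v c mod_smult_closed[OF C] by blast
  qed
qed

locale nondegenerate_hom = B: nonunital_algebra K B + C: nondegenerate_algebra K C
  for K (structure) and B (structure) and C (structure) +
  fixes h
  assumes h: "h \<in> algebra_hom K B C.MX"
    and span_l: "linear_span K C {fst (h b) c | b c. b \<in> carrier B \<and> c \<in> carrier C} = carrier C"
    and span_r: "linear_span K C {snd (h b) c | b c. b \<in> carrier B \<and> c \<in> carrier C} = carrier C"
begin

lemmas hc [simp, intro] = algebra_hom_closed[OF h]
lemmas hm = algebra_hom_mult[OF h]

lemma span_l_induct:
  "submodule T K C \<Longrightarrow> (\<And>b c. b \<in> carrier B \<Longrightarrow> c \<in> carrier C \<Longrightarrow> fst (h b) c \<in> T) \<Longrightarrow> u \<in> carrier C \<Longrightarrow> u \<in> T"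
  by (rule span_carrier_subset[OF span_l]) auto

lemma span_r_induct:
  "submodule T K C \<Longrightarrow> (\<And>b c. b \<in> carrier B \<Longrightarrow> c \<in> carrier C \<Longrightarrow> snd (h b) c \<in> T) \<Longrightarrow> u \<in> carrier C \<Longrightarrow> u \<in> T"
  by (rule span_carrier_subset[OF span_r]) auto

lemma fst_cancel:
  assumes "v \<in> carrier C" "v' \<in> carrier C" "\<And>b. b \<in> carrier B \<Longrightarrow> fst (h b) v = fst (h b) v'"
  shows "v = v'"
proof (rule C.nondeg_r[OF assms(1,2)])
  fix y assume y: "y \<in> carrier C"
  have "y \<in> {y \<in> carrier C. y \<otimes>\<^bsub>C\<^esub> v = y \<otimes>\<^bsub>C\<^esub> v'}"
  proof (rule span_r_induct[OF _ _ y])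
    show "submodule {y \<in> carrier C. y \<otimes>\<^bsub>C\<^esub> v = y \<otimes>\<^bsub>C\<^esub> v'} K C"
      by (rule equalizer_submod[OF C.X_module C.X_module]) (use assms in \<open>simp_all add: C.mult_lin_l\<close>)
  qed (use assms in \<open>simp add: C.snd_fst\<close>)
  then show "y \<otimes>\<^bsub>C\<^esub> v = y \<otimes>\<^bsub>C\<^esub> v'" by simp
qed

lemma snd_cancel:
  assumes "v \<in> carrier C" "v' \<in> carrier C" "\<And>b. b \<in> carrier B \<Longrightarrow> snd (h b) v = snd (h b) v'"
  shows "v = v'"
proof (rule C.nondeg_l[OF assms(1,2)])
  fix y assume y: "y \<in> carrier C"
  have "y \<in> {y \<in> carrier C. v \<otimes>\<^bsub>C\<^esub> y = v' \<otimes>\<^bsub>C\<^esub> y}"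
  proof (rule span_l_induct[OF _ _ y])
    show "submodule {y \<in> carrier C. v \<otimes>\<^bsub>C\<^esub> y = v' \<otimes>\<^bsub>C\<^esub> y} K C"
      by (rule equalizer_submod[OF C.X_module C.X_module]) (use assms in \<open>simp_all add: C.mult_lin_r\<close>)
  qed (use assms in \<open>simp add: C.snd_fst[symmetric]\<close>)
  then show "v \<otimes>\<^bsub>C\<^esub> y = v' \<otimes>\<^bsub>C\<^esub> y" by simp
qed

lemma extension_unique:
  assumes "n \<in> carrier C.MX" "n' \<in> carrier C.MX"
    "\<And>b. b \<in> carrier B \<Longrightarrow> n \<otimes>\<^bsub>C.MX\<^esub> h b = n' \<otimes>\<^bsub>C.MX\<^esub> h b"
  shows "n = n'"
proof (rule C.mult_eqI_fst[OF assms(1,2)])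
  fix u assume u: "u \<in> carrier C"
  have "u \<in> {u \<in> carrier C. fst n u = fst n' u}"
  proof (rule span_l_induct[OF _ _ u])
    note l = C.fst_linear[OF assms(1)] C.fst_linear[OF assms(2)]
    show "submodule {u \<in> carrier C. fst n u = fst n' u} K C"
      by (rule equalizer_submod[OF C.X_module C.X_module l])
    fix b c assume b: "b \<in> carrier B" and c: "c \<in> carrier C"
    show "fst (h b) c \<in> {u \<in> carrier C. fst n u = fst n' u}"
      using b c arg_cong[OF assms(3)[OF b], of "\<lambda>m. fst m c"] by simp
  qed
  then show "fst n u = fst n' u" by simp
qed

text \<open>
  The extension \<open>n\<close> of \<open>m\<close> acts by the element \<open>v = n u\<close> determined by \<open>h(b) v = h(b m) u\<close> for all
  \<open>b\<close>. Such a \<open>v\<close> exists for \<open>u\<close> of the form \<open>h(b') c\<close>, namely \<open>h(m b') c\<close>, and hence for every \<open>u\<close> by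
  non-degeneracy.
\<close>

lemma extension_exists:
  assumes m: "m \<in> carrier B.MX"
  shows "\<exists>n\<in>carrier C.MX. \<forall>b\<in>carrier B. n \<otimes>\<^bsub>C.MX\<^esub> h b = h (fst m b) \<and> h b \<otimes>\<^bsub>C.MX\<^esub> n = h (snd m b)"
proof -
  note mcl = B.fst_closed[OF m] B.snd_closed[OF m]
  note fl = C.fst_linear[OF hc] and sl = C.snd_linear[OF hc]
  have ex: "\<exists>v\<in>carrier C. \<forall>b\<in>carrier B. fst (h b) v = fst (h (snd m b)) u" if u: "u \<in> carrier C" for u
  proof -
    have "u \<in> {u \<in> carrier C. \<exists>v\<in>carrier C. \<forall>b\<in>carrier B. fst (h b) v = fst (h (snd m b)) u}" (is "u \<in> ?T")
    proof (rule span_l_induct[OF _ _ u])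
      show "submodule ?T K C"
        by (rule solvable_submod[OF C.X_module]) (use fl mcl in auto)
      fix b' c assume b': "b' \<in> carrier B" and c: "c \<in> carrier C"
      have "fst (h b) (fst (h (fst m b')) c) = fst (h (snd m b)) (fst (h b') c)" if b: "b \<in> carrier B" for b
      proof -
        have "fst (h b \<otimes>\<^bsub>C.MX\<^esub> h (fst m b')) c = fst (h (snd m b) \<otimes>\<^bsub>C.MX\<^esub> h b') c"
          using b b' mcl by (simp only: hm[symmetric] B.snd_fst[OF m])
        then show ?thesis using c by simp
      qed
      then have "\<forall>b\<in>carrier B. fst (h b) (fst (h (fst m b')) c) = fst (h (snd m b)) (fst (h b') c)" by blast
      moreover have "fst (h (fst m b')) c \<in> carrier C" "fst (h b') c \<in> carrier C" using b' c mcl by auto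
      ultimately show "fst (h b') c \<in> ?T" by blast
    qed
    then show ?thesis by blast
  qed
  have ex': "\<exists>v\<in>carrier C. \<forall>b\<in>carrier B. snd (h b) v = snd (h (fst m b)) u" if u: "u \<in> carrier C" for u
  proof -
    have "u \<in> {u \<in> carrier C. \<exists>v\<in>carrier C. \<forall>b\<in>carrier B. snd (h b) v = snd (h (fst m b)) u}" (is "u \<in> ?T")
    proof (rule span_r_induct[OF _ _ u])
      show "submodule ?T K C"
        by (rule solvable_submod[OF C.X_module]) (use sl mcl in auto)
      fix b' c assume b': "b' \<in> carrier B" and c: "c \<in> carrier C"
      have "snd (h b) (snd (h (snd m b')) c) = snd (h (fst m b)) (snd (h b') c)" if b: "b \<in> carrier B" for b
      proof -
        have "snd (h (snd m b') \<otimes>\<^bsub>C.MX\<^esub> h b) c = snd (h b' \<otimes>\<^bsub>C.MX\<^esub> h (fst m b)) c"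
          using b b' mcl by (simp only: hm[symmetric] B.snd_fst[OF m])
        then show ?thesis using c by simp
      qed
      then have "\<forall>b\<in>carrier B. snd (h b) (snd (h (snd m b')) c) = snd (h (fst m b)) (snd (h b') c)" by blast
      moreover have "snd (h (snd m b')) c \<in> carrier C" "snd (h b') c \<in> carrier C" using b' c mcl by auto
      ultimately show "snd (h b') c \<in> ?T" by blast
    qed
    then show ?thesis by blast
  qed
  define l where "l = (\<lambda>u\<in>carrier C. SOME v. v \<in> carrier C \<and> (\<forall>b\<in>carrier B. fst (h b) v = fst (h (snd m b)) u))"
  define r where "r = (\<lambda>u\<in>carrier C. SOME v. v \<in> carrier C \<and> (\<forall>b\<in>carrier B. snd (h b) v = snd (h (fst m b)) u))"
  have l: "l u \<in> carrier C" "b \<in> carrier B \<Longrightarrow> fst (h b) (l u) = fst (h (snd m b)) u" if u: "u \<in> carrier C" for u b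
    using someI_ex[OF ex[OF u, unfolded Bex_def]] u by (auto simp: l_def)
  have r: "r u \<in> carrier C" "b \<in> carrier B \<Longrightarrow> snd (h b) (r u) = snd (h (fst m b)) u" if u: "u \<in> carrier C" for u b
    using someI_ex[OF ex'[OF u, unfolded Bex_def]] u by (auto simp: r_def)
  have llin: "l \<in> linear_map K C C"
    by (rule linear_mapI; (rule fst_cancel)?) (simp_all add: l lin_add[OF fl] lin_smult[OF fl] mcl)
  have rlin: "r \<in> linear_map K C C"
    by (rule linear_mapI; (rule snd_cancel)?) (simp_all add: r lin_add[OF sl] lin_smult[OF sl] mcl)
  have lh: "l (fst (h b) c) = fst (h (fst m b)) c" if b: "b \<in> carrier B" and c: "c \<in> carrier C" for b c
  proof (rule fst_cancel)
    fix b' assume b': "b' \<in> carrier B"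
    have "fst (h (snd m b') \<otimes>\<^bsub>C.MX\<^esub> h b) c = fst (h b' \<otimes>\<^bsub>C.MX\<^esub> h (fst m b)) c"
      using b b' mcl by (simp only: hm[symmetric] B.snd_fst[OF m])
    then show "fst (h b') (l (fst (h b) c)) = fst (h b') (fst (h (fst m b)) c)"
      using b b' c mcl by (simp add: l)
  qed (use b c mcl in \<open>simp_all add: l\<close>)
  have n: "(l, r) \<in> carrier C.MX"
  proof (rule C.multI[OF llin rlin])
    show "l \<in> extensional (carrier C)" "r \<in> extensional (carrier C)" by (simp_all add: l_def r_def)
    show "l (x \<otimes>\<^bsub>C\<^esub> y) = l x \<otimes>\<^bsub>C\<^esub> y" if "x \<in> carrier C" "y \<in> carrier C" for x y
      by (rule fst_cancel) (use that mcl in \<open>simp_all add: l C.amult_closed C.fst_mult\<close>)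
    show "r (x \<otimes>\<^bsub>C\<^esub> y) = x \<otimes>\<^bsub>C\<^esub> r y" if "x \<in> carrier C" "y \<in> carrier C" for x y
      by (rule snd_cancel) (use that mcl in \<open>simp_all add: r C.amult_closed C.snd_mult\<close>)
    show "r x \<otimes>\<^bsub>C\<^esub> y = x \<otimes>\<^bsub>C\<^esub> l y" if x: "x \<in> carrier C" and y: "y \<in> carrier C" for x y
    proof -
      note L = C.mult_lin_r[OF r(1)[OF x]] lin_comp[OF llin C.mult_lin_r[OF x]]
      have "y \<in> {y \<in> carrier C. r x \<otimes>\<^bsub>C\<^esub> y = x \<otimes>\<^bsub>C\<^esub> l y}"
      proof (rule span_l_induct[OF _ _ y])
        show "submodule {y \<in> carrier C. r x \<otimes>\<^bsub>C\<^esub> y = x \<otimes>\<^bsub>C\<^esub> l y} K C"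
          by (rule equalizer_submod[OF C.X_module C.X_module L])
        fix b c assume b: "b \<in> carrier B" and c: "c \<in> carrier C"
        have "r x \<otimes>\<^bsub>C\<^esub> fst (h b) c = x \<otimes>\<^bsub>C\<^esub> l (fst (h b) c)"
          using b c x mcl by (simp add: C.snd_fst[symmetric] r lh)
        then show "fst (h b) c \<in> {y \<in> carrier C. r x \<otimes>\<^bsub>C\<^esub> y = x \<otimes>\<^bsub>C\<^esub> l y}" using b c by simp
      qed
      then show ?thesis by simp
    qed
  qed
  show ?thesis
  proof (rule bexI[OF _ n], intro ballI conjI)
    fix b assume b: "b \<in> carrier B"
    show "(l, r) \<otimes>\<^bsub>C.MX\<^esub> h b = h (fst m b)"
      by (rule C.mult_eqI_fst) (use n b mcl in \<open>simp_all add: lh\<close>)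
    show "h b \<otimes>\<^bsub>C.MX\<^esub> (l, r) = h (snd m b)"
      by (rule C.mult_eqI_fst) (use n b mcl in \<open>simp_all add: l\<close>)
  qed
qed

lemma extension_eqI:
  assumes "n \<in> carrier C.MX" "\<And>b. b \<in> carrier B \<Longrightarrow> n \<otimes>\<^bsub>C.MX\<^esub> h b = h (fst m b)"
    "\<And>b. b \<in> carrier B \<Longrightarrow> h b \<otimes>\<^bsub>C.MX\<^esub> n = h (snd m b)"
  shows "multiplier_extension K B C h m = n"
  unfolding multiplier_extension_def
proof (rule the_equality)
  show "n \<in> carrier C.MX \<and> (\<forall>x\<in>carrier B. n \<otimes>\<^bsub>C.MX\<^esub> h x = h (fst m x) \<and> h x \<otimes>\<^bsub>C.MX\<^esub> n = h (snd m x))"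
    using assms by simp
  fix n' assume n': "n' \<in> carrier C.MX \<and> (\<forall>x\<in>carrier B. n' \<otimes>\<^bsub>C.MX\<^esub> h x = h (fst m x) \<and> h x \<otimes>\<^bsub>C.MX\<^esub> n' = h (snd m x))"
  show "n' = n" by (rule extension_unique) (use n' assms in simp_all)
qed

lemma
  assumes m: "m \<in> carrier B.MX"
  shows extension_closed: "multiplier_extension K B C h m \<in> carrier C.MX"
    and extension_l: "b \<in> carrier B \<Longrightarrow> multiplier_extension K B C h m \<otimes>\<^bsub>C.MX\<^esub> h b = h (fst m b)"
    and extension_r: "b \<in> carrier B \<Longrightarrow> h b \<otimes>\<^bsub>C.MX\<^esub> multiplier_extension K B C h m = h (snd m b)"
proof -
  from extension_exists[OF m] obtain n where n: "n \<in> carrier C.MX"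
    "\<And>b. b \<in> carrier B \<Longrightarrow> n \<otimes>\<^bsub>C.MX\<^esub> h b = h (fst m b)"
    "\<And>b. b \<in> carrier B \<Longrightarrow> h b \<otimes>\<^bsub>C.MX\<^esub> n = h (snd m b)" by blast
  note e = extension_eqI[OF n]
  show "multiplier_extension K B C h m \<in> carrier C.MX" using n e by simp
  show "b \<in> carrier B \<Longrightarrow> multiplier_extension K B C h m \<otimes>\<^bsub>C.MX\<^esub> h b = h (fst m b)" using n e by simp
  show "b \<in> carrier B \<Longrightarrow> h b \<otimes>\<^bsub>C.MX\<^esub> multiplier_extension K B C h m = h (snd m b)" using n e by simp
qed

end

context tensor_algebra
begin

lemma multiplier_tens_bilinear: "multiplier_tens K V W \<in> bilinear_map K V.MX W.MX T.MX"
  by (intro bilinear_mapI linear_mapI; (rule mult_eq_on_pure)?)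
    (simp_all add: multiplier_tens_closed V.mult_add_closed V.mult_smult_closed W.mult_add_closed W.mult_smult_closed
      T.mult_add_closed T.mult_smult_closed multiplier_tens_apply lin_add[OF tens_l] lin_smult[OF tens_l]
      lin_add[OF tens_r] lin_smult[OF tens_r])

lemma multiplier_tens_mult:
  assumes "m \<in> carrier V.MX" "n \<in> carrier W.MX" "m' \<in> carrier V.MX" "n' \<in> carrier W.MX"
  shows "multiplier_tens K V W m n \<otimes>\<^bsub>T.MX\<^esub> multiplier_tens K V W m' n' =
    multiplier_tens K V W (m \<otimes>\<^bsub>V.MX\<^esub> m') (n \<otimes>\<^bsub>W.MX\<^esub> n')"
  by (rule mult_eq_on_pure) (simp_all add: assms multiplier_tens_closed multiplier_tens_apply)

text \<open>
  Multiplicativity is an identity between bilinear maps, so pure tensors suffice. Both \<open>\<alpha> \<otimes> \<iota>\<close> and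
  \<open>\<iota> \<otimes> \<Delta>\<close> are homomorphisms for this reason.
\<close>

lemma lift_algebra_hom:
  assumes C: "nonunital_algebra K C" and b: "b \<in> bilinear_map K V W (multiplier_algebra K C)"
    and m: "\<And>v w v' w'. v \<in> carrier V \<Longrightarrow> w \<in> carrier W \<Longrightarrow> v' \<in> carrier V \<Longrightarrow> w' \<in> carrier W \<Longrightarrow>
      b (v \<otimes>\<^bsub>V\<^esub> v') (w \<otimes>\<^bsub>W\<^esub> w') = b v w \<otimes>\<^bsub>multiplier_algebra K C\<^esub> b v' w'"
  shows "tensor_lift K V W (multiplier_algebra K C) b \<in> algebra_hom K VW (multiplier_algebra K C)"
proof -
  interpret C: nonunital_algebra K C by (rule C)
  note L = lift_linear[OF C.mult_module b] and Lt = lift_tens[OF C.mult_module b]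
  have "tensor_lift K V W C.MX b (x \<otimes>\<^bsub>VW\<^esub> y) = tensor_lift K V W C.MX b x \<otimes>\<^bsub>C.MX\<^esub> tensor_lift K V W C.MX b y"
    if x: "x \<in> carrier VW" and y: "y \<in> carrier VW" for x y
    by (rule tensor_bilin_eq[OF C.mult_module bilin_post[OF tensor_mult_bilinear L] bilin_comp_args[OF C.mult_bilinear L L] _ x y])
      (simp add: Lt m V.amult_closed W.amult_closed)
  then show ?thesis using L by (simp add: algebra_hom_def)
qed

end

section \<open>Triple tensor products\<close>

locale tensor_triple = X: nondegenerate_algebra K X + A: nondegenerate_algebra K A
  for K :: "('k, 'r) ring_scheme" (structure)
    and X :: "('k, 'x, 'm) module_scheme" (structure)
    and A :: "('k, 'a, 'n) module_scheme" (structure)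

sublocale tensor_triple \<subseteq> XA: tensor_nondegenerate K X A
  by unfold_locales

sublocale tensor_triple \<subseteq> AA: tensor_nondegenerate K A A
  by unfold_locales

sublocale tensor_triple \<subseteq> XAA: tensor_nondegenerate K "tensor K X A" A
  by unfold_locales

sublocale tensor_triple \<subseteq> X_AA: tensor_nondegenerate K X "tensor K A A"
  by unfold_locales

context tensor_triple
begin

abbreviation "XAm \<equiv> tensor K X A"
abbreviation "AAm \<equiv> tensor K A A"
abbreviation "XAAm \<equiv> tensor K (tensor K X A) A"
abbreviation "X_AAm \<equiv> tensor K X (tensor K A A)"
abbreviation "txa \<equiv> tens K X A"
abbreviation "taa \<equiv> tens K A A"
abbreviation "txaa \<equiv> tens K (tensor K X A) A"
abbreviation "tx_aa \<equiv> tens K X (tensor K A A)"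
abbreviation "assoc \<equiv> tensor_assoc K X A A"

lemma assoc_inner: "x \<in> carrier X \<Longrightarrow> (\<lambda>y z. txaa (txa x y) z) \<in> bilinear_map K A A XAAm"
  by (rule bilinear_mapI) (rule XAA.tens_r, simp, rule XAA.tens_lin_l[OF XA.tens_r])

lemma assoc_outer: "(\<lambda>x. tensor_lift K A A XAAm (\<lambda>y z. txaa (txa x y) z)) \<in> bilinear_map K X AAm XAAm"
proof (rule bilinear_mapI)
  fix x assume x: "x \<in> carrier X"
  show "(\<lambda>w. tensor_lift K A A XAAm (\<lambda>y z. txaa (txa x y) z) w) \<in> linear_map K AAm XAAm"
    by (rule AA.lift_linear[OF XAA.tensor_module assoc_inner[OF x]])
next
  fix w assume w: "w \<in> carrier AAm"
  show "(\<lambda>x. tensor_lift K A A XAAm (\<lambda>y z. txaa (txa x y) z) w) \<in> linear_map K X XAAm"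
    by (rule AA.lift_lin_par[OF XAA.tensor_module assoc_inner _ X.X_module w])
      (assumption, rule XAA.tens_lin_l[OF XA.tens_l])
qed

lemma assoc_linear: "assoc \<in> linear_map K X_AAm XAAm"
  unfolding tensor_assoc_def by (rule X_AA.lift_linear[OF XAA.tensor_module assoc_outer])

lemma assoc_lift:
  "x \<in> carrier X \<Longrightarrow> w \<in> carrier AAm \<Longrightarrow> assoc (tx_aa x w) = tensor_lift K A A XAAm (\<lambda>y z. txaa (txa x y) z) w"
  unfolding tensor_assoc_def by (rule X_AA.lift_tens[OF XAA.tensor_module assoc_outer])

lemma assoc_tens [simp]:
  "x \<in> carrier X \<Longrightarrow> a \<in> carrier A \<Longrightarrow> b \<in> carrier A \<Longrightarrow> assoc (tx_aa x (taa a b)) = txaa (txa x a) b"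
  by (simp add: assoc_lift AA.lift_tens[OF XAA.tensor_module assoc_inner])

lemma X_AA_lin_eq:
  assumes "module K Z" "f \<in> linear_map K X_AAm Z" "g \<in> linear_map K X_AAm Z"
    and e: "\<And>x a b. x \<in> carrier X \<Longrightarrow> a \<in> carrier A \<Longrightarrow> b \<in> carrier A \<Longrightarrow> f (tx_aa x (taa a b)) = g (tx_aa x (taa a b))"
    and u: "u \<in> carrier X_AAm"
  shows "f u = g u"
proof (rule X_AA.tensor_lin_eq[OF assms(1-3) _ u])
  fix x w assume x: "x \<in> carrier X" and w: "w \<in> carrier AAm"
  show "f (tx_aa x w) = g (tx_aa x w)"
    by (rule AA.tensor_lin_eq[OF assms(1) lin_comp[OF X_AA.tens_r[OF x] assms(2)] lin_comp[OF X_AA.tens_r[OF x] assms(3)] _ w])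
      (rule e[OF x])
qed

lemma XAA_lin_eq:
  assumes "module K Z" "f \<in> linear_map K XAAm Z" "g \<in> linear_map K XAAm Z"
    and e: "\<And>x a b. x \<in> carrier X \<Longrightarrow> a \<in> carrier A \<Longrightarrow> b \<in> carrier A \<Longrightarrow> f (txaa (txa x a) b) = g (txaa (txa x a) b)"
    and u: "u \<in> carrier XAAm"
  shows "f u = g u"
proof (rule XAA.tensor_lin_eq[OF assms(1-3) _ u])
  fix w b assume w: "w \<in> carrier XAm" and b: "b \<in> carrier A"
  show "f (txaa w b) = g (txaa w b)"
    by (rule XA.tensor_lin_eq[OF assms(1) lin_comp[OF XAA.tens_l[OF b] assms(2)] lin_comp[OF XAA.tens_l[OF b] assms(3)] _ w])
      (use e b in simp)
qed

definition unassoc where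
  "unassoc = tensor_lift K XAm A X_AAm (\<lambda>w b. tensor_lift K X A X_AAm (\<lambda>x a. tx_aa x (taa a b)) w)"

lemma unassoc_inner: "b \<in> carrier A \<Longrightarrow> (\<lambda>x a. tx_aa x (taa a b)) \<in> bilinear_map K X A X_AAm"
  by (rule bilinear_mapI) (rule X_AA.tens_lin_r[OF AA.tens_l], assumption+, rule X_AA.tens_l, simp)

lemma unassoc_outer: "(\<lambda>w b. tensor_lift K X A X_AAm (\<lambda>x a. tx_aa x (taa a b)) w) \<in> bilinear_map K XAm A X_AAm"
proof (rule bilinear_mapI)
  fix w assume w: "w \<in> carrier XAm"
  show "(\<lambda>b. tensor_lift K X A X_AAm (\<lambda>x a. tx_aa x (taa a b)) w) \<in> linear_map K A X_AAm"
    by (rule XA.lift_lin_par[OF X_AA.tensor_module unassoc_inner _ A.X_module w])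
      (assumption, rule X_AA.tens_lin_r[OF AA.tens_r])
next
  fix b assume b: "b \<in> carrier A"
  show "(\<lambda>w. tensor_lift K X A X_AAm (\<lambda>x a. tx_aa x (taa a b)) w) \<in> linear_map K XAm X_AAm"
    by (rule XA.lift_linear[OF X_AA.tensor_module unassoc_inner[OF b]])
qed

lemma unassoc_linear: "unassoc \<in> linear_map K XAAm X_AAm"
  unfolding unassoc_def by (rule XAA.lift_linear[OF X_AA.tensor_module unassoc_outer])

lemma unassoc_tens [simp]:
  "x \<in> carrier X \<Longrightarrow> a \<in> carrier A \<Longrightarrow> b \<in> carrier A \<Longrightarrow> unassoc (txaa (txa x a) b) = tx_aa x (taa a b)"
  unfolding unassoc_def
  by (simp add: XAA.lift_tens[OF X_AA.tensor_module unassoc_outer] XA.lift_tens[OF X_AA.tensor_module unassoc_inner])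

lemma unassoc_assoc [simp]: "w \<in> carrier X_AAm \<Longrightarrow> unassoc (assoc w) = w"
  by (rule X_AA_lin_eq[OF X_AA.tensor_module lin_comp[OF assoc_linear unassoc_linear] lin_id]) simp_all

lemma assoc_unassoc [simp]: "w \<in> carrier XAAm \<Longrightarrow> assoc (unassoc w) = w"
  by (rule XAA_lin_eq[OF XAA.tensor_module lin_comp[OF unassoc_linear assoc_linear] lin_id]) simp_all

lemmas assoc_closed [simp, intro] = lin_closed[OF assoc_linear]
lemmas unassoc_closed [simp, intro] = lin_closed[OF unassoc_linear]

lemma assoc_mult:
  assumes u: "u \<in> carrier X_AAm" and v: "v \<in> carrier X_AAm"
  shows "assoc (u \<otimes>\<^bsub>X_AAm\<^esub> v) = assoc u \<otimes>\<^bsub>XAAm\<^esub> assoc v"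
proof (rule X_AA_lin_eq[OF XAA.tensor_module lin_comp[OF X_AA.T.mult_lin_l[OF v] assoc_linear]
      lin_comp[OF assoc_linear XAA.T.mult_lin_l[OF assoc_closed[OF v]]] _ u])
  fix x a b assume p: "x \<in> carrier X" "a \<in> carrier A" "b \<in> carrier A"
  then have c: "tx_aa x (taa a b) \<in> carrier X_AAm" by simp
  show "assoc (tx_aa x (taa a b) \<otimes>\<^bsub>X_AAm\<^esub> v) = assoc (tx_aa x (taa a b)) \<otimes>\<^bsub>XAAm\<^esub> assoc v"
    by (rule X_AA_lin_eq[OF XAA.tensor_module lin_comp[OF X_AA.T.mult_lin_r[OF c] assoc_linear]
        lin_comp[OF assoc_linear XAA.T.mult_lin_r[OF assoc_closed[OF c]]] _ v])
      (use p in \<open>simp add: X.amult_closed A.amult_closed\<close>)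
qed

lemma unassoc_mult:
  assumes u: "u \<in> carrier XAAm" and v: "v \<in> carrier XAAm"
  shows "unassoc (u \<otimes>\<^bsub>XAAm\<^esub> v) = unassoc u \<otimes>\<^bsub>X_AAm\<^esub> unassoc v"
proof -
  have "unassoc (assoc (unassoc u) \<otimes>\<^bsub>XAAm\<^esub> assoc (unassoc v)) = unassoc u \<otimes>\<^bsub>X_AAm\<^esub> unassoc v"
    using u v by (simp only: assoc_mult[symmetric] unassoc_closed) (simp add: X_AA.T.amult_closed)
  then show ?thesis using u v by simp
qed

abbreviation "trp \<equiv> transport_multiplier X_AAm XAAm assoc"

lemma the_inv_assoc: "w \<in> carrier XAAm \<Longrightarrow> the_inv_into (carrier X_AAm) assoc w = unassoc w"
proof (rule the_inv_into_f_eq)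
  show "inj_on assoc (carrier X_AAm)" by (rule inj_on_inverseI[of _ unassoc]) simp
qed simp_all

lemma transp_apply [simp]:
  "w \<in> carrier XAAm \<Longrightarrow> fst (trp m) w = assoc (fst m (unassoc w))"
  "w \<in> carrier XAAm \<Longrightarrow> snd (trp m) w = assoc (snd m (unassoc w))"
  by (simp_all add: transport_multiplier_def the_inv_assoc)

lemma transp_closed:
  assumes m: "m \<in> carrier X_AA.T.MX" shows "trp m \<in> carrier XAA.T.MX"
proof -
  have l: "fst (trp m) \<in> linear_map K XAAm XAAm"
    by (rule lin_cong[OF lin_comp[OF lin_comp[OF unassoc_linear X_AA.T.fst_linear[OF m]] assoc_linear] _ XAA.tensor_module]) simp
  have r: "snd (trp m) \<in> linear_map K XAAm XAAm"
    by (rule lin_cong[OF lin_comp[OF lin_comp[OF unassoc_linear X_AA.T.snd_linear[OF m]] assoc_linear] _ XAA.tensor_module]) simp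
  have e: "fst (trp m) \<in> extensional (carrier XAAm)" "snd (trp m) \<in> extensional (carrier XAAm)"
    by (simp_all add: transport_multiplier_def)
  have ass: "assoc u \<otimes>\<^bsub>XAAm\<^esub> y = assoc (u \<otimes>\<^bsub>X_AAm\<^esub> unassoc y)" "y \<otimes>\<^bsub>XAAm\<^esub> assoc u = assoc (unassoc y \<otimes>\<^bsub>X_AAm\<^esub> u)"
    if "u \<in> carrier X_AAm" "y \<in> carrier XAAm" for u y
    using that by (simp_all add: assoc_mult)
  have "(fst (trp m), snd (trp m)) \<in> carrier XAA.T.MX"
    by (rule XAA.T.multI[OF l r e])
      (use m in \<open>simp_all add: XAA.T.amult_closed unassoc_mult ass X_AA.T.fst_mult X_AA.T.snd_mult X_AA.T.snd_fst\<close>)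
  then show ?thesis by simp
qed

lemma transp_linear: "trp \<in> linear_map K X_AA.T.MX XAA.T.MX"
  by (rule linear_mapI; (rule XAA.T.mult_eqI)?)
    (simp_all add: transp_closed X_AA.T.mult_add_closed X_AA.T.mult_smult_closed XAA.T.mult_add_closed
      XAA.T.mult_smult_closed lin_add[OF assoc_linear] lin_smult[OF assoc_linear])

lemma transp_mult:
  assumes "m \<in> carrier X_AA.T.MX" "n \<in> carrier X_AA.T.MX"
  shows "trp (m \<otimes>\<^bsub>X_AA.T.MX\<^esub> n) = trp m \<otimes>\<^bsub>XAA.T.MX\<^esub> trp n"
  by (rule XAA.T.mult_eqI) (use assms in \<open>simp_all add: transp_closed\<close>)

lemma XAA_bilin_pure_eq:
  assumes S: "S \<in> carrier XAAm" "R \<in> carrier XAAm"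
    and e: "\<And>x a b. x \<in> carrier X \<Longrightarrow> a \<in> carrier A \<Longrightarrow> b \<in> carrier A \<Longrightarrow>
      S \<otimes>\<^bsub>XAAm\<^esub> txaa (txa x a) b = R \<otimes>\<^bsub>XAAm\<^esub> txaa (txa x a) b"
  shows "S = R"
proof (rule XAA.T.nondeg_l[OF S])
  fix u assume u: "u \<in> carrier XAAm"
  show "S \<otimes>\<^bsub>XAAm\<^esub> u = R \<otimes>\<^bsub>XAAm\<^esub> u"
    by (rule XAA_lin_eq[OF XAA.tensor_module XAA.T.mult_lin_r[OF S(1)] XAA.T.mult_lin_r[OF S(2)] e u])
qed

end

section \<open>Covered products\<close>

text \<open>
  The products \<open>\<alpha>(x)(1 \<otimes> a)\<close>, \<open>(1 \<otimes> a)\<alpha>(x)\<close> and \<open>(x \<otimes> 1)\<alpha>(y)\<close> as elements of \<open>X \<otimes> A\<close>. They are of use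
  when the products lie in \<open>X \<otimes> A\<close>; the second factor covers the leg that has no finite expression.
\<close>

definition act_r where
  "act_r K X A \<alpha> x a = element_of (tensor K X A) (\<alpha> x \<otimes>\<^bsub>multiplier_algebra K (tensor K X A)\<^esub> in_snd K X A a)"

definition act_l where
  "act_l K X A \<alpha> a x = element_of (tensor K X A) (in_snd K X A a \<otimes>\<^bsub>multiplier_algebra K (tensor K X A)\<^esub> \<alpha> x)"

definition gal where
  "gal K X A \<alpha> x y = element_of (tensor K X A) (in_fst K X A x \<otimes>\<^bsub>multiplier_algebra K (tensor K X A)\<^esub> \<alpha> y)"

text \<open>
  Common ground of the coproduct and of a reduced coaction: homomorphisms whose products with \<open>1 \<otimes> a\<close> on
  either side and with \<open>x \<otimes> 1\<close> on the left lie in \<open>X \<otimes> A\<close>.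
\<close>

locale covered_hom = tensor_triple K X A
  for K :: "('k, 'r) ring_scheme" (structure)
    and X :: "('k, 'x, 'm) module_scheme" (structure)
    and A :: "('k, 'a, 'n) module_scheme" (structure)
    and \<alpha> :: "'x \<Rightarrow> ('x \<times> 'a \<Rightarrow> 'k) set multiplier" +
  assumes hom: "\<alpha> \<in> algebra_hom K X (multiplier_algebra K (tensor K X A))"
    and emb_r: "\<lbrakk>x \<in> carrier X; a \<in> carrier A\<rbrakk> \<Longrightarrow>
        \<alpha> x \<otimes>\<^bsub>multiplier_algebra K (tensor K X A)\<^esub> in_snd K X A a \<in> embedded (tensor K X A)"
    and emb_l: "\<lbrakk>x \<in> carrier X; a \<in> carrier A\<rbrakk> \<Longrightarrow>
        in_snd K X A a \<otimes>\<^bsub>multiplier_algebra K (tensor K X A)\<^esub> \<alpha> x \<in> embedded (tensor K X A)"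
    and emb_g: "\<lbrakk>x \<in> carrier X; y \<in> carrier X\<rbrakk> \<Longrightarrow>
        in_fst K X A x \<otimes>\<^bsub>multiplier_algebra K (tensor K X A)\<^esub> \<alpha> y \<in> embedded (tensor K X A)"
begin

abbreviation "M \<equiv> multiplier_algebra K (tensor K X A)"
abbreviation "\<rho> \<equiv> act_r K X A \<alpha>"
abbreviation "\<Lambda> \<equiv> act_l K X A \<alpha>"
abbreviation "\<gamma> \<equiv> gal K X A \<alpha>"
abbreviation "as \<equiv> as_multiplier XAm"
abbreviation "i1 \<equiv> in_fst K X A"
abbreviation "i2 \<equiv> in_snd K X A"

lemmas \<alpha>_closed [simp, intro] = algebra_hom_closed[OF hom]
lemmas \<alpha>_mult = algebra_hom_mult[OF hom]
lemmas \<alpha>_linear = algebra_hom_linear[OF hom]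

lemma r_closed [simp, intro]: "x \<in> carrier X \<Longrightarrow> a \<in> carrier A \<Longrightarrow> \<rho> x a \<in> carrier XAm"
  unfolding act_r_def by (rule XA.T.embeddedD[OF emb_r])

lemma l_closed [simp, intro]: "a \<in> carrier A \<Longrightarrow> x \<in> carrier X \<Longrightarrow> \<Lambda> a x \<in> carrier XAm"
  unfolding act_l_def by (rule XA.T.embeddedD[OF emb_l])

lemma g_closed [simp, intro]: "x \<in> carrier X \<Longrightarrow> y \<in> carrier X \<Longrightarrow> \<gamma> x y \<in> carrier XAm"
  unfolding gal_def by (rule XA.T.embeddedD[OF emb_g])

lemma as_r: "x \<in> carrier X \<Longrightarrow> a \<in> carrier A \<Longrightarrow> as (\<rho> x a) = \<alpha> x \<otimes>\<^bsub>M\<^esub> i2 a"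
  unfolding act_r_def by (rule XA.T.embeddedD[OF emb_r])

lemma as_l: "a \<in> carrier A \<Longrightarrow> x \<in> carrier X \<Longrightarrow> as (\<Lambda> a x) = i2 a \<otimes>\<^bsub>M\<^esub> \<alpha> x"
  unfolding act_l_def by (rule XA.T.embeddedD[OF emb_l])

lemma as_g: "x \<in> carrier X \<Longrightarrow> y \<in> carrier X \<Longrightarrow> as (\<gamma> x y) = i1 x \<otimes>\<^bsub>M\<^esub> \<alpha> y"
  unfolding gal_def by (rule XA.T.embeddedD[OF emb_g])

lemma as_inject: "u \<in> carrier XAm \<Longrightarrow> v \<in> carrier XAm \<Longrightarrow> as u = as v \<Longrightarrow> u = v"
  using XA.T.as_multiplier_inj by (auto dest: inj_onD)

lemma i1_i2: "x \<in> carrier X \<Longrightarrow> a \<in> carrier A \<Longrightarrow> i1 x \<otimes>\<^bsub>M\<^esub> i2 a = as (txa x a)"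
  by (rule XA.mult_eq_on_pure) (simp_all add: X.amult_closed A.amult_closed)

lemma i2_i1: "x \<in> carrier X \<Longrightarrow> a \<in> carrier A \<Longrightarrow> i2 a \<otimes>\<^bsub>M\<^esub> i1 x = as (txa x a)"
  by (rule XA.mult_eq_on_pure) (simp_all add: X.amult_closed A.amult_closed)

lemma i1_mult: "x \<in> carrier X \<Longrightarrow> y \<in> carrier X \<Longrightarrow> i1 (x \<otimes>\<^bsub>X\<^esub> y) = i1 x \<otimes>\<^bsub>M\<^esub> i1 y"
  by (rule XA.mult_eq_on_pure) (simp_all add: X.amult_closed A.amult_closed X.amult_assoc)

lemma i2_mult: "a \<in> carrier A \<Longrightarrow> b \<in> carrier A \<Longrightarrow> i2 (a \<otimes>\<^bsub>A\<^esub> b) = i2 a \<otimes>\<^bsub>M\<^esub> i2 b"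
  by (rule XA.mult_eq_on_pure) (simp_all add: X.amult_closed A.amult_closed A.amult_assoc)

lemmas as_ideal = XA.T.as_multiplier_ideal[symmetric]
lemmas as_simps = as_ideal as_r as_l as_g i1_i2[symmetric] \<alpha>_mult i1_mult i2_mult

text \<open>
  The following identities move factors between the covered products. All of them hold by
  associativity in the multiplier algebra, into which \<open>X \<otimes> A\<close> embeds.
\<close>

lemma r_mult: "x \<in> carrier X \<Longrightarrow> y \<in> carrier X \<Longrightarrow> a \<in> carrier A \<Longrightarrow> \<rho> (x \<otimes>\<^bsub>X\<^esub> y) a = fst (\<alpha> x) (\<rho> y a)"
  by (rule as_inject) (simp_all add: as_simps X.amult_closed XA.T.mult_assoc)

lemma r_r: "x \<in> carrier X \<Longrightarrow> b \<in> carrier A \<Longrightarrow> a \<in> carrier A \<Longrightarrow> \<rho> x (a \<otimes>\<^bsub>A\<^esub> b) = snd (i2 b) (\<rho> x a)"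
  by (rule as_inject) (simp_all add: as_simps A.amult_closed XA.T.mult_assoc)

lemma i1_r: "x \<in> carrier X \<Longrightarrow> z \<in> carrier X \<Longrightarrow> a \<in> carrier A \<Longrightarrow> fst (i1 z) (\<rho> x a) = snd (i2 a) (\<gamma> z x)"
  by (rule as_inject) (simp_all add: as_simps XA.T.mult_assoc)

lemma i2_r: "x \<in> carrier X \<Longrightarrow> c \<in> carrier A \<Longrightarrow> a \<in> carrier A \<Longrightarrow> fst (i2 c) (\<rho> x a) = snd (i2 a) (\<Lambda> c x)"
  by (rule as_inject) (simp_all add: as_simps XA.T.mult_assoc)

lemma i1_l: "x \<in> carrier X \<Longrightarrow> z \<in> carrier X \<Longrightarrow> a \<in> carrier A \<Longrightarrow> fst (i1 z) (\<Lambda> a x) = fst (i2 a) (\<gamma> z x)"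
proof (rule as_inject)
  assume p: "x \<in> carrier X" "z \<in> carrier X" "a \<in> carrier A"
  have "i1 z \<otimes>\<^bsub>M\<^esub> (i2 a \<otimes>\<^bsub>M\<^esub> \<alpha> x) = i2 a \<otimes>\<^bsub>M\<^esub> (i1 z \<otimes>\<^bsub>M\<^esub> \<alpha> x)"
    using p by (simp add: XA.T.mult_assoc[symmetric] i1_i2 i2_i1)
  then show "as (fst (i1 z) (\<Lambda> a x)) = as (fst (i2 a) (\<gamma> z x))" using p by (simp add: as_ideal as_l as_g)
qed simp_all

lemma \<alpha>_tens: "x \<in> carrier X \<Longrightarrow> y \<in> carrier X \<Longrightarrow> a \<in> carrier A \<Longrightarrow> fst (\<alpha> x) (txa y a) = snd (i1 y) (\<rho> x a)"
  by (rule as_inject) (simp_all add: as_ideal as_r i2_i1[symmetric] XA.T.mult_assoc)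

lemma tens_\<alpha>: "x \<in> carrier X \<Longrightarrow> y \<in> carrier X \<Longrightarrow> a \<in> carrier A \<Longrightarrow> snd (\<alpha> x) (txa y a) = fst (i1 y) (\<Lambda> a x)"
  by (rule as_inject) (simp_all add: as_simps XA.T.mult_assoc)

lemma tens_\<alpha>': "x \<in> carrier X \<Longrightarrow> y \<in> carrier X \<Longrightarrow> a \<in> carrier A \<Longrightarrow> snd (\<alpha> x) (txa y a) = fst (i2 a) (\<gamma> y x)"
  by (simp add: tens_\<alpha> i1_l)

lemma g_mult: "x \<in> carrier X \<Longrightarrow> y \<in> carrier X \<Longrightarrow> z \<in> carrier X \<Longrightarrow> \<gamma> z (x \<otimes>\<^bsub>X\<^esub> y) = snd (\<alpha> y) (\<gamma> z x)"
  by (rule as_inject) (simp_all add: as_simps X.amult_closed XA.T.mult_assoc)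

lemma g_l: "x \<in> carrier X \<Longrightarrow> y \<in> carrier X \<Longrightarrow> z \<in> carrier X \<Longrightarrow> \<gamma> (z \<otimes>\<^bsub>X\<^esub> y) x = fst (i1 z) (\<gamma> y x)"
  by (rule as_inject) (simp_all add: as_simps X.amult_closed XA.T.mult_assoc)

lemma l_l: "x \<in> carrier X \<Longrightarrow> a \<in> carrier A \<Longrightarrow> c \<in> carrier A \<Longrightarrow> \<Lambda> (c \<otimes>\<^bsub>A\<^esub> a) x = fst (i2 c) (\<Lambda> a x)"
  by (rule as_inject) (simp_all add: as_simps A.amult_closed XA.T.mult_assoc)

lemma r_times: "x \<in> carrier X \<Longrightarrow> a \<in> carrier A \<Longrightarrow> w \<in> carrier XAm \<Longrightarrow> \<rho> x a \<otimes>\<^bsub>XAm\<^esub> w = fst (\<alpha> x) (fst (i2 a) w)"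
  using arg_cong[OF as_r, of x a "\<lambda>m. fst m w"] by simp

lemma g_times: "x \<in> carrier X \<Longrightarrow> y \<in> carrier X \<Longrightarrow> w \<in> carrier XAm \<Longrightarrow> \<gamma> x y \<otimes>\<^bsub>XAm\<^esub> w = fst (i1 x) (fst (\<alpha> y) w)"
  using arg_cong[OF as_g, of x y "\<lambda>m. fst m w"] by simp

lemma r_bilinear: "\<rho> \<in> bilinear_map K X A XAm"
proof (rule bilinear_mapI)
  fix x assume x: "x \<in> carrier X"
  note L = lin_comp[OF XA.in_snd_linear bilin_r[OF XA.T.mult_bilinear \<alpha>_closed[OF x]]]
  show "(\<lambda>a. \<rho> x a) \<in> linear_map K A XAm"
    by (rule linear_mapI; (rule as_inject)?)
      (use x in \<open>simp_all add: lin_add[OF XA.T.as_multiplier_linear] lin_smult[OF XA.T.as_multiplier_linear] as_r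
        lin_add[OF L] lin_smult[OF L]\<close>)
next
  fix a assume a: "a \<in> carrier A"
  note L = lin_comp[OF \<alpha>_linear bilin_l[OF XA.T.mult_bilinear XA.in_snd_closed[OF a]]]
  show "(\<lambda>x. \<rho> x a) \<in> linear_map K X XAm"
    by (rule linear_mapI; (rule as_inject)?)
      (use a in \<open>simp_all add: lin_add[OF XA.T.as_multiplier_linear] lin_smult[OF XA.T.as_multiplier_linear] as_r
        lin_add[OF L] lin_smult[OF L]\<close>)
qed

lemma l_bilinear: "\<Lambda> \<in> bilinear_map K A X XAm"
proof (rule bilinear_mapI)
  fix x assume x: "x \<in> carrier X"
  note L = lin_comp[OF XA.in_snd_linear bilin_l[OF XA.T.mult_bilinear \<alpha>_closed[OF x]]]
  show "(\<lambda>a. \<Lambda> a x) \<in> linear_map K A XAm"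
    by (rule linear_mapI; (rule as_inject)?)
      (use x in \<open>simp_all add: lin_add[OF XA.T.as_multiplier_linear] lin_smult[OF XA.T.as_multiplier_linear] as_l
        lin_add[OF L] lin_smult[OF L]\<close>)
next
  fix a assume a: "a \<in> carrier A"
  note L = lin_comp[OF \<alpha>_linear bilin_r[OF XA.T.mult_bilinear XA.in_snd_closed[OF a]]]
  show "(\<lambda>x. \<Lambda> a x) \<in> linear_map K X XAm"
    by (rule linear_mapI; (rule as_inject)?)
      (use a in \<open>simp_all add: lin_add[OF XA.T.as_multiplier_linear] lin_smult[OF XA.T.as_multiplier_linear] as_l
        lin_add[OF L] lin_smult[OF L]\<close>)
qed

lemma g_bilinear: "\<gamma> \<in> bilinear_map K X X XAm"
proof (rule bilinear_mapI)
  fix x assume x: "x \<in> carrier X"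
  note L = lin_comp[OF \<alpha>_linear bilin_r[OF XA.T.mult_bilinear XA.in_fst_closed[OF x]]]
  show "(\<lambda>y. \<gamma> x y) \<in> linear_map K X XAm"
    by (rule linear_mapI; (rule as_inject)?)
      (use x in \<open>simp_all add: lin_add[OF XA.T.as_multiplier_linear] lin_smult[OF XA.T.as_multiplier_linear] as_g
        lin_add[OF L] lin_smult[OF L]\<close>)
  note L = lin_comp[OF XA.in_fst_linear bilin_l[OF XA.T.mult_bilinear \<alpha>_closed[OF x]]]
  show "(\<lambda>y. \<gamma> y x) \<in> linear_map K X XAm"
    by (rule linear_mapI; (rule as_inject)?)
      (use x in \<open>simp_all add: lin_add[OF XA.T.as_multiplier_linear] lin_smult[OF XA.T.as_multiplier_linear] as_g
        lin_add[OF L] lin_smult[OF L]\<close>)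
qed

end

section \<open>Coassociativity in covered form\<close>

context tensor_nondegenerate
begin

text \<open>
  The difference of the two tensors has vanishing slices, and the linear functionals separate \<open>V\<close>.
\<close>

lemma slice_fst_eqI:
  assumes u: "u \<in> carrier VW" "u' \<in> carrier VW"
    and e: "\<And>f. f \<in> linear_functional K V \<Longrightarrow> slice_fst K V W f u = slice_fst K V W f u'"
  shows "u = u'"
proof -
  have "u \<ominus>\<^bsub>VW\<^esub> u' = \<zero>\<^bsub>VW\<^esub>"
  proof (rule tensor_eqI_fst[of "linear_functional K V"])
    show "v = \<zero>\<^bsub>V\<^esub>" if "v \<in> carrier V" "\<forall>h\<in>linear_functional K V. h v = \<zero>" for v
      by (rule functional_zero[OF V_module that(1)]) (use that(2) in blast)
    show "slice_fst K V W h (u \<ominus>\<^bsub>VW\<^esub> u') = \<zero>\<^bsub>W\<^esub>" if h: "h \<in> linear_functional K V" for h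
      using e[OF h] u mod_diff_zero[OF W_module lin_closed[OF slice_fst_linear[OF h]] lin_closed[OF slice_fst_linear[OF h]]]
      by (simp add: lin_minus[OF tensor_module W_module slice_fst_linear[OF h]])
  qed (use u in simp_all)
  then show ?thesis using mod_diff_zero[OF tensor_module u] by simp
qed

lemma slice_snd_eqI:
  assumes u: "u \<in> carrier VW" "u' \<in> carrier VW"
    and e: "\<And>f. f \<in> linear_functional K W \<Longrightarrow> slice_snd K V W f u = slice_snd K V W f u'"
  shows "u = u'"
proof -
  have "u \<ominus>\<^bsub>VW\<^esub> u' = \<zero>\<^bsub>VW\<^esub>"
  proof (rule tensor_eqI_snd[of "linear_functional K W"])
    show "v = \<zero>\<^bsub>W\<^esub>" if "v \<in> carrier W" "\<forall>h\<in>linear_functional K W. h v = \<zero>" for v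
      by (rule functional_zero[OF W_module that(1)]) (use that(2) in blast)
    show "slice_snd K V W h (u \<ominus>\<^bsub>VW\<^esub> u') = \<zero>\<^bsub>V\<^esub>" if h: "h \<in> linear_functional K W" for h
      using e[OF h] u mod_diff_zero[OF V_module lin_closed[OF slice_snd_linear[OF h]] lin_closed[OF slice_snd_linear[OF h]]]
      by (simp add: lin_minus[OF tensor_module V_module slice_snd_linear[OF h]])
  qed (use u in simp_all)
  then show ?thesis using mod_diff_zero[OF tensor_module u] by simp
qed

end

context covered_hom
begin

abbreviation "H1 \<equiv> coaction_tens_id K X A \<alpha>"

lemma H1_bilinear: "(\<lambda>x a. multiplier_tens K XAm A (\<alpha> x) (as_multiplier A a)) \<in> bilinear_map K X A XAA.T.MX"
  by (rule XA.bilin_comp_args[OF XAA.multiplier_tens_bilinear \<alpha>_linear A.as_multiplier_linear])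

lemma H1_tens: "x \<in> carrier X \<Longrightarrow> a \<in> carrier A \<Longrightarrow> H1 (txa x a) = multiplier_tens K XAm A (\<alpha> x) (as_multiplier A a)"
  unfolding coaction_tens_id_def by (rule XA.lift_tens[OF XAA.T.mult_module H1_bilinear])

lemma as_A_mult: "a \<in> carrier A \<Longrightarrow> b \<in> carrier A \<Longrightarrow>
    as_multiplier A (a \<otimes>\<^bsub>A\<^esub> b) = as_multiplier A a \<otimes>\<^bsub>A.MX\<^esub> as_multiplier A b"
  by (rule A.mult_eqI) (simp_all add: A.amult_closed A.amult_assoc)

lemma H1_hom: "H1 \<in> algebra_hom K XAm XAA.T.MX"
  unfolding coaction_tens_id_def
  by (rule XA.lift_algebra_hom[OF XAA.tensor_nonunital_algebra H1_bilinear])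
    (simp add: \<alpha>_mult as_A_mult XAA.multiplier_tens_mult)

end

locale comult_triple = tensor_triple K X A + D: covered_hom K A A \<Delta>
  for K :: "('k, 'r) ring_scheme" (structure)
    and X :: "('k, 'x, 'm) module_scheme" (structure)
    and A :: "('k, 'a, 'n) module_scheme" (structure)
    and \<Delta> :: "'a \<Rightarrow> ('a \<times> 'a \<Rightarrow> 'k) set multiplier" +
  assumes span_l: "linear_span K AAm {fst (\<Delta> a) w | a w. a \<in> carrier A \<and> w \<in> carrier AAm} = carrier AAm"
    and span_r: "linear_span K AAm {snd (\<Delta> a) w | a w. a \<in> carrier A \<and> w \<in> carrier AAm} = carrier AAm"
begin

sublocale DN: nondegenerate_hom K A "tensor K A A" \<Delta>
  by unfold_locales (use D.hom span_l span_r in auto)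

abbreviation "H2 \<equiv> id_tens_comult K X A \<Delta>"

lemma as_X_mult: "x \<in> carrier X \<Longrightarrow> y \<in> carrier X \<Longrightarrow>
    as_multiplier X (x \<otimes>\<^bsub>X\<^esub> y) = as_multiplier X x \<otimes>\<^bsub>X.MX\<^esub> as_multiplier X y"
  by (rule X.mult_eqI) (simp_all add: X.amult_closed X.amult_assoc)

lemma H2_bilinear: "(\<lambda>x a. trp (multiplier_tens K X AAm (as_multiplier X x) (\<Delta> a))) \<in> bilinear_map K X A XAA.T.MX"
  by (rule XA.bilin_post[OF XA.bilin_comp_args[OF X_AA.multiplier_tens_bilinear X.as_multiplier_linear D.\<alpha>_linear] transp_linear])

lemma H2_tens: "x \<in> carrier X \<Longrightarrow> a \<in> carrier A \<Longrightarrow> H2 (txa x a) = trp (multiplier_tens K X AAm (as_multiplier X x) (\<Delta> a))"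
  unfolding id_tens_comult_def by (rule XA.lift_tens[OF XAA.T.mult_module H2_bilinear])

lemma trp_tens_mult:
  assumes "m \<in> carrier X.MX" "m' \<in> carrier X.MX" "n \<in> carrier AA.T.MX" "n' \<in> carrier AA.T.MX"
  shows "trp (multiplier_tens K X AAm (m \<otimes>\<^bsub>X.MX\<^esub> m') (n \<otimes>\<^bsub>AA.T.MX\<^esub> n')) =
    trp (multiplier_tens K X AAm m n) \<otimes>\<^bsub>XAA.T.MX\<^esub> trp (multiplier_tens K X AAm m' n')"
  using assms by (simp add: X_AA.multiplier_tens_mult[symmetric] transp_mult X_AA.multiplier_tens_closed)

lemma H2_hom: "H2 \<in> algebra_hom K XAm XAA.T.MX"
  unfolding id_tens_comult_def
  by (rule XA.lift_algebra_hom[OF XAA.tensor_nonunital_algebra H2_bilinear])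
    (simp add: D.\<alpha>_mult as_X_mult trp_tens_mult)

lemma trp_tens_apply:
  assumes "m \<in> carrier X.MX" "n \<in> carrier AA.T.MX" "y \<in> carrier X" "w \<in> carrier AAm"
  shows "fst (trp (multiplier_tens K X AAm m n)) (assoc (tx_aa y w)) = assoc (tx_aa (fst m y) (fst n w))"
    "snd (trp (multiplier_tens K X AAm m n)) (assoc (tx_aa y w)) = assoc (tx_aa (snd m y) (snd n w))"
  using assms by (simp_all add: X_AA.multiplier_tens_apply)

lemma XAA_assoc_induct:
  assumes T: "submodule T K XAAm" and p: "\<And>y w. y \<in> carrier X \<Longrightarrow> w \<in> carrier AAm \<Longrightarrow> assoc (tx_aa y w) \<in> T"
    and u: "u \<in> carrier XAAm"
  shows "u \<in> T"
proof -
  have "unassoc u \<in> {w \<in> carrier X_AAm. assoc w \<in> T}"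
    by (rule X_AA.tensor_induct[OF vimage_submod[OF X_AA.tensor_module XAA.tensor_module assoc_linear T]])
      (use p u in simp_all)
  then show ?thesis using u by simp
qed

text \<open>
  \<open>\<iota> \<otimes> \<Delta>\<close> inherits non-degeneracy from \<open>\<Delta>\<close> once \<open>X\<close> is spanned by products.
\<close>

lemma H2_nondegenerate:
  assumes idem: "\<And>T. submodule T K X \<Longrightarrow> (\<And>x y. x \<in> carrier X \<Longrightarrow> y \<in> carrier X \<Longrightarrow> x \<otimes>\<^bsub>X\<^esub> y \<in> T) \<Longrightarrow> carrier X \<subseteq> T"
  shows "nondegenerate_hom K XAm XAAm H2"
proof -
  note H2c = algebra_hom_closed[OF H2_hom]
  have L: "(\<lambda>y. assoc (tx_aa y w)) \<in> linear_map K X XAAm" if "w \<in> carrier AAm" for w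
    by (rule lin_comp[OF X_AA.tens_l[OF that] assoc_linear])
  have R: "(\<lambda>w. assoc (tx_aa y w)) \<in> linear_map K AAm XAAm" if "y \<in> carrier X" for y
    by (rule lin_comp[OF X_AA.tens_r[OF that] assoc_linear])
  have gen: "u \<in> T" if T: "submodule T K XAAm" and u: "u \<in> carrier XAAm"
    and sp: "linear_span K AAm {q (\<Delta> a) w | a w. a \<in> carrier A \<and> w \<in> carrier AAm} = carrier AAm"
    and q: "\<And>x y a w. x \<in> carrier X \<Longrightarrow> y \<in> carrier X \<Longrightarrow> a \<in> carrier A \<Longrightarrow> w \<in> carrier AAm \<Longrightarrow>
      assoc (tx_aa (x \<otimes>\<^bsub>X\<^esub> y) (q (\<Delta> a) w)) \<in> T"
    and qc: "\<And>a w. a \<in> carrier A \<Longrightarrow> w \<in> carrier AAm \<Longrightarrow> q (\<Delta> a) w \<in> carrier AAm" for u T q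
  proof (rule XAA_assoc_induct[OF T _ u])
    fix y w assume y: "y \<in> carrier X" and w: "w \<in> carrier AAm"
    have 1: "w \<in> {w \<in> carrier AAm. assoc (tx_aa (x \<otimes>\<^bsub>X\<^esub> z) w) \<in> T}" if "x \<in> carrier X" "z \<in> carrier X" for x z
    proof -
      note xz = X.amult_closed[OF that]
      have "{q (\<Delta> a) w | a w. a \<in> carrier A \<and> w \<in> carrier AAm} \<subseteq> {w \<in> carrier AAm. assoc (tx_aa (x \<otimes>\<^bsub>X\<^esub> z) w) \<in> T}"
        using q[OF that] qc by blast
      then show ?thesis
        by (rule span_carrier_subset[OF sp vimage_submod[OF AA.tensor_module XAA.tensor_module R[OF xz] T] _ w])
    qed
    have "carrier X \<subseteq> {y \<in> carrier X. assoc (tx_aa y w) \<in> T}"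
      by (rule idem[OF vimage_submod[OF X.X_module XAA.tensor_module L[OF w] T]])
        (use 1 in \<open>simp add: X.amult_closed\<close>)
    then show "assoc (tx_aa y w) \<in> T" using y by blast
  qed
  show ?thesis
  proof (intro nondegenerate_hom.intro nondegenerate_hom_axioms.intro XA.tensor_nonunital_algebra
      XAA.tensor_nondegenerate_algebra H2_hom)
    let ?S = "\<lambda>q. {q (H2 b) c | b c. b \<in> carrier XAm \<and> c \<in> carrier XAAm}"
    show "linear_span K XAAm (?S fst) = carrier XAAm"
    proof (rule antisym[OF submod_subset[OF XAA.tensor_module linear_span_submod[OF XAA.tensor_module]]])
      show s: "?S fst \<subseteq> carrier XAAm"
        by (rule subsetI, elim CollectE exE conjE) (simp add: H2c)
      show "carrier XAAm \<subseteq> linear_span K XAAm (?S fst)"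
      proof
        fix u assume u: "u \<in> carrier XAAm"
        show "u \<in> linear_span K XAAm (?S fst)"
        proof (rule gen[OF linear_span_submod[OF XAA.tensor_module s] u span_l])
          fix x y a w assume p: "x \<in> carrier X" "y \<in> carrier X" "a \<in> carrier A" "w \<in> carrier AAm"
          have e: "assoc (tx_aa (x \<otimes>\<^bsub>X\<^esub> y) (fst (\<Delta> a) w)) = fst (H2 (txa x a)) (assoc (tx_aa y w))"
            using p by (simp add: H2_tens trp_tens_apply del: transp_apply)
          show "assoc (tx_aa (x \<otimes>\<^bsub>X\<^esub> y) (fst (\<Delta> a) w)) \<in> linear_span K XAAm (?S fst)"
            unfolding e by (rule subsetD[OF linear_span_superset], rule CollectI, intro exI conjI, rule refl) (use p in simp_all)
        qed simp
      qed
    qed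
    show "linear_span K XAAm (?S snd) = carrier XAAm"
    proof (rule antisym[OF submod_subset[OF XAA.tensor_module linear_span_submod[OF XAA.tensor_module]]])
      show s: "?S snd \<subseteq> carrier XAAm"
        by (rule subsetI, elim CollectE exE conjE) (simp add: H2c)
      show "carrier XAAm \<subseteq> linear_span K XAAm (?S snd)"
      proof
        fix u assume u: "u \<in> carrier XAAm"
        show "u \<in> linear_span K XAAm (?S snd)"
        proof (rule gen[OF linear_span_submod[OF XAA.tensor_module s] u span_r])
          fix x y a w assume p: "x \<in> carrier X" "y \<in> carrier X" "a \<in> carrier A" "w \<in> carrier AAm"
          have e: "assoc (tx_aa (x \<otimes>\<^bsub>X\<^esub> y) (snd (\<Delta> a) w)) = snd (H2 (txa y a)) (assoc (tx_aa x w))"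
            using p by (simp add: H2_tens trp_tens_apply del: transp_apply)
          show "assoc (tx_aa (x \<otimes>\<^bsub>X\<^esub> y) (snd (\<Delta> a) w)) \<in> linear_span K XAAm (?S snd)"
            unfolding e by (rule subsetD[OF linear_span_superset], rule CollectI, intro exI conjI, rule refl) (use p in simp_all)
        qed simp
      qed
    qed
  qed
qed

text \<open>
  The products \<open>w\<Delta>(c)\<close> span \<open>A \<otimes> A\<close>, so a left factor \<open>1 \<otimes> \<Delta>(c)\<close> running over all \<open>c\<close> can be cancelled.
\<close>

lemma comult_leg_cancel:
  assumes q: "q \<in> carrier XAAm" "q' \<in> carrier XAAm"
    and e: "\<And>c. c \<in> carrier A \<Longrightarrow> fst (trp (multiplier_tens K X AAm \<one>\<^bsub>X.MX\<^esub> (\<Delta> c))) q =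
      fst (trp (multiplier_tens K X AAm \<one>\<^bsub>X.MX\<^esub> (\<Delta> c))) q'"
  shows "q = q'"
proof -
  let ?m = "\<lambda>c. multiplier_tens K X AAm \<one>\<^bsub>X.MX\<^esub> (\<Delta> c)"
  have mc: "?m c \<in> carrier X_AA.T.MX" if "c \<in> carrier A" for c using that by (simp add: X_AA.multiplier_tens_closed)
  have "unassoc q = unassoc q'"
  proof (rule X_AA.slice_fst_eqI)
    fix f assume f: "f \<in> linear_functional K X"
    note sl = X_AA.slice_fst_linear[OF f]
    have sm: "slice_fst K X AAm f (fst (?m c) w) = fst (\<Delta> c) (slice_fst K X AAm f w)"
      if c: "c \<in> carrier A" and w: "w \<in> carrier X_AAm" for c w
      by (rule X_AA.tensor_lin_eq[OF AA.tensor_module lin_comp[OF X_AA.T.fst_linear[OF mc[OF c]] sl]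
          lin_comp[OF sl AA.T.fst_linear[OF D.\<alpha>_closed[OF c]]] _ w])
        (use c in \<open>simp add: X_AA.multiplier_tens_apply X_AA.slice_fst_tens[OF f] lin_smult[OF AA.T.fst_linear[OF D.\<alpha>_closed[OF c]]] fun_closed[OF f]\<close>)
    show "slice_fst K X AAm f (unassoc q) = slice_fst K X AAm f (unassoc q')"
    proof (rule DN.fst_cancel)
      fix c assume c: "c \<in> carrier A"
      have "fst (?m c) (unassoc q) = fst (?m c) (unassoc q')"
        using arg_cong[OF e[OF c], of unassoc] q mc[OF c] by simp
      then show "fst (\<Delta> c) (slice_fst K X AAm f (unassoc q)) = fst (\<Delta> c) (slice_fst K X AAm f (unassoc q'))"
        using sm[OF c, of "unassoc q"] sm[OF c, of "unassoc q'"] q by simp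
    qed (use q lin_closed[OF sl] in simp_all)
  qed (use q in simp_all)
  then show ?thesis using q by (metis assoc_unassoc)
qed

end

locale coaction_pair = covered_hom K X A \<alpha> + comult_triple K X A \<Delta>
  for K :: "('k, 'r) ring_scheme" (structure)
    and X :: "('k, 'x, 'm) module_scheme" (structure)
    and A :: "('k, 'a, 'n) module_scheme" (structure)
    and \<alpha> :: "'x \<Rightarrow> ('x \<times> 'a \<Rightarrow> 'k) set multiplier"
    and \<Delta> :: "'a \<Rightarrow> ('a \<times> 'a \<Rightarrow> 'k) set multiplier"
begin

lemma coassoc_l_bilinear: "z \<in> carrier X \<Longrightarrow> (\<lambda>x a. txaa (\<gamma> z x) a) \<in> bilinear_map K X A XAAm"
  by (rule bilinear_mapI) (rule XAA.tens_r, simp, rule XAA.tens_lin_l[OF bilin_r[OF g_bilinear]])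

lemma coassoc_r_bilinear: "a \<in> carrier A \<Longrightarrow> (\<lambda>y c. tx_aa y (D.\<rho> c a)) \<in> bilinear_map K X A X_AAm"
  by (rule bilinear_mapI) (rule X_AA.tens_lin_r[OF bilin_l[OF D.r_bilinear]], assumption+, rule X_AA.tens_l, simp)

text \<open>
  Coassociativity without multipliers, in Sweedler notation \<open>z x\<^sub>0 \<otimes> x\<^sub>1 \<otimes> x\<^sub>2 a\<close>: applied to
  \<open>\<alpha>(x)(1 \<otimes> a)\<close>, the map \<open>x' \<otimes> a' \<mapsto> (z \<otimes> 1)\<alpha>(x') \<otimes> a'\<close> gives the same as \<open>y \<otimes> c \<mapsto> y \<otimes> \<Delta>(c)(1 \<otimes> a)\<close>
  applied to \<open>(z \<otimes> 1)\<alpha>(x)\<close>. The multiplier \<open>n\<close> stands for \<open>(\<alpha> \<otimes> \<iota>)\<alpha>(x) = (\<iota> \<otimes> \<Delta>)\<alpha>(x)\<close>; the two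
  descriptions of \<open>n\<close> in the hypotheses are evaluated between \<open>z \<otimes> \<Delta>(c)\<close> on the left and a pure tensor
  on the right, and \<open>\<Delta>(c)\<close> is cancelled at the end.
\<close>

lemma covered_coassoc:
  assumes x: "x \<in> carrier X" and n: "n \<in> carrier XAA.T.MX"
    and n1: "\<And>a. a \<in> carrier A \<Longrightarrow> H1 (\<rho> x a) = n \<otimes>\<^bsub>XAA.T.MX\<^esub> in_snd K XAm A a"
    and n2: "\<And>w. w \<in> carrier XAm \<Longrightarrow> H2 w \<otimes>\<^bsub>XAA.T.MX\<^esub> n = H2 (snd (\<alpha> x) w)"
    and z: "z \<in> carrier X" and a: "a \<in> carrier A"
  shows "tensor_lift K X A XAAm (\<lambda>x a. txaa (\<gamma> z x) a) (\<rho> x a) =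
    assoc (tensor_lift K X A X_AAm (\<lambda>y c. tx_aa y (D.\<rho> c a)) (\<gamma> z x))"
proof -
  note Ll = XA.lift_linear[OF XAA.tensor_module coassoc_l_bilinear[OF z]] XA.lift_tens[OF XAA.tensor_module coassoc_l_bilinear[OF z]]
  note Lr = XA.lift_linear[OF X_AA.tensor_module coassoc_r_bilinear[OF a]] XA.lift_tens[OF X_AA.tensor_module coassoc_r_bilinear[OF a]]
  let ?Sf = "tensor_lift K X A XAAm (\<lambda>x a. txaa (\<gamma> z x) a)"
  let ?Rf = "\<lambda>w. assoc (tensor_lift K X A X_AAm (\<lambda>y c. tx_aa y (D.\<rho> c a)) w)"
  note Rfl = lin_comp[OF Lr(1) assoc_linear]
  let ?\<tau> = "\<lambda>c. trp (multiplier_tens K X AAm \<one>\<^bsub>X.MX\<^esub> (\<Delta> c))"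
  \<comment> \<open>The factors of \<open>z \<otimes> \<Delta>(c)\<close>, as multipliers of the triple tensor product.\<close>
  let ?\<zeta> = "trp (multiplier_tens K X AAm (as_multiplier X z) \<one>\<^bsub>AA.T.MX\<^esub>)"
  note H1c = algebra_hom_closed[OF H1_hom] and H2c = algebra_hom_closed[OF H2_hom]
  have \<tau>c: "?\<tau> c \<in> carrier XAA.T.MX" if "c \<in> carrier A" for c
    using that by (simp add: transp_closed X_AA.multiplier_tens_closed)
  have \<zeta>c: "?\<zeta> \<in> carrier XAA.T.MX" using z by (simp add: transp_closed X_AA.multiplier_tens_closed)
  have one: "m \<otimes>\<^bsub>AA.T.MX\<^esub> \<one>\<^bsub>AA.T.MX\<^esub> = m" if "m \<in> carrier AA.T.MX" for m
    by (rule AA.T.mult_eqI) (use that in simp_all)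
  have one': "\<one>\<^bsub>X.MX\<^esub> \<otimes>\<^bsub>X.MX\<^esub> m = m" if "m \<in> carrier X.MX" for m
    by (rule X.mult_eqI) (use that in simp_all)
  have H2z: "H2 (txa z c) = ?\<tau> c \<otimes>\<^bsub>XAA.T.MX\<^esub> ?\<zeta>" if c: "c \<in> carrier A" for c
    using c z by (simp add: H2_tens trp_tens_mult[symmetric] one one' del: transp_apply)
  have H2i: "H2 (fst (i2 c) w) = ?\<tau> c \<otimes>\<^bsub>XAA.T.MX\<^esub> H2 w" if c: "c \<in> carrier A" and w: "w \<in> carrier XAm" for c w
  proof (rule XA.tensor_lin_eq[OF XAA.T.mult_module lin_comp[OF XA.T.fst_linear[OF XA.in_snd_closed[OF c]] algebra_hom_linear[OF H2_hom]]
        lin_comp[OF algebra_hom_linear[OF H2_hom] bilin_r[OF XAA.T.mult_bilinear \<tau>c[OF c]]] _ w])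
    fix y b assume "y \<in> carrier X" "b \<in> carrier A"
    then show "H2 (fst (i2 c) (txa y b)) = ?\<tau> c \<otimes>\<^bsub>XAA.T.MX\<^esub> H2 (txa y b)"
      using c by (simp add: H2_tens A.amult_closed D.\<alpha>_mult trp_tens_mult[symmetric] one' del: transp_apply)
  qed
  show ?thesis
  proof (rule XAA_bilin_pure_eq)
    show "?Sf (\<rho> x a) \<in> carrier XAAm" "?Rf (\<gamma> z x) \<in> carrier XAAm"
      using x a z by (auto intro: lin_closed[OF Ll(1)] lin_closed[OF Rfl])
    fix y e d assume yed: "y \<in> carrier X" "e \<in> carrier A" "d \<in> carrier A"
    let ?p = "txa y e"
    let ?P = "txaa ?p d"
    have Pc: "?P \<in> carrier XAAm" using yed by simp
    have \<zeta>t: "fst ?\<zeta> (txaa w b) = txaa (fst (i1 z) w) b" if w: "w \<in> carrier XAm" and b: "b \<in> carrier A" for w b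
    proof (rule XA.tensor_lin_eq[OF XAA.tensor_module lin_comp[OF XAA.tens_l[OF b] XAA.T.fst_linear[OF \<zeta>c]]
          lin_comp[OF XA.T.fst_linear[OF XA.in_fst_closed[OF z]] XAA.tens_l[OF b]] _ w])
      fix v c assume "v \<in> carrier X" "c \<in> carrier A"
      then show "fst ?\<zeta> (txaa (txa v c) b) = txaa (fst (i1 z) (txa v c)) b"
        using z b trp_tens_apply(1)[of "as_multiplier X z" "\<one>\<^bsub>AA.T.MX\<^esub>" v "taa c b"] by (simp add: X.amult_closed del: transp_apply)
    qed
    have S: "fst ?\<zeta> (fst (H1 w) ?P) = ?Sf w \<otimes>\<^bsub>XAAm\<^esub> ?P" if w: "w \<in> carrier XAm" for w
    proof (rule XA.tensor_lin_eq[OF XAA.tensor_module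
          lin_comp[OF lin_comp[OF algebra_hom_linear[OF H1_hom] XAA.T.fst_apply_linear[OF Pc]] XAA.T.fst_linear[OF \<zeta>c]]
          lin_comp[OF Ll(1) XAA.T.mult_lin_l[OF Pc]] _ w])
      fix x1 a1 assume p: "x1 \<in> carrier X" "a1 \<in> carrier A"
      show "fst ?\<zeta> (fst (H1 (txa x1 a1)) ?P) = ?Sf (txa x1 a1) \<otimes>\<^bsub>XAAm\<^esub> ?P"
        using p yed z by (simp add: H1_tens XAA.multiplier_tens_apply \<zeta>t Ll(2) g_times A.amult_closed del: transp_apply)
    qed
    have R: "fst (H2 w) (fst (in_snd K XAm A a) ?P) = ?Rf w \<otimes>\<^bsub>XAAm\<^esub> ?P" if w: "w \<in> carrier XAm" for w
    proof -
      have aP: "fst (in_snd K XAm A a) ?P = assoc (tx_aa y (taa e (a \<otimes>\<^bsub>A\<^esub> d)))"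
        using yed a by (simp add: A.amult_closed)
      have aPc: "assoc (tx_aa y (taa e (a \<otimes>\<^bsub>A\<^esub> d))) \<in> carrier XAAm" using yed a by (simp add: A.amult_closed)
      have PP: "?P = assoc (tx_aa y (taa e d))" using yed by simp
      show ?thesis unfolding aP
      proof (rule XA.tensor_lin_eq[OF XAA.tensor_module lin_comp[OF algebra_hom_linear[OF H2_hom] XAA.T.fst_apply_linear[OF aPc]]
            lin_comp[OF Rfl XAA.T.mult_lin_l[OF Pc]] _ w])
        fix z1 c1 assume p: "z1 \<in> carrier X" "c1 \<in> carrier A"
        have "fst (H2 (txa z1 c1)) (assoc (tx_aa y (taa e (a \<otimes>\<^bsub>A\<^esub> d)))) = assoc (tx_aa (z1 \<otimes>\<^bsub>X\<^esub> y) (fst (\<Delta> c1) (taa e (a \<otimes>\<^bsub>A\<^esub> d))))"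
          using p yed a by (simp add: H2_tens trp_tens_apply A.amult_closed del: transp_apply assoc_tens)
        also have "fst (\<Delta> c1) (taa e (a \<otimes>\<^bsub>A\<^esub> d)) = D.\<rho> c1 a \<otimes>\<^bsub>AAm\<^esub> taa e d"
          using p yed a by (simp add: D.r_times)
        also have "assoc (tx_aa (z1 \<otimes>\<^bsub>X\<^esub> y) (D.\<rho> c1 a \<otimes>\<^bsub>AAm\<^esub> taa e d)) = assoc (tx_aa z1 (D.\<rho> c1 a)) \<otimes>\<^bsub>XAAm\<^esub> assoc (tx_aa y (taa e d))"
          using p yed a by (simp add: assoc_mult[symmetric] del: assoc_tens)
        finally show "fst (H2 (txa z1 c1)) (assoc (tx_aa y (taa e (a \<otimes>\<^bsub>A\<^esub> d)))) = ?Rf (txa z1 c1) \<otimes>\<^bsub>XAAm\<^esub> ?P"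
          using p PP by (simp add: Lr(2) del: assoc_tens)
      qed
    qed
    have aPc: "fst (in_snd K XAm A a) ?P \<in> carrier XAAm" by (rule XAA.T.fst_closed[OF XAA.in_snd_closed[OF a] Pc])
    show "?Sf (\<rho> x a) \<otimes>\<^bsub>XAAm\<^esub> ?P = ?Rf (\<gamma> z x) \<otimes>\<^bsub>XAAm\<^esub> ?P"
    proof (rule comult_leg_cancel)
      show "?Sf (\<rho> x a) \<otimes>\<^bsub>XAAm\<^esub> ?P \<in> carrier XAAm" "?Rf (\<gamma> z x) \<otimes>\<^bsub>XAAm\<^esub> ?P \<in> carrier XAAm"
        using x a z by (auto intro!: XAA.T.amult_closed Pc lin_closed[OF Ll(1)] lin_closed[OF Rfl])
      fix c assume c: "c \<in> carrier A"
      have e: "snd (\<alpha> x) (txa z c) = fst (i2 c) (\<gamma> z x)" by (rule tens_\<alpha>'[OF x z c])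
      have "fst (?\<tau> c) (?Sf (\<rho> x a) \<otimes>\<^bsub>XAAm\<^esub> ?P) = fst (?\<tau> c) (fst ?\<zeta> (fst (n \<otimes>\<^bsub>XAA.T.MX\<^esub> in_snd K XAm A a) ?P))"
        using S[of "\<rho> x a"] n1[OF a] x a by simp
      also have "\<dots> = fst (?\<tau> c \<otimes>\<^bsub>XAA.T.MX\<^esub> ?\<zeta>) (fst n (fst (in_snd K XAm A a) ?P))"
        unfolding XAA.T.mult_apply(1)[OF Pc]
        by (rule XAA.T.mult_apply(1)[symmetric, OF XAA.T.fst_closed[OF n aPc]])
      also have "\<dots> = fst (H2 (txa z c) \<otimes>\<^bsub>XAA.T.MX\<^esub> n) (fst (in_snd K XAm A a) ?P)"
        unfolding H2z[OF c, symmetric] by (rule XAA.T.mult_apply(1)[symmetric, OF aPc])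
      also have "\<dots> = fst (?\<tau> c \<otimes>\<^bsub>XAA.T.MX\<^esub> H2 (\<gamma> z x)) (fst (in_snd K XAm A a) ?P)"
        using n2[of "txa z c"] H2i[OF c, of "\<gamma> z x"] x z c e by simp
      also have "\<dots> = fst (?\<tau> c) (?Rf (\<gamma> z x) \<otimes>\<^bsub>XAAm\<^esub> ?P)"
        unfolding XAA.T.mult_apply(1)[OF aPc] using R[of "\<gamma> z x"] x z by simp
      finally show "fst (?\<tau> c) (?Sf (\<rho> x a) \<otimes>\<^bsub>XAAm\<^esub> ?P) = fst (?\<tau> c) (?Rf (\<gamma> z x) \<otimes>\<^bsub>XAAm\<^esub> ?P)" .
    qed
  qed
qed

end

context tensor_space
begin

text \<open>
  A bijective canonical map is given with values in the embedded copy of \<open>C\<close> inside its multipliers;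
  pulling it back to \<open>C\<close> preserves bilinearity and bijectivity.
\<close>

lemma embedded_bij:
  assumes C: "nondegenerate_algebra K C" and B: "B \<in> bilinear_map K V W (multiplier_algebra K C)"
    and bij: "bij_betw (tensor_lift K V W (multiplier_algebra K C) B) (carrier VW) (embedded C)"
  shows "v \<in> carrier V \<Longrightarrow> w \<in> carrier W \<Longrightarrow> B v w \<in> embedded C"
    and "(\<lambda>v w. element_of C (B v w)) \<in> bilinear_map K V W C"
    and "bij_betw (tensor_lift K V W C (\<lambda>v w. element_of C (B v w))) (carrier VW) (carrier C)"
proof -
  interpret C: nondegenerate_algebra K C by (rule C)
  note L = lift_linear[OF C.mult_module B] and Lt = lift_tens[OF C.mult_module B]
  show emb: "B v w \<in> embedded C" if "v \<in> carrier V" "w \<in> carrier W" for v w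
    using bij_betwE[OF bij] tens_closed[OF that] Lt[OF that] by metis
  let ?b = "\<lambda>v w. element_of C (B v w)"
  have ec: "?b v w \<in> carrier C" "as_multiplier C (?b v w) = B v w" if "v \<in> carrier V" "w \<in> carrier W" for v w
    using C.embeddedD[OF emb[OF that]] by auto
  have inj: "x = y" if "x \<in> carrier C" "y \<in> carrier C" "as_multiplier C x = as_multiplier C y" for x y
    using C.as_multiplier_inj that by (auto dest: inj_onD)
  note al = lin_add[OF C.as_multiplier_linear] lin_smult[OF C.as_multiplier_linear]
  show bb: "?b \<in> bilinear_map K V W C"
  proof (rule bilinear_mapI)
    fix v assume v: "v \<in> carrier V"
    show "(\<lambda>w. ?b v w) \<in> linear_map K W C"
      by (rule linear_mapI; (rule inj)?)
        (use v in \<open>simp_all add: ec al, simp_all add: lin_add[OF bilin_r[OF B v]] lin_smult[OF bilin_r[OF B v]]\<close>)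
  next
    fix w assume w: "w \<in> carrier W"
    show "(\<lambda>v. ?b v w) \<in> linear_map K V C"
      by (rule linear_mapI; (rule inj)?)
        (use w in \<open>simp_all add: ec al, simp_all add: lin_add[OF bilin_l[OF B w]] lin_smult[OF bilin_l[OF B w]]\<close>)
  qed
  note l = lift_linear[OF C.X_module bb] and lt = lift_tens[OF C.X_module bb]
  have asl: "as_multiplier C (tensor_lift K V W C ?b u) = tensor_lift K V W C.MX B u" if "u \<in> carrier VW" for u
    by (rule tensor_lin_eq[OF C.mult_module lin_comp[OF l C.as_multiplier_linear] L _ that]) (simp add: Lt lt ec)
  show "bij_betw (tensor_lift K V W C ?b) (carrier VW) (carrier C)"
  proof (rule bij_betw_imageI)
    show "inj_on (tensor_lift K V W C ?b) (carrier VW)"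
    proof (rule inj_onI)
      fix u u' assume u: "u \<in> carrier VW" "u' \<in> carrier VW" and e: "tensor_lift K V W C ?b u = tensor_lift K V W C ?b u'"
      have "tensor_lift K V W C.MX B u = tensor_lift K V W C.MX B u'"
        using asl[OF u(1)] asl[OF u(2)] e by simp
      then show "u = u'" using bij_betw_imp_inj_on[OF bij] u by (auto dest: inj_onD)
    qed
    show "tensor_lift K V W C ?b ` carrier VW = carrier C"
    proof (intro equalityI subsetI)
      fix c assume c: "c \<in> carrier C"
      then have "as_multiplier C c \<in> tensor_lift K V W C.MX B ` carrier VW"
        using bij_betw_imp_surj_on[OF bij] C.embeddedI by simp
      then obtain u where u: "u \<in> carrier VW" "as_multiplier C c = tensor_lift K V W C.MX B u" by (rule imageE)
      then have "c = tensor_lift K V W C ?b u"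
        using inj[OF c lin_closed[OF l u(1)]] asl[OF u(1)] by simp
      then show "c \<in> tensor_lift K V W C ?b ` carrier VW" using u(1) by (rule image_eqI)
    qed (use lin_closed[OF l] in blast)
  qed
qed

end

context covered_hom
begin

text \<open>
  \<open>\<alpha> \<otimes> \<iota>\<close> inherits non-degeneracy from \<open>\<alpha>\<close> once \<open>A\<close> is spanned by products.
\<close>

lemma H1_nondegenerate:
  assumes sl: "linear_span K XAm {fst (\<alpha> a) w | a w. a \<in> carrier X \<and> w \<in> carrier XAm} = carrier XAm"
    and sr: "linear_span K XAm {snd (\<alpha> a) w | a w. a \<in> carrier X \<and> w \<in> carrier XAm} = carrier XAm"
    and idem: "\<And>T. submodule T K A \<Longrightarrow> (\<And>x y. x \<in> carrier A \<Longrightarrow> y \<in> carrier A \<Longrightarrow> x \<otimes>\<^bsub>A\<^esub> y \<in> T) \<Longrightarrow> carrier A \<subseteq> T"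
  shows "nondegenerate_hom K XAm XAAm H1"
proof -
  note H1c = algebra_hom_closed[OF H1_hom]
  have gen: "u \<in> T" if T: "submodule T K XAAm" and u: "u \<in> carrier XAAm"
    and sp: "linear_span K XAm {q (\<alpha> a) w | a w. a \<in> carrier X \<and> w \<in> carrier XAm} = carrier XAm"
    and q: "\<And>x w a b. x \<in> carrier X \<Longrightarrow> w \<in> carrier XAm \<Longrightarrow> a \<in> carrier A \<Longrightarrow> b \<in> carrier A \<Longrightarrow>
      txaa (q (\<alpha> x) w) (a \<otimes>\<^bsub>A\<^esub> b) \<in> T"
    and qc: "\<And>a w. a \<in> carrier X \<Longrightarrow> w \<in> carrier XAm \<Longrightarrow> q (\<alpha> a) w \<in> carrier XAm" for u T q
  proof (rule XAA.tensor_induct[OF T _ u])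
    fix w d assume w: "w \<in> carrier XAm" and d: "d \<in> carrier A"
    have 1: "w \<in> {w \<in> carrier XAm. txaa w (a \<otimes>\<^bsub>A\<^esub> b) \<in> T}" if "a \<in> carrier A" "b \<in> carrier A" for a b
    proof -
      note ab = A.amult_closed[OF that]
      have "{q (\<alpha> x) w | x w. x \<in> carrier X \<and> w \<in> carrier XAm} \<subseteq> {w \<in> carrier XAm. txaa w (a \<otimes>\<^bsub>A\<^esub> b) \<in> T}"
        using q[OF _ _ that] qc by blast
      then show ?thesis
        by (rule span_carrier_subset[OF sp vimage_submod[OF XA.tensor_module XAA.tensor_module XAA.tens_l[OF ab] T] _ w])
    qed
    have "carrier A \<subseteq> {d \<in> carrier A. txaa w d \<in> T}"
      by (rule idem[OF vimage_submod[OF A.X_module XAA.tensor_module XAA.tens_r[OF w] T]])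
        (use 1 in \<open>simp add: A.amult_closed\<close>)
    then show "txaa w d \<in> T" using d by blast
  qed
  show ?thesis
  proof (intro nondegenerate_hom.intro nondegenerate_hom_axioms.intro XA.tensor_nonunital_algebra
      XAA.tensor_nondegenerate_algebra H1_hom)
    let ?S = "\<lambda>q. {q (H1 b) c | b c. b \<in> carrier XAm \<and> c \<in> carrier XAAm}"
    show "linear_span K XAAm (?S fst) = carrier XAAm"
    proof (rule antisym[OF submod_subset[OF XAA.tensor_module linear_span_submod[OF XAA.tensor_module]]])
      show s: "?S fst \<subseteq> carrier XAAm"
        by (rule subsetI, elim CollectE exE conjE) (simp add: H1c)
      show "carrier XAAm \<subseteq> linear_span K XAAm (?S fst)"
      proof
        fix u assume u: "u \<in> carrier XAAm"
        show "u \<in> linear_span K XAAm (?S fst)"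
        proof (rule gen[OF linear_span_submod[OF XAA.tensor_module s] u sl])
          fix x w a b assume p: "x \<in> carrier X" "w \<in> carrier XAm" "a \<in> carrier A" "b \<in> carrier A"
          have e: "txaa (fst (\<alpha> x) w) (a \<otimes>\<^bsub>A\<^esub> b) = fst (H1 (txa x a)) (txaa w b)"
            using p by (simp add: H1_tens XAA.multiplier_tens_apply)
          show "txaa (fst (\<alpha> x) w) (a \<otimes>\<^bsub>A\<^esub> b) \<in> linear_span K XAAm (?S fst)"
            unfolding e by (rule subsetD[OF linear_span_superset], rule CollectI, intro exI conjI, rule refl) (use p in simp_all)
        qed simp
      qed
    qed
    show "linear_span K XAAm (?S snd) = carrier XAAm"
    proof (rule antisym[OF submod_subset[OF XAA.tensor_module linear_span_submod[OF XAA.tensor_module]]])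
      show s: "?S snd \<subseteq> carrier XAAm"
        by (rule subsetI, elim CollectE exE conjE) (simp add: H1c)
      show "carrier XAAm \<subseteq> linear_span K XAAm (?S snd)"
      proof
        fix u assume u: "u \<in> carrier XAAm"
        show "u \<in> linear_span K XAAm (?S snd)"
        proof (rule gen[OF linear_span_submod[OF XAA.tensor_module s] u sr])
          fix x w a b assume p: "x \<in> carrier X" "w \<in> carrier XAm" "a \<in> carrier A" "b \<in> carrier A"
          have e: "txaa (snd (\<alpha> x) w) (a \<otimes>\<^bsub>A\<^esub> b) = snd (H1 (txa x b)) (txaa w a)"
            using p by (simp add: H1_tens XAA.multiplier_tens_apply)
          show "txaa (snd (\<alpha> x) w) (a \<otimes>\<^bsub>A\<^esub> b) \<in> linear_span K XAAm (?S snd)"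
            unfolding e by (rule subsetD[OF linear_span_superset], rule CollectI, intro exI conjI, rule refl) (use p in simp_all)
        qed simp
      qed
    qed
  qed
qed

lemma slice_snd_i1:
  assumes h: "h \<in> linear_functional K A" and x: "x \<in> carrier X" and w: "w \<in> carrier XAm"
  shows "slice_snd K X A h (fst (i1 x) w) = x \<otimes>\<^bsub>X\<^esub> slice_snd K X A h w"
    "slice_snd K X A h (snd (i1 x) w) = slice_snd K X A h w \<otimes>\<^bsub>X\<^esub> x"
  by (rule XA.tensor_lin_eq[OF X.X_module lin_comp[OF XA.T.fst_linear[OF XA.in_fst_closed[OF x]] XA.slice_snd_linear[OF h]]
        lin_comp[OF XA.slice_snd_linear[OF h] X.mult_lin_r[OF x]] _ w],
      use x in \<open>simp add: XA.slice_snd_tens[OF h] X.amult_closed X.amult_smult_r fun_closed[OF h]\<close>)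
    (rule XA.tensor_lin_eq[OF X.X_module lin_comp[OF XA.T.snd_linear[OF XA.in_fst_closed[OF x]] XA.slice_snd_linear[OF h]]
        lin_comp[OF XA.slice_snd_linear[OF h] X.mult_lin_l[OF x]] _ w],
      use x in \<open>simp add: XA.slice_snd_tens[OF h] X.amult_closed X.amult_smult_l fun_closed[OF h]\<close>)

end

text \<open>
  What remains to be known of a coaction after \<open>covered_coassoc\<close>. The coproduct is an instance, with
  \<open>X = A\<close>, so the consequences below hold for both.
\<close>

locale coassociative_coaction = coaction_pair +
  assumes coassoc: "\<lbrakk>z \<in> carrier X; x \<in> carrier X; a \<in> carrier A\<rbrakk> \<Longrightarrow>
    tensor_lift K X A XAAm (\<lambda>x a. txaa (\<gamma> z x) a) (\<rho> x a) =
    assoc (tensor_lift K X A X_AAm (\<lambda>y c. tx_aa y (D.\<rho> c a)) (\<gamma> z x))"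

section \<open>The coproduct as a coaction\<close>

text \<open>
  The product \<open>\<alpha>(x)(y \<otimes> 1)\<close>, opposite to \<open>gal\<close>. For the coproduct it is in the algebra by definition,
  for a Galois object only as a consequence of the existence of the left invariant functional.
\<close>

definition gal' where
  "gal' K X A \<alpha> x y = element_of (tensor K X A) (\<alpha> x \<otimes>\<^bsub>multiplier_algebra K (tensor K X A)\<^esub> in_fst K X A y)"

context regular_multiplier_hopf_algebra
begin

lemma tensor_triple_A: "tensor_triple K A A"
  by unfold_locales

sublocale C: tensor_triple K A A
  by (rule tensor_triple_A)

abbreviation "MA2 \<equiv> multiplier_algebra K (tensor K A A)"

lemmas comult_linear = algebra_hom_linear[OF comult_hom]

lemma B1: "(\<lambda>a b. \<Delta> a \<otimes>\<^bsub>MA2\<^esub> in_snd K A A b) \<in> bilinear_map K A A MA2"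
  by (rule C.XA.bilin_comp_args[OF C.XA.T.mult_bilinear comult_linear C.XA.in_snd_linear])
lemma B2: "(\<lambda>a b. in_fst K A A a \<otimes>\<^bsub>MA2\<^esub> \<Delta> b) \<in> bilinear_map K A A MA2"
  by (rule C.XA.bilin_comp_args[OF C.XA.T.mult_bilinear C.XA.in_fst_linear comult_linear])
lemma B3: "(\<lambda>a b. \<Delta> a \<otimes>\<^bsub>MA2\<^esub> in_fst K A A b) \<in> bilinear_map K A A MA2"
  by (rule C.XA.bilin_comp_args[OF C.XA.T.mult_bilinear comult_linear C.XA.in_fst_linear])
lemma B4: "(\<lambda>a b. in_snd K A A a \<otimes>\<^bsub>MA2\<^esub> \<Delta> b) \<in> bilinear_map K A A MA2"
  by (rule C.XA.bilin_comp_args[OF C.XA.T.mult_bilinear C.XA.in_snd_linear comult_linear])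

lemmas E1 = C.XA.embedded_bij[OF C.XA.tensor_nondegenerate_algebra B1 bij_comult_in_snd]
lemmas E2 = C.XA.embedded_bij[OF C.XA.tensor_nondegenerate_algebra B2 bij_in_fst_comult]
lemmas E3 = C.XA.embedded_bij[OF C.XA.tensor_nondegenerate_algebra B3 bij_comult_in_fst]
lemmas E4 = C.XA.embedded_bij[OF C.XA.tensor_nondegenerate_algebra B4 bij_in_snd_comult]

lemma covered_hom_A: "covered_hom K A A \<Delta>"
  by (intro covered_hom.intro covered_hom_axioms.intro tensor_triple_A comult_hom E1(1) E4(1) E2(1))

sublocale C: covered_hom K A A \<Delta>
  by (rule covered_hom_A)

lemma T1_bij: "bij_betw (tensor_lift K A A (tensor K A A) (act_r K A A \<Delta>)) (carrier (tensor K A A)) (carrier (tensor K A A))"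
  using E1(3) unfolding act_r_def[abs_def] .
lemma T2_bij: "bij_betw (tensor_lift K A A (tensor K A A) (gal K A A \<Delta>)) (carrier (tensor K A A)) (carrier (tensor K A A))"
  using E2(3) unfolding gal_def[abs_def] .
lemma T3_bij: "bij_betw (tensor_lift K A A (tensor K A A) (gal' K A A \<Delta>)) (carrier (tensor K A A)) (carrier (tensor K A A))"
  using E3(3) unfolding gal'_def[abs_def] .
lemma T4_bij: "bij_betw (tensor_lift K A A (tensor K A A) (act_l K A A \<Delta>)) (carrier (tensor K A A)) (carrier (tensor K A A))"
  using E4(3) unfolding act_l_def[abs_def] .

lemma T3_bilinear: "gal' K A A \<Delta> \<in> bilinear_map K A A (tensor K A A)"
  using E3(2) unfolding gal'_def[abs_def] .

lemma T3_closed [simp, intro]: "a \<in> carrier A \<Longrightarrow> b \<in> carrier A \<Longrightarrow> gal' K A A \<Delta> a b \<in> carrier (tensor K A A)"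
  by (rule bilin_closed[OF T3_bilinear])

lemma as_T3: "a \<in> carrier A \<Longrightarrow> b \<in> carrier A \<Longrightarrow> as_multiplier (tensor K A A) (gal' K A A \<Delta> a b) = \<Delta> a \<otimes>\<^bsub>MA2\<^esub> in_fst K A A b"
  unfolding gal'_def by (rule C.XA.T.embeddedD[OF E3(1)])

text \<open>
  \<open>A = A A\<close>, since \<open>A \<otimes> A\<close> is spanned by products \<open>\<Delta>(c)(x \<otimes> y) = (\<Delta>(c)(1 \<otimes> y))(x \<otimes> 1)\<close>, whose slices
  along the second leg are products.
\<close>

lemma A_idem:
  assumes T: "submodule T K A" and p: "\<And>x y. x \<in> carrier A \<Longrightarrow> y \<in> carrier A \<Longrightarrow> x \<otimes>\<^bsub>A\<^esub> y \<in> T"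
  shows "carrier A \<subseteq> T"
proof
  fix a assume a: "a \<in> carrier A"
  obtain b where b: "b \<in> carrier A" "b \<noteq> \<zero>\<^bsub>A\<^esub>" using nonzero M.zero_closed by blast
  obtain h where h: "h \<in> linear_functional K A" "h b = \<one>" using separating_functional[OF field_axioms X_module b] by blast
  note sl = C.XA.slice_snd_linear[OF h(1)]
  let ?T = "{u \<in> carrier (tensor K A A). slice_snd K A A h u \<in> T}"
  have sub: "submodule ?T K (tensor K A A)" by (rule vimage_submod[OF C.XA.tensor_module X_module sl T])
  have "taa \<in> ?T" if "taa \<in> carrier (tensor K A A)" for taa
  proof (rule span_carrier_subset[OF comult_nondegenerate_l sub _ that], rule subsetI, elim CollectE exE conjE)
    fix u c w assume u: "u = fst (\<Delta> c) w" and c: "c \<in> carrier A" and w: "w \<in> carrier (tensor K A A)"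
    have "w \<in> {w \<in> carrier (tensor K A A). fst (\<Delta> c) w \<in> ?T}"
    proof (rule C.XA.tensor_induct[OF vimage_submod[OF C.XA.tensor_module C.XA.tensor_module C.XA.T.fst_linear[OF C.\<alpha>_closed[OF c]] sub] _ w])
      fix x y assume xy: "x \<in> carrier A" "y \<in> carrier A"
      have "slice_snd K A A h (fst (\<Delta> c) (tens K A A x y)) \<in> T"
        using xy c p lin_closed[OF sl] by (simp add: C.\<alpha>_tens C.slice_snd_i1[OF h(1)])
      then show "tens K A A x y \<in> {w \<in> carrier (tensor K A A). fst (\<Delta> c) w \<in> ?T}" using xy c by simp
    qed
    then show "u \<in> ?T" using u by simp
  qed
  then have "tens K A A a b \<in> ?T" using a b by simp
  then show "a \<in> T" using a b h by (simp add: C.XA.slice_snd_tens)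
qed

sublocale C: coaction_pair K A A \<Delta> \<Delta>
  by (intro coaction_pair.intro comult_triple.intro comult_triple_axioms.intro covered_hom_A tensor_triple_A
      comult_nondegenerate_l comult_nondegenerate_r)

sublocale C: coassociative_coaction K A A \<Delta> \<Delta>
proof (intro coassociative_coaction.intro coassociative_coaction_axioms.intro)
  show "coaction_pair K A A \<Delta> \<Delta>" by unfold_locales
  interpret h1: nondegenerate_hom K "tensor K A A" "tensor K (tensor K A A) A" "C.H1"
    by (rule C.H1_nondegenerate[OF comult_nondegenerate_l comult_nondegenerate_r A_idem])
  interpret h2: nondegenerate_hom K "tensor K A A" "tensor K (tensor K A A) A" "C.H2"
    by (rule C.H2_nondegenerate[OF A_idem])
  fix z x a assume z: "z \<in> carrier A" and x: "x \<in> carrier A" and a: "a \<in> carrier A"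
  let ?n = "multiplier_extension K (tensor K A A) (tensor K (tensor K A A) A) C.H1 (\<Delta> x)"
  note dx = C.\<alpha>_closed[OF x]
  have n: "?n = multiplier_extension K (tensor K A A) (tensor K (tensor K A A) A) C.H2 (\<Delta> x)"
    by (rule comult_coassoc[OF x])
  show "tensor_lift K A A C.XAAm (\<lambda>x a. C.txaa (C.\<gamma> z x) a) (C.\<rho> x a) =
    C.assoc (tensor_lift K A A C.X_AAm (\<lambda>y c. C.tx_aa y (C.\<rho> c a)) (C.\<gamma> z x))"
  proof (rule C.covered_coassoc[OF x h1.extension_closed[OF dx] _ _ z a])
    fix w assume w: "w \<in> carrier C.XAm"
    show "C.H2 w \<otimes>\<^bsub>C.XAA.T.MX\<^esub> ?n = C.H2 (snd (\<Delta> x) w)" unfolding n by (rule h2.extension_r[OF dx w])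
  next
    fix d assume d: "d \<in> carrier A"
    let ?i = "in_snd K C.XAm A d"
    show "C.H1 (C.\<rho> x d) = ?n \<otimes>\<^bsub>C.XAA.T.MX\<^esub> ?i"
    proof (rule h1.extension_unique)
      show "C.H1 (C.\<rho> x d) \<in> carrier C.XAA.T.MX" using x d by simp
      show "?n \<otimes>\<^bsub>C.XAA.T.MX\<^esub> ?i \<in> carrier C.XAA.T.MX"
        by (rule C.XAA.T.mult_closed[OF h1.extension_closed[OF dx] C.XAA.in_snd_closed[OF d]])
      fix w assume w: "w \<in> carrier C.XAm"
      have iw: "C.H1 (fst (C.i2 d) w) = ?i \<otimes>\<^bsub>C.XAA.T.MX\<^esub> C.H1 w"
      proof (rule C.XA.tensor_lin_eq[OF C.XAA.T.mult_module lin_comp[OF C.XA.T.fst_linear[OF C.XA.in_snd_closed[OF d]] algebra_hom_linear[OF C.H1_hom]]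
            lin_comp[OF algebra_hom_linear[OF C.H1_hom] bilin_r[OF C.XAA.T.mult_bilinear C.XAA.in_snd_closed[OF d]]] _ w])
        fix y e assume p: "y \<in> carrier A" "e \<in> carrier A"
        have one: "\<one>\<^bsub>C.XA.T.MX\<^esub> \<otimes>\<^bsub>C.XA.T.MX\<^esub> \<Delta> y = \<Delta> y"
          by (rule C.XA.T.mult_eqI) (use p in simp_all)
        show "C.H1 (fst (C.i2 d) (C.txa y e)) = ?i \<otimes>\<^bsub>C.XAA.T.MX\<^esub> C.H1 (C.txa y e)"
          unfolding in_snd_def[of K C.XAm]
          using p d by (simp add: C.H1_tens amult_closed C.as_A_mult C.XAA.multiplier_tens_mult one)
      qed
      have "C.H1 (C.\<rho> x d) \<otimes>\<^bsub>C.XAA.T.MX\<^esub> C.H1 w = C.H1 (fst (\<Delta> x) (fst (C.i2 d) w))"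
        using x d w by (simp add: h1.hm[symmetric] C.r_times)
      also have "\<dots> = ?n \<otimes>\<^bsub>C.XAA.T.MX\<^esub> C.H1 (fst (C.i2 d) w)"
        using x d w by (simp add: h1.extension_l[OF dx])
      also have "\<dots> = ?n \<otimes>\<^bsub>C.XAA.T.MX\<^esub> ?i \<otimes>\<^bsub>C.XAA.T.MX\<^esub> C.H1 w"
        unfolding iw using C.XAA.T.mult_assoc[OF h1.extension_closed[OF dx] C.XAA.in_snd_closed[OF d] h1.hc[OF w]] by simp
      finally show "C.H1 (C.\<rho> x d) \<otimes>\<^bsub>C.XAA.T.MX\<^esub> C.H1 w = ?n \<otimes>\<^bsub>C.XAA.T.MX\<^esub> ?i \<otimes>\<^bsub>C.XAA.T.MX\<^esub> C.H1 w" .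
    qed
  qed
qed

end

section \<open>Galois objects as coassociative coactions\<close>

context reduced_right_coaction
begin

lemma tensor_triple_X: "tensor_triple K X A"
  by unfold_locales

sublocale P: tensor_triple K X A
  by (rule tensor_triple_X)

lemma covered_hom_X: "covered_hom K X A \<alpha>"
  by (intro covered_hom.intro covered_hom_axioms.intro tensor_triple_X coaction_hom coaction_in_snd in_snd_coaction in_fst_coaction)

sublocale P: covered_hom K X A \<alpha>
  by (rule covered_hom_X)

sublocale P: coaction_pair K X A \<alpha> \<Delta>
  by (intro coaction_pair.intro comult_triple.intro comult_triple_axioms.intro covered_hom_X tensor_triple_X covered_hom_A
      comult_nondegenerate_l comult_nondegenerate_r)

end

context galois_object
begin

abbreviation "MXA \<equiv> multiplier_algebra K (tensor K X A)"

lemma gal_bij: "bij_betw (tensor_lift K X X (tensor K X A) (gal K X A \<alpha>)) (carrier (tensor K X X)) (carrier (tensor K X A))"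
proof -
  interpret XX: tensor_nondegenerate K X X by unfold_locales
  have B: "(\<lambda>x y. in_fst K X A x \<otimes>\<^bsub>MXA\<^esub> \<alpha> y) \<in> bilinear_map K X X MXA"
    by (rule P.XA.bilin_comp_args[OF P.XA.T.mult_bilinear P.XA.in_fst_linear P.\<alpha>_linear])
  show ?thesis
    using XX.embedded_bij(3)[OF P.XA.tensor_nondegenerate_algebra B galois_bij] unfolding gal_def[abs_def] .
qed

text \<open>
  Surjectivity of the Galois map in the form in which it is used: a linear statement about \<open>X \<otimes> A\<close>
  has to be checked on \<open>(x \<otimes> 1)\<alpha>(y)\<close> only.
\<close>

lemma gal_induct:
  assumes T: "submodule T K (tensor K X A)" and p: "\<And>x y. x \<in> carrier X \<Longrightarrow> y \<in> carrier X \<Longrightarrow> P.\<gamma> x y \<in> T"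
    and u: "u \<in> carrier (tensor K X A)"
  shows "u \<in> T"
proof -
  interpret XX: tensor_nondegenerate K X X by unfold_locales
  note l = XX.lift_linear[OF P.XA.tensor_module P.g_bilinear] and lt = XX.lift_tens[OF P.XA.tensor_module P.g_bilinear]
  from bij_betw_imp_surj_on[OF gal_bij] u
  obtain r where r: "r \<in> carrier (tensor K X X)" "u = tensor_lift K X X (tensor K X A) (gal K X A \<alpha>) r" by blast
  have "r \<in> {r \<in> carrier (tensor K X X). tensor_lift K X X (tensor K X A) (gal K X A \<alpha>) r \<in> T}"
    by (rule XX.tensor_induct[OF vimage_submod[OF XX.tensor_module P.XA.tensor_module l T] _ r(1)])
      (use p lt in simp)
  then show ?thesis using r by simp
qed

text \<open>
  \<open>X = X X\<close>: by the Galois condition \<open>u \<otimes> c\<close> is a sum of tensors \<open>(x \<otimes> 1)\<alpha>(y)\<close>; cover them by \<open>1 \<otimes> a\<close>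
  and slice.
\<close>

lemma X_idem:
  assumes T: "submodule T K X" and p: "\<And>x y. x \<in> carrier X \<Longrightarrow> y \<in> carrier X \<Longrightarrow> x \<otimes>\<^bsub>X\<^esub> y \<in> T"
  shows "carrier X \<subseteq> T"
proof
  fix u assume u: "u \<in> carrier X"
  obtain c where c: "c \<in> carrier A" "c \<noteq> \<zero>\<^bsub>A\<^esub>" using nonzero M.zero_closed by blast
  then obtain a where a: "a \<in> carrier A" "c \<otimes>\<^bsub>A\<^esub> a \<noteq> \<zero>\<^bsub>A\<^esub>" using nondegenerate_l[OF c(1)] by blast
  obtain h where h: "h \<in> linear_functional K A" "h (c \<otimes>\<^bsub>A\<^esub> a) = \<one>"
    using separating_functional[OF field_axioms X_module amult_closed[OF c(1) a(1)] a(2)] by blast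
  note sl = lin_comp[OF P.XA.T.snd_linear[OF P.XA.in_snd_closed[OF a(1)]] P.XA.slice_snd_linear[OF h(1)]]
  have "tens K X A u c \<in> {w \<in> carrier (tensor K X A). slice_snd K X A h (snd (P.i2 a) w) \<in> T}"
  proof (rule gal_induct[OF vimage_submod[OF P.XA.tensor_module X.X_module sl T]])
    fix x y assume xy: "x \<in> carrier X" "y \<in> carrier X"
    have "slice_snd K X A h (snd (P.i2 a) (P.\<gamma> x y)) = x \<otimes>\<^bsub>X\<^esub> slice_snd K X A h (P.\<rho> y a)"
      using xy a P.i1_r[of y x a] P.slice_snd_i1(1)[OF h(1) xy(1) P.r_closed[OF xy(2) a(1)]] by simp
    then show "P.\<gamma> x y \<in> {w \<in> carrier (tensor K X A). slice_snd K X A h (snd (P.i2 a) w) \<in> T}"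
      using xy a p[OF xy(1) lin_closed[OF P.XA.slice_snd_linear[OF h(1)] P.r_closed[OF xy(2) a(1)]]] by simp
  qed (use u c in simp)
  then show "u \<in> T" using u c a h by (simp add: P.XA.slice_snd_tens amult_closed)
qed

sublocale P: coassociative_coaction K X A \<alpha> \<Delta>
proof (intro coassociative_coaction.intro coassociative_coaction_axioms.intro)
  show "coaction_pair K X A \<alpha> \<Delta>" by unfold_locales
  interpret h2: nondegenerate_hom K "tensor K X A" "tensor K (tensor K X A) A" "P.H2"
    by (rule P.H2_nondegenerate[OF X_idem])
  fix z x a assume z: "z \<in> carrier X" and x: "x \<in> carrier X" and a: "a \<in> carrier A"
  note ax = P.\<alpha>_closed[OF x]
  show "tensor_lift K X A P.XAAm (\<lambda>x a. P.txaa (P.\<gamma> z x) a) (P.\<rho> x a) =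
    P.assoc (tensor_lift K X A P.X_AAm (\<lambda>y c. P.tx_aa y (C.\<rho> c a)) (P.\<gamma> z x))"
  proof (rule P.covered_coassoc[OF x h2.extension_closed[OF ax] _ _ z a])
    show "P.H2 w \<otimes>\<^bsub>P.XAA.T.MX\<^esub> multiplier_extension K P.XAm P.XAAm P.H2 (\<alpha> x) = P.H2 (snd (\<alpha> x) w)"
      if "w \<in> carrier P.XAm" for w by (rule h2.extension_r[OF ax that])
    show "P.H1 (P.\<rho> x a) = multiplier_extension K P.XAm P.XAAm P.H2 (\<alpha> x) \<otimes>\<^bsub>P.XAA.T.MX\<^esub> in_snd K P.XAm A a"
      if "a \<in> carrier A" for a
      using coaction_coassoc_l[OF x that] unfolding act_r_def .
  qed
qed

end

section \<open>Consequences of coassociativity\<close>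

lemma bilin_arg_l: "b \<in> bilinear_map K V W Z \<Longrightarrow> w \<in> carrier W \<Longrightarrow> f \<in> linear_map K U V \<Longrightarrow> (\<lambda>u. b (f u) w) \<in> linear_map K U Z"
  by (rule lin_comp[OF _ bilin_l])

lemma bilin_arg_r: "b \<in> bilinear_map K V W Z \<Longrightarrow> v \<in> carrier V \<Longrightarrow> f \<in> linear_map K U W \<Longrightarrow> (\<lambda>u. b v (f u)) \<in> linear_map K U Z"
  by (rule lin_comp[OF _ bilin_r])

context nonunital_algebra
begin

lemma fst_lin: "m \<in> carrier MX \<Longrightarrow> f \<in> linear_map K U X \<Longrightarrow> (\<lambda>u. fst m (f u)) \<in> linear_map K U X"
  by (rule lin_comp[OF _ fst_linear])

lemma snd_lin: "m \<in> carrier MX \<Longrightarrow> f \<in> linear_map K U X \<Longrightarrow> (\<lambda>u. snd m (f u)) \<in> linear_map K U X"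
  by (rule lin_comp[OF _ snd_linear])

lemma fst_par_lin: "x \<in> carrier X \<Longrightarrow> f \<in> linear_map K U MX \<Longrightarrow> (\<lambda>u. fst (f u) x) \<in> linear_map K U X"
  by (rule lin_comp[OF _ fst_apply_linear])

lemma snd_par_lin: "x \<in> carrier X \<Longrightarrow> f \<in> linear_map K U MX \<Longrightarrow> (\<lambda>u. snd (f u) x) \<in> linear_map K U X"
  by (rule lin_comp[OF _ snd_apply_linear])

end

context tensor_nondegenerate
begin

lemma slice_snd_lin: "h \<in> linear_functional K W \<Longrightarrow> f \<in> linear_map K U VW \<Longrightarrow> (\<lambda>u. slice_snd K V W h (f u)) \<in> linear_map K U V"
  by (rule lin_comp[OF _ slice_snd_linear])

lemma slice_fst_lin: "h \<in> linear_functional K V \<Longrightarrow> f \<in> linear_map K U VW \<Longrightarrow> (\<lambda>u. slice_fst K V W h (f u)) \<in> linear_map K U W"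
  by (rule lin_comp[OF _ slice_fst_linear])

lemma in_snd_lin: "f \<in> linear_map K U W \<Longrightarrow> (\<lambda>u. in_snd K V W (f u)) \<in> linear_map K U T.MX"
  by (rule lin_comp[OF _ in_snd_linear])

lemma in_snd_right_cancel:
  assumes q: "q \<in> carrier VW" "q' \<in> carrier VW"
    and e: "\<And>d. d \<in> carrier W \<Longrightarrow> snd (in_snd K V W d) q = snd (in_snd K V W d) q'"
  shows "q = q'"
proof (rule T.nondeg_l[OF q])
  fix u assume u: "u \<in> carrier VW"
  show "q \<otimes>\<^bsub>VW\<^esub> u = q' \<otimes>\<^bsub>VW\<^esub> u"
  proof (rule tensor_lin_eq[OF tensor_module T.mult_lin_r[OF q(1)] T.mult_lin_r[OF q(2)] _ u])
    fix v w assume vw: "v \<in> carrier V" "w \<in> carrier W"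
    have e: "in_snd K V W w \<otimes>\<^bsub>T.MX\<^esub> in_fst K V W v = as_multiplier VW (t v w)"
      by (rule mult_eq_on_pure) (use vw in \<open>simp_all add: V.amult_closed W.amult_closed\<close>)
    have "p \<otimes>\<^bsub>VW\<^esub> t v w = snd (in_fst K V W v) (snd (in_snd K V W w) p)" if "p \<in> carrier VW" for p
      using that arg_cong[OF e, of "\<lambda>m. snd m p"] by simp
    then show "q \<otimes>\<^bsub>VW\<^esub> t v w = q' \<otimes>\<^bsub>VW\<^esub> t v w" using q assms(3)[OF vw(2)] by simp
  qed
qed

lemma in_fst_left_cancel:
  assumes q: "q \<in> carrier VW" "q' \<in> carrier VW"
    and e: "\<And>d. d \<in> carrier V \<Longrightarrow> fst (in_fst K V W d) q = fst (in_fst K V W d) q'"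
  shows "q = q'"
proof (rule T.nondeg_r[OF q])
  fix u assume u: "u \<in> carrier VW"
  show "u \<otimes>\<^bsub>VW\<^esub> q = u \<otimes>\<^bsub>VW\<^esub> q'"
  proof (rule tensor_lin_eq[OF tensor_module T.mult_lin_l[OF q(1)] T.mult_lin_l[OF q(2)] _ u])
    fix v w assume vw: "v \<in> carrier V" "w \<in> carrier W"
    have e: "in_snd K V W w \<otimes>\<^bsub>T.MX\<^esub> in_fst K V W v = as_multiplier VW (t v w)"
      by (rule mult_eq_on_pure) (use vw in \<open>simp_all add: V.amult_closed W.amult_closed\<close>)
    have "t v w \<otimes>\<^bsub>VW\<^esub> p = fst (in_snd K V W w) (fst (in_fst K V W v) p)" if "p \<in> carrier VW" for p
      using that arg_cong[OF e, of "\<lambda>m. fst m p"] by simp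
    then show "t v w \<otimes>\<^bsub>VW\<^esub> q = t v w \<otimes>\<^bsub>VW\<^esub> q'" using q assms(3)[OF vw(1)] by simp
  qed
qed

text \<open>
  Cancelling a left factor \<open>m \<otimes> 1\<close> in \<open>V \<otimes> W\<close> is a matter of the first leg: slices by functionals on \<open>W\<close>
  commute with \<open>m \<otimes> 1\<close>.
\<close>

lemma tens_one_cancel:
  assumes m: "\<And>i. i \<in> I \<Longrightarrow> m i \<in> carrier V.MX"
    and c: "\<And>v v'. v \<in> carrier V \<Longrightarrow> v' \<in> carrier V \<Longrightarrow> (\<And>i. i \<in> I \<Longrightarrow> fst (m i) v = fst (m i) v') \<Longrightarrow> v = v'"
    and q: "q \<in> carrier VW" "q' \<in> carrier VW"
    and e: "\<And>i. i \<in> I \<Longrightarrow> fst (multiplier_tens K V W (m i) \<one>\<^bsub>W.MX\<^esub>) q = fst (multiplier_tens K V W (m i) \<one>\<^bsub>W.MX\<^esub>) q'"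
  shows "q = q'"
proof (rule slice_snd_eqI[OF q])
  fix h assume h: "h \<in> linear_functional K W"
  have s: "slice_snd K V W h (fst (multiplier_tens K V W (m i) \<one>\<^bsub>W.MX\<^esub>) p) = fst (m i) (slice_snd K V W h p)"
    if i: "i \<in> I" and p: "p \<in> carrier VW" for i p
    by (rule tensor_lin_eq[OF V_module slice_snd_lin[OF h T.fst_linear[OF multiplier_tens_closed[OF m[OF i] W.mult_one_closed]]]
          V.fst_lin[OF m[OF i] slice_snd_linear[OF h]] _ p])
      (use m[OF i] in \<open>simp add: multiplier_tens_apply slice_snd_tens[OF h] lin_smult[OF V.fst_linear[OF m[OF i]]] fun_closed[OF h]\<close>)
  show "slice_snd K V W h q = slice_snd K V W h q'"
    by (rule c) (use q e in \<open>simp_all add: lin_closed[OF slice_snd_linear[OF h]] s[symmetric]\<close>)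
qed

end

context covered_hom
begin

lemma l_mult: "x \<in> carrier X \<Longrightarrow> y \<in> carrier X \<Longrightarrow> a \<in> carrier A \<Longrightarrow> \<Lambda> a (x \<otimes>\<^bsub>X\<^esub> y) = snd (\<alpha> y) (\<Lambda> a x)"
  by (rule as_inject) (simp_all add: as_simps X.amult_closed XA.T.mult_assoc)

lemma slice_fst_i1:
  assumes h: "h \<in> linear_functional K X" and a: "a \<in> carrier A" and w: "w \<in> carrier XAm"
  shows "slice_fst K X A h (fst (i2 a) w) = a \<otimes>\<^bsub>A\<^esub> slice_fst K X A h w"
    "slice_fst K X A h (snd (i2 a) w) = slice_fst K X A h w \<otimes>\<^bsub>A\<^esub> a"
  by (rule XA.tensor_lin_eq[OF A.X_module lin_comp[OF XA.T.fst_linear[OF XA.in_snd_closed[OF a]] XA.slice_fst_linear[OF h]]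
        lin_comp[OF XA.slice_fst_linear[OF h] A.mult_lin_r[OF a]] _ w],
      use a in \<open>simp add: XA.slice_fst_tens[OF h] A.amult_closed A.amult_smult_r fun_closed[OF h]\<close>)
    (rule XA.tensor_lin_eq[OF A.X_module lin_comp[OF XA.T.snd_linear[OF XA.in_snd_closed[OF a]] XA.slice_fst_linear[OF h]]
        lin_comp[OF XA.slice_fst_linear[OF h] A.mult_lin_l[OF a]] _ w],
      use a in \<open>simp add: XA.slice_fst_tens[OF h] A.amult_closed A.amult_smult_l fun_closed[OF h]\<close>)

lemma slice_snd_i2:
  assumes h: "h \<in> linear_functional K A" and a: "a \<in> carrier A" and w: "w \<in> carrier XAm"
  shows "slice_snd K X A h (fst (i2 a) w) = slice_snd K X A (\<lambda>b. h (a \<otimes>\<^bsub>A\<^esub> b)) w"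
    "slice_snd K X A h (snd (i2 a) w) = slice_snd K X A (\<lambda>b. h (b \<otimes>\<^bsub>A\<^esub> a)) w"
proof -
  have hl: "(\<lambda>b. h (a \<otimes>\<^bsub>A\<^esub> b)) \<in> linear_functional K A" by (rule fun_comp[OF A.mult_lin_r[OF a] h])
  have hr: "(\<lambda>b. h (b \<otimes>\<^bsub>A\<^esub> a)) \<in> linear_functional K A" by (rule fun_comp[OF A.mult_lin_l[OF a] h])
  show "slice_snd K X A h (fst (i2 a) w) = slice_snd K X A (\<lambda>b. h (a \<otimes>\<^bsub>A\<^esub> b)) w"
    by (rule XA.tensor_lin_eq[OF X.X_module XA.slice_snd_lin[OF h XA.T.fst_linear[OF XA.in_snd_closed[OF a]]] XA.slice_snd_linear[OF hl] _ w])
      (use a in \<open>simp add: XA.slice_snd_tens[OF h] XA.slice_snd_tens[OF hl] A.amult_closed\<close>)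
  show "slice_snd K X A h (snd (i2 a) w) = slice_snd K X A (\<lambda>b. h (b \<otimes>\<^bsub>A\<^esub> a)) w"
    by (rule XA.tensor_lin_eq[OF X.X_module XA.slice_snd_lin[OF h XA.T.snd_linear[OF XA.in_snd_closed[OF a]]] XA.slice_snd_linear[OF hr] _ w])
      (use a in \<open>simp add: XA.slice_snd_tens[OF h] XA.slice_snd_tens[OF hr] A.amult_closed\<close>)
qed

end

context coassociative_coaction
begin

lemma assoc_lin: "f \<in> linear_map K U X_AAm \<Longrightarrow> (\<lambda>u. assoc (f u)) \<in> linear_map K U XAAm"
  by (rule lin_comp[OF _ assoc_linear])

lemmas mods = X.X_module A.X_module XA.tensor_module AA.tensor_module XAA.tensor_module X_AA.tensor_module

text \<open>
  Rules for assembling linearity of composed expressions, and closure facts for their side conditions.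
\<close>

lemmas lins =
  lin_id assoc_lin
  bilin_arg_l[OF r_bilinear] bilin_arg_r[OF r_bilinear] bilin_arg_l[OF l_bilinear] bilin_arg_r[OF l_bilinear]
  bilin_arg_l[OF g_bilinear] bilin_arg_r[OF g_bilinear]
  bilin_arg_l[OF D.r_bilinear] bilin_arg_r[OF D.r_bilinear] bilin_arg_l[OF D.l_bilinear] bilin_arg_r[OF D.l_bilinear]
  bilin_arg_l[OF D.g_bilinear] bilin_arg_r[OF D.g_bilinear]
  XA.tens_lin_l XA.tens_lin_r AA.tens_lin_l AA.tens_lin_r XAA.tens_lin_l XAA.tens_lin_r X_AA.tens_lin_l X_AA.tens_lin_r
  XA.lift_lin_arg AA.lift_lin_arg XAA.lift_lin_arg X_AA.lift_lin_arg
  XA.lift_lin_par AA.lift_lin_par XAA.lift_lin_par X_AA.lift_lin_par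
  XA.T.fst_lin AA.T.fst_lin XAA.T.fst_lin X_AA.T.fst_lin XA.T.snd_lin AA.T.snd_lin XAA.T.snd_lin X_AA.T.snd_lin
  XA.T.fst_par_lin AA.T.fst_par_lin XAA.T.fst_par_lin XA.T.snd_par_lin AA.T.snd_par_lin XAA.T.snd_par_lin
  XA.in_snd_lin AA.in_snd_lin XAA.in_snd_lin
  XA.slice_snd_lin XA.slice_fst_lin AA.slice_snd_lin AA.slice_fst_lin XAA.slice_snd_lin XAA.slice_fst_lin

lemmas closeds =
  mods X.amult_closed A.amult_closed XA.multiplier_tens_closed XAA.multiplier_tens_closed X_AA.multiplier_tens_closed
  transp_closed XA.T.mult_one_closed

text \<open>
  For \<open>w = x \<otimes> a\<close> this is \<open>z x\<^sub>0 \<otimes> x\<^sub>1 \<otimes> a\<close>, one side of the coassociativity identity.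
\<close>

abbreviation "lift_l z w \<equiv> tensor_lift K X A XAAm (\<lambda>x a. txaa (\<gamma> z x) a) w"

lemma rl_bil: "a \<in> carrier A \<Longrightarrow> (\<lambda>y c. tx_aa y (D.\<Lambda> a c)) \<in> bilinear_map K X A X_AAm"
  by (intro bilinear_mapI lins) (simp_all add: closeds)

abbreviation "right3 d \<equiv> snd (in_snd K XAm A d)"
abbreviation "left3 d \<equiv> fst (in_snd K XAm A d)"

lemma in_snd3_assoc:
  assumes y: "y \<in> carrier X" and d: "d \<in> carrier A" and w: "w \<in> carrier AAm"
  shows "left3 d (assoc (tx_aa y w)) = assoc (tx_aa y (fst (D.i2 d) w))"
    "right3 d (assoc (tx_aa y w)) = assoc (tx_aa y (snd (D.i2 d) w))"
proof -
  have c: "in_snd K XAm A d \<in> carrier XAA.T.MX" "D.i2 d \<in> carrier AA.T.MX" using d by auto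
  show "left3 d (assoc (tx_aa y w)) = assoc (tx_aa y (fst (D.i2 d) w))"
    by (rule AA.tensor_lin_eq[OF XAA.tensor_module _ _ _ w]; (intro lins)?) (use y d c in \<open>simp_all add: closeds\<close>)
  show "right3 d (assoc (tx_aa y w)) = assoc (tx_aa y (snd (D.i2 d) w))"
    by (rule AA.tensor_lin_eq[OF XAA.tensor_module _ _ _ w]; (intro lins)?) (use y d c in \<open>simp_all add: closeds\<close>)
qed

text \<open>
  Coassociativity for \<open>z x\<^sub>0 \<otimes> x\<^sub>1 \<otimes> a x\<^sub>2\<close>. Multiplying by \<open>d\<close> on the right of the last leg turns it into
  the identity for \<open>x\<^sub>2 d\<close> multiplied by \<open>a\<close> on the left, and \<open>d\<close> can be cancelled.
\<close>

lemma coassoc_l: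
  assumes z: "z \<in> carrier X" and x: "x \<in> carrier X" and a: "a \<in> carrier A"
  shows "lift_l z (\<Lambda> a x) = assoc (tensor_lift K X A X_AAm (\<lambda>y c. tx_aa y (D.\<Lambda> a c)) (\<gamma> z x))"
proof (rule XAA.in_snd_right_cancel)
  note L = XA.lift_linear[OF XAA.tensor_module coassoc_l_bilinear[OF z]] XA.lift_tens[OF XAA.tensor_module coassoc_l_bilinear[OF z]]
  note R = XA.lift_linear[OF X_AA.tensor_module rl_bil[OF a]] XA.lift_tens[OF X_AA.tensor_module rl_bil[OF a]]
  let ?R = "\<lambda>w. assoc (tensor_lift K X A X_AAm (\<lambda>y c. tx_aa y (D.\<Lambda> a c)) w)"
  show "lift_l z (\<Lambda> a x) \<in> carrier XAAm" "?R (\<gamma> z x) \<in> carrier XAAm"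
    using lin_closed[OF L(1)] lin_closed[OF R(1)] x z a by auto
  fix d assume d: "d \<in> carrier A"
  note R' = XA.lift_linear[OF X_AA.tensor_module coassoc_r_bilinear[OF d]] XA.lift_tens[OF X_AA.tensor_module coassoc_r_bilinear[OF d]]
  have r3: "right3 d (lift_l z w) = lift_l z (snd (i2 d) w)" "left3 d (lift_l z w) = lift_l z (fst (i2 d) w)"
    if w: "w \<in> carrier XAm" and d: "d \<in> carrier A" for w d
    by (rule XA.tensor_lin_eq[OF XAA.tensor_module XAA.T.snd_lin[OF XAA.in_snd_closed[OF d] L(1)] lin_comp[OF XA.T.snd_linear[OF XA.in_snd_closed[OF d]] L(1)] _ w],
        use d z in \<open>simp add: L(2) A.amult_closed\<close>)
      (rule XA.tensor_lin_eq[OF XAA.tensor_module XAA.T.fst_lin[OF XAA.in_snd_closed[OF d] L(1)] lin_comp[OF XA.T.fst_linear[OF XA.in_snd_closed[OF d]] L(1)] _ w],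
        use d z in \<open>simp add: L(2) A.amult_closed\<close>)
  have rr: "left3 a (assoc (tensor_lift K X A X_AAm (\<lambda>y c. tx_aa y (D.\<rho> c d)) w)) = right3 d (?R w)" if w: "w \<in> carrier XAm" for w
    by (rule XA.tensor_lin_eq[OF XAA.tensor_module XAA.T.fst_lin[OF XAA.in_snd_closed[OF a] assoc_lin[OF R'(1)]]
        XAA.T.snd_lin[OF XAA.in_snd_closed[OF d] assoc_lin[OF R(1)]] _ w])
      (use a d in \<open>simp add: R(2) R'(2) in_snd3_assoc D.i2_r del: assoc_tens\<close>)
  have "right3 d (lift_l z (\<Lambda> a x)) = left3 a (lift_l z (\<rho> x d))"
    using r3 x a d by (simp add: i2_r)
  also have "\<dots> = right3 d (?R (\<gamma> z x))"
    using rr[of "\<gamma> z x"] z x d coassoc[OF z x d] by simp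
  finally show "right3 d (lift_l z (\<Lambda> a x)) = right3 d (?R (\<gamma> z x))" .
qed

abbreviation "left1 u \<equiv> fst (multiplier_tens K XAm A (i1 u) \<one>\<^bsub>A.MX\<^esub>)"

lemma left1_tens: "u \<in> carrier X \<Longrightarrow> w \<in> carrier XAm \<Longrightarrow> b \<in> carrier A \<Longrightarrow> left1 u (txaa w b) = txaa (fst (i1 u) w) b"
  by (simp add: XAA.multiplier_tens_apply)

lemma left1_mult: "u \<in> carrier X \<Longrightarrow> multiplier_tens K XAm A (i1 u) \<one>\<^bsub>A.MX\<^esub> \<in> carrier XAA.T.MX"
  by (simp add: XAA.multiplier_tens_closed)

lemma left1_cancel:
  assumes "q \<in> carrier XAAm" "q' \<in> carrier XAAm" "\<And>u. u \<in> carrier X \<Longrightarrow> left1 u q = left1 u q'"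
  shows "q = q'"
  by (rule XAA.tens_one_cancel[where I = "carrier X" and m = i1])
    (use assms XA.in_fst_left_cancel in \<open>simp_all\<close>)

lemma left1_assoc:
  assumes u: "u \<in> carrier X" and y: "y \<in> carrier X" and w: "w \<in> carrier AAm"
  shows "left1 u (assoc (tx_aa y w)) = assoc (tx_aa (u \<otimes>\<^bsub>X\<^esub> y) w)"
  by (rule AA.tensor_lin_eq[OF XAA.tensor_module _ _ _ w]; (intro lins)?)
    (use u y in \<open>simp_all add: closeds left1_tens left1_mult\<close>)

text \<open>The multiplier \<open>1 \<otimes> \<Delta>(c)\<close> of the triple tensor product.\<close>

abbreviation "\<tau> c \<equiv> trp (multiplier_tens K X AAm \<one>\<^bsub>X.MX\<^esub> (\<Delta> c))"

lemma \<tau>_closed: "c \<in> carrier A \<Longrightarrow> \<tau> c \<in> carrier XAA.T.MX"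
  by (simp add: transp_closed X_AA.multiplier_tens_closed)

lemma \<tau>_assoc:
  assumes "c \<in> carrier A" "y \<in> carrier X" "w \<in> carrier AAm"
  shows "fst (\<tau> c) (assoc (tx_aa y w)) = assoc (tx_aa y (fst (\<Delta> c) w))"
    "snd (\<tau> c) (assoc (tx_aa y w)) = assoc (tx_aa y (snd (\<Delta> c) w))"
  using assms trp_tens_apply[of "\<one>\<^bsub>X.MX\<^esub>" "\<Delta> c" y w] by simp_all

lemma left_mid_bil: "c \<in> carrier A \<Longrightarrow> x1 \<in> carrier X \<Longrightarrow>
    (\<lambda>c1 b2. txaa (\<Lambda> c1 x1) b2) \<in> bilinear_map K A A XAAm"
  by (intro bilinear_mapI lins) (simp_all add: closeds)

lemma coassoc_mixed_bil: "c \<in> carrier A \<Longrightarrow>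
    (\<lambda>x1 b1. tensor_lift K A A XAAm (\<lambda>c1 b2. txaa (\<Lambda> c1 x1) b2) (D.\<rho> c b1)) \<in> bilinear_map K X A XAAm"
  by (intro bilinear_mapI lins) (simp_all add: closeds)

text \<open>
  In Sweedler notation: \<open>x\<^sub>0 \<otimes> c\<^sub>1 x\<^sub>1 \<otimes> c\<^sub>2 x\<^sub>2 b\<close>, computed in two ways. After multiplication with \<open>u\<close> on
  the first leg, both sides are \<open>1 \<otimes> \<Delta>(c)\<close> applied to the two sides of the coassociativity identity.
\<close>

lemma coassoc_mixed:
  assumes x: "x \<in> carrier X" and b: "b \<in> carrier A" and c: "c \<in> carrier A"
  shows "assoc (tensor_lift K X A X_AAm (\<lambda>y a. tx_aa y (D.\<rho> a b)) (\<Lambda> c x)) =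
    tensor_lift K X A XAAm (\<lambda>x1 b1. tensor_lift K A A XAAm (\<lambda>c1 b2. txaa (\<Lambda> c1 x1) b2) (D.\<rho> c b1)) (\<rho> x b)"
    (is "?E1 (\<Lambda> c x) = ?E2 (\<rho> x b)")
proof (rule left1_cancel)
  note R = XA.lift_linear[OF X_AA.tensor_module coassoc_r_bilinear[OF b]] XA.lift_tens[OF X_AA.tensor_module coassoc_r_bilinear[OF b]]
  note E2 = XA.lift_linear[OF XAA.tensor_module coassoc_mixed_bil[OF c]] XA.lift_tens[OF XAA.tensor_module coassoc_mixed_bil[OF c]]
  note E1 = assoc_lin[OF R(1)]
  show "?E1 (\<Lambda> c x) \<in> carrier XAAm" "?E2 (\<rho> x b) \<in> carrier XAAm"
    using lin_closed[OF E1] lin_closed[OF E2(1)] x b c by auto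
  fix u assume u: "u \<in> carrier X"
  note L = XA.lift_linear[OF XAA.tensor_module coassoc_l_bilinear[OF u]] XA.lift_tens[OF XAA.tensor_module coassoc_l_bilinear[OF u]]
  have 1: "left1 u (?E1 w) = ?E1 (fst (i1 u) w)" if w: "w \<in> carrier XAm" for w
    by (rule XA.tensor_lin_eq[OF XAA.tensor_module XAA.T.fst_lin[OF left1_mult[OF u] E1] lin_comp[OF XA.T.fst_linear[OF XA.in_fst_closed[OF u]] E1] _ w])
      (use u b in \<open>simp add: R(2) left1_assoc X.amult_closed del: assoc_tens\<close>)
  have 2: "?E1 (fst (i2 c) w) = fst (\<tau> c) (?E1 w)" if w: "w \<in> carrier XAm" for w
    by (rule XA.tensor_lin_eq[OF XAA.tensor_module lin_comp[OF XA.T.fst_linear[OF XA.in_snd_closed[OF c]] E1] XAA.T.fst_lin[OF \<tau>_closed[OF c] E1] _ w])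
      (use c b in \<open>simp add: R(2) \<tau>_assoc A.amult_closed D.r_mult del: assoc_tens transp_apply\<close>)
  have B3: "(\<lambda>c1 b2. txaa (fst (i2 c1) w) b2) \<in> bilinear_map K A A XAAm" if "w \<in> carrier XAm" for w
    using that by (intro bilinear_mapI lins) (simp_all add: closeds)
  note F = AA.lift_tens[OF XAA.tensor_module B3] AA.lift_linear[OF XAA.tensor_module B3]
  have 3: "fst (\<tau> c) (txaa w b1) = tensor_lift K A A XAAm (\<lambda>c1 b2. txaa (fst (i2 c1) w) b2) (D.\<rho> c b1)"
    if w: "w \<in> carrier XAm" and b1: "b1 \<in> carrier A" for w b1
  proof (rule XA.tensor_lin_eq[OF XAA.tensor_module XAA.T.fst_lin[OF \<tau>_closed[OF c] XAA.tens_l[OF b1]] _ _ w])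
    show "(\<lambda>w. tensor_lift K A A XAAm (\<lambda>c1 b2. txaa (fst (i2 c1) w) b2) (D.\<rho> c b1)) \<in> linear_map K XAm XAAm"
      using c b1 by (intro lins B3) (simp_all add: closeds)
    fix y a assume ya: "y \<in> carrier X" "a \<in> carrier A"
    have 4: "assoc (tx_aa y (snd (D.i1 a) s)) = tensor_lift K A A XAAm (\<lambda>c1 b2. txaa (fst (i2 c1) (txa y a)) b2) s" if s: "s \<in> carrier AAm" for s
      by (rule AA.tensor_lin_eq[OF XAA.tensor_module _ F(2) _ s]; (intro lins)?) (use ya in \<open>simp_all add: F(1) closeds\<close>)
    have "fst (\<tau> c) (assoc (tx_aa y (taa a b1))) = assoc (tx_aa y (snd (D.i1 a) (D.\<rho> c b1)))"
      using c ya b1 by (simp add: \<tau>_assoc D.\<alpha>_tens del: assoc_tens transp_apply)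
    then show "fst (\<tau> c) (txaa (txa y a) b1) = tensor_lift K A A XAAm (\<lambda>c1 b2. txaa (fst (i2 c1) (txa y a)) b2) (D.\<rho> c b1)"
      using ya b1 c 4[of "D.\<rho> c b1"] by (simp del: transp_apply)
  qed
  have 5: "fst (\<tau> c) (lift_l u w) = left1 u (?E2 w)" if w: "w \<in> carrier XAm" for w
  proof (rule XA.tensor_lin_eq[OF XAA.tensor_module XAA.T.fst_lin[OF \<tau>_closed[OF c] L(1)] XAA.T.fst_lin[OF left1_mult[OF u] E2(1)] _ w])
    fix x1 b1 assume p: "x1 \<in> carrier X" "b1 \<in> carrier A"
    have "left1 u (tensor_lift K A A XAAm (\<lambda>c1 b2. txaa (\<Lambda> c1 x1) b2) s) = tensor_lift K A A XAAm (\<lambda>c1 b2. txaa (fst (i2 c1) (\<gamma> u x1)) b2) s"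
      if s: "s \<in> carrier AAm" for s
      by (rule AA.tensor_lin_eq[OF XAA.tensor_module XAA.T.fst_lin[OF left1_mult[OF u] AA.lift_linear[OF XAA.tensor_module left_mid_bil[OF c p(1)]]] F(2) _ s])
        (use p u c in \<open>simp_all add: F(1) AA.lift_tens[OF XAA.tensor_module left_mid_bil[OF c]] left1_tens i1_l\<close>)
    then show "fst (\<tau> c) (lift_l u (txa x1 b1)) = left1 u (?E2 (txa x1 b1))"
      using p u c by (simp add: L(2) E2(2) 3 del: transp_apply)
  qed
  have "left1 u (?E1 (\<Lambda> c x)) = fst (\<tau> c) (?E1 (\<gamma> u x))"
    using 1[of "\<Lambda> c x"] 2[of "\<gamma> u x"] x c u by (simp add: i1_l)
  also have "\<dots> = left1 u (?E2 (\<rho> x b))"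
    using 5[of "\<rho> x b"] x b u coassoc[OF u x b] by simp
  finally show "left1 u (?E1 (\<Lambda> c x)) = left1 u (?E2 (\<rho> x b))" .
qed

lemma right_mid_bil: "x1 \<in> carrier X \<Longrightarrow>
    (\<lambda>c1 b2. txaa (\<rho> x1 c1) b2) \<in> bilinear_map K A A XAAm"
  by (intro bilinear_mapI lins) (simp_all add: closeds)

lemma coassoc_mixed'_bil: "c \<in> carrier A \<Longrightarrow>
    (\<lambda>x1 b1. tensor_lift K A A XAAm (\<lambda>c1 b2. txaa (\<rho> x1 c1) b2) (D.\<Lambda> b1 c)) \<in> bilinear_map K X A XAAm"
  by (intro bilinear_mapI lins) (simp_all add: closeds)

text \<open>
  The mirror image \<open>x\<^sub>0 \<otimes> x\<^sub>1 c\<^sub>1 \<otimes> b x\<^sub>2 c\<^sub>2\<close>. It follows in the same way from the form of coassociativity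
  that is covered on the left.
\<close>

lemma coassoc_mixed':
  assumes x: "x \<in> carrier X" and b: "b \<in> carrier A" and c: "c \<in> carrier A"
  shows "assoc (tensor_lift K X A X_AAm (\<lambda>y a. tx_aa y (D.\<Lambda> b a)) (\<rho> x c)) =
    tensor_lift K X A XAAm (\<lambda>x1 b1. tensor_lift K A A XAAm (\<lambda>c1 b2. txaa (\<rho> x1 c1) b2) (D.\<Lambda> b1 c)) (\<Lambda> b x)"
    (is "?E1 (\<rho> x c) = ?E2 (\<Lambda> b x)")
proof (rule left1_cancel)
  note R = XA.lift_linear[OF X_AA.tensor_module rl_bil[OF b]] XA.lift_tens[OF X_AA.tensor_module rl_bil[OF b]]
  note E2 = XA.lift_linear[OF XAA.tensor_module coassoc_mixed'_bil[OF c]] XA.lift_tens[OF XAA.tensor_module coassoc_mixed'_bil[OF c]]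
  note E1 = assoc_lin[OF R(1)]
  show "?E1 (\<rho> x c) \<in> carrier XAAm" "?E2 (\<Lambda> b x) \<in> carrier XAAm"
    using lin_closed[OF E1] lin_closed[OF E2(1)] x b c by auto
  fix u assume u: "u \<in> carrier X"
  note L = XA.lift_linear[OF XAA.tensor_module coassoc_l_bilinear[OF u]] XA.lift_tens[OF XAA.tensor_module coassoc_l_bilinear[OF u]]
  have 1: "left1 u (?E1 w) = ?E1 (fst (i1 u) w)" if w: "w \<in> carrier XAm" for w
    by (rule XA.tensor_lin_eq[OF XAA.tensor_module XAA.T.fst_lin[OF left1_mult[OF u] E1] lin_comp[OF XA.T.fst_linear[OF XA.in_fst_closed[OF u]] E1] _ w])
      (use u b in \<open>simp add: R(2) left1_assoc X.amult_closed del: assoc_tens\<close>)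
  have 2: "?E1 (snd (i2 c) w) = snd (\<tau> c) (?E1 w)" if w: "w \<in> carrier XAm" for w
    by (rule XA.tensor_lin_eq[OF XAA.tensor_module lin_comp[OF XA.T.snd_linear[OF XA.in_snd_closed[OF c]] E1] XAA.T.snd_lin[OF \<tau>_closed[OF c] E1] _ w])
      (use c b in \<open>simp add: R(2) \<tau>_assoc A.amult_closed D.l_mult del: assoc_tens transp_apply\<close>)
  have B3: "(\<lambda>c1 b2. txaa (snd (i2 c1) w) b2) \<in> bilinear_map K A A XAAm" if "w \<in> carrier XAm" for w
    using that by (intro bilinear_mapI lins) (simp_all add: closeds)
  note F = AA.lift_tens[OF XAA.tensor_module B3] AA.lift_linear[OF XAA.tensor_module B3]
  have 3: "snd (\<tau> c) (txaa w b1) = tensor_lift K A A XAAm (\<lambda>c1 b2. txaa (snd (i2 c1) w) b2) (D.\<Lambda> b1 c)"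
    if w: "w \<in> carrier XAm" and b1: "b1 \<in> carrier A" for w b1
  proof (rule XA.tensor_lin_eq[OF XAA.tensor_module XAA.T.snd_lin[OF \<tau>_closed[OF c] XAA.tens_l[OF b1]] _ _ w])
    show "(\<lambda>w. tensor_lift K A A XAAm (\<lambda>c1 b2. txaa (snd (i2 c1) w) b2) (D.\<Lambda> b1 c)) \<in> linear_map K XAm XAAm"
      using c b1 by (intro lins B3) (simp_all add: closeds)
    fix y a assume ya: "y \<in> carrier X" "a \<in> carrier A"
    have 4: "assoc (tx_aa y (fst (D.i1 a) s)) = tensor_lift K A A XAAm (\<lambda>c1 b2. txaa (snd (i2 c1) (txa y a)) b2) s" if s: "s \<in> carrier AAm" for s
      by (rule AA.tensor_lin_eq[OF XAA.tensor_module _ F(2) _ s]; (intro lins)?) (use ya in \<open>simp_all add: F(1) closeds\<close>)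
    have "snd (\<tau> c) (assoc (tx_aa y (taa a b1))) = assoc (tx_aa y (fst (D.i1 a) (D.\<Lambda> b1 c)))"
      using c ya b1 by (simp add: \<tau>_assoc D.tens_\<alpha> del: assoc_tens transp_apply)
    then show "snd (\<tau> c) (txaa (txa y a) b1) = tensor_lift K A A XAAm (\<lambda>c1 b2. txaa (snd (i2 c1) (txa y a)) b2) (D.\<Lambda> b1 c)"
      using ya b1 c 4[of "D.\<Lambda> b1 c"] by (simp del: transp_apply)
  qed
  have 5: "snd (\<tau> c) (lift_l u w) = left1 u (?E2 w)" if w: "w \<in> carrier XAm" for w
  proof (rule XA.tensor_lin_eq[OF XAA.tensor_module XAA.T.snd_lin[OF \<tau>_closed[OF c] L(1)] XAA.T.fst_lin[OF left1_mult[OF u] E2(1)] _ w])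
    fix x1 b1 assume p: "x1 \<in> carrier X" "b1 \<in> carrier A"
    have "left1 u (tensor_lift K A A XAAm (\<lambda>c1 b2. txaa (\<rho> x1 c1) b2) s) = tensor_lift K A A XAAm (\<lambda>c1 b2. txaa (snd (i2 c1) (\<gamma> u x1)) b2) s"
      if s: "s \<in> carrier AAm" for s
      by (rule AA.tensor_lin_eq[OF XAA.tensor_module XAA.T.fst_lin[OF left1_mult[OF u] AA.lift_linear[OF XAA.tensor_module right_mid_bil[OF p(1)]]] F(2) _ s])
        (use p u c in \<open>simp_all add: F(1) AA.lift_tens[OF XAA.tensor_module right_mid_bil] left1_tens i1_r\<close>)
    then show "snd (\<tau> c) (lift_l u (txa x1 b1)) = left1 u (?E2 (txa x1 b1))"
      using p u c by (simp add: L(2) E2(2) 3 del: transp_apply)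
  qed
  have "left1 u (?E1 (\<rho> x c)) = snd (\<tau> c) (?E1 (\<gamma> u x))"
    using 1[of "\<rho> x c"] 2[of "\<gamma> u x"] x c u by (simp add: i1_r)
  also have "\<dots> = left1 u (?E2 (\<Lambda> b x))"
    using 5[of "\<Lambda> b x"] x b u coassoc_l[OF u x b] by simp
  finally show "left1 u (?E1 (\<rho> x c)) = left1 u (?E2 (\<Lambda> b x))" .
qed

end

section \<open>Slices of the coassociativity identities\<close>

context coassociative_coaction
begin

text \<open>
  Slices of the triple tensor product \<open>(X \<otimes> A) \<otimes> A\<close>: in the first, the middle and the last leg.
\<close>

abbreviation "\<Phi> f \<equiv> tensor_lift K XAm A AAm (\<lambda>w b. taa (slice_fst K X A f w) b)"
abbreviation "\<Theta> h \<equiv> tensor_lift K XAm A XAm (\<lambda>w b. txa (slice_snd K X A h w) b)"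
abbreviation "slice3 h \<equiv> slice_snd K XAm A h"

lemma \<Phi>_bil: "f \<in> linear_functional K X \<Longrightarrow> (\<lambda>w b. taa (slice_fst K X A f w) b) \<in> bilinear_map K XAm A AAm"
  by (intro bilinear_mapI lins) (simp_all add: closeds lin_closed[OF XA.slice_fst_linear])

lemma \<Theta>_bil: "h \<in> linear_functional K A \<Longrightarrow> (\<lambda>w b. txa (slice_snd K X A h w) b) \<in> bilinear_map K XAm A XAm"
  by (intro bilinear_mapI lins) (simp_all add: closeds lin_closed[OF XA.slice_snd_linear])

lemmas \<Phi>_linear = XAA.lift_linear[OF AA.tensor_module \<Phi>_bil] and \<Phi>_tens = XAA.lift_tens[OF AA.tensor_module \<Phi>_bil]
lemmas \<Theta>_linear = XAA.lift_linear[OF XA.tensor_module \<Theta>_bil] and \<Theta>_tens = XAA.lift_tens[OF XA.tensor_module \<Theta>_bil]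

lemma \<Phi>_assoc:
  assumes f: "f \<in> linear_functional K X" and y: "y \<in> carrier X" and w: "w \<in> carrier AAm"
  shows "\<Phi> f (assoc (tx_aa y w)) = f y \<odot>\<^bsub>AAm\<^esub> w"
  by (rule AA.tensor_lin_eq[OF AA.tensor_module lin_comp[OF assoc_lin[OF X_AA.tens_r[OF y]] \<Phi>_linear[OF f]] lin_scale[OF AA.tensor_module lin_id fun_closed[OF f y]] _ w])
    (use y f in \<open>simp add: \<Phi>_tens XA.slice_fst_tens lin_smult[OF AA.tens_l] fun_closed\<close>)

lemma \<Theta>_assoc:
  assumes h: "h \<in> linear_functional K A" and y: "y \<in> carrier X" and w: "w \<in> carrier AAm"
  shows "\<Theta> h (assoc (tx_aa y w)) = txa y (slice_fst K A A h w)"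
  by (rule AA.tensor_lin_eq[OF XA.tensor_module lin_comp[OF assoc_lin[OF X_AA.tens_r[OF y]] \<Theta>_linear[OF h]] XA.tens_lin_r[OF AA.slice_fst_linear[OF h] y] _ w])
    (use y h in \<open>simp add: \<Theta>_tens XA.slice_snd_tens AA.slice_fst_tens lin_smult[OF XA.tens_l] lin_smult[OF XA.tens_r] fun_closed\<close>)

lemma slice3_assoc:
  assumes h: "h \<in> linear_functional K A" and y: "y \<in> carrier X" and w: "w \<in> carrier AAm"
  shows "slice3 h (assoc (tx_aa y w)) = txa y (slice_snd K A A h w)"
  by (rule AA.tensor_lin_eq[OF XA.tensor_module XAA.slice_snd_lin[OF h assoc_lin[OF X_AA.tens_r[OF y]]] XA.tens_lin_r[OF AA.slice_snd_linear[OF h] y] _ w])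
    (use y h in \<open>simp add: XAA.slice_snd_tens AA.slice_snd_tens lin_smult[OF XA.tens_r] fun_closed\<close>)

text \<open>
  For \<open>w = x \<otimes> b\<close> these are \<open>f(x\<^sub>0) c\<^sub>1 x\<^sub>1 \<otimes> c\<^sub>2 b\<close> and \<open>f(x\<^sub>0) x\<^sub>1 c\<^sub>1 \<otimes> b c\<^sub>2\<close>: the first leg of the mixed
  identities is evaluated by \<open>f\<close>.
\<close>

abbreviation "mixed f c \<equiv> tensor_lift K X A AAm (\<lambda>x1 b1. tensor_lift K A A AAm (\<lambda>c1 b2. taa (slice_fst K X A f (\<Lambda> c1 x1)) b2) (D.\<rho> c b1))"
abbreviation "mixed' f c \<equiv> tensor_lift K X A AAm (\<lambda>x1 b1. tensor_lift K A A AAm (\<lambda>c1 b2. taa (slice_fst K X A f (\<rho> x1 c1)) b2) (D.\<Lambda> b1 c))"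

lemma mixed_inner: "f \<in> linear_functional K X \<Longrightarrow> x1 \<in> carrier X \<Longrightarrow>
    (\<lambda>c1 b2. taa (slice_fst K X A f (\<Lambda> c1 x1)) b2) \<in> bilinear_map K A A AAm"
  "f \<in> linear_functional K X \<Longrightarrow> x1 \<in> carrier X \<Longrightarrow>
    (\<lambda>c1 b2. taa (slice_fst K X A f (\<rho> x1 c1)) b2) \<in> bilinear_map K A A AAm"
  by (intro bilinear_mapI lins; simp add: closeds lin_closed[OF XA.slice_fst_linear])+

lemma mixed_outer: "f \<in> linear_functional K X \<Longrightarrow> c \<in> carrier A \<Longrightarrow>
    (\<lambda>x1 b1. tensor_lift K A A AAm (\<lambda>c1 b2. taa (slice_fst K X A f (\<Lambda> c1 x1)) b2) (D.\<rho> c b1)) \<in> bilinear_map K X A AAm"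
  "f \<in> linear_functional K X \<Longrightarrow> c \<in> carrier A \<Longrightarrow>
    (\<lambda>x1 b1. tensor_lift K A A AAm (\<lambda>c1 b2. taa (slice_fst K X A f (\<rho> x1 c1)) b2) (D.\<Lambda> b1 c)) \<in> bilinear_map K X A AAm"
  by (intro bilinear_mapI lins mixed_inner; simp add: closeds lin_closed[OF XA.slice_fst_linear])+

lemmas mixed_linear = XA.lift_linear[OF AA.tensor_module mixed_outer(1)] XA.lift_linear[OF AA.tensor_module mixed_outer(2)]
lemmas mixed_tens = XA.lift_tens[OF AA.tensor_module mixed_outer(1)] XA.lift_tens[OF AA.tensor_module mixed_outer(2)]

text \<open>
  The elements \<open>f(x\<^sub>0) c x\<^sub>1\<close> of \<open>A\<close> link \<open>\<alpha>\<close> to \<open>\<Delta>\<close>: the coproduct of such an element, covered by \<open>b\<close>, is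
  \<open>f(x\<^sub>0) c\<^sub>1 x\<^sub>1 \<otimes> c\<^sub>2 x\<^sub>2 b\<close> and depends on \<open>x\<close> through \<open>\<alpha>(x)(1 \<otimes> b)\<close> only.
\<close>

lemma mixed_slice:
  assumes f: "f \<in> linear_functional K X" and x: "x \<in> carrier X" and b: "b \<in> carrier A" and c: "c \<in> carrier A"
  shows "D.\<rho> (slice_fst K X A f (\<Lambda> c x)) b = mixed f c (\<rho> x b)"
proof -
  note R = XA.lift_linear[OF X_AA.tensor_module coassoc_r_bilinear[OF b]] XA.lift_tens[OF X_AA.tensor_module coassoc_r_bilinear[OF b]]
  note E2 = XA.lift_linear[OF XAA.tensor_module coassoc_mixed_bil[OF c]] XA.lift_tens[OF XAA.tensor_module coassoc_mixed_bil[OF c]]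
  note sl = XA.slice_fst_linear[OF f]
  have 1: "\<Phi> f (assoc (tensor_lift K X A X_AAm (\<lambda>y a. tx_aa y (D.\<rho> a b)) w)) = D.\<rho> (slice_fst K X A f w) b" if w: "w \<in> carrier XAm" for w
    by (rule XA.tensor_lin_eq[OF AA.tensor_module lin_comp[OF assoc_lin[OF R(1)] \<Phi>_linear[OF f]] lin_comp[OF sl bilin_l[OF D.r_bilinear b]] _ w])
      (use b f in \<open>simp add: R(2) \<Phi>_assoc XA.slice_fst_tens lin_smult[OF bilin_l[OF D.r_bilinear b]] fun_closed\<close>)
  have 2: "\<Phi> f (tensor_lift K X A XAAm (\<lambda>x1 b1. tensor_lift K A A XAAm (\<lambda>c1 b2. txaa (\<Lambda> c1 x1) b2) (D.\<rho> c b1)) w) = mixed f c w"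
    if w: "w \<in> carrier XAm" for w
  proof (rule XA.tensor_lin_eq[OF AA.tensor_module lin_comp[OF E2(1) \<Phi>_linear[OF f]] mixed_linear(1)[OF f c] _ w])
    fix x1 b1 assume p: "x1 \<in> carrier X" "b1 \<in> carrier A"
    note M = left_mid_bil[OF c p(1)]
    have "\<Phi> f (tensor_lift K A A XAAm (\<lambda>c1 b2. txaa (\<Lambda> c1 x1) b2) s) = tensor_lift K A A AAm (\<lambda>c1 b2. taa (slice_fst K X A f (\<Lambda> c1 x1)) b2) s"
      if s: "s \<in> carrier AAm" for s
      by (rule AA.tensor_lin_eq[OF AA.tensor_module lin_comp[OF AA.lift_linear[OF XAA.tensor_module M] \<Phi>_linear[OF f]] AA.lift_linear[OF AA.tensor_module mixed_inner(1)[OF f p(1)]] _ s])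
        (use p f in \<open>simp add: AA.lift_tens[OF XAA.tensor_module M] AA.lift_tens[OF AA.tensor_module mixed_inner(1)] \<Phi>_tens\<close>)
    then show "\<Phi> f (tensor_lift K X A XAAm (\<lambda>x1 b1. tensor_lift K A A XAAm (\<lambda>c1 b2. txaa (\<Lambda> c1 x1) b2) (D.\<rho> c b1)) (txa x1 b1)) = mixed f c (txa x1 b1)"
      using p c f by (simp add: E2(2) mixed_tens(1))
  qed
  show ?thesis
    using arg_cong[OF coassoc_mixed[OF x b c], of "\<Phi> f"] 1[of "\<Lambda> c x"] 2[of "\<rho> x b"] x b c by simp
qed

text \<open>
  The same for \<open>f(x\<^sub>0) x\<^sub>1 c\<close> with the covering factor on the left.
\<close>

lemma mixed_slice':
  assumes f: "f \<in> linear_functional K X" and x: "x \<in> carrier X" and b: "b \<in> carrier A" and c: "c \<in> carrier A"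
  shows "D.\<Lambda> b (slice_fst K X A f (\<rho> x c)) = mixed' f c (\<Lambda> b x)"
proof -
  note R = XA.lift_linear[OF X_AA.tensor_module rl_bil[OF b]] XA.lift_tens[OF X_AA.tensor_module rl_bil[OF b]]
  note E2 = XA.lift_linear[OF XAA.tensor_module coassoc_mixed'_bil[OF c]] XA.lift_tens[OF XAA.tensor_module coassoc_mixed'_bil[OF c]]
  note sl = XA.slice_fst_linear[OF f]
  have 1: "\<Phi> f (assoc (tensor_lift K X A X_AAm (\<lambda>y a. tx_aa y (D.\<Lambda> b a)) w)) = D.\<Lambda> b (slice_fst K X A f w)" if w: "w \<in> carrier XAm" for w
    by (rule XA.tensor_lin_eq[OF AA.tensor_module lin_comp[OF assoc_lin[OF R(1)] \<Phi>_linear[OF f]] lin_comp[OF sl bilin_r[OF D.l_bilinear b]] _ w])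
      (use b f in \<open>simp add: R(2) \<Phi>_assoc XA.slice_fst_tens lin_smult[OF bilin_r[OF D.l_bilinear b]] fun_closed\<close>)
  have 2: "\<Phi> f (tensor_lift K X A XAAm (\<lambda>x1 b1. tensor_lift K A A XAAm (\<lambda>c1 b2. txaa (\<rho> x1 c1) b2) (D.\<Lambda> b1 c)) w) = mixed' f c w"
    if w: "w \<in> carrier XAm" for w
  proof (rule XA.tensor_lin_eq[OF AA.tensor_module lin_comp[OF E2(1) \<Phi>_linear[OF f]] mixed_linear(2)[OF f c] _ w])
    fix x1 b1 assume p: "x1 \<in> carrier X" "b1 \<in> carrier A"
    note M = right_mid_bil[OF p(1)]
    have "\<Phi> f (tensor_lift K A A XAAm (\<lambda>c1 b2. txaa (\<rho> x1 c1) b2) s) = tensor_lift K A A AAm (\<lambda>c1 b2. taa (slice_fst K X A f (\<rho> x1 c1)) b2) s"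
      if s: "s \<in> carrier AAm" for s
      by (rule AA.tensor_lin_eq[OF AA.tensor_module lin_comp[OF AA.lift_linear[OF XAA.tensor_module M] \<Phi>_linear[OF f]] AA.lift_linear[OF AA.tensor_module mixed_inner(2)[OF f p(1)]] _ s])
        (use p f in \<open>simp add: AA.lift_tens[OF XAA.tensor_module M] AA.lift_tens[OF AA.tensor_module mixed_inner(2)] \<Phi>_tens\<close>)
    then show "\<Phi> f (tensor_lift K X A XAAm (\<lambda>x1 b1. tensor_lift K A A XAAm (\<lambda>c1 b2. txaa (\<rho> x1 c1) b2) (D.\<Lambda> b1 c)) (txa x1 b1)) = mixed' f c (txa x1 b1)"
      using p c f by (simp add: E2(2) mixed_tens(2))
  qed
  show ?thesis
    using arg_cong[OF coassoc_mixed'[OF x b c], of "\<Phi> f"] 1[of "\<rho> x c"] 2[of "\<Lambda> b x"] x b c by simp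
qed

lemma slice_mid_bil:
  "h \<in> linear_functional K A \<Longrightarrow> z \<in> carrier X \<Longrightarrow> (\<lambda>x a. txa (slice_snd K X A h (\<gamma> z x)) a) \<in> bilinear_map K X A XAm"
  "h \<in> linear_functional K A \<Longrightarrow> a \<in> carrier A \<Longrightarrow> (\<lambda>y c. txa y (slice_fst K A A h (D.\<rho> c a))) \<in> bilinear_map K X A XAm"
  "h \<in> linear_functional K A \<Longrightarrow> a \<in> carrier A \<Longrightarrow> (\<lambda>y c. txa y (slice_fst K A A h (D.\<Lambda> a c))) \<in> bilinear_map K X A XAm"
  "h \<in> linear_functional K A \<Longrightarrow> a \<in> carrier A \<Longrightarrow> (\<lambda>y c. txa y (slice_snd K A A h (D.\<rho> c a))) \<in> bilinear_map K X A XAm"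
  by (intro bilinear_mapI lins; simp add: closeds lin_closed[OF XA.slice_snd_linear] lin_closed[OF AA.slice_fst_linear]
      lin_closed[OF AA.slice_snd_linear])+

lemma \<Theta>_lift_l:
  assumes h: "h \<in> linear_functional K A" and z: "z \<in> carrier X" and w: "w \<in> carrier XAm"
  shows "\<Theta> h (lift_l z w) = tensor_lift K X A XAm (\<lambda>x a. txa (slice_snd K X A h (\<gamma> z x)) a) w"
proof -
  note L = XA.lift_linear[OF XAA.tensor_module coassoc_l_bilinear[OF z]] XA.lift_tens[OF XAA.tensor_module coassoc_l_bilinear[OF z]]
  note B = slice_mid_bil(1)[OF h z]
  show ?thesis
    by (rule XA.tensor_lin_eq[OF XA.tensor_module lin_comp[OF L(1) \<Theta>_linear[OF h]] XA.lift_linear[OF XA.tensor_module B] _ w])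
      (use h z in \<open>simp add: L(2) XA.lift_tens[OF XA.tensor_module B] \<Theta>_tens\<close>)
qed

text \<open>
  With \<open>h\<close> on the middle leg coassociativity reads \<open>z x\<^sub>0 h(x\<^sub>1) \<otimes> x\<^sub>2 a = z x\<^sub>0 \<otimes> h(x\<^sub>1) x\<^sub>2 a\<close>, where on the
  right \<open>h\<close> meets the coproduct in the way it does in the definition of the modular element.
\<close>

lemma coassoc_slice_mid:
  assumes h: "h \<in> linear_functional K A" and z: "z \<in> carrier X" and x: "x \<in> carrier X" and a: "a \<in> carrier A"
  shows "tensor_lift K X A XAm (\<lambda>x a. txa (slice_snd K X A h (\<gamma> z x)) a) (\<rho> x a) =
    tensor_lift K X A XAm (\<lambda>y c. txa y (slice_fst K A A h (D.\<rho> c a))) (\<gamma> z x)"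
    "tensor_lift K X A XAm (\<lambda>x a. txa (slice_snd K X A h (\<gamma> z x)) a) (\<Lambda> a x) =
    tensor_lift K X A XAm (\<lambda>y c. txa y (slice_fst K A A h (D.\<Lambda> a c))) (\<gamma> z x)"
proof -
  note R = XA.lift_linear[OF X_AA.tensor_module coassoc_r_bilinear[OF a]] XA.lift_tens[OF X_AA.tensor_module coassoc_r_bilinear[OF a]]
  note R' = XA.lift_linear[OF X_AA.tensor_module rl_bil[OF a]] XA.lift_tens[OF X_AA.tensor_module rl_bil[OF a]]
  note B = slice_mid_bil(2)[OF h a] and B' = slice_mid_bil(3)[OF h a]
  have 1: "\<Theta> h (assoc (tensor_lift K X A X_AAm (\<lambda>y c. tx_aa y (D.\<rho> c a)) w)) = tensor_lift K X A XAm (\<lambda>y c. txa y (slice_fst K A A h (D.\<rho> c a))) w"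
    if w: "w \<in> carrier XAm" for w
    by (rule XA.tensor_lin_eq[OF XA.tensor_module lin_comp[OF assoc_lin[OF R(1)] \<Theta>_linear[OF h]] XA.lift_linear[OF XA.tensor_module B] _ w])
      (use h a in \<open>simp add: R(2) XA.lift_tens[OF XA.tensor_module B] \<Theta>_assoc\<close>)
  have 2: "\<Theta> h (assoc (tensor_lift K X A X_AAm (\<lambda>y c. tx_aa y (D.\<Lambda> a c)) w)) = tensor_lift K X A XAm (\<lambda>y c. txa y (slice_fst K A A h (D.\<Lambda> a c))) w"
    if w: "w \<in> carrier XAm" for w
    by (rule XA.tensor_lin_eq[OF XA.tensor_module lin_comp[OF assoc_lin[OF R'(1)] \<Theta>_linear[OF h]] XA.lift_linear[OF XA.tensor_module B'] _ w])
      (use h a in \<open>simp add: R'(2) XA.lift_tens[OF XA.tensor_module B'] \<Theta>_assoc\<close>)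
  show "tensor_lift K X A XAm (\<lambda>x a. txa (slice_snd K X A h (\<gamma> z x)) a) (\<rho> x a) =
    tensor_lift K X A XAm (\<lambda>y c. txa y (slice_fst K A A h (D.\<rho> c a))) (\<gamma> z x)"
    using arg_cong[OF coassoc[OF z x a], of "\<Theta> h"] 1[of "\<gamma> z x"] \<Theta>_lift_l[OF h z, of "\<rho> x a"] x z a by simp
  show "tensor_lift K X A XAm (\<lambda>x a. txa (slice_snd K X A h (\<gamma> z x)) a) (\<Lambda> a x) =
    tensor_lift K X A XAm (\<lambda>y c. txa y (slice_fst K A A h (D.\<Lambda> a c))) (\<gamma> z x)"
    using arg_cong[OF coassoc_l[OF z x a], of "\<Theta> h"] 2[of "\<gamma> z x"] \<Theta>_lift_l[OF h z, of "\<Lambda> a x"] x z a by simp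
qed

lemma slice3_lift_l:
  assumes h: "h \<in> linear_functional K A" and z: "z \<in> carrier X" and w: "w \<in> carrier XAm"
  shows "slice3 h (lift_l z w) = \<gamma> z (slice_snd K X A h w)"
proof -
  note L = XA.lift_linear[OF XAA.tensor_module coassoc_l_bilinear[OF z]] XA.lift_tens[OF XAA.tensor_module coassoc_l_bilinear[OF z]]
  show ?thesis
    by (rule XA.tensor_lin_eq[OF XA.tensor_module XAA.slice_snd_lin[OF h L(1)] lin_comp[OF XA.slice_snd_linear[OF h] bilin_r[OF g_bilinear z]] _ w])
      (use h z in \<open>simp add: L(2) XAA.slice_snd_tens XA.slice_snd_tens lin_smult[OF bilin_r[OF g_bilinear z]] fun_closed\<close>)
qed

text \<open>
  With \<open>h\<close> on the last leg: \<open>(z \<otimes> 1)\<alpha>(x\<^sub>0 h(x\<^sub>1 a)) = z x\<^sub>0 \<otimes> x\<^sub>1 h(x\<^sub>2 a)\<close>.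
\<close>

lemma coassoc_slice_last:
  assumes h: "h \<in> linear_functional K A" and z: "z \<in> carrier X" and x: "x \<in> carrier X" and a: "a \<in> carrier A"
  shows "\<gamma> z (slice_snd K X A h (\<rho> x a)) = tensor_lift K X A XAm (\<lambda>y c. txa y (slice_snd K A A h (D.\<rho> c a))) (\<gamma> z x)"
proof -
  note R = XA.lift_linear[OF X_AA.tensor_module coassoc_r_bilinear[OF a]] XA.lift_tens[OF X_AA.tensor_module coassoc_r_bilinear[OF a]]
  note B = slice_mid_bil(4)[OF h a]
  have 1: "slice3 h (assoc (tensor_lift K X A X_AAm (\<lambda>y c. tx_aa y (D.\<rho> c a)) w)) = tensor_lift K X A XAm (\<lambda>y c. txa y (slice_snd K A A h (D.\<rho> c a))) w"
    if w: "w \<in> carrier XAm" for w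
    by (rule XA.tensor_lin_eq[OF XA.tensor_module XAA.slice_snd_lin[OF h assoc_lin[OF R(1)]] XA.lift_linear[OF XA.tensor_module B] _ w])
      (use h a in \<open>simp add: R(2) XA.lift_tens[OF XA.tensor_module B] slice3_assoc\<close>)
  show ?thesis
    using arg_cong[OF coassoc[OF z x a], of "slice3 h"] 1[of "\<gamma> z x"] slice3_lift_l[OF h z, of "\<rho> x a"] x z a by simp
qed

lemma gg_inner: "a \<in> carrier A \<Longrightarrow> (\<lambda>y' c. tx_aa y' (D.\<gamma> a c)) \<in> bilinear_map K X A X_AAm"
  by (intro bilinear_mapI lins; simp add: closeds)

lemma gg_bil: "x \<in> carrier X \<Longrightarrow>
  (\<lambda>y a. assoc (tensor_lift K X A X_AAm (\<lambda>y' c. tx_aa y' (D.\<gamma> a c)) (\<gamma> y x))) \<in> bilinear_map K X A XAAm"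
  by (intro bilinear_mapI lins gg_inner; simp add: closeds)

abbreviation "left2 a \<equiv> fst (multiplier_tens K XAm A (i2 a) \<one>\<^bsub>A.MX\<^esub>)"

lemma left2_mult: "a \<in> carrier A \<Longrightarrow> multiplier_tens K XAm A (i2 a) \<one>\<^bsub>A.MX\<^esub> \<in> carrier XAA.T.MX"
  by (simp add: XAA.multiplier_tens_closed)

lemma left2_assoc:
  assumes a: "a \<in> carrier A" and y: "y \<in> carrier X" and w: "w \<in> carrier AAm"
  shows "left2 a (assoc (tx_aa y w)) = assoc (tx_aa y (fst (D.i1 a) w))"
  by (rule AA.tensor_lin_eq[OF XAA.tensor_module XAA.T.fst_lin[OF left2_mult[OF a] assoc_lin[OF X_AA.tens_r[OF y]]]
        assoc_lin[OF X_AA.tens_lin_r[OF AA.T.fst_linear[OF AA.in_fst_closed[OF a]] y]] _ w])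
    (use a y in \<open>simp add: closeds XAA.multiplier_tens_apply\<close>)

text \<open>
  In Sweedler notation: \<open>u z\<^sub>0 x\<^sub>0 \<otimes> z\<^sub>1 x\<^sub>1 \<otimes> x\<^sub>2\<close>, computed in two ways. No covering factor from \<open>A\<close> is
  left here, so \<open>h\<close> can be applied to the last leg alone. After multiplication by \<open>d\<close> on the last leg the
  identity is coassociativity for \<open>x\<^sub>2 d\<close>, multiplied from the left by \<open>u z\<^sub>0 \<otimes> z\<^sub>1\<close>.
\<close>

lemma coassoc_gg:
  assumes u: "u \<in> carrier X" and z: "z \<in> carrier X" and x: "x \<in> carrier X"
  shows "lift_l u (\<gamma> z x) =
    tensor_lift K X A XAAm (\<lambda>y a. assoc (tensor_lift K X A X_AAm (\<lambda>y' c. tx_aa y' (D.\<gamma> a c)) (\<gamma> y x))) (\<gamma> u z)"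
    (is "_ = ?R (\<gamma> u z)")
proof (rule XAA.in_snd_right_cancel)
  note L = XA.lift_linear[OF XAA.tensor_module coassoc_l_bilinear[OF u]] XA.lift_tens[OF XAA.tensor_module coassoc_l_bilinear[OF u]]
  note R = XA.lift_linear[OF XAA.tensor_module gg_bil[OF x]] XA.lift_tens[OF XAA.tensor_module gg_bil[OF x]]
  show "lift_l u (\<gamma> z x) \<in> carrier XAAm" "?R (\<gamma> u z) \<in> carrier XAAm"
    using lin_closed[OF L(1)] lin_closed[OF R(1)] u z x by auto
  fix d assume d: "d \<in> carrier A"
  note i3 = XAA.in_snd_closed[OF d]
  have 1: "right3 d (lift_l u w) = lift_l u (snd (i2 d) w)" if w: "w \<in> carrier XAm" for w
    by (rule XA.tensor_lin_eq[OF XAA.tensor_module XAA.T.snd_lin[OF i3 L(1)] lin_comp[OF XA.T.snd_linear[OF XA.in_snd_closed[OF d]] L(1)] _ w])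
      (use d u in \<open>simp add: L(2) A.amult_closed\<close>)
  have B: "(\<lambda>y a. left2 a (lift_l y v)) \<in> bilinear_map K X A XAAm" if v: "v \<in> carrier XAm" for v
  proof (rule bilinear_mapI)
    fix y assume y: "y \<in> carrier X"
    have lc: "lift_l y v \<in> carrier XAAm" by (rule XA.lift_closed[OF XAA.tensor_module coassoc_l_bilinear[OF y] v])
    show "(\<lambda>a. left2 a (lift_l y v)) \<in> linear_map K A XAAm"
      by (rule XAA.T.fst_par_lin[OF lc lin_comp[OF XA.in_snd_linear bilin_l[OF XAA.multiplier_tens_bilinear A.mult_one_closed]]])
  next
    fix a assume a: "a \<in> carrier A"
    show "(\<lambda>y. left2 a (lift_l y v)) \<in> linear_map K X XAAm"
      by (rule XAA.T.fst_lin[OF left2_mult[OF a] XA.lift_lin_par[OF XAA.tensor_module coassoc_l_bilinear _ X.X_module v]])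
        (assumption, rule XAA.tens_lin_l, rule bilin_l[OF g_bilinear], assumption+)
  qed
  have 2: "lift_l u (fst (i1 z) v) = tensor_lift K X A XAAm (\<lambda>y a. left2 a (lift_l y v)) (\<gamma> u z)" if v: "v \<in> carrier XAm" for v
  proof (rule XA.tensor_lin_eq[OF XAA.tensor_module lin_comp[OF XA.T.fst_linear[OF XA.in_fst_closed[OF z]] L(1)] _ _ v])
    have l2: "left2 a (lift_l y (txa x1 a1)) = txaa (fst (i2 a) (\<gamma> y x1)) a1"
      if "a \<in> carrier A" "y \<in> carrier X" "x1 \<in> carrier X" "a1 \<in> carrier A" for a y x1 a1
      using that by (simp add: XA.lift_tens[OF XAA.tensor_module coassoc_l_bilinear] XAA.multiplier_tens_apply)
    show "(\<lambda>v. tensor_lift K X A XAAm (\<lambda>y a. left2 a (lift_l y v)) (\<gamma> u z)) \<in> linear_map K XAm XAAm"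
    proof (rule XA.lift_lin_par[OF XAA.tensor_module B _ XA.tensor_module g_closed[OF u z]], assumption)
      fix y a assume "y \<in> carrier X" "a \<in> carrier A"
      then show "(\<lambda>v. left2 a (lift_l y v)) \<in> linear_map K XAm XAAm"
        by (intro XAA.T.fst_lin[OF left2_mult] XA.lift_linear[OF XAA.tensor_module coassoc_l_bilinear])
    qed
    fix x1 a1 assume p: "x1 \<in> carrier X" "a1 \<in> carrier A"
    note BB = B[OF XA.tens_closed[OF p]]
    have "txaa (snd (\<alpha> x1) w) a1 = tensor_lift K X A XAAm (\<lambda>y a. left2 a (lift_l y (txa x1 a1))) w" if w: "w \<in> carrier XAm" for w
      by (rule XA.tensor_lin_eq[OF XAA.tensor_module XAA.tens_lin_l[OF XA.T.snd_linear[OF \<alpha>_closed[OF p(1)]] p(2)] XA.lift_linear[OF XAA.tensor_module BB] _ w])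
        (use p in \<open>simp add: XA.lift_tens[OF XAA.tensor_module BB] l2 tens_\<alpha>'\<close>)
    then show "lift_l u (fst (i1 z) (txa x1 a1)) = tensor_lift K X A XAAm (\<lambda>y a. left2 a (lift_l y (txa x1 a1))) (\<gamma> u z)"
      using p z u by (simp add: L(2) X.amult_closed g_mult)
  qed
  have 3: "left2 a (lift_l y (\<rho> x d)) = right3 d (assoc (tensor_lift K X A X_AAm (\<lambda>y' c. tx_aa y' (D.\<gamma> a c)) (\<gamma> y x)))"
    if y: "y \<in> carrier X" and a: "a \<in> carrier A" for y a
  proof -
    note RR = XA.lift_linear[OF X_AA.tensor_module coassoc_r_bilinear[OF d]] XA.lift_tens[OF X_AA.tensor_module coassoc_r_bilinear[OF d]]
    note GG = XA.lift_linear[OF X_AA.tensor_module gg_inner[OF a]] XA.lift_tens[OF X_AA.tensor_module gg_inner[OF a]]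
    have "left2 a (assoc (tensor_lift K X A X_AAm (\<lambda>y c. tx_aa y (D.\<rho> c d)) w)) = right3 d (assoc (tensor_lift K X A X_AAm (\<lambda>y' c. tx_aa y' (D.\<gamma> a c)) w))"
      if w: "w \<in> carrier XAm" for w
      by (rule XA.tensor_lin_eq[OF XAA.tensor_module XAA.T.fst_lin[OF left2_mult[OF a] assoc_lin[OF RR(1)]] XAA.T.snd_lin[OF i3 assoc_lin[OF GG(1)]] _ w])
        (use a d in \<open>simp add: RR(2) GG(2) left2_assoc in_snd3_assoc D.i1_r del: assoc_tens\<close>)
    then show ?thesis using coassoc[OF y x d] y x by simp
  qed
  have Bv: "(\<lambda>y a. right3 d (assoc (tensor_lift K X A X_AAm (\<lambda>y' c. tx_aa y' (D.\<gamma> a c)) (\<gamma> y x)))) \<in> bilinear_map K X A XAAm"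
    by (rule XA.bilin_post[OF gg_bil[OF x] XAA.T.snd_linear[OF i3]])
  have "right3 d (lift_l u (\<gamma> z x)) = lift_l u (fst (i1 z) (\<rho> x d))"
    using 1[of "\<gamma> z x"] z x u d by (simp add: i1_r)
  also have "\<dots> = tensor_lift K X A XAAm (\<lambda>y a. left2 a (lift_l y (\<rho> x d))) (\<gamma> u z)"
    using 2[of "\<rho> x d"] x d by simp
  also have "\<dots> = tensor_lift K X A XAAm (\<lambda>y a. right3 d (assoc (tensor_lift K X A X_AAm (\<lambda>y' c. tx_aa y' (D.\<gamma> a c)) (\<gamma> y x)))) (\<gamma> u z)"
    by (rule XA.lift_cong[OF XAA.tensor_module B Bv 3]) (use x d u z in simp_all)
  also have "\<dots> = right3 d (?R (\<gamma> u z))"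
    by (rule XA.lift_push[symmetric, OF XAA.tensor_module XAA.tensor_module gg_bil[OF x] XAA.T.snd_linear[OF i3] g_closed[OF u z]])
  finally show "right3 d (lift_l u (\<gamma> z x)) = right3 d (?R (\<gamma> u z))" .
qed

text \<open>
  Evaluating the last leg of \<open>coassoc_gg\<close> by a left invariant \<open>h\<close>: with \<open>f = x\<^sub>0 h(x\<^sub>1)\<close> it says
  \<open>(u \<otimes> 1)\<alpha>(z f) = (u \<otimes> 1)\<alpha>(z)(f \<otimes> 1)\<close>, which is one half of the coinvariance of \<open>f\<close>.
\<close>

lemma invariant_slice_coinvariant:
  assumes h: "h \<in> linear_functional K A"
    and inv: "\<And>a c. a \<in> carrier A \<Longrightarrow> c \<in> carrier A \<Longrightarrow> slice_snd K A A h (D.\<gamma> a c) = h c \<odot>\<^bsub>A\<^esub> a"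
    and u: "u \<in> carrier X" and z: "z \<in> carrier X" and x: "x \<in> carrier X"
  shows "\<gamma> u (slice_snd K X A h (\<gamma> z x)) =
    tensor_lift K X A XAm (\<lambda>y a. txa (slice_snd K X A h (\<gamma> y x)) a) (\<gamma> u z)"
proof -
  have B: "(\<lambda>y a. txa (slice_snd K X A h (\<gamma> y x)) a) \<in> bilinear_map K X A XAm"
    using h x by (intro bilinear_mapI lins; simp add: closeds lin_closed[OF XA.slice_snd_linear])
  have 1: "slice3 h (assoc (tensor_lift K X A X_AAm (\<lambda>y' c. tx_aa y' (D.\<gamma> a c)) w)) = txa (slice_snd K X A h w) a"
    if w: "w \<in> carrier XAm" and a: "a \<in> carrier A" for w a
  proof -
    note GG = XA.lift_linear[OF X_AA.tensor_module gg_inner[OF a]] XA.lift_tens[OF X_AA.tensor_module gg_inner[OF a]]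
    show ?thesis
      by (rule XA.tensor_lin_eq[OF XA.tensor_module XAA.slice_snd_lin[OF h assoc_lin[OF GG(1)]] XA.tens_lin_l[OF XA.slice_snd_linear[OF h] a] _ w])
        (use a h in \<open>simp add: GG(2) slice3_assoc inv XA.slice_snd_tens lin_smult[OF XA.tens_l] lin_smult[OF XA.tens_r] fun_closed\<close>)
  qed
  have "\<gamma> u (slice_snd K X A h (\<gamma> z x)) = slice3 h (lift_l u (\<gamma> z x))"
    using slice3_lift_l[OF h u, of "\<gamma> z x"] z x by simp
  also have "\<dots> = tensor_lift K X A XAm (\<lambda>y a. slice3 h (assoc (tensor_lift K X A X_AAm (\<lambda>y' c. tx_aa y' (D.\<gamma> a c)) (\<gamma> y x)))) (\<gamma> u z)"
    unfolding coassoc_gg[OF u z x]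
    by (rule XA.lift_push[OF XAA.tensor_module XA.tensor_module gg_bil[OF x] XAA.slice_snd_linear[OF h] g_closed[OF u z]])
  also have "\<dots> = tensor_lift K X A XAm (\<lambda>y a. txa (slice_snd K X A h (\<gamma> y x)) a) (\<gamma> u z)"
    by (rule XA.lift_cong[OF XA.tensor_module XA.bilin_post[OF gg_bil[OF x] XAA.slice_snd_linear[OF h]] B])
      (use 1 x u z in simp_all)
  finally show ?thesis .
qed

end

context tensor_space
begin

lemma bij_lift_induct:
  assumes Z: "module K Z" and b: "b \<in> bilinear_map K V W Z"
    and bij: "bij_betw (tensor_lift K V W Z b) (carrier VW) (carrier Z)"
    and T: "submodule T K Z" and p: "\<And>v w. v \<in> carrier V \<Longrightarrow> w \<in> carrier W \<Longrightarrow> b v w \<in> T" and u: "u \<in> carrier Z"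
  shows "u \<in> T"
proof -
  from bij_betw_imp_surj_on[OF bij] u obtain r where r: "r \<in> carrier VW" "u = tensor_lift K V W Z b r" by blast
  have "r \<in> {r \<in> carrier VW. tensor_lift K V W Z b r \<in> T}"
    by (rule tensor_induct[OF vimage_submod[OF tensor_module Z lift_linear[OF Z b] T] _ r(1)])
      (use p in \<open>simp add: lift_tens[OF Z b]\<close>)
  then show ?thesis using r by simp
qed

text \<open>
  Bijectivity is independent of the order of the tensor factors. It is needed for the canonical map
  \<open>a \<otimes> b \<mapsto> (1 \<otimes> a)\<Delta>(b)\<close>, whose arguments appear in the opposite order.
\<close>

lemma bij_lift_swap:
  assumes Z: "module K Z" and b: "b \<in> bilinear_map K V W Z"
    and bij: "bij_betw (tensor_lift K V W Z b) (carrier VW) (carrier Z)"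
  shows "(\<lambda>w v. b v w) \<in> bilinear_map K W V Z"
    "bij_betw (tensor_lift K W V Z (\<lambda>w v. b v w)) (carrier (tensor K W V)) (carrier Z)"
proof -
  interpret WV: tensor_space K W V ..
  have fb: "(\<lambda>v w. tens K W V w v) \<in> bilinear_map K V W WV.VW"
    by (rule bilinear_mapI) (rule WV.tens_l, assumption, rule WV.tens_r)
  have fb': "(\<lambda>w v. t v w) \<in> bilinear_map K W V VW"
    by (rule bilinear_mapI) (rule tens_l, assumption, rule tens_r)
  note fl = lift_linear[OF WV.tensor_module fb] and fl' = WV.lift_linear[OF tensor_module fb']
  note ft = lift_tens[OF WV.tensor_module fb] and ft' = WV.lift_tens[OF tensor_module fb']
  have 1: "WV.flip (flip u) = u" if "u \<in> carrier VW" for u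
    by (rule tensor_lin_eq[OF tensor_module lin_comp[OF fl fl'] lin_id _ that]) (simp add: ft ft')
  have 2: "flip (WV.flip u) = u" if "u \<in> carrier WV.VW" for u
    by (rule WV.tensor_lin_eq[OF WV.tensor_module lin_comp[OF fl' fl] lin_id _ that]) (simp add: ft ft')
  show bb: "(\<lambda>w v. b v w) \<in> bilinear_map K W V Z"
    by (rule bilinear_mapI) (rule bilin_l[OF b], assumption, rule bilin_r[OF b])
  have e: "tensor_lift K W V Z (\<lambda>w v. b v w) u = (tensor_lift K V W Z b \<circ> WV.flip) u" if "u \<in> carrier WV.VW" for u
    unfolding comp_def
    by (rule WV.tensor_lin_eq[OF Z WV.lift_linear[OF Z bb] lin_comp[OF fl' lift_linear[OF Z b]] _ that])
      (simp add: WV.lift_tens[OF Z bb] ft' lift_tens[OF Z b])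
  have "bij_betw WV.flip (carrier WV.VW) (carrier VW)"
    by (rule bij_betwI[of _ _ _ flip]) (rule funcsetI, rule lin_closed[OF fl'], assumption, rule funcsetI, rule lin_closed[OF fl], assumption, rule 2, assumption, rule 1)
  then have "bij_betw (tensor_lift K V W Z b \<circ> WV.flip) (carrier WV.VW) (carrier Z)"
    by (rule bij_betw_trans[OF _ bij])
  then show "bij_betw (tensor_lift K W V Z (\<lambda>w v. b v w)) (carrier WV.VW) (carrier Z)"
    by (rule iffD2[OF bij_betw_cong, rotated]) (rule e)
qed

text \<open>
  Suppose \<open>\<kappa>\<close> intertwines the map \<open>R\<close> with an injective map \<open>R'\<close>. Then \<open>\<kappa>\<close> kills all slices of a tensor
  that \<open>R\<close> followed by \<open>J\<close> sends to zero: \<open>R'\<close> sends its image under \<open>\<kappa> \<otimes> \<iota>\<close> to zero. This serves with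
  \<open>J = mixed f c\<close> and \<open>\<kappa>(x) = f(x\<^sub>0) c x\<^sub>1\<close>.
\<close>

lemma slice_kernel:
  assumes V': "tensor_space K V' W" and Z: "module K Z" "module K Z'"
    and R: "R \<in> bilinear_map K V W Z" and R': "R' \<in> bilinear_map K V' W Z'"
    and inj: "inj_on (tensor_lift K V' W Z' R') (carrier (tensor K V' W))"
    and \<kappa>: "\<kappa> \<in> linear_map K V V'" and J: "J \<in> linear_map K Z Z'"
    and RJ: "\<And>v w. v \<in> carrier V \<Longrightarrow> w \<in> carrier W \<Longrightarrow> R' (\<kappa> v) w = J (R v w)"
    and u: "u \<in> carrier VW" and z: "J (tensor_lift K V W Z R u) = \<zero>\<^bsub>Z'\<^esub>"
    and h: "h \<in> linear_functional K W"
  shows "\<kappa> (slice_snd K V W h u) = \<zero>\<^bsub>V'\<^esub>"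
proof -
  interpret V': tensor_space K V' W by (rule V')
  have b: "(\<lambda>v w. tens K V' W (\<kappa> v) w) \<in> bilinear_map K V W V'.VW"
    by (rule bilinear_mapI) (rule V'.tens_r, rule lin_closed[OF \<kappa>], assumption, rule V'.tens_lin_l[OF \<kappa>])
  let ?L = "tensor_lift K V W V'.VW (\<lambda>v w. tens K V' W (\<kappa> v) w)"
  note l = lift_linear[OF V'.tensor_module b] lift_tens[OF V'.tensor_module b]
  note R'l = V'.lift_linear[OF Z(2) R']
  have "tensor_lift K V' W Z' R' (?L u) = J (tensor_lift K V W Z R u)"
    by (rule tensor_lin_eq[OF Z(2) lin_comp[OF l(1) R'l] lin_comp[OF lift_linear[OF Z(1) R] J] _ u])
      (simp add: l(2) lin_closed[OF \<kappa>] V'.lift_tens[OF Z(2) R'] lift_tens[OF Z(1) R] RJ)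
  then have "tensor_lift K V' W Z' R' (?L u) = tensor_lift K V' W Z' R' \<zero>\<^bsub>V'.VW\<^esub>"
    using z lin_zero[OF V'.tensor_module Z(2) R'l] by simp
  then have "?L u = \<zero>\<^bsub>V'.VW\<^esub>" by (rule inj_onD[OF inj _ lin_closed[OF l(1) u] mod_zero_closed[OF V'.tensor_module]])
  moreover have "slice_snd K V' W h (?L u) = \<kappa> (slice_snd K V W h u)"
    by (rule tensor_lin_eq[OF V'.V_module lin_comp[OF l(1) V'.slice_snd_linear[OF h]] lin_comp[OF slice_snd_linear[OF h] \<kappa>] _ u])
      (simp add: l(2) slice_snd_tens[OF h] V'.slice_snd_tens[OF h] lin_closed[OF \<kappa>] lin_smult[OF \<kappa>] fun_closed[OF h])
  ultimately show ?thesis using lin_zero[OF V'.tensor_module V'.V_module V'.slice_snd_linear[OF h]] by simp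
qed

end

context covered_hom
begin

lemma \<alpha>_eq_zero:
  assumes inj: "inj_on \<alpha> (carrier X)" and x: "x \<in> carrier X" and z: "\<And>c. c \<in> carrier A \<Longrightarrow> \<Lambda> c x = \<zero>\<^bsub>XAm\<^esub>"
  shows "x = \<zero>\<^bsub>X\<^esub>"
proof -
  have "\<alpha> x = \<alpha> \<zero>\<^bsub>X\<^esub>"
  proof (rule XA.T.mult_eqI_snd)
    fix w assume w: "w \<in> carrier XAm"
    have \<alpha>0: "\<alpha> \<zero>\<^bsub>X\<^esub> = \<zero>\<^bsub>M\<^esub>" by (rule lin_zero[OF X.X_module XA.T.mult_module \<alpha>_linear])
    have zl: "(\<lambda>_. \<zero>\<^bsub>XAm\<^esub>) \<in> linear_map K XAm XAm" by (rule linear_mapI) auto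
    have "snd (\<alpha> x) w = \<zero>\<^bsub>XAm\<^esub>"
      by (rule XA.tensor_lin_eq[OF XA.tensor_module XA.T.snd_linear[OF \<alpha>_closed[OF x]] zl _ w])
        (use x z in \<open>simp add: tens_\<alpha> lin_zero[OF XA.tensor_module XA.tensor_module XA.T.fst_linear[OF XA.in_fst_closed]]\<close>)
    then show "snd (\<alpha> x) w = snd (\<alpha> \<zero>\<^bsub>X\<^esub>) w" using w by (simp add: \<alpha>0)
  qed (use x in simp_all)
  then show ?thesis by (rule inj_onD[OF inj _ x]) simp
qed

lemma r_eq_zero_l:
  assumes x: "x \<in> carrier X" and z: "\<And>a. a \<in> carrier A \<Longrightarrow> \<rho> x a = \<zero>\<^bsub>XAm\<^esub>" and c: "c \<in> carrier A"
  shows "\<Lambda> c x = \<zero>\<^bsub>XAm\<^esub>"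
proof (rule XA.in_snd_right_cancel)
  fix d assume d: "d \<in> carrier A"
  have "snd (i2 d) (\<Lambda> c x) = fst (i2 c) (\<rho> x d)" by (rule i2_r[OF x c d, symmetric])
  also have "\<dots> = \<zero>\<^bsub>XAm\<^esub>"
    unfolding z[OF d] by (rule lin_zero[OF XA.tensor_module XA.tensor_module XA.T.fst_linear[OF XA.in_snd_closed[OF c]]])
  also have "\<dots> = snd (i2 d) \<zero>\<^bsub>XAm\<^esub>"
    by (rule lin_zero[OF XA.tensor_module XA.tensor_module XA.T.snd_linear[OF XA.in_snd_closed[OF d]], symmetric])
  finally show "snd (i2 d) (\<Lambda> c x) = snd (i2 d) \<zero>\<^bsub>XAm\<^esub>" .
qed (use x c in simp_all)

lemma slice_fst_functional_zero:
  assumes "w \<in> carrier XAm" "\<And>f. f \<in> linear_functional K X \<Longrightarrow> slice_fst K X A f w = \<zero>\<^bsub>A\<^esub>"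
  shows "w = \<zero>\<^bsub>XAm\<^esub>"
  by (rule XA.slice_fst_eqI)
    (use assms lin_zero[OF XA.tensor_module A.X_module XA.slice_fst_linear] in simp_all)

lemma slice_snd_functional_zero:
  assumes "w \<in> carrier XAm" "\<And>f. f \<in> linear_functional K A \<Longrightarrow> slice_snd K X A f w = \<zero>\<^bsub>X\<^esub>"
  shows "w = \<zero>\<^bsub>XAm\<^esub>"
  by (rule XA.slice_snd_eqI)
    (use assms lin_zero[OF XA.tensor_module X.X_module XA.slice_snd_linear] in simp_all)

lemma right_right_l:
  assumes "x \<in> carrier X" "e \<in> carrier X" "c \<in> carrier A" "d \<in> carrier A"
  shows "snd (i2 d) (snd (i1 e) (\<Lambda> c x)) = fst (i2 c) (fst (\<alpha> x) (txa e d))"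
  by (rule as_inject) (use assms in \<open>simp_all add: as_ideal as_l i1_i2[symmetric] XA.T.mult_assoc\<close>)

lemma left_left_r:
  assumes "x \<in> carrier X" "e \<in> carrier X" "c \<in> carrier A" "d \<in> carrier A"
  shows "fst (i2 d) (fst (i1 e) (\<rho> x c)) = snd (i2 c) (snd (\<alpha> x) (txa e d))"
  by (rule as_inject) (use assms in \<open>simp_all add: as_ideal as_r i2_i1[symmetric] XA.T.mult_assoc\<close>)

end

context coassociative_coaction
begin

text \<open>
  Let \<open>x \<otimes> b \<mapsto> \<alpha>(x)(1 \<otimes> b)\<close> kill \<open>u\<close>. By \<open>mixed_slice\<close> the canonical map of \<open>A\<close> kills the image of \<open>u\<close>
  under \<open>\<kappa> \<otimes> \<iota>\<close>, where \<open>\<kappa>(x) = f(x\<^sub>0) c x\<^sub>1\<close>; so \<open>\<kappa>\<close> kills the slices of \<open>u\<close>. As \<open>f\<close> and \<open>c\<close> vary, the maps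
  \<open>\<kappa>\<close> detect \<open>\<alpha>(x) = 0\<close>, hence \<open>x = 0\<close>.
\<close>

lemma r_hat_injective:
  assumes T1: "inj_on (tensor_lift K A A AAm D.\<rho>) (carrier AAm)" and \<alpha>: "inj_on \<alpha> (carrier X)"
    and u: "u \<in> carrier XAm" and z: "tensor_lift K X A XAm \<rho> u = \<zero>\<^bsub>XAm\<^esub>"
  shows "u = \<zero>\<^bsub>XAm\<^esub>"
proof (rule slice_snd_functional_zero[OF u])
  fix h assume h: "h \<in> linear_functional K A"
  have xc: "slice_snd K X A h u \<in> carrier X" by (rule lin_closed[OF XA.slice_snd_linear[OF h] u])
  show "slice_snd K X A h u = \<zero>\<^bsub>X\<^esub>"
  proof (rule \<alpha>_eq_zero[OF \<alpha> xc])
    fix c assume c: "c \<in> carrier A"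
    show "\<Lambda> c (slice_snd K X A h u) = \<zero>\<^bsub>XAm\<^esub>"
    proof (rule slice_fst_functional_zero)
      fix f assume f: "f \<in> linear_functional K X"
      show "slice_fst K X A f (\<Lambda> c (slice_snd K X A h u)) = \<zero>\<^bsub>A\<^esub>"
      proof (rule XA.slice_kernel[OF AA.tensor_space_axioms XA.tensor_module AA.tensor_module r_bilinear D.r_bilinear T1 _ mixed_linear(1)[OF f c] _ u _ h,
            where \<kappa> = "\<lambda>x. slice_fst K X A f (\<Lambda> c x)"])
        show "(\<lambda>x. slice_fst K X A f (\<Lambda> c x)) \<in> linear_map K X A" using f c by (intro lins) simp_all
        show "D.\<rho> (slice_fst K X A f (\<Lambda> c v)) w = mixed f c (\<rho> v w)" if "v \<in> carrier X" "w \<in> carrier A" for v w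
          by (rule mixed_slice[OF f that c])
        show "mixed f c (tensor_lift K X A XAm \<rho> u) = \<zero>\<^bsub>AAm\<^esub>"
          unfolding z by (rule lin_zero[OF XA.tensor_module AA.tensor_module mixed_linear(1)[OF f c]])
      qed
    qed (use c xc in simp)
  qed
qed

end

section \<open>Faithfulness of the left invariant functional\<close>

locale modular_quantum_group = algebraic_quantum_group K A \<Delta> \<phi>
  for K :: "('k, 'r) ring_scheme" (structure)
    and A :: "('k, 'a, 'n) module_scheme" (structure)
    and \<Delta> :: "'a \<Rightarrow> ('a \<times> 'a \<Rightarrow> 'k) set multiplier" and \<phi> :: "'a \<Rightarrow> 'k" +
  fixes \<delta> :: "'a multiplier"
  assumes modular: "modular_element K A \<Delta> \<phi> \<delta>"
begin

abbreviation "A2 \<equiv> tensor K A A"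
abbreviation "T3 \<equiv> gal' K A A \<Delta>"
abbreviation "s\<phi> \<equiv> slice_snd K A A \<phi>"
abbreviation "p\<phi> \<equiv> slice_fst K A A \<phi>"

lemmas \<phi> = left_functional
lemmas s_linear = C.XA.slice_snd_linear[OF \<phi>] and p_linear = C.XA.slice_fst_linear[OF \<phi>]
lemmas A2_module = C.XA.tensor_module

lemma \<delta>_closed: "\<delta> \<in> carrier (multiplier_algebra K A)"
  and p_r: "a \<in> carrier A \<Longrightarrow> b \<in> carrier A \<Longrightarrow> p\<phi> (C.\<rho> a b) = \<phi> a \<odot>\<^bsub>A\<^esub> fst \<delta> b"
  and p_l: "a \<in> carrier A \<Longrightarrow> b \<in> carrier A \<Longrightarrow> p\<phi> (C.\<Lambda> b a) = \<phi> a \<odot>\<^bsub>A\<^esub> snd \<delta> b"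
  using modular unfolding modular_element_def act_r_def act_l_def by simp_all

lemma s_T3: "a \<in> carrier A \<Longrightarrow> b \<in> carrier A \<Longrightarrow> s\<phi> (T3 a b) = \<phi> a \<odot>\<^bsub>A\<^esub> b"
  unfolding gal'_def by (rule left_invariant)

lemma g_T3:
  assumes "a \<in> carrier A" "b \<in> carrier A" "c \<in> carrier A"
  shows "snd (C.i1 c) (C.\<gamma> b a) = fst (C.i1 b) (T3 a c)"
  by (rule C.as_inject) (use assms in \<open>simp_all add: C.as_ideal C.as_g as_T3 C.XA.T.mult_assoc\<close>)

lemma T3_mult:
  assumes "x \<in> carrier A" "a \<in> carrier A" "c \<in> carrier A"
  shows "T3 (x \<otimes>\<^bsub>A\<^esub> a) c = fst (\<Delta> x) (T3 a c)"
  by (rule C.as_inject) (use assms in \<open>simp_all add: C.as_ideal as_T3 C.\<alpha>_mult amult_closed C.XA.T.mult_assoc\<close>)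

text \<open>
  Left invariance for \<open>(b \<otimes> 1)\<Delta>(a)\<close>, from the version with \<open>b\<close> on the right by multiplying with \<open>c \<otimes> 1\<close>.
\<close>

lemma s_g:
  assumes a: "a \<in> carrier A" and b: "b \<in> carrier A"
  shows "s\<phi> (C.\<gamma> b a) = \<phi> a \<odot>\<^bsub>A\<^esub> b"
proof (rule nondeg_l)
  have fa: "\<phi> a \<in> carrier K" by (rule fun_closed[OF \<phi> a])
  show "s\<phi> (C.\<gamma> b a) \<in> carrier A" "\<phi> a \<odot>\<^bsub>A\<^esub> b \<in> carrier A" using a b fa lin_closed[OF s_linear] by auto
  fix c assume c: "c \<in> carrier A"
  have "s\<phi> (C.\<gamma> b a) \<otimes>\<^bsub>A\<^esub> c = s\<phi> (fst (C.i1 b) (T3 a c))"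
    using C.slice_snd_i1(2)[OF \<phi> c C.g_closed[OF b a]] g_T3[OF a b c] by simp
  also have "\<dots> = (\<phi> a \<odot>\<^bsub>A\<^esub> b) \<otimes>\<^bsub>A\<^esub> c"
    using C.slice_snd_i1(1)[OF \<phi> b T3_closed[OF a c]] a b c fa by (simp add: s_T3 amult_smult_l amult_smult_r)
  finally show "s\<phi> (C.\<gamma> b a) \<otimes>\<^bsub>A\<^esub> c = (\<phi> a \<odot>\<^bsub>A\<^esub> b) \<otimes>\<^bsub>A\<^esub> c" .
qed

lemma smult_eq_zero:
  assumes c: "c \<in> carrier K" and a: "a \<in> carrier A" "a \<noteq> \<zero>\<^bsub>A\<^esub>" and z: "c \<odot>\<^bsub>A\<^esub> a = \<zero>\<^bsub>A\<^esub>"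
  shows "c = \<zero>"
proof (rule ccontr)
  assume "c \<noteq> \<zero>"
  then have u: "c \<in> Units K" using c field_Units by simp
  have "a = (inv c \<otimes> c) \<odot>\<^bsub>A\<^esub> a" using u a(1) by simp
  also have "\<dots> = inv c \<odot>\<^bsub>A\<^esub> (c \<odot>\<^bsub>A\<^esub> a)" by (rule smult_assoc1[OF Units_inv_closed[OF u] c a(1)])
  also have "\<dots> = \<zero>\<^bsub>A\<^esub>" unfolding z by (rule smult_r_null[OF Units_inv_closed[OF u]])
  finally show False using a(2) by simp
qed

lemma p_nonzero: "\<exists>w\<in>carrier A2. p\<phi> w \<noteq> \<zero>\<^bsub>A\<^esub>"
proof -
  obtain a where a: "a \<in> carrier A" "\<phi> a \<noteq> \<zero>" using left_functional_nonzero by blast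
  obtain b where b: "b \<in> carrier A" "b \<noteq> \<zero>\<^bsub>A\<^esub>" using nonzero M.zero_closed by blast
  have "p\<phi> (tens K A A a b) \<noteq> \<zero>\<^bsub>A\<^esub>"
    unfolding C.XA.slice_fst_tens[OF \<phi> a(1) b(1)] using smult_eq_zero[OF fun_closed[OF \<phi> a(1)] b] a(2) by blast
  then show ?thesis by (rule bexI[OF _ C.XA.tens_closed[OF a(1) b(1)]])
qed

text \<open>
  The slices \<open>(\<phi> \<otimes> \<iota>)(\<Delta>(a)(1 \<otimes> b)) = \<phi>(a) \<delta> b\<close> cannot all vanish, because the tensors \<open>\<Delta>(a)(1 \<otimes> b)\<close> exhaust
  \<open>A \<otimes> A\<close>.
\<close>

lemma \<delta>_l_nonzero: "\<exists>d\<in>carrier A. fst \<delta> d \<noteq> \<zero>\<^bsub>A\<^esub>"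
proof (rule ccontr)
  assume n: "\<not> ?thesis"
  have "w \<in> {w \<in> carrier A2. p\<phi> w \<in> {\<zero>\<^bsub>A\<^esub>}}" if "w \<in> carrier A2" for w
    by (rule C.XA.bij_lift_induct[OF A2_module C.r_bilinear T1_bij vimage_submod[OF A2_module X_module p_linear zero_submod[OF X_module]] _ that])
      (use n fun_closed[OF \<phi>] in \<open>simp_all add: p_r\<close>)
  then show False using p_nonzero by simp
qed

lemma \<delta>_r_nonzero: "\<exists>d\<in>carrier A. snd \<delta> d \<noteq> \<zero>\<^bsub>A\<^esub>"
proof (rule ccontr)
  assume n: "\<not> ?thesis"
  have "w \<in> {w \<in> carrier A2. p\<phi> w \<in> {\<zero>\<^bsub>A\<^esub>}}" if "w \<in> carrier A2" for w
    by (rule C.XA.bij_lift_induct[OF A2_module C.l_bilinear T4_bij vimage_submod[OF A2_module X_module p_linear zero_submod[OF X_module]] _ that])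
      (use n fun_closed[OF \<phi>] in \<open>simp_all add: p_l\<close>)
  then show False using p_nonzero by simp
qed

text \<open>The two radicals of \<open>\<phi>\<close>.\<close>

definition "Nr = {n \<in> carrier A. \<forall>b\<in>carrier A. \<phi> (n \<otimes>\<^bsub>A\<^esub> b) = \<zero>}"
definition "Nl = {n \<in> carrier A. \<forall>b\<in>carrier A. \<phi> (b \<otimes>\<^bsub>A\<^esub> n) = \<zero>}"

lemma Nr_submod: "submodule Nr K A"
  by (rule submodI[OF X_module])
    (simp_all add: subset_iff Nr_def amult_l_distr amult_smult_l amult_closed fun_add[OF \<phi>] fun_smult[OF \<phi>] fun_zero[OF X_module \<phi>])

lemma Nl_submod: "submodule Nl K A"
  by (rule submodI[OF X_module])
    (simp_all add: subset_iff Nl_def amult_r_distr amult_smult_r amult_closed fun_add[OF \<phi>] fun_smult[OF \<phi>] fun_zero[OF X_module \<phi>])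

text \<open>
  \<open>\<Delta>(n)T(a \<otimes> c) = T(n a \<otimes> c)\<close> for the canonical maps \<open>T\<close> with the coproduct on the left, and the slices of
  \<open>T(n a \<otimes> c)\<close> are multiples of \<open>\<phi>(n a)\<close>. Since \<open>T\<close> is onto, \<open>\<Delta>(n)w\<close> has vanishing slices for every \<open>w\<close>.
\<close>

lemma Nr_slices:
  assumes n: "n \<in> Nr" and w: "w \<in> carrier A2"
  shows "s\<phi> (fst (\<Delta> n) w) = \<zero>\<^bsub>A\<^esub>" "p\<phi> (fst (\<Delta> n) w) = \<zero>\<^bsub>A\<^esub>"
proof -
  have nc: "n \<in> carrier A" and nz: "\<And>b. b \<in> carrier A \<Longrightarrow> \<phi> (n \<otimes>\<^bsub>A\<^esub> b) = \<zero>" using n by (simp_all add: Nr_def)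
  note fl = C.XA.T.fst_linear[OF C.\<alpha>_closed[OF nc]]
  have "w \<in> {w \<in> carrier A2. s\<phi> (fst (\<Delta> n) w) \<in> {\<zero>\<^bsub>A\<^esub>}}"
    by (rule C.XA.bij_lift_induct[OF A2_module T3_bilinear T3_bij vimage_submod[OF A2_module X_module lin_comp[OF fl s_linear] zero_submod[OF X_module]] _ w])
      (use nc nz in \<open>simp add: T3_mult[symmetric] s_T3 amult_closed\<close>)
  then show "s\<phi> (fst (\<Delta> n) w) = \<zero>\<^bsub>A\<^esub>" by simp
  have "w \<in> {w \<in> carrier A2. p\<phi> (fst (\<Delta> n) w) \<in> {\<zero>\<^bsub>A\<^esub>}}"
    by (rule C.XA.bij_lift_induct[OF A2_module C.r_bilinear T1_bij vimage_submod[OF A2_module X_module lin_comp[OF fl p_linear] zero_submod[OF X_module]] _ w])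
      (use nc nz fst_closed[OF \<delta>_closed] in \<open>simp add: C.r_mult[symmetric] p_r amult_closed\<close>)
  then show "p\<phi> (fst (\<Delta> n) w) = \<zero>\<^bsub>A\<^esub>" by simp
qed

lemma Nl_slices:
  assumes n: "n \<in> Nl" and w: "w \<in> carrier A2"
  shows "s\<phi> (snd (\<Delta> n) w) = \<zero>\<^bsub>A\<^esub>" "p\<phi> (snd (\<Delta> n) w) = \<zero>\<^bsub>A\<^esub>"
proof -
  have nc: "n \<in> carrier A" and nz: "\<And>b. b \<in> carrier A \<Longrightarrow> \<phi> (b \<otimes>\<^bsub>A\<^esub> n) = \<zero>" using n by (simp_all add: Nl_def)
  note fl = C.XA.T.snd_linear[OF C.\<alpha>_closed[OF nc]]
  have "w \<in> {w \<in> carrier A2. s\<phi> (snd (\<Delta> n) w) \<in> {\<zero>\<^bsub>A\<^esub>}}"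
    by (rule C.XA.bij_lift_induct[OF A2_module C.g_bilinear T2_bij vimage_submod[OF A2_module X_module lin_comp[OF fl s_linear] zero_submod[OF X_module]] _ w])
      (use nc nz in \<open>simp add: C.g_mult[symmetric] s_g amult_closed\<close>)
  then show "s\<phi> (snd (\<Delta> n) w) = \<zero>\<^bsub>A\<^esub>" by simp
  have "w \<in> {w \<in> carrier A2. p\<phi> (snd (\<Delta> n) w) \<in> {\<zero>\<^bsub>A\<^esub>}}"
    by (rule C.XA.bij_lift_induct[OF A2_module C.l_bilinear T4_bij vimage_submod[OF A2_module X_module lin_comp[OF fl p_linear] zero_submod[OF X_module]] _ w])
      (use nc nz snd_closed[OF \<delta>_closed] in \<open>simp add: C.l_mult[symmetric] p_l amult_closed\<close>)
  then show "p\<phi> (snd (\<Delta> n) w) = \<zero>\<^bsub>A\<^esub>" by simp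
qed

text \<open>
  Conversely \<open>\<phi>(x b) \<delta> d\<close> is a slice of \<open>\<Delta>(x)\<Delta>(b)(1 \<otimes> d)\<close>; choose \<open>d\<close> with \<open>\<delta> d\<close> non-zero.
\<close>

lemma NrI:
  assumes x: "x \<in> carrier A" and z: "\<And>w. w \<in> carrier A2 \<Longrightarrow> p\<phi> (fst (\<Delta> x) w) = \<zero>\<^bsub>A\<^esub>"
  shows "x \<in> Nr"
proof -
  obtain d where d: "d \<in> carrier A" "fst \<delta> d \<noteq> \<zero>\<^bsub>A\<^esub>" using \<delta>_l_nonzero by blast
  have "\<phi> (x \<otimes>\<^bsub>A\<^esub> b) = \<zero>" if b: "b \<in> carrier A" for b
    using z[of "C.\<rho> b d"] x b d fst_closed[OF \<delta>_closed d(1)]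
    by (intro smult_eq_zero[OF _ _ d(2)]) (simp_all add: C.r_mult[symmetric] p_r amult_closed fun_closed[OF \<phi>])
  then show ?thesis using x by (simp add: Nr_def)
qed

lemma NlI:
  assumes x: "x \<in> carrier A" and z: "\<And>w. w \<in> carrier A2 \<Longrightarrow> p\<phi> (snd (\<Delta> x) w) = \<zero>\<^bsub>A\<^esub>"
  shows "x \<in> Nl"
proof -
  obtain d where d: "d \<in> carrier A" "snd \<delta> d \<noteq> \<zero>\<^bsub>A\<^esub>" using \<delta>_r_nonzero by blast
  have "\<phi> (b \<otimes>\<^bsub>A\<^esub> x) = \<zero>" if b: "b \<in> carrier A" for b
    using z[of "C.\<Lambda> d b"] x b d snd_closed[OF \<delta>_closed d(1)]
    by (intro smult_eq_zero[OF _ _ d(2)]) (simp_all add: C.l_mult[symmetric] p_l amult_closed fun_closed[OF \<phi>])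
  then show ?thesis using x by (simp add: Nl_def)
qed

lemma \<phi>_mult_nonzero: "\<exists>b\<in>carrier A. \<exists>d\<in>carrier A. \<phi> (b \<otimes>\<^bsub>A\<^esub> d) \<noteq> \<zero>"
proof (rule ccontr)
  assume n: "\<not> ?thesis"
  have "w \<in> {w \<in> carrier A2. p\<phi> w \<in> {\<zero>\<^bsub>A\<^esub>}}" if "w \<in> carrier A2" for w
  proof (rule span_carrier_subset[OF comult_nondegenerate_l vimage_submod[OF A2_module X_module p_linear zero_submod[OF X_module]] _ that],
      rule subsetI, elim CollectE exE conjE)
    fix u a v assume u: "u = fst (\<Delta> a) v" "a \<in> carrier A" "v \<in> carrier A2"
    have "a \<in> Nr" using n u(2) by (simp add: Nr_def)
    then show "u \<in> {w \<in> carrier A2. p\<phi> w \<in> {\<zero>\<^bsub>A\<^esub>}}" using Nr_slices(2)[OF _ u(3)] u by simp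
  qed
  then show False using p_nonzero by simp
qed

lemma \<phi>r: "e \<in> carrier A \<Longrightarrow> (\<lambda>a. \<phi> (a \<otimes>\<^bsub>A\<^esub> e)) \<in> linear_functional K A"
  by (rule fun_comp[OF mult_lin_l \<phi>])

lemma \<phi>l: "e \<in> carrier A \<Longrightarrow> (\<lambda>a. \<phi> (e \<otimes>\<^bsub>A\<^esub> a)) \<in> linear_functional K A"
  by (rule fun_comp[OF mult_lin_r \<phi>])

lemma slice_fst_comp_i1:
  assumes "e \<in> carrier A" "w \<in> carrier A2"
  shows "slice_fst K A A (\<lambda>a. \<phi> (a \<otimes>\<^bsub>A\<^esub> e)) w = p\<phi> (snd (C.i1 e) w)"
    "slice_fst K A A (\<lambda>a. \<phi> (e \<otimes>\<^bsub>A\<^esub> a)) w = p\<phi> (fst (C.i1 e) w)"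
proof -
  note e = assms(1)
  show "slice_fst K A A (\<lambda>a. \<phi> (a \<otimes>\<^bsub>A\<^esub> e)) w = p\<phi> (snd (C.i1 e) w)"
    by (rule C.XA.tensor_lin_eq[OF X_module C.XA.slice_fst_linear[OF \<phi>r[OF e]] lin_comp[OF C.XA.T.snd_linear[OF C.XA.in_fst_closed[OF e]] p_linear] _ assms(2)])
      (use e in \<open>simp add: C.XA.slice_fst_tens \<phi>r \<phi> amult_closed\<close>)
  show "slice_fst K A A (\<lambda>a. \<phi> (e \<otimes>\<^bsub>A\<^esub> a)) w = p\<phi> (fst (C.i1 e) w)"
    by (rule C.XA.tensor_lin_eq[OF X_module C.XA.slice_fst_linear[OF \<phi>l[OF e]] lin_comp[OF C.XA.T.fst_linear[OF C.XA.in_fst_closed[OF e]] p_linear] _ assms(2)])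
      (use e in \<open>simp add: C.XA.slice_fst_tens \<phi>l \<phi> amult_closed\<close>)
qed

lemma p_l_cover:
  assumes "x \<in> carrier A" "e \<in> carrier A" "c \<in> carrier A" "d \<in> carrier A"
  shows "slice_fst K A A (\<lambda>a. \<phi> (a \<otimes>\<^bsub>A\<^esub> e)) (C.\<Lambda> c x) \<otimes>\<^bsub>A\<^esub> d = c \<otimes>\<^bsub>A\<^esub> p\<phi> (fst (\<Delta> x) (tens K A A e d))"
  using assms C.right_right_l[OF assms] C.slice_fst_i1(1)[OF \<phi> assms(3), of "fst (\<Delta> x) (tens K A A e d)"]
    C.slice_fst_i1(2)[OF \<phi> assms(4), of "snd (C.i1 e) (C.\<Lambda> c x)"]
  by (simp add: slice_fst_comp_i1)

lemma p_r_cover: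
  assumes "x \<in> carrier A" "e \<in> carrier A" "c \<in> carrier A" "d \<in> carrier A"
  shows "d \<otimes>\<^bsub>A\<^esub> slice_fst K A A (\<lambda>a. \<phi> (e \<otimes>\<^bsub>A\<^esub> a)) (C.\<rho> x c) = p\<phi> (snd (\<Delta> x) (tens K A A e d)) \<otimes>\<^bsub>A\<^esub> c"
  using assms C.left_left_r[OF assms] C.slice_fst_i1(2)[OF \<phi> assms(3), of "snd (\<Delta> x) (tens K A A e d)"]
    C.slice_fst_i1(1)[OF \<phi> assms(4), of "fst (C.i1 e) (C.\<rho> x c)"]
  by (simp add: slice_fst_comp_i1)

text \<open>
  The slices \<open>(\<phi> \<otimes> \<iota>)(\<Delta>(x)w)\<close> of \<open>Nr_slices\<close> and \<open>NrI\<close> are rewritten as slices of \<open>(1 \<otimes> c)\<Delta>(x)\<close> by the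
  functionals \<open>\<phi>(\<cdot> e)\<close>. In this form they are values of the maps \<open>\<kappa>\<close> to which \<open>slice_kernel\<close> applies.
\<close>

lemma Nr_iff:
  assumes x: "x \<in> carrier A"
  shows "x \<in> Nr \<longleftrightarrow> (\<forall>e\<in>carrier A. \<forall>c\<in>carrier A. slice_fst K A A (\<lambda>a. \<phi> (a \<otimes>\<^bsub>A\<^esub> e)) (C.\<Lambda> c x) = \<zero>\<^bsub>A\<^esub>)"
proof (intro iffI ballI)
  fix e c assume n: "x \<in> Nr" and e: "e \<in> carrier A" and c: "c \<in> carrier A"
  show "slice_fst K A A (\<lambda>a. \<phi> (a \<otimes>\<^bsub>A\<^esub> e)) (C.\<Lambda> c x) = \<zero>\<^bsub>A\<^esub>"
    by (rule nondegenerate_l) (use x e c n in \<open>simp_all add: lin_closed[OF C.XA.slice_fst_linear[OF \<phi>r[OF e]]] p_l_cover Nr_slices\<close>)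
next
  assume z: "\<forall>e\<in>carrier A. \<forall>c\<in>carrier A. slice_fst K A A (\<lambda>a. \<phi> (a \<otimes>\<^bsub>A\<^esub> e)) (C.\<Lambda> c x) = \<zero>\<^bsub>A\<^esub>"
  show "x \<in> Nr"
  proof (rule NrI[OF x])
    fix w assume w: "w \<in> carrier A2"
    note fl = lin_comp[OF C.XA.T.fst_linear[OF C.\<alpha>_closed[OF x]] p_linear]
    have "w \<in> {w \<in> carrier A2. p\<phi> (fst (\<Delta> x) w) \<in> {\<zero>\<^bsub>A\<^esub>}}"
    proof (rule C.XA.tensor_induct[OF vimage_submod[OF A2_module X_module fl zero_submod[OF X_module]] _ w])
      fix e d assume ed: "e \<in> carrier A" "d \<in> carrier A"
      have "p\<phi> (fst (\<Delta> x) (tens K A A e d)) = \<zero>\<^bsub>A\<^esub>"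
        by (rule nondegenerate_r) (use x ed z in \<open>simp_all add: lin_closed[OF fl] p_l_cover[symmetric]\<close>)
      then show "tens K A A e d \<in> {w \<in> carrier A2. p\<phi> (fst (\<Delta> x) w) \<in> {\<zero>\<^bsub>A\<^esub>}}" using ed by simp
    qed
    then show "p\<phi> (fst (\<Delta> x) w) = \<zero>\<^bsub>A\<^esub>" by simp
  qed
qed

lemma Nl_iff:
  assumes x: "x \<in> carrier A"
  shows "x \<in> Nl \<longleftrightarrow> (\<forall>e\<in>carrier A. \<forall>c\<in>carrier A. slice_fst K A A (\<lambda>a. \<phi> (e \<otimes>\<^bsub>A\<^esub> a)) (C.\<rho> x c) = \<zero>\<^bsub>A\<^esub>)"
proof (intro iffI ballI)
  fix e c assume n: "x \<in> Nl" and e: "e \<in> carrier A" and c: "c \<in> carrier A"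
  show "slice_fst K A A (\<lambda>a. \<phi> (e \<otimes>\<^bsub>A\<^esub> a)) (C.\<rho> x c) = \<zero>\<^bsub>A\<^esub>"
    by (rule nondegenerate_r) (use x e c n in \<open>simp_all add: lin_closed[OF C.XA.slice_fst_linear[OF \<phi>l[OF e]]] p_r_cover Nl_slices\<close>)
next
  assume z: "\<forall>e\<in>carrier A. \<forall>c\<in>carrier A. slice_fst K A A (\<lambda>a. \<phi> (e \<otimes>\<^bsub>A\<^esub> a)) (C.\<rho> x c) = \<zero>\<^bsub>A\<^esub>"
  show "x \<in> Nl"
  proof (rule NlI[OF x])
    fix w assume w: "w \<in> carrier A2"
    note fl = lin_comp[OF C.XA.T.snd_linear[OF C.\<alpha>_closed[OF x]] p_linear]
    have "w \<in> {w \<in> carrier A2. p\<phi> (snd (\<Delta> x) w) \<in> {\<zero>\<^bsub>A\<^esub>}}"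
    proof (rule C.XA.tensor_induct[OF vimage_submod[OF A2_module X_module fl zero_submod[OF X_module]] _ w])
      fix e d assume ed: "e \<in> carrier A" "d \<in> carrier A"
      have "p\<phi> (snd (\<Delta> x) (tens K A A e d)) = \<zero>\<^bsub>A\<^esub>"
        by (rule nondegenerate_l) (use x ed z in \<open>simp_all add: lin_closed[OF fl] p_r_cover[symmetric]\<close>)
      then show "tens K A A e d \<in> {w \<in> carrier A2. p\<phi> (snd (\<Delta> x) w) \<in> {\<zero>\<^bsub>A\<^esub>}}" using ed by simp
    qed
    then show "p\<phi> (snd (\<Delta> x) w) = \<zero>\<^bsub>A\<^esub>" by simp
  qed
qed

text \<open>
  A tensor \<open>r\<close> whose slices lie in \<open>N\<close> is a sum of pure tensors \<open>n \<otimes> c\<close> with \<open>n\<close> in \<open>N\<close>, so what is known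
  of the values of \<open>R\<close> on these carries over to \<open>r\<close>.
\<close>

lemma slice_of_preimage:
  assumes R: "R \<in> bilinear_map K A A A2" and N: "submodule N K A" and r: "r \<in> carrier A2"
    and sl: "\<And>h. h \<in> linear_functional K A \<Longrightarrow> slice_snd K A A h r \<in> N"
    and f: "f \<in> linear_functional K A"
    and z: "\<And>n c. n \<in> N \<Longrightarrow> c \<in> carrier A \<Longrightarrow> slice_snd K A A f (R n c) = \<zero>\<^bsub>A\<^esub>"
  shows "slice_snd K A A f (tensor_lift K A A A2 R r) = \<zero>\<^bsub>A\<^esub>"
proof -
  note l = lin_comp[OF C.XA.lift_linear[OF A2_module R] C.XA.slice_snd_linear[OF f]]
  let ?S = "{r \<in> carrier A2. slice_snd K A A f (tensor_lift K A A A2 R r) \<in> {\<zero>\<^bsub>A\<^esub>}}"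
  have S: "submodule ?S K A2" by (rule vimage_submod[OF A2_module X_module l zero_submod[OF X_module]])
  have "r \<in> ?S"
  proof (rule C.XA.slice_elimination[of "linear_functional K A", OF _ N S _ _ r sl])
    show "tens K A A n c \<in> ?S" if "n \<in> N" "c \<in> carrier A" for n c
      using that z subsetD[OF submod_subset[OF X_module N]] by (simp add: C.XA.lift_tens[OF A2_module R])
    show "tens K A A v w \<in> ?S" if v: "v \<in> carrier A" "w \<in> carrier A" "\<forall>h\<in>linear_functional K A. h w = \<zero>" for v w
    proof -
      have "w = \<zero>\<^bsub>A\<^esub>" by (rule C.XA.functional_zero[OF X_module v(2)]) (use v(3) in blast)
      then show ?thesis using v(1) submod_zero[OF A2_module S] by simp
    qed
  qed auto
  then show ?thesis by simp
qed

text \<open>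
  Write \<open>a \<otimes> b\<close> as the image of \<open>r\<close> under the canonical map \<open>x \<otimes> c \<mapsto> \<Delta>(x)(1 \<otimes> c)\<close>. The conditions of
  \<open>Nr_iff\<close> for \<open>a\<close> pass to the slices of \<open>r\<close> by \<open>slice_kernel\<close>, so these lie in the radical. Then
  \<open>(\<iota> \<otimes> \<phi>(\<cdot> d))(a \<otimes> b) = \<phi>(b d) a\<close> vanishes by \<open>Nr_slices\<close>, and \<open>b\<close>, \<open>d\<close> can be chosen with
  \<open>\<phi>(b d)\<close> non-zero.
\<close>

lemma \<phi>_faithful_r:
  assumes a: "a \<in> Nr" shows "a = \<zero>\<^bsub>A\<^esub>"
proof -
  have ac: "a \<in> carrier A" using a by (simp add: Nr_def)
  obtain b d where b: "b \<in> carrier A" and d: "d \<in> carrier A" and bd: "\<phi> (b \<otimes>\<^bsub>A\<^esub> d) \<noteq> \<zero>" using \<phi>_mult_nonzero by blast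
  have "tens K A A a b \<in> tensor_lift K A A A2 C.\<rho> ` carrier A2"
    using bij_betw_imp_surj_on[OF T1_bij] C.XA.tens_closed[OF ac b] by simp
  then obtain r where r: "tens K A A a b = tensor_lift K A A A2 C.\<rho> r" "r \<in> carrier A2" by (rule imageE)
  have "slice_snd K A A h r \<in> Nr" if h: "h \<in> linear_functional K A" for h
  proof -
    have c: "slice_snd K A A h r \<in> carrier A" by (rule lin_closed[OF C.XA.slice_snd_linear[OF h] r(2)])
    have "slice_fst K A A (\<lambda>a. \<phi> (a \<otimes>\<^bsub>A\<^esub> e)) (C.\<Lambda> c (slice_snd K A A h r)) = \<zero>\<^bsub>A\<^esub>"
      if e: "e \<in> carrier A" and c: "c \<in> carrier A" for e c
    proof (rule C.XA.slice_kernel[OF C.XA.tensor_space_axioms A2_module A2_module C.r_bilinear C.r_bilinear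
          bij_betw_imp_inj_on[OF T1_bij] _ C.mixed_linear(1)[OF \<phi>r[OF e] c] _ r(2) _ h,
            where \<kappa> = "\<lambda>x. slice_fst K A A (\<lambda>a. \<phi> (a \<otimes>\<^bsub>A\<^esub> e)) (C.\<Lambda> c x)"])
      note f = \<phi>r[OF e]
      show "(\<lambda>x. slice_fst K A A (\<lambda>a. \<phi> (a \<otimes>\<^bsub>A\<^esub> e)) (C.\<Lambda> c x)) \<in> linear_map K A A"
        by (rule lin_comp[OF bilin_r[OF C.l_bilinear c] C.XA.slice_fst_linear[OF f]])
      show "C.\<rho> (slice_fst K A A (\<lambda>a. \<phi> (a \<otimes>\<^bsub>A\<^esub> e)) (C.\<Lambda> c v)) w = C.mixed (\<lambda>a. \<phi> (a \<otimes>\<^bsub>A\<^esub> e)) c (C.\<rho> v w)"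
        if "v \<in> carrier A" "w \<in> carrier A" for v w
        by (rule C.mixed_slice[OF f that c])
      have z: "slice_fst K A A (\<lambda>a. \<phi> (a \<otimes>\<^bsub>A\<^esub> e)) (C.\<Lambda> c1 a) = \<zero>\<^bsub>A\<^esub>" if "c1 \<in> carrier A" for c1
        using a Nr_iff[OF ac] e that by blast
      have zl: "(\<lambda>_. \<zero>\<^bsub>A2\<^esub>) \<in> linear_map K A2 A2" by (rule linear_mapI) auto
      have "tensor_lift K A A A2 (\<lambda>c1 b2. tens K A A (slice_fst K A A (\<lambda>a. \<phi> (a \<otimes>\<^bsub>A\<^esub> e)) (C.\<Lambda> c1 a)) b2) (C.\<rho> c b) = \<zero>\<^bsub>A2\<^esub>"
        by (rule C.XA.lift_unique[OF A2_module C.mixed_inner(1)[OF f ac] zl]) (use z b c in simp_all)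
      then show "C.mixed (\<lambda>a. \<phi> (a \<otimes>\<^bsub>A\<^esub> e)) c (tensor_lift K A A A2 C.\<rho> r) = \<zero>\<^bsub>A2\<^esub>"
        unfolding r(1)[symmetric] using C.mixed_tens(1)[OF f c ac b] by simp
    qed
    then show ?thesis using Nr_iff[OF c] by blast
  qed
  then have "slice_snd K A A (\<lambda>x. \<phi> (x \<otimes>\<^bsub>A\<^esub> d)) (tensor_lift K A A A2 C.\<rho> r) = \<zero>\<^bsub>A\<^esub>"
  proof (rule slice_of_preimage[OF C.r_bilinear Nr_submod r(2) _ \<phi>r[OF d]])
    fix n c assume n: "n \<in> Nr" and c: "c \<in> carrier A"
    have nc: "n \<in> carrier A" using n by (simp add: Nr_def)
    have cd: "c \<otimes>\<^bsub>A\<^esub> d \<in> carrier A" using c d by (rule amult_closed)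
    have "s\<phi> (C.\<rho> n (c \<otimes>\<^bsub>A\<^esub> d)) = \<zero>\<^bsub>A\<^esub>"
    proof (rule nondegenerate_l[OF lin_closed[OF s_linear C.r_closed[OF nc cd]]])
      fix v assume v: "v \<in> carrier A"
      show "s\<phi> (C.\<rho> n (c \<otimes>\<^bsub>A\<^esub> d)) \<otimes>\<^bsub>A\<^esub> v = \<zero>\<^bsub>A\<^esub>"
        using Nr_slices(1)[OF n C.XA.tens_closed[OF v cd]] C.\<alpha>_tens[OF nc v cd] C.slice_snd_i1(2)[OF \<phi> v C.r_closed[OF nc cd]] by simp
    qed
    then show "slice_snd K A A (\<lambda>x. \<phi> (x \<otimes>\<^bsub>A\<^esub> d)) (C.\<rho> n c) = \<zero>\<^bsub>A\<^esub>"
      using C.slice_snd_i2(2)[OF \<phi> d C.r_closed[OF nc c]] C.r_r[OF nc d c] by simp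
  qed
  then have "\<phi> (b \<otimes>\<^bsub>A\<^esub> d) \<odot>\<^bsub>A\<^esub> a = \<zero>\<^bsub>A\<^esub>"
    unfolding r(1)[symmetric] using C.XA.slice_snd_tens[OF \<phi>r[OF d] ac b] by simp
  then show ?thesis using smult_eq_zero[OF fun_closed[OF \<phi> amult_closed[OF b d]] ac] bd by blast
qed

lemma \<phi>_faithful_l:
  assumes a: "a \<in> Nl" shows "a = \<zero>\<^bsub>A\<^esub>"
proof -
  have ac: "a \<in> carrier A" using a by (simp add: Nl_def)
  obtain d b where b: "b \<in> carrier A" and d: "d \<in> carrier A" and bd: "\<phi> (d \<otimes>\<^bsub>A\<^esub> b) \<noteq> \<zero>" using \<phi>_mult_nonzero by blast
  let ?R = "\<lambda>x b. C.\<Lambda> b x"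
  note R = C.XA.bij_lift_swap[OF A2_module C.l_bilinear T4_bij]
  have "tens K A A a b \<in> tensor_lift K A A A2 ?R ` carrier A2"
    using bij_betw_imp_surj_on[OF R(2)] C.XA.tens_closed[OF ac b] by simp
  then obtain r where r: "tens K A A a b = tensor_lift K A A A2 ?R r" "r \<in> carrier A2" by (rule imageE)
  have "slice_snd K A A h r \<in> Nl" if h: "h \<in> linear_functional K A" for h
  proof -
    have c: "slice_snd K A A h r \<in> carrier A" by (rule lin_closed[OF C.XA.slice_snd_linear[OF h] r(2)])
    have "slice_fst K A A (\<lambda>a. \<phi> (e \<otimes>\<^bsub>A\<^esub> a)) (C.\<rho> (slice_snd K A A h r) c) = \<zero>\<^bsub>A\<^esub>"
      if e: "e \<in> carrier A" and c: "c \<in> carrier A" for e c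
    proof (rule C.XA.slice_kernel[OF C.XA.tensor_space_axioms A2_module A2_module R(1) R(1)
          bij_betw_imp_inj_on[OF R(2)] _ C.mixed_linear(2)[OF \<phi>l[OF e] c] _ r(2) _ h,
            where \<kappa> = "\<lambda>x. slice_fst K A A (\<lambda>a. \<phi> (e \<otimes>\<^bsub>A\<^esub> a)) (C.\<rho> x c)"])
      note f = \<phi>l[OF e]
      show "(\<lambda>x. slice_fst K A A (\<lambda>a. \<phi> (e \<otimes>\<^bsub>A\<^esub> a)) (C.\<rho> x c)) \<in> linear_map K A A"
        by (rule lin_comp[OF bilin_l[OF C.r_bilinear c] C.XA.slice_fst_linear[OF f]])
      show "C.\<Lambda> w (slice_fst K A A (\<lambda>a. \<phi> (e \<otimes>\<^bsub>A\<^esub> a)) (C.\<rho> v c)) = C.mixed' (\<lambda>a. \<phi> (e \<otimes>\<^bsub>A\<^esub> a)) c (C.\<Lambda> w v)"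
        if "v \<in> carrier A" "w \<in> carrier A" for v w
        by (rule C.mixed_slice'[OF f that c])
      have z: "slice_fst K A A (\<lambda>a. \<phi> (e \<otimes>\<^bsub>A\<^esub> a)) (C.\<rho> a c1) = \<zero>\<^bsub>A\<^esub>" if "c1 \<in> carrier A" for c1
        using a Nl_iff[OF ac] e that by blast
      have zl: "(\<lambda>_. \<zero>\<^bsub>A2\<^esub>) \<in> linear_map K A2 A2" by (rule linear_mapI) auto
      have "tensor_lift K A A A2 (\<lambda>c1 b2. tens K A A (slice_fst K A A (\<lambda>a. \<phi> (e \<otimes>\<^bsub>A\<^esub> a)) (C.\<rho> a c1)) b2) (C.\<Lambda> b c) = \<zero>\<^bsub>A2\<^esub>"
        by (rule C.XA.lift_unique[OF A2_module C.mixed_inner(2)[OF f ac] zl]) (use z b c in simp_all)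
      then show "C.mixed' (\<lambda>a. \<phi> (e \<otimes>\<^bsub>A\<^esub> a)) c (tensor_lift K A A A2 ?R r) = \<zero>\<^bsub>A2\<^esub>"
        unfolding r(1)[symmetric] using C.mixed_tens(2)[OF f c ac b] by simp
    qed
    then show ?thesis using Nl_iff[OF c] by blast
  qed
  then have "slice_snd K A A (\<lambda>x. \<phi> (d \<otimes>\<^bsub>A\<^esub> x)) (tensor_lift K A A A2 ?R r) = \<zero>\<^bsub>A\<^esub>"
  proof (rule slice_of_preimage[OF R(1) Nl_submod r(2) _ \<phi>l[OF d]])
    fix n c assume n: "n \<in> Nl" and c: "c \<in> carrier A"
    have nc: "n \<in> carrier A" using n by (simp add: Nl_def)
    have cd: "d \<otimes>\<^bsub>A\<^esub> c \<in> carrier A" using d c by (rule amult_closed)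
    have "s\<phi> (C.\<Lambda> (d \<otimes>\<^bsub>A\<^esub> c) n) = \<zero>\<^bsub>A\<^esub>"
    proof (rule nondegenerate_r[OF lin_closed[OF s_linear C.l_closed[OF cd nc]]])
      fix v assume v: "v \<in> carrier A"
      show "v \<otimes>\<^bsub>A\<^esub> s\<phi> (C.\<Lambda> (d \<otimes>\<^bsub>A\<^esub> c) n) = \<zero>\<^bsub>A\<^esub>"
        using Nl_slices(1)[OF n C.XA.tens_closed[OF v cd]] C.tens_\<alpha>[OF nc v cd] C.slice_snd_i1(1)[OF \<phi> v C.l_closed[OF cd nc]] by simp
    qed
    then show "slice_snd K A A (\<lambda>x. \<phi> (d \<otimes>\<^bsub>A\<^esub> x)) (C.\<Lambda> c n) = \<zero>\<^bsub>A\<^esub>"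
      using C.slice_snd_i2(1)[OF \<phi> d C.l_closed[OF c nc]] C.l_l[OF nc c d] by simp
  qed
  then have "\<phi> (d \<otimes>\<^bsub>A\<^esub> b) \<odot>\<^bsub>A\<^esub> a = \<zero>\<^bsub>A\<^esub>"
    unfolding r(1)[symmetric] using C.XA.slice_snd_tens[OF \<phi>l[OF d] ac b] by simp
  then show ?thesis using smult_eq_zero[OF fun_closed[OF \<phi> amult_closed[OF d b]] ac] bd by blast
qed

end

section \<open>The invariant functional of a Galois object\<close>

locale galois_modular = modular_quantum_group K A \<Delta> \<phi> \<delta> + galois_object K A \<Delta> X \<alpha>
  for K :: "('k, 'r) ring_scheme" (structure)
    and A :: "('k, 'a, 'n) module_scheme" (structure)
    and \<Delta> :: "'a \<Rightarrow> ('a \<times> 'a \<Rightarrow> 'k) set multiplier" and \<phi> :: "'a \<Rightarrow> 'k" and \<delta> :: "'a multiplier"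
    and X :: "('k, 'x, 'm) module_scheme" (structure)
    and \<alpha> :: "'x \<Rightarrow> ('x \<times> 'a \<Rightarrow> 'k) set multiplier"
begin

abbreviation "XA2 \<equiv> tensor K X A"
abbreviation "sX \<equiv> slice_snd K X A \<phi>"

lemmas XA2_module = P.XA.tensor_module
lemmas sX_linear = P.XA.slice_snd_linear[OF \<phi>]
lemmas sX_closed = lin_closed[OF sX_linear]

lemma slice_act_bil: "q \<in> carrier A \<Longrightarrow> (\<lambda>v c. tens K X A v (s\<phi> (C.\<rho> c q))) \<in> bilinear_map K X A XA2"
  by (rule P.slice_mid_bil(4)[OF \<phi>])

lemma act_slice_linear: "y \<in> carrier X \<Longrightarrow> (\<lambda>q. sX (P.\<rho> y q)) \<in> linear_map K A X"
  by (rule lin_comp[OF bilin_r[OF P.r_bilinear] sX_linear])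

lemma r_slice_bil:
  assumes y: "y \<in> carrier X"
  shows "(\<lambda>b' q'. P.\<rho> (sX (P.\<rho> y q')) b') \<in> bilinear_map K A A XA2"
proof (rule bilinear_mapI)
  fix b' assume "b' \<in> carrier A"
  then show "(\<lambda>q'. P.\<rho> (sX (P.\<rho> y q')) b') \<in> linear_map K A XA2"
    by (rule bilin_arg_l[OF P.r_bilinear _ act_slice_linear[OF y]])
next
  fix q' assume "q' \<in> carrier A"
  then show "(\<lambda>b'. P.\<rho> (sX (P.\<rho> y q')) b') \<in> linear_map K A XA2"
    by (intro bilin_r[OF P.r_bilinear] sX_closed P.r_closed y)
qed

text \<open>
  In Sweedler notation: \<open>y\<^sub>0 \<otimes> y\<^sub>1 q\<^sub>1 b \<phi>(y\<^sub>2 q\<^sub>2) = y\<^sub>0 \<phi>(y\<^sub>1 q) \<otimes> b\<close> by left invariance. Here \<open>q\<^sub>1 b \<otimes> q\<^sub>2\<close> is a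
  covered product, and the left-hand side is a sum of terms \<open>\<alpha>(y')(1 \<otimes> b')\<close> with
  \<open>y' = y\<^sub>0 \<phi>(y\<^sub>1 q')\<close>. The identity does the work of the antipode in showing that \<open>y' \<otimes> b\<close> is in the image
  of \<open>x \<otimes> b \<mapsto> \<alpha>(x)(1 \<otimes> b)\<close>.
\<close>

lemma r_slice:
  assumes y: "y \<in> carrier X" and q: "q \<in> carrier A" and b: "b \<in> carrier A"
  shows "tensor_lift K A A XA2 (\<lambda>b' q'. P.\<rho> (sX (P.\<rho> y q')) b') (T3 q b) = tens K X A (sX (P.\<rho> y q)) b"
proof (rule P.XA.in_fst_left_cancel)
  note T = T3_closed[OF q b] and B = r_slice_bil[OF y]
  show "tensor_lift K A A XA2 (\<lambda>b' q'. P.\<rho> (sX (P.\<rho> y q')) b') (T3 q b) \<in> carrier XA2"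
    by (rule C.XA.lift_closed[OF XA2_module B T])
  show "tens K X A (sX (P.\<rho> y q)) b \<in> carrier XA2"
    by (rule P.XA.tens_closed[OF sX_closed[OF P.r_closed[OF y q]] b])
  fix u assume u: "u \<in> carrier X"
  let ?L = "\<lambda>q' w. tensor_lift K X A XA2 (\<lambda>v c. tens K X A v (s\<phi> (C.\<rho> c q'))) w"
  let ?F = "\<lambda>b' q' w. snd (P.i2 b') (?L q' w)"
  have Lq: "(\<lambda>q'. ?L q' w) \<in> linear_map K A XA2" if w: "w \<in> carrier XA2" for w
    by (rule P.XA.lift_lin_par[OF XA2_module slice_act_bil _ X_module w], assumption)
      (rule P.XA.tens_lin_r[OF lin_comp[OF bilin_r[OF C.r_bilinear] s_linear]], assumption+)
  have Lw: "(\<lambda>w. ?L q' w) \<in> linear_map K XA2 XA2" if "q' \<in> carrier A" for q'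
    by (rule P.XA.lift_linear[OF XA2_module slice_act_bil[OF that]])
  have FB: "(\<lambda>b' q'. ?F b' q' w) \<in> bilinear_map K A A XA2" if w: "w \<in> carrier XA2" for w
  proof (rule bilinear_mapI)
    fix b' assume "b' \<in> carrier A"
    then show "(\<lambda>q'. ?F b' q' w) \<in> linear_map K A XA2"
      by (intro P.XA.T.snd_lin[OF P.XA.in_snd_closed] Lq[OF w])
  next
    fix q' assume "q' \<in> carrier A"
    then show "(\<lambda>b'. ?F b' q' w) \<in> linear_map K A XA2"
      by (intro P.XA.T.snd_par_lin[OF _ P.XA.in_snd_linear] lin_closed[OF Lw] w)
  qed
  have key: "tensor_lift K A A XA2 (\<lambda>b' q'. ?F b' q' w) (T3 q b) = tens K X A (sX (snd (P.i2 q) w)) b"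
    if w: "w \<in> carrier XA2" for w
  proof (rule P.XA.tensor_lin_eq[OF XA2_module _ _ _ w])
    show "(\<lambda>w. tensor_lift K A A XA2 (\<lambda>b' q'. ?F b' q' w) (T3 q b)) \<in> linear_map K XA2 XA2"
      by (rule C.XA.lift_lin_par[OF XA2_module FB _ XA2_module T], assumption)
        (rule P.XA.T.snd_lin[OF P.XA.in_snd_closed Lw], assumption+)
    show "(\<lambda>w. tens K X A (sX (snd (P.i2 q) w)) b) \<in> linear_map K XA2 XA2"
      by (rule P.XA.tens_lin_l[OF lin_comp[OF P.XA.T.snd_linear[OF P.XA.in_snd_closed[OF q]] sX_linear] b])
    fix v c assume v: "v \<in> carrier X" and c: "c \<in> carrier A"
    note vc = P.XA.tens_closed[OF v c]
    have g: "(\<lambda>r. tens K X A v (s\<phi> (fst (\<Delta> c) r))) \<in> linear_map K A2 XA2"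
      by (rule P.XA.tens_lin_r[OF lin_comp[OF C.XA.T.fst_linear[OF C.\<alpha>_closed[OF c]] s_linear] v])
    have "tensor_lift K A A XA2 (\<lambda>b' q'. ?F b' q' (tens K X A v c)) (T3 q b) = tens K X A v (s\<phi> (fst (\<Delta> c) (T3 q b)))"
    proof (rule C.XA.lift_unique[OF XA2_module FB[OF vc] g _ T])
      fix b' q' assume p: "b' \<in> carrier A" "q' \<in> carrier A"
      have "s\<phi> (fst (\<Delta> c) (tens K A A b' q')) = s\<phi> (C.\<rho> c q') \<otimes>\<^bsub>A\<^esub> b'"
        unfolding C.\<alpha>_tens[OF c p] by (rule C.slice_snd_i1(2)[OF \<phi> p(1) C.r_closed[OF c p(2)]])
      then show "tens K X A v (s\<phi> (fst (\<Delta> c) (tens K A A b' q'))) = ?F b' q' (tens K X A v c)"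
        using v c p lin_closed[OF s_linear C.r_closed[OF c p(2)]]
        by (simp add: P.XA.lift_tens[OF XA2_module slice_act_bil])
    qed
    also have "\<dots> = tens K X A v (\<phi> (c \<otimes>\<^bsub>A\<^esub> q) \<odot>\<^bsub>A\<^esub> b)"
      using T3_mult[OF c q b] s_T3[OF amult_closed[OF c q] b] by simp
    also have "\<dots> = tens K X A (sX (snd (P.i2 q) (tens K X A v c))) b"
      using v c q b fun_closed[OF \<phi> amult_closed[OF c q]]
      by (simp add: P.XA.slice_snd_tens[OF \<phi>] amult_closed lin_smult[OF P.XA.tens_l] lin_smult[OF P.XA.tens_r])
    finally show "tensor_lift K A A XA2 (\<lambda>b' q'. ?F b' q' (tens K X A v c)) (T3 q b) =
      tens K X A (sX (snd (P.i2 q) (tens K X A v c))) b" .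
  qed
  have "fst (P.i1 u) (tensor_lift K A A XA2 (\<lambda>b' q'. P.\<rho> (sX (P.\<rho> y q')) b') (T3 q b)) =
    tensor_lift K A A XA2 (\<lambda>b' q'. fst (P.i1 u) (P.\<rho> (sX (P.\<rho> y q')) b')) (T3 q b)"
    by (rule C.XA.lift_push[OF XA2_module XA2_module B P.XA.T.fst_linear[OF P.XA.in_fst_closed[OF u]] T])
  also have "\<dots> = tensor_lift K A A XA2 (\<lambda>b' q'. ?F b' q' (P.\<gamma> u y)) (T3 q b)"
  proof (rule C.XA.lift_cong[OF XA2_module C.XA.bilin_post[OF B P.XA.T.fst_linear[OF P.XA.in_fst_closed[OF u]]] FB[OF P.g_closed[OF u y]] _ T])
    fix b' q' assume p: "b' \<in> carrier A" "q' \<in> carrier A"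
    have "fst (P.i1 u) (P.\<rho> (sX (P.\<rho> y q')) b') = snd (P.i2 b') (P.\<gamma> u (sX (P.\<rho> y q')))"
      by (rule P.i1_r[OF sX_closed[OF P.r_closed[OF y p(2)]] u p(1)])
    then show "fst (P.i1 u) (P.\<rho> (sX (P.\<rho> y q')) b') = ?F b' q' (P.\<gamma> u y)"
      unfolding P.coassoc_slice_last[OF \<phi> u y p(2)] .
  qed
  also have "\<dots> = tens K X A (sX (snd (P.i2 q) (P.\<gamma> u y))) b" by (rule key[OF P.g_closed[OF u y]])
  also have "\<dots> = tens K X A (u \<otimes>\<^bsub>X\<^esub> sX (P.\<rho> y q)) b"
    unfolding P.i1_r[OF y u q, symmetric] P.slice_snd_i1(1)[OF \<phi> u P.r_closed[OF y q]] ..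
  also have "\<dots> = fst (P.i1 u) (tens K X A (sX (P.\<rho> y q)) b)"
    using u b sX_closed[OF P.r_closed[OF y q]] by simp
  finally show "fst (P.i1 u) (tensor_lift K A A XA2 (\<lambda>b' q'. P.\<rho> (sX (P.\<rho> y q')) b') (T3 q b)) =
    fst (P.i1 u) (tens K X A (sX (P.\<rho> y q)) b)" .
qed

abbreviation "r_hat \<equiv> tensor_lift K X A XA2 P.\<rho>"

lemmas r_hat_linear = P.XA.lift_linear[OF XA2_module P.r_bilinear]
lemmas r_hat_tens = P.XA.lift_tens[OF XA2_module P.r_bilinear]
lemmas slice_r_hat_linear = lin_comp[OF r_hat_linear sX_linear]

lemma \<phi>_separates_l: "w \<in> carrier A \<Longrightarrow> \<forall>h\<in>(\<lambda>q a. \<phi> (a \<otimes>\<^bsub>A\<^esub> q)) ` carrier A. h w = \<zero> \<Longrightarrow> w = \<zero>\<^bsub>A\<^esub>"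
  by (rule \<phi>_faithful_r) (simp add: Nr_def)

lemma \<phi>_separates_r: "w \<in> carrier A \<Longrightarrow> \<forall>h\<in>(\<lambda>q a. \<phi> (q \<otimes>\<^bsub>A\<^esub> a)) ` carrier A. h w = \<zero> \<Longrightarrow> w = \<zero>\<^bsub>A\<^esub>"
  by (rule \<phi>_faithful_l) (simp add: Nl_def)

lemma r_hat_inj:
  assumes u: "u \<in> carrier XA2" "u' \<in> carrier XA2" and e: "r_hat u = r_hat u'"
  shows "u = u'"
proof -
  have "u \<ominus>\<^bsub>XA2\<^esub> u' = \<zero>\<^bsub>XA2\<^esub>"
  proof (rule P.r_hat_injective[OF bij_betw_imp_inj_on[OF T1_bij] coaction_inj])
    show "r_hat (u \<ominus>\<^bsub>XA2\<^esub> u') = \<zero>\<^bsub>XA2\<^esub>"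
      unfolding lin_minus[OF XA2_module XA2_module r_hat_linear u]
      using e mod_diff_zero[OF XA2_module lin_closed[OF r_hat_linear u(1)] lin_closed[OF r_hat_linear u(2)]] by simp
  qed (use u in simp)
  then show ?thesis using mod_diff_zero[OF XA2_module u] by simp
qed

text \<open>
  Let \<open>Y\<close> be the span of the elements \<open>y\<^sub>0 \<phi>(y\<^sub>1 q)\<close>, and \<open>T\<close> the image under \<open>r_hat\<close> of the tensors with
  slices in \<open>Y\<close>. By \<open>r_slice\<close>, \<open>Y \<otimes> A\<close> is contained in \<open>T\<close>. The slices of \<open>\<alpha>(x)(1 \<otimes> b)\<close> by \<open>\<phi>(\<cdot> q)\<close> lie in
  \<open>Y\<close>, so elimination puts \<open>\<alpha>(x)(1 \<otimes> b)\<close> in \<open>T\<close>. As \<open>r_hat\<close> is injective, \<open>x \<otimes> b\<close> itself has its slices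
  in \<open>Y\<close>.
\<close>

lemma act_slices_span:
  assumes x: "x \<in> carrier X"
  shows "\<exists>r\<in>carrier XA2. x = sX (r_hat r)"
proof -
  let ?Y = "(\<lambda>r. sX (r_hat r)) ` carrier XA2"
  let ?R = "{r \<in> carrier XA2. \<forall>h\<in>linear_functional K A. slice_snd K X A h r \<in> ?Y}"
  let ?T = "r_hat ` ?R"
  have full: "submodule (carrier XA2) K XA2" by (rule module.carrier_is_submodule[OF XA2_module])
  have Y: "submodule ?Y K X" by (rule image_submod[OF XA2_module X.X_module slice_r_hat_linear full])
  have R: "submodule ?R K XA2"
  proof (rule submodI[OF XA2_module])
    show "?R \<subseteq> carrier XA2" by (rule subsetI) simp
    show "\<zero>\<^bsub>XA2\<^esub> \<in> ?R"
      using submod_zero[OF X.X_module Y] mod_zero_closed[OF XA2_module]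
      by (simp add: lin_zero[OF XA2_module X.X_module P.XA.slice_snd_linear])
    show "a \<oplus>\<^bsub>XA2\<^esub> b \<in> ?R" if "a \<in> ?R" "b \<in> ?R" for a b
      using that submod_add[OF X.X_module Y] mod_add_closed[OF XA2_module]
      by (simp add: lin_add[OF P.XA.slice_snd_linear])
    show "c \<odot>\<^bsub>XA2\<^esub> a \<in> ?R" if "c \<in> carrier K" "a \<in> ?R" for c a
      using that submod_smult[OF X.X_module Y] mod_smult_closed[OF XA2_module]
      by (simp add: lin_smult[OF P.XA.slice_snd_linear])
  qed
  have T: "submodule ?T K XA2" by (rule image_submod[OF XA2_module XA2_module r_hat_linear R])
  have in_T: "P.\<rho> y b \<in> ?T" if y: "y \<in> ?Y" "y \<in> carrier X" and b: "b \<in> carrier A" for y b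
  proof (rule image_eqI)
    show "P.\<rho> y b = r_hat (tens K X A y b)" by (rule r_hat_tens[OF y(2) b, symmetric])
    show "tens K X A y b \<in> ?R"
      using y b submod_smult[OF X.X_module Y _ y(1)] fun_closed[of _ K A b]
      by (simp add: P.XA.slice_snd_tens del: image_iff)
  qed
  have pure: "tens K X A y b \<in> ?T" if y: "y \<in> ?Y" and b: "b \<in> carrier A" for y b
  proof -
    from y obtain r where r: "y = sX (r_hat r)" "r \<in> carrier XA2" by (rule imageE)
    have "r \<in> {r \<in> carrier XA2. tens K X A (sX (r_hat r)) b \<in> ?T}"
    proof (rule P.XA.tensor_induct[OF vimage_submod[OF XA2_module XA2_module P.XA.tens_lin_l[OF slice_r_hat_linear b] T] _ r(2)])
      fix v q assume v: "v \<in> carrier X" and q: "q \<in> carrier A"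
      note B = r_slice_bil[OF v]
      have "T3 q b \<in> {t \<in> carrier A2. tensor_lift K A A XA2 (\<lambda>b' q'. P.\<rho> (sX (P.\<rho> v q')) b') t \<in> ?T}"
      proof (rule C.XA.tensor_induct[OF vimage_submod[OF A2_module XA2_module C.XA.lift_linear[OF XA2_module B] T] _ T3_closed[OF q b]])
        fix b' q' assume p: "b' \<in> carrier A" "q' \<in> carrier A"
        have "P.\<rho> (sX (P.\<rho> v q')) b' \<in> ?T"
        proof (rule in_T[OF _ sX_closed[OF P.r_closed[OF v p(2)]] p(1)])
          show "sX (P.\<rho> v q') \<in> ?Y"
            by (rule image_eqI[of _ _ "tens K X A v q'"]) (use v p in \<open>simp_all add: r_hat_tens\<close>)
        qed
        then show "tens K A A b' q' \<in> {t \<in> carrier A2. tensor_lift K A A XA2 (\<lambda>b' q'. P.\<rho> (sX (P.\<rho> v q')) b') t \<in> ?T}"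
          using p by (simp add: C.XA.lift_tens[OF XA2_module B] del: image_iff)
      qed
      then have "tens K X A (sX (P.\<rho> v q)) b \<in> ?T" unfolding r_slice[OF v q b, symmetric] by (elim CollectE conjE)
      then show "tens K X A v q \<in> {r \<in> carrier XA2. tens K X A (sX (r_hat r)) b \<in> ?T}"
        using v q by (simp add: r_hat_tens del: image_iff)
    qed
    then show ?thesis unfolding r(1) by (elim CollectE conjE)
  qed
  obtain b where b: "b \<in> carrier A" "b \<noteq> \<zero>\<^bsub>A\<^esub>" using nonzero M.zero_closed by blast
  obtain h where h: "h \<in> linear_functional K A" "h b = \<one>" using separating_functional[OF field_axioms X_module b] by blast
  have "P.\<rho> x b \<in> ?T"
  proof (rule P.XA.slice_elimination[of "(\<lambda>q a. \<phi> (a \<otimes>\<^bsub>A\<^esub> q)) ` carrier A", OF _ Y T pure _ P.r_closed[OF x b(1)]])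
    show "(\<lambda>q a. \<phi> (a \<otimes>\<^bsub>A\<^esub> q)) ` carrier A \<subseteq> linear_functional K A" using \<phi>r by blast
    show "tens K X A v w \<in> ?T" if "v \<in> carrier X" "w \<in> carrier A"
      "\<forall>h\<in>(\<lambda>q a. \<phi> (a \<otimes>\<^bsub>A\<^esub> q)) ` carrier A. h w = \<zero>" for v w
      unfolding \<phi>_separates_l[OF that(2,3)] using submod_zero[OF XA2_module T] that(1) by (simp del: image_iff)
    fix k assume "k \<in> (\<lambda>q a. \<phi> (a \<otimes>\<^bsub>A\<^esub> q)) ` carrier A"
    then obtain q where q: "k = (\<lambda>a. \<phi> (a \<otimes>\<^bsub>A\<^esub> q))" "q \<in> carrier A" by (rule imageE)
    have "slice_snd K X A k (P.\<rho> x b) = sX (P.\<rho> x (b \<otimes>\<^bsub>A\<^esub> q))"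
      unfolding q(1) P.r_r[OF x q(2) b(1)] P.slice_snd_i2(2)[OF \<phi> q(2) P.r_closed[OF x b(1)]] ..
    also have "\<dots> \<in> ?Y"
      by (rule image_eqI[of _ _ "tens K X A x (b \<otimes>\<^bsub>A\<^esub> q)"]) (use x q b in \<open>simp_all add: r_hat_tens amult_closed\<close>)
    finally show "slice_snd K X A k (P.\<rho> x b) \<in> ?Y" .
  qed
  then obtain r where r: "P.\<rho> x b = r_hat r" "r \<in> ?R" by (rule imageE)
  have rc: "r \<in> carrier XA2" and rs: "slice_snd K X A h r \<in> ?Y" using r(2) h(1) by blast+
  have "tens K X A x b = r"
    by (rule r_hat_inj[OF P.XA.tens_closed[OF x b(1)] rc]) (use r(1) r_hat_tens[OF x b(1)] in simp)
  then have "x = slice_snd K X A h r" using P.XA.slice_snd_tens[OF h(1) x b(1)] h(2) x by simp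
  then have "x \<in> ?Y" using rs by simp
  then show ?thesis by blast
qed

end

context galois_modular
begin

abbreviation "W \<equiv> gal' K X A \<alpha>"

lemma covered_slice_bil:
  assumes q: "q \<in> carrier A"
  shows "(\<lambda>u a. P.\<rho> u (s\<phi> (C.\<Lambda> a q))) \<in> bilinear_map K X A XA2"
proof (rule bilinear_mapI)
  have l: "(\<lambda>a. s\<phi> (C.\<Lambda> a q)) \<in> linear_map K A A"
    by (rule lin_comp[OF bilin_l[OF C.l_bilinear q] s_linear])
  show "(\<lambda>a. P.\<rho> u (s\<phi> (C.\<Lambda> a q))) \<in> linear_map K A XA2" if "u \<in> carrier X" for u
    by (rule bilin_arg_r[OF P.r_bilinear that l])
  show "(\<lambda>u. P.\<rho> u (s\<phi> (C.\<Lambda> a q))) \<in> linear_map K X XA2" if "a \<in> carrier A" for a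
    by (rule bilin_l[OF P.r_bilinear lin_closed[OF l that]])
qed

text \<open>
  For \<open>w = u \<otimes> a\<close> this is \<open>u\<^sub>0 \<otimes> u\<^sub>1 q\<^sub>1 \<phi>(a q\<^sub>2)\<close>.
\<close>

abbreviation "cov q w \<equiv> tensor_lift K X A XA2 (\<lambda>u a. P.\<rho> u (s\<phi> (C.\<Lambda> a q))) w"

text \<open>
  In Sweedler notation: \<open>x\<^sub>0 y\<^sub>0 \<phi>(y\<^sub>1 q) \<otimes> x\<^sub>1 t = x\<^sub>0 y\<^sub>0 \<otimes> x\<^sub>1 y\<^sub>1 q\<^sub>1 \<phi>(y\<^sub>2 q\<^sub>2) t\<close>. The factor \<open>y\<^sub>0 \<phi>(y\<^sub>1 q) \<otimes> t\<close> is
  expanded by \<open>r_slice\<close>, and \<open>x\<close> is then moved into each term.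
\<close>

lemma cov_key:
  assumes x: "x \<in> carrier X" and y: "y \<in> carrier X" and q: "q \<in> carrier A" and t: "t \<in> carrier A"
  shows "fst (\<alpha> x) (tens K X A (sX (P.\<rho> y q)) t) = snd (P.i2 t) (cov q (P.\<gamma> x y))"
proof -
  note T = T3_closed[OF q t] and B = r_slice_bil[OF y]
  let ?F = "\<lambda>w b' q'. P.\<rho> (sX (snd (P.i2 q') w)) b'"
  have FB: "?F w \<in> bilinear_map K A A XA2" if w: "w \<in> carrier XA2" for w
  proof (rule bilinear_mapI)
    have l: "(\<lambda>q'. sX (snd (P.i2 q') w)) \<in> linear_map K A X"
      by (rule lin_comp[OF P.XA.T.snd_par_lin[OF w P.XA.in_snd_linear] sX_linear])
    show "(\<lambda>q'. ?F w b' q') \<in> linear_map K A XA2" if "b' \<in> carrier A" for b'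
      by (rule bilin_arg_l[OF P.r_bilinear that l])
    show "(\<lambda>b'. ?F w b' q') \<in> linear_map K A XA2" if "q' \<in> carrier A" for q'
      by (rule bilin_r[OF P.r_bilinear lin_closed[OF l that]])
  qed
  have key: "tensor_lift K A A XA2 (?F w) (T3 q t) = snd (P.i2 t) (cov q w)" if w: "w \<in> carrier XA2" for w
  proof (rule P.XA.tensor_lin_eq[OF XA2_module _ _ _ w])
    show "(\<lambda>w. tensor_lift K A A XA2 (?F w) (T3 q t)) \<in> linear_map K XA2 XA2"
      by (rule C.XA.lift_lin_par[OF XA2_module FB _ XA2_module T], assumption)
        (rule bilin_arg_l[OF P.r_bilinear], assumption, rule lin_comp[OF P.XA.T.snd_linear[OF P.XA.in_snd_closed] sX_linear], assumption)
    show "(\<lambda>w. snd (P.i2 t) (cov q w)) \<in> linear_map K XA2 XA2"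
      by (rule P.XA.T.snd_lin[OF P.XA.in_snd_closed[OF t] P.XA.lift_linear[OF XA2_module covered_slice_bil[OF q]]])
    fix u a assume u: "u \<in> carrier X" and a: "a \<in> carrier A"
    note ua = P.XA.tens_closed[OF u a] and Lc = C.l_closed[OF a q]
    have g: "(\<lambda>r. P.\<rho> u (s\<phi> (fst (C.i2 a) r))) \<in> linear_map K A2 XA2"
      by (rule bilin_arg_r[OF P.r_bilinear u lin_comp[OF C.XA.T.fst_linear[OF C.XA.in_snd_closed[OF a]] s_linear]])
    have "tensor_lift K A A XA2 (?F (tens K X A u a)) (T3 q t) = P.\<rho> u (s\<phi> (fst (C.i2 a) (T3 q t)))"
    proof (rule C.XA.lift_unique[OF XA2_module FB[OF ua] g _ T])
      fix b' q' assume p: "b' \<in> carrier A" "q' \<in> carrier A"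
      have "P.\<rho> u (\<phi> (a \<otimes>\<^bsub>A\<^esub> q') \<odot>\<^bsub>A\<^esub> b') = P.\<rho> (\<phi> (a \<otimes>\<^bsub>A\<^esub> q') \<odot>\<^bsub>X\<^esub> u) b'"
        using p u a fun_closed[OF \<phi> amult_closed[OF a p(2)]]
        by (simp add: lin_smult[OF bilin_l[OF P.r_bilinear]] lin_smult[OF bilin_r[OF P.r_bilinear]])
      then show "P.\<rho> u (s\<phi> (fst (C.i2 a) (tens K A A b' q'))) = ?F (tens K X A u a) b' q'"
        using p u a by (simp add: P.XA.slice_snd_tens[OF \<phi>] C.XA.slice_snd_tens[OF \<phi>] amult_closed)
    qed
    also have "fst (C.i2 a) (T3 q t) = snd (C.i1 t) (C.\<Lambda> a q)"
      by (rule C.as_inject) (use q t a in \<open>simp_all add: C.as_ideal C.as_l as_T3 C.XA.T.mult_assoc\<close>)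
    also have "s\<phi> \<dots> = s\<phi> (C.\<Lambda> a q) \<otimes>\<^bsub>A\<^esub> t" by (rule C.slice_snd_i1(2)[OF \<phi> t Lc])
    also have "P.\<rho> u \<dots> = snd (P.i2 t) (P.\<rho> u (s\<phi> (C.\<Lambda> a q)))"
      by (rule P.r_r[OF u t lin_closed[OF s_linear Lc]])
    also have "\<dots> = snd (P.i2 t) (cov q (tens K X A u a))"
      by (simp add: P.XA.lift_tens[OF XA2_module covered_slice_bil[OF q] u a])
    finally show "tensor_lift K A A XA2 (?F (tens K X A u a)) (T3 q t) = snd (P.i2 t) (cov q (tens K X A u a))" .
  qed
  note Fx = P.XA.T.fst_linear[OF P.\<alpha>_closed[OF x]]
  have "fst (\<alpha> x) (tens K X A (sX (P.\<rho> y q)) t) = tensor_lift K A A XA2 (\<lambda>b' q'. fst (\<alpha> x) (P.\<rho> (sX (P.\<rho> y q')) b')) (T3 q t)"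
    unfolding r_slice[OF y q t, symmetric] by (rule C.XA.lift_push[OF XA2_module XA2_module B Fx T])
  also have "\<dots> = tensor_lift K A A XA2 (?F (P.\<gamma> x y)) (T3 q t)"
  proof (rule C.XA.lift_cong[OF XA2_module C.XA.bilin_post[OF B Fx] FB[OF P.g_closed[OF x y]] _ T])
    fix b' q' assume p: "b' \<in> carrier A" "q' \<in> carrier A"
    note yc = sX_closed[OF P.r_closed[OF y p(2)]]
    show "fst (\<alpha> x) (P.\<rho> (sX (P.\<rho> y q')) b') = ?F (P.\<gamma> x y) b' q'"
      unfolding P.r_mult[OF x yc p(1), symmetric] P.i1_r[OF y x p(2), symmetric] P.slice_snd_i1(1)[OF \<phi> x P.r_closed[OF y p(2)]] ..
  qed
  also have "\<dots> = snd (P.i2 t) (cov q (P.\<gamma> x y))" by (rule key[OF P.g_closed[OF x y]])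
  finally show ?thesis .
qed

lemma cov_closed: "q \<in> carrier A \<Longrightarrow> w \<in> carrier XA2 \<Longrightarrow> cov q w \<in> carrier XA2"
  by (rule P.XA.lift_closed[OF XA2_module covered_slice_bil])

lemma as_cov:
  assumes x: "x \<in> carrier X" and y: "y \<in> carrier X" and q: "q \<in> carrier A"
  shows "as_multiplier XA2 (cov q (P.\<gamma> x y)) = \<alpha> x \<otimes>\<^bsub>MXA\<^esub> P.i1 (sX (P.\<rho> y q))"
proof -
  note z = sX_closed[OF P.r_closed[OF y q]] and w = cov_closed[OF q P.g_closed[OF x y]] and ax = P.\<alpha>_closed[OF x]
  note iz = P.XA.in_fst_closed[OF z]
  show ?thesis
  proof (rule P.XA.T.mult_eqI_snd[OF P.XA.T.as_multiplier_closed[OF w] P.XA.T.mult_closed[OF ax iz]])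
    fix u assume u: "u \<in> carrier XA2"
    have "u \<otimes>\<^bsub>XA2\<^esub> cov q (P.\<gamma> x y) = snd (P.i1 (sX (P.\<rho> y q))) (snd (\<alpha> x) u)"
    proof (rule P.XA.in_snd_right_cancel)
      show "u \<otimes>\<^bsub>XA2\<^esub> cov q (P.\<gamma> x y) \<in> carrier XA2" by (rule P.XA.T.amult_closed[OF u w])
      show "snd (P.i1 (sX (P.\<rho> y q))) (snd (\<alpha> x) u) \<in> carrier XA2"
        by (rule P.XA.T.snd_closed[OF iz P.XA.T.snd_closed[OF ax u]])
      fix t assume t: "t \<in> carrier A"
      note it = P.XA.in_snd_closed[OF t] and zt = P.XA.tens_closed[OF z t]
      have "snd (P.i2 t) (u \<otimes>\<^bsub>XA2\<^esub> cov q (P.\<gamma> x y)) = u \<otimes>\<^bsub>XA2\<^esub> snd (P.i2 t) (cov q (P.\<gamma> x y))"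
        by (rule P.XA.T.snd_mult[OF it u w])
      also have "\<dots> = u \<otimes>\<^bsub>XA2\<^esub> fst (\<alpha> x) (tens K X A (sX (P.\<rho> y q)) t)" unfolding cov_key[OF x y q t] ..
      also have "\<dots> = snd (\<alpha> x) u \<otimes>\<^bsub>XA2\<^esub> tens K X A (sX (P.\<rho> y q)) t"
        by (rule P.XA.T.snd_fst[OF ax u zt, symmetric])
      also have "\<dots> = snd (P.i2 t) (snd (P.i1 (sX (P.\<rho> y q))) (snd (\<alpha> x) u))"
        using arg_cong[OF P.i1_i2[OF z t], of "\<lambda>m. snd m (snd (\<alpha> x) u)"] P.XA.T.snd_closed[OF ax u] zt iz it by simp
      finally show "snd (P.i2 t) (u \<otimes>\<^bsub>XA2\<^esub> cov q (P.\<gamma> x y)) = snd (P.i2 t) (snd (P.i1 (sX (P.\<rho> y q))) (snd (\<alpha> x) u))" .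
    qed
    then show "snd (as_multiplier XA2 (cov q (P.\<gamma> x y))) u = snd (\<alpha> x \<otimes>\<^bsub>MXA\<^esub> P.i1 (sX (P.\<rho> y q))) u"
      using u w ax iz by simp
  qed
qed

text \<open>
  \<open>as_cov\<close> treats the elements \<open>z = y\<^sub>0 \<phi>(y\<^sub>1 q)\<close>, and these span \<open>X\<close>.
\<close>

lemma coaction_in_fst:
  assumes x: "x \<in> carrier X" and z: "z \<in> carrier X"
  shows "\<alpha> x \<otimes>\<^bsub>MXA\<^esub> P.i1 z \<in> embedded XA2"
proof -
  note L = lin_comp[OF slice_r_hat_linear lin_comp[OF P.XA.in_fst_linear bilin_r[OF P.XA.T.mult_bilinear P.\<alpha>_closed[OF x]]]]
  have E: "submodule (embedded XA2) K MXA"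
    unfolding embedded_def
    by (rule image_submod[OF XA2_module P.XA.T.mult_module P.XA.T.as_multiplier_linear module.carrier_is_submodule[OF XA2_module]])
  from act_slices_span[OF z] obtain r where r: "r \<in> carrier XA2" "z = sX (r_hat r)" by blast
  have "r \<in> {r \<in> carrier XA2. \<alpha> x \<otimes>\<^bsub>MXA\<^esub> P.i1 (sX (r_hat r)) \<in> embedded XA2}"
  proof (rule P.XA.tensor_induct[OF vimage_submod[OF XA2_module P.XA.T.mult_module L E] _ r(1)])
    fix y q assume y: "y \<in> carrier X" and q: "q \<in> carrier A"
    have "\<alpha> x \<otimes>\<^bsub>MXA\<^esub> P.i1 (sX (P.\<rho> y q)) \<in> embedded XA2"
      unfolding as_cov[OF x y q, symmetric] by (rule P.XA.T.embeddedI[OF cov_closed[OF q P.g_closed[OF x y]]])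
    then show "tens K X A y q \<in> {r \<in> carrier XA2. \<alpha> x \<otimes>\<^bsub>MXA\<^esub> P.i1 (sX (r_hat r)) \<in> embedded XA2}"
      using y q by (simp add: r_hat_tens)
  qed
  then show ?thesis unfolding r(2) by (elim CollectE conjE)
qed

lemma W_closed [simp, intro]: "x \<in> carrier X \<Longrightarrow> z \<in> carrier X \<Longrightarrow> W x z \<in> carrier XA2"
  unfolding gal'_def by (rule P.XA.T.embeddedD[OF coaction_in_fst])

lemma as_W: "x \<in> carrier X \<Longrightarrow> z \<in> carrier X \<Longrightarrow> as_multiplier XA2 (W x z) = \<alpha> x \<otimes>\<^bsub>MXA\<^esub> P.i1 z"
  unfolding gal'_def by (rule P.XA.T.embeddedD[OF coaction_in_fst])

lemma W_mult:
  assumes "x \<in> carrier X" "z \<in> carrier X" "e \<in> carrier X"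
  shows "W x (z \<otimes>\<^bsub>X\<^esub> e) = snd (P.i1 e) (W x z)" "W (x \<otimes>\<^bsub>X\<^esub> z) e = fst (\<alpha> x) (W z e)"
    "fst (P.i1 z) (W x e) = snd (P.i1 e) (P.\<gamma> z x)"
  by (rule P.as_inject; use assms in \<open>simp add: P.as_ideal as_W P.as_g P.i1_mult P.\<alpha>_mult X.amult_closed P.XA.T.mult_assoc\<close>)+

lemma W_linear:
  assumes x: "x \<in> carrier X" shows "(\<lambda>z. W x z) \<in> linear_map K X XA2"
proof -
  note L = lin_comp[OF P.XA.in_fst_linear bilin_r[OF P.XA.T.mult_bilinear P.\<alpha>_closed[OF x]]]
  show ?thesis
    by (rule linear_mapI; (rule P.as_inject)?)
      (use x in \<open>simp_all add: lin_add[OF P.XA.T.as_multiplier_linear] lin_smult[OF P.XA.T.as_multiplier_linear] as_W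
        lin_add[OF L] lin_smult[OF L]\<close>)
qed

text \<open>
  By \<open>as_cov\<close> the tensors \<open>\<alpha>(x)(z \<otimes> 1)\<close> include the values of \<open>cov q\<close> on the Galois map, hence on all of
  \<open>X \<otimes> A\<close>, that is \<open>\<alpha>(u)(1 \<otimes> d)\<close> for \<open>d = q\<^sub>1 \<phi>(a q\<^sub>2)\<close>. Such elements \<open>d\<close> span \<open>A\<close>, because the tensors
  \<open>(1 \<otimes> a)\<Delta>(q)\<close> exhaust \<open>A \<otimes> A\<close>.
\<close>

lemma W_spans:
  assumes y: "module K Y" and \<theta>: "\<theta> \<in> linear_map K XA2 Y"
    and z: "\<And>x e. x \<in> carrier X \<Longrightarrow> e \<in> carrier X \<Longrightarrow> \<theta> (W x e) = \<zero>\<^bsub>Y\<^esub>"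
    and u: "u \<in> carrier X" and d: "d \<in> carrier A"
  shows "\<theta> (P.\<rho> u d) = \<zero>\<^bsub>Y\<^esub>"
proof -
  obtain b where b: "b \<in> carrier A" "\<phi> b \<noteq> \<zero>" using left_functional_nonzero by blast
  have fb: "\<phi> b \<in> Units K" using b fun_closed[OF \<phi> b(1)] field_Units by simp
  let ?S = "{r \<in> carrier A2. \<theta> (P.\<rho> u (s\<phi> r)) \<in> {\<zero>\<^bsub>Y\<^esub>}}"
  note l = lin_comp[OF bilin_arg_r[OF P.r_bilinear u s_linear] \<theta>]
  have ic: "inv (\<phi> b) \<odot>\<^bsub>A\<^esub> d \<in> carrier A" using fb d by simp
  have "tens K A A (inv (\<phi> b) \<odot>\<^bsub>A\<^esub> d) b \<in> ?S"
  proof (rule C.XA.bij_lift_induct[OF A2_module C.l_bilinear T4_bij vimage_submod[OF A2_module y l zero_submod[OF y]]])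
    fix a q assume a: "a \<in> carrier A" and q: "q \<in> carrier A"
    have "tens K X A u a \<in> {w \<in> carrier XA2. \<theta> (cov q w) \<in> {\<zero>\<^bsub>Y\<^esub>}}"
    proof (rule gal_induct[OF vimage_submod[OF XA2_module y lin_comp[OF P.XA.lift_linear[OF XA2_module covered_slice_bil[OF q]] \<theta>] zero_submod[OF y]]])
      fix x x' assume x: "x \<in> carrier X" "x' \<in> carrier X"
      have zc: "sX (P.\<rho> x' q) \<in> carrier X" by (rule sX_closed[OF P.r_closed[OF x(2) q]])
      have "cov q (P.\<gamma> x x') = W x (sX (P.\<rho> x' q))"
        by (rule P.as_inject[OF cov_closed[OF q P.g_closed[OF x]] W_closed[OF x(1) zc]]) (simp add: as_cov[OF x q] as_W[OF x(1) zc])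
      then show "P.\<gamma> x x' \<in> {w \<in> carrier XA2. \<theta> (cov q w) \<in> {\<zero>\<^bsub>Y\<^esub>}}" using z[OF x(1) zc] x by simp
    qed (use u a in simp)
    then show "C.\<Lambda> a q \<in> ?S" using u a q by (simp add: P.XA.lift_tens[OF XA2_module covered_slice_bil[OF q]])
  qed (use ic b in simp)
  moreover have "s\<phi> (tens K A A (inv (\<phi> b) \<odot>\<^bsub>A\<^esub> d) b) = d"
    unfolding C.XA.slice_snd_tens[OF \<phi> ic b(1)]
    using smult_assoc1[OF Units_closed[OF fb] Units_inv_closed[OF fb] d] Units_r_inv[OF fb] d by simp
  ultimately show ?thesis by simp
qed

end

context galois_modular
begin

abbreviation "F x \<equiv> multiplier_slice_snd K X A \<phi> (\<alpha> x)"

lemma F_apply: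
  "z \<in> carrier X \<Longrightarrow> fst (F x) z = sX (W x z)"
  "z \<in> carrier X \<Longrightarrow> snd (F x) z = sX (P.\<gamma> z x)"
  unfolding multiplier_slice_snd_def gal_def gal'_def by simp_all

lemma F_closed:
  assumes x: "x \<in> carrier X" shows "F x \<in> carrier X.MX"
proof -
  have l: "fst (F x) \<in> linear_map K X X"
    by (rule lin_cong[OF lin_comp[OF W_linear[OF x] sX_linear] _ X.X_module]) (simp add: F_apply)
  have r: "snd (F x) \<in> linear_map K X X"
    by (rule lin_cong[OF lin_comp[OF bilin_l[OF P.g_bilinear x] sX_linear] _ X.X_module]) (simp add: F_apply)
  have "(fst (F x), snd (F x)) \<in> carrier X.MX"
  proof (rule X.multI[OF l r])
    show "fst (F x) \<in> extensional (carrier X)" "snd (F x) \<in> extensional (carrier X)"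
      by (simp_all add: multiplier_slice_snd_def)
    fix z e assume z: "z \<in> carrier X" and e: "e \<in> carrier X"
    show "fst (F x) (z \<otimes>\<^bsub>X\<^esub> e) = fst (F x) z \<otimes>\<^bsub>X\<^esub> e"
      using z e x by (simp add: F_apply X.amult_closed W_mult P.slice_snd_i1(2)[OF \<phi>])
    show "snd (F x) (z \<otimes>\<^bsub>X\<^esub> e) = z \<otimes>\<^bsub>X\<^esub> snd (F x) e"
      using z e x by (simp add: F_apply X.amult_closed P.g_l P.slice_snd_i1(1)[OF \<phi>])
    show "snd (F x) z \<otimes>\<^bsub>X\<^esub> e = z \<otimes>\<^bsub>X\<^esub> fst (F x) e"
      using z e x by (simp add: F_apply P.slice_snd_i1(1)[OF \<phi>, symmetric] W_mult P.slice_snd_i1(2)[OF \<phi>, symmetric])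
  qed
  then show ?thesis by simp
qed

text \<open>
  \<open>(X \<otimes> 1)\<alpha>(X) = X \<otimes> A\<close>, so a multiplier \<open>m\<close> is determined by the products \<open>\<alpha>(v)m\<close>. In particular
  \<open>multiplier_extension\<close> along \<open>\<alpha>\<close> has at most one candidate value.
\<close>

lemma coaction_cancel:
  assumes m: "m \<in> carrier MXA" "m' \<in> carrier MXA"
    and e: "\<And>v. v \<in> carrier X \<Longrightarrow> \<alpha> v \<otimes>\<^bsub>MXA\<^esub> m = \<alpha> v \<otimes>\<^bsub>MXA\<^esub> m'"
  shows "m = m'"
proof (rule P.XA.T.mult_eqI_snd[OF m])
  interpret XX: tensor_nondegenerate K X X by unfold_locales
  note L = XX.lift_linear[OF XA2_module P.g_bilinear] XX.lift_tens[OF XA2_module P.g_bilinear]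
  fix w assume "w \<in> carrier XA2"
  then obtain r where r: "r \<in> carrier (tensor K X X)" "w = tensor_lift K X X XA2 P.\<gamma> r"
    using bij_betw_imp_surj_on[OF gal_bij] by blast
  have "snd m (P.\<gamma> a v) = snd m' (P.\<gamma> a v)" if a: "a \<in> carrier X" and v: "v \<in> carrier X" for a v
  proof -
    have as: "as_multiplier XA2 (snd n (P.\<gamma> a v)) = P.i1 a \<otimes>\<^bsub>MXA\<^esub> (\<alpha> v \<otimes>\<^bsub>MXA\<^esub> n)" if n: "n \<in> carrier MXA" for n
      using a v n by (simp add: P.as_ideal P.as_g P.XA.T.mult_assoc)
    show ?thesis
      by (rule P.as_inject[OF P.XA.T.snd_closed[OF m(1) P.g_closed[OF a v]] P.XA.T.snd_closed[OF m(2) P.g_closed[OF a v]]])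
        (simp only: as[OF m(1)] as[OF m(2)] e[OF v])
  qed
  then show "snd m w = snd m' w"
    unfolding r(2)
    by (intro XX.tensor_lin_eq[OF XA2_module P.XA.T.snd_lin[OF m(1) L(1)] P.XA.T.snd_lin[OF m(2) L(1)] _ r(1)])
      (simp add: L(2))
qed

lemma in_fst_cancel:
  assumes m: "m \<in> carrier MXA" "m' \<in> carrier MXA"
    and e: "\<And>u. u \<in> carrier X \<Longrightarrow> P.i1 u \<otimes>\<^bsub>MXA\<^esub> m = P.i1 u \<otimes>\<^bsub>MXA\<^esub> m'"
  shows "m = m'"
proof (rule P.XA.T.mult_eqI_fst[OF m])
  fix w assume w: "w \<in> carrier XA2"
  show "fst m w = fst m' w"
  proof (rule P.XA.in_fst_left_cancel)
    fix u assume u: "u \<in> carrier X"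
    show "fst (P.i1 u) (fst m w) = fst (P.i1 u) (fst m' w)"
      using arg_cong[OF e[OF u], of "\<lambda>n. fst n w"] u m w by simp
  qed (use m w in simp_all)
qed

text \<open>
  \<open>\<alpha>(z)(f \<otimes> 1) = \<alpha>(z f)\<close> is \<open>invariant_slice_coinvariant\<close>. The other half \<open>(f \<otimes> 1)\<alpha>(z) = \<alpha>(f z)\<close> follows by
  multiplying with \<open>\<alpha>(v)\<close> on the left, which can be cancelled.
\<close>

lemma F_coinvariant:
  assumes x: "x \<in> carrier X" shows "F x \<in> coinvariants K A X \<alpha>"
proof -
  let ?n = "multiplier_tens K X A (F x) \<one>\<^bsub>multiplier_algebra K A\<^esub>"
  note f = F_closed[OF x]
  have n: "?n \<in> carrier MXA" using f by (simp add: P.XA.multiplier_tens_closed)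
  have fc: "fst (F x) z \<in> carrier X" "snd (F x) z \<in> carrier X" if "z \<in> carrier X" for z
    by (rule X.fst_closed[OF f that], rule X.snd_closed[OF f that])
  have 2: "\<alpha> z \<otimes>\<^bsub>MXA\<^esub> ?n = \<alpha> (snd (F x) z)" if z: "z \<in> carrier X" for z
  proof (rule in_fst_cancel[OF P.XA.T.mult_closed[OF P.\<alpha>_closed[OF z] n] P.\<alpha>_closed[OF fc(2)[OF z]]])
    fix u assume u: "u \<in> carrier X"
    have B: "(\<lambda>y a. tens K X A (sX (P.\<gamma> y x)) a) \<in> bilinear_map K X A XA2"
      by (rule bilinear_mapI)
        (rule P.XA.tens_r, rule sX_closed, rule P.g_closed, assumption, rule x,
         rule P.XA.tens_lin_l[OF lin_comp[OF bilin_l[OF P.g_bilinear x] sX_linear]])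
    have "P.\<gamma> u (snd (F x) z) = tensor_lift K X A XA2 (\<lambda>y a. tens K X A (sX (P.\<gamma> y x)) a) (P.\<gamma> u z)"
      unfolding F_apply(2)[OF z] by (rule P.invariant_slice_coinvariant[OF \<phi> s_g u z x])
    also have "\<dots> = snd ?n (P.\<gamma> u z)"
      by (rule P.XA.lift_unique[OF XA2_module B P.XA.T.snd_linear[OF n] _ P.g_closed[OF u z]])
        (use f in \<open>simp add: P.XA.multiplier_tens_apply F_apply(2)\<close>)
    finally have e: "P.\<gamma> u (snd (F x) z) = snd ?n (P.\<gamma> u z)" .
    have "P.i1 u \<otimes>\<^bsub>MXA\<^esub> (\<alpha> z \<otimes>\<^bsub>MXA\<^esub> ?n) = as_multiplier XA2 (snd ?n (P.\<gamma> u z))"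
      using u z n by (simp add: P.as_ideal P.as_g P.XA.T.mult_assoc)
    also have "\<dots> = P.i1 u \<otimes>\<^bsub>MXA\<^esub> \<alpha> (snd (F x) z)"
      unfolding e[symmetric] by (rule P.as_g[OF u fc(2)[OF z]])
    finally show "P.i1 u \<otimes>\<^bsub>MXA\<^esub> (\<alpha> z \<otimes>\<^bsub>MXA\<^esub> ?n) = P.i1 u \<otimes>\<^bsub>MXA\<^esub> \<alpha> (snd (F x) z)" .
  qed
  have 1: "?n \<otimes>\<^bsub>MXA\<^esub> \<alpha> z = \<alpha> (fst (F x) z)" if z: "z \<in> carrier X" for z
  proof (rule coaction_cancel[OF P.XA.T.mult_closed[OF n P.\<alpha>_closed[OF z]] P.\<alpha>_closed[OF fc(1)[OF z]]])
    fix v assume v: "v \<in> carrier X"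
    have "\<alpha> v \<otimes>\<^bsub>MXA\<^esub> (?n \<otimes>\<^bsub>MXA\<^esub> \<alpha> z) = \<alpha> v \<otimes>\<^bsub>MXA\<^esub> ?n \<otimes>\<^bsub>MXA\<^esub> \<alpha> z"
      by (rule P.XA.T.mult_assoc[OF P.\<alpha>_closed[OF v] n P.\<alpha>_closed[OF z], symmetric])
    also have "\<dots> = \<alpha> (snd (F x) v \<otimes>\<^bsub>X\<^esub> z)"
      unfolding 2[OF v] by (rule P.\<alpha>_mult[OF fc(2)[OF v] z, symmetric])
    also have "\<dots> = \<alpha> v \<otimes>\<^bsub>MXA\<^esub> \<alpha> (fst (F x) z)"
      unfolding X.snd_fst[OF f v z] by (rule P.\<alpha>_mult[OF v fc(1)[OF z]])
    finally show "\<alpha> v \<otimes>\<^bsub>MXA\<^esub> (?n \<otimes>\<^bsub>MXA\<^esub> \<alpha> z) = \<alpha> v \<otimes>\<^bsub>MXA\<^esub> \<alpha> (fst (F x) z)" .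
  qed
  have "multiplier_extension K X XA2 \<alpha> (F x) = ?n"
    unfolding multiplier_extension_def
  proof (rule the_equality)
    show "?n \<in> carrier MXA \<and> (\<forall>z\<in>carrier X. ?n \<otimes>\<^bsub>MXA\<^esub> \<alpha> z = \<alpha> (fst (F x) z) \<and> \<alpha> z \<otimes>\<^bsub>MXA\<^esub> ?n = \<alpha> (snd (F x) z))"
      using n 1 2 by blast
  next
    fix n' assume n': "n' \<in> carrier MXA \<and> (\<forall>z\<in>carrier X. n' \<otimes>\<^bsub>MXA\<^esub> \<alpha> z = \<alpha> (fst (F x) z) \<and> \<alpha> z \<otimes>\<^bsub>MXA\<^esub> n' = \<alpha> (snd (F x) z))"
    show "n' = ?n" by (rule coaction_cancel[OF conjunct1[OF n'] n]) (use n' 2 in simp)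
  qed
  then show ?thesis using f by (simp add: coinvariants_def)
qed

text \<open>Any functional normalised at one vector recovers the scalar from the multiplier.\<close>

lemma invariant_functional_exists:
  "\<exists>\<phi>X\<in>linear_functional K X. \<forall>x\<in>carrier X. F x = \<phi>X x \<odot>\<^bsub>X.MX\<^esub> \<one>\<^bsub>X.MX\<^esub>"
proof -
  obtain z where z: "z \<in> carrier X" "z \<noteq> \<zero>\<^bsub>X\<^esub>" using X.nonzero X.M.zero_closed by blast
  obtain h where h: "h \<in> linear_functional K X" "h z = \<one>" using separating_functional[OF field_axioms X.X_module z] by blast
  have l: "(\<lambda>x. h (sX (P.\<gamma> z x))) \<in> linear_functional K X"
    by (rule fun_comp[OF lin_comp[OF bilin_r[OF P.g_bilinear z(1)] sX_linear] h(1)])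
  have "F x = h (sX (P.\<gamma> z x)) \<odot>\<^bsub>X.MX\<^esub> \<one>\<^bsub>X.MX\<^esub>" if x: "x \<in> carrier X" for x
  proof -
    have "F x \<in> {c \<odot>\<^bsub>X.MX\<^esub> \<one>\<^bsub>X.MX\<^esub> | c. c \<in> carrier K}"
      using F_coinvariant[OF x] unfolding coinvariants_trivial .
    then obtain c where c: "F x = c \<odot>\<^bsub>X.MX\<^esub> \<one>\<^bsub>X.MX\<^esub>" "c \<in> carrier K" by (elim CollectE exE conjE)
    have "sX (P.\<gamma> z x) = c \<odot>\<^bsub>X\<^esub> z"
      unfolding F_apply(2)[OF z(1), symmetric] c(1) using c(2) z(1) by simp
    then have "h (sX (P.\<gamma> z x)) = c" using c(2) h(2) fun_smult[OF h(1) c(2) z(1)] by simp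
    then show ?thesis using c(1) by simp
  qed
  then show ?thesis by (intro bexI[OF _ l] ballI)
qed

context
  fixes \<phi>X :: "'x \<Rightarrow> 'k"
  assumes \<phi>X: "\<phi>X \<in> linear_functional K X"
    and F: "x \<in> carrier X \<Longrightarrow> F x = \<phi>X x \<odot>\<^bsub>X.MX\<^esub> \<one>\<^bsub>X.MX\<^esub>"
begin

lemma \<phi>X_closed: "x \<in> carrier X \<Longrightarrow> \<phi>X x \<in> carrier K"
  by (rule fun_closed[OF \<phi>X])

lemma sX_g: "x \<in> carrier X \<Longrightarrow> z \<in> carrier X \<Longrightarrow> sX (P.\<gamma> z x) = \<phi>X x \<odot>\<^bsub>X\<^esub> z"
  using F_apply(2)[of z x] \<phi>X_closed by (simp add: F)

lemma sX_W: "x \<in> carrier X \<Longrightarrow> z \<in> carrier X \<Longrightarrow> sX (W x z) = \<phi>X x \<odot>\<^bsub>X\<^esub> z"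
  using F_apply(1)[of z x] \<phi>X_closed by (simp add: F)

text \<open>
  Both sides of \<open>coassoc_slice_mid\<close> for \<open>h = \<phi>\<close> are of the form \<open>z \<otimes> a'\<close>: on the left \<open>\<phi>_X\<close> appears through
  \<open>z x\<^sub>0 \<phi>(x\<^sub>1) = \<phi>_X(x) z\<close>, on the right \<open>\<delta>\<close> through the definition of the modular element.
\<close>

lemma modular_slices:
  assumes x: "x \<in> carrier X" and a: "a \<in> carrier A"
  shows "slice_fst K X A \<phi>X (P.\<rho> x a) = \<phi>X x \<odot>\<^bsub>A\<^esub> fst \<delta> a"
    "slice_fst K X A \<phi>X (P.\<Lambda> a x) = \<phi>X x \<odot>\<^bsub>A\<^esub> snd \<delta> a"
proof -
  obtain z where z: "z \<in> carrier X" "z \<noteq> \<zero>\<^bsub>X\<^esub>" using X.nonzero X.M.zero_closed by blast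
  obtain h where h: "h \<in> linear_functional K X" "h z = \<one>" using separating_functional[OF field_axioms X.X_module z] by blast
  have cancel: "p = q" if "p \<in> carrier A" "q \<in> carrier A" "tens K X A z p = tens K X A z q" for p q
    using arg_cong[OF that(3), of "slice_fst K X A h"] that(1,2) z(1) h by (simp add: P.XA.slice_fst_tens)
  have sc: "slice_fst K X A \<phi>X w \<in> carrier A" if "w \<in> carrier XA2" for w
    by (rule lin_closed[OF P.XA.slice_fst_linear[OF \<phi>X] that])
  have L: "tensor_lift K X A XA2 (\<lambda>x a. tens K X A (sX (P.\<gamma> z x)) a) w = tens K X A z (slice_fst K X A \<phi>X w)"
    if w: "w \<in> carrier XA2" for w
  proof (rule P.XA.lift_unique[OF XA2_module _ P.XA.tens_lin_r[OF P.XA.slice_fst_linear[OF \<phi>X] z(1)] _ w])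
    show "(\<lambda>x a. tens K X A (sX (P.\<gamma> z x)) a) \<in> bilinear_map K X A XA2"
      by (rule bilinear_mapI)
        (rule P.XA.tens_r, rule sX_closed, rule P.g_closed, rule z(1), assumption,
         rule P.XA.tens_lin_l[OF lin_comp[OF bilin_r[OF P.g_bilinear z(1)] sX_linear]])
  qed (use z(1) \<phi>X_closed in \<open>simp add: sX_g P.XA.slice_fst_tens[OF \<phi>X] lin_smult[OF P.XA.tens_l] lin_smult[OF P.XA.tens_r]\<close>)
  have R: "tensor_lift K X A XA2 B (P.\<gamma> z x) = tens K X A z (\<phi>X x \<odot>\<^bsub>A\<^esub> d)"
    if d: "d \<in> carrier A" and B: "B \<in> bilinear_map K X A XA2"
      and e: "\<And>y c. y \<in> carrier X \<Longrightarrow> c \<in> carrier A \<Longrightarrow> B y c = tens K X A y (\<phi> c \<odot>\<^bsub>A\<^esub> d)" for d B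
  proof -
    have "tensor_lift K X A XA2 B (P.\<gamma> z x) = tens K X A (sX (P.\<gamma> z x)) d"
      by (rule P.XA.lift_unique[OF XA2_module B P.XA.tens_lin_l[OF sX_linear d] _ P.g_closed[OF z(1) x]])
        (use d in \<open>simp add: e P.XA.slice_snd_tens[OF \<phi>] fun_closed[OF \<phi>] lin_smult[OF P.XA.tens_l] lin_smult[OF P.XA.tens_r]\<close>)
    then show ?thesis
      using x z(1) d \<phi>X_closed by (simp add: sX_g lin_smult[OF P.XA.tens_l] lin_smult[OF P.XA.tens_r])
  qed
  have d: "fst \<delta> a \<in> carrier A" "snd \<delta> a \<in> carrier A" by (rule fst_closed[OF \<delta>_closed a], rule snd_closed[OF \<delta>_closed a])
  show "slice_fst K X A \<phi>X (P.\<rho> x a) = \<phi>X x \<odot>\<^bsub>A\<^esub> fst \<delta> a"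
  proof (rule cancel)
    show "tens K X A z (slice_fst K X A \<phi>X (P.\<rho> x a)) = tens K X A z (\<phi>X x \<odot>\<^bsub>A\<^esub> fst \<delta> a)"
      unfolding L[OF P.r_closed[OF x a], symmetric] P.coassoc_slice_mid(1)[OF \<phi> z(1) x a]
      by (rule R[OF d(1) P.slice_mid_bil(2)[OF \<phi> a]]) (simp add: p_r a)
  qed (use sc x a d \<phi>X_closed in simp_all)
  show "slice_fst K X A \<phi>X (P.\<Lambda> a x) = \<phi>X x \<odot>\<^bsub>A\<^esub> snd \<delta> a"
  proof (rule cancel)
    show "tens K X A z (slice_fst K X A \<phi>X (P.\<Lambda> a x)) = tens K X A z (\<phi>X x \<odot>\<^bsub>A\<^esub> snd \<delta> a)"
      unfolding L[OF P.l_closed[OF a x], symmetric] P.coassoc_slice_mid(2)[OF \<phi> z(1) x a]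
      by (rule R[OF d(2) P.slice_mid_bil(3)[OF \<phi> a]]) (simp add: p_l a)
  qed (use sc x a d \<phi>X_closed in simp_all)
qed

lemma \<phi>X_invariant: "invariant_functional K A X \<alpha> \<delta> \<phi>X"
proof -
  have "multiplier_slice_fst K X A \<phi>X (\<alpha> x) = \<phi>X x \<odot>\<^bsub>multiplier_algebra K A\<^esub> \<delta>" if x: "x \<in> carrier X" for x
  proof -
    have "multiplier_slice_fst K X A \<phi>X (\<alpha> x) =
        (\<lambda>a\<in>carrier A. slice_fst K X A \<phi>X (P.\<rho> x a), \<lambda>a\<in>carrier A. slice_fst K X A \<phi>X (P.\<Lambda> a x))"
      unfolding multiplier_slice_fst_def act_r_def act_l_def ..
    also have "\<dots> = (\<lambda>a\<in>carrier A. \<phi>X x \<odot>\<^bsub>A\<^esub> fst \<delta> a, \<lambda>a\<in>carrier A. \<phi>X x \<odot>\<^bsub>A\<^esub> snd \<delta> a)"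
      by (intro prod_eqI; unfold fst_conv snd_conv; intro restrict_ext) (simp_all only: modular_slices x)
    also have "\<dots> = \<phi>X x \<odot>\<^bsub>multiplier_algebra K A\<^esub> \<delta>" by (simp add: multiplier_algebra_def)
    finally show ?thesis .
  qed
  then show ?thesis unfolding invariant_functional_def by blast
qed

text \<open>
  \<open>\<phi>_X(y x) z\<close> is the slice of \<open>(z \<otimes> 1)\<alpha>(y)\<alpha>(x)\<close>, so \<open>\<phi>_X(X x) = 0\<close> makes all slices of \<open>w\<alpha>(x)\<close> vanish. Taking
  \<open>w = e \<otimes> a\<close> gives \<open>(\<iota> \<otimes> \<phi>)((1 \<otimes> a)\<alpha>(x)) = 0\<close>, and then \<open>(1 \<otimes> a)\<alpha>(x) = 0\<close> as the functionals \<open>\<phi>(q \<cdot>)\<close>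
  separate \<open>A\<close>.
\<close>

lemma \<phi>X_faithful_l:
  assumes x: "x \<in> carrier X" and z: "\<And>y. y \<in> carrier X \<Longrightarrow> \<phi>X (y \<otimes>\<^bsub>X\<^esub> x) = \<zero>"
  shows "x = \<zero>\<^bsub>X\<^esub>"
proof (rule P.\<alpha>_eq_zero[OF coaction_inj x])
  note l = lin_comp[OF P.XA.T.snd_linear[OF P.\<alpha>_closed[OF x]] sX_linear]
  have 0: "sX (snd (\<alpha> x) w) = \<zero>\<^bsub>X\<^esub>" if w: "w \<in> carrier XA2" for w
  proof -
    have "w \<in> {w \<in> carrier XA2. sX (snd (\<alpha> x) w) \<in> {\<zero>\<^bsub>X\<^esub>}}"
    proof (rule gal_induct[OF vimage_submod[OF XA2_module X.X_module l zero_submod[OF X.X_module]] _ w])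
      fix u y assume u: "u \<in> carrier X" and y: "y \<in> carrier X"
      have "sX (snd (\<alpha> x) (P.\<gamma> u y)) = \<zero>\<^bsub>X\<^esub>"
        unfolding P.g_mult[OF y x u, symmetric] sX_g[OF X.amult_closed[OF y x] u] z[OF y] by (rule X.smult_l_null[OF u])
      then show "P.\<gamma> u y \<in> {w \<in> carrier XA2. sX (snd (\<alpha> x) w) \<in> {\<zero>\<^bsub>X\<^esub>}}" using u y by simp
    qed
    then show ?thesis by simp
  qed
  have 1: "sX (P.\<Lambda> a x) = \<zero>\<^bsub>X\<^esub>" if a: "a \<in> carrier A" for a
  proof (rule X.nondegenerate_r[OF sX_closed[OF P.l_closed[OF a x]]])
    fix e assume e: "e \<in> carrier X"
    have "e \<otimes>\<^bsub>X\<^esub> sX (P.\<Lambda> a x) = sX (snd (\<alpha> x) (tens K X A e a))"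
      unfolding P.tens_\<alpha>[OF x e a] P.slice_snd_i1(1)[OF \<phi> e P.l_closed[OF a x]] ..
    then show "e \<otimes>\<^bsub>X\<^esub> sX (P.\<Lambda> a x) = \<zero>\<^bsub>X\<^esub>" using 0[OF P.XA.tens_closed[OF e a]] by simp
  qed
  fix a assume a: "a \<in> carrier A"
  show "P.\<Lambda> a x = \<zero>\<^bsub>XA2\<^esub>"
  proof (rule P.XA.tensor_eqI_snd[OF _ \<phi>_separates_r P.l_closed[OF a x]], rule image_subsetI, rule \<phi>l)
    fix k assume "k \<in> (\<lambda>q a. \<phi> (q \<otimes>\<^bsub>A\<^esub> a)) ` carrier A"
    then obtain q where q: "k = (\<lambda>a. \<phi> (q \<otimes>\<^bsub>A\<^esub> a))" "q \<in> carrier A" by (rule imageE)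
    show "slice_snd K X A k (P.\<Lambda> a x) = \<zero>\<^bsub>X\<^esub>"
      unfolding q(1) P.slice_snd_i2(1)[OF \<phi> q(2) P.l_closed[OF a x], symmetric] P.l_l[OF x a q(2), symmetric]
      by (rule 1[OF amult_closed[OF q(2) a]])
  qed
qed

text \<open>
  \<open>\<phi>_X(x y) e\<close> is the slice of \<open>\<alpha>(x)\<alpha>(y)(e \<otimes> 1)\<close>. By \<open>W_spans\<close> the slices of \<open>\<alpha>(x)\<alpha>(u)(1 \<otimes> d)\<close> vanish as well,
  so \<open>\<alpha>(x u) = 0\<close> for all \<open>u\<close>.
\<close>

lemma \<phi>X_faithful_r:
  assumes x: "x \<in> carrier X" and z: "\<And>y. y \<in> carrier X \<Longrightarrow> \<phi>X (x \<otimes>\<^bsub>X\<^esub> y) = \<zero>"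
  shows "x = \<zero>\<^bsub>X\<^esub>"
proof (rule X.nondegenerate_l[OF x])
  fix u assume u: "u \<in> carrier X"
  note xu = X.amult_closed[OF x u] and l = lin_comp[OF P.XA.T.fst_linear[OF P.\<alpha>_closed[OF x]] sX_linear]
  have 1: "sX (P.\<rho> (x \<otimes>\<^bsub>X\<^esub> u) d) = \<zero>\<^bsub>X\<^esub>" if d: "d \<in> carrier A" for d
    unfolding P.r_mult[OF x u d]
  proof (rule W_spans[OF X.X_module l _ u d])
    fix y e assume y: "y \<in> carrier X" and e: "e \<in> carrier X"
    show "sX (fst (\<alpha> x) (W y e)) = \<zero>\<^bsub>X\<^esub>"
      unfolding W_mult(2)[OF x y e, symmetric] sX_W[OF X.amult_closed[OF x y] e] z[OF y] by (rule X.smult_l_null[OF e])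
  qed
  have 2: "P.\<rho> (x \<otimes>\<^bsub>X\<^esub> u) d = \<zero>\<^bsub>XA2\<^esub>" if d: "d \<in> carrier A" for d
  proof (rule P.XA.tensor_eqI_snd[OF _ \<phi>_separates_l P.r_closed[OF xu d]], rule image_subsetI, rule \<phi>r)
    fix k assume "k \<in> (\<lambda>q a. \<phi> (a \<otimes>\<^bsub>A\<^esub> q)) ` carrier A"
    then obtain q where q: "k = (\<lambda>a. \<phi> (a \<otimes>\<^bsub>A\<^esub> q))" "q \<in> carrier A" by (rule imageE)
    show "slice_snd K X A k (P.\<rho> (x \<otimes>\<^bsub>X\<^esub> u) d) = \<zero>\<^bsub>X\<^esub>"
      unfolding q(1) P.slice_snd_i2(2)[OF \<phi> q(2) P.r_closed[OF xu d], symmetric] P.r_r[OF xu q(2) d, symmetric]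
      by (rule 1[OF amult_closed[OF d q(2)]])
  qed
  show "x \<otimes>\<^bsub>X\<^esub> u = \<zero>\<^bsub>X\<^esub>"
    by (rule P.\<alpha>_eq_zero[OF coaction_inj xu P.r_eq_zero_l[OF xu 2]])
qed

lemma \<phi>X_faithful: "faithful_functional K X \<phi>X"
  unfolding faithful_functional_def using \<phi>X_faithful_r \<phi>X_faithful_l by blast

end

end

theorem proposition2p2:
  fixes K :: "('k, 'r) ring_scheme"
    and A :: "('k, 'a, 'm) module_scheme"
    and X :: "('k, 'x, 'n) module_scheme"
  assumes "algebraic_quantum_group K A \<Delta> \<phi>"
    and "modular_element K A \<Delta> \<phi> \<delta>"
    and "galois_object K A \<Delta> X \<alpha>"
  shows "\<exists>\<phi>\<^sub>X. \<phi>\<^sub>X \<in> linear_functional K X \<and>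
    faithful_functional K X \<phi>\<^sub>X \<and>
    invariant_functional K A X \<alpha> \<delta> \<phi>\<^sub>X \<and>
    (\<forall>x\<in>carrier X. multiplier_slice_snd K X A \<phi> (\<alpha> x) =
      \<phi>\<^sub>X x \<odot>\<^bsub>multiplier_algebra K X\<^esub> \<one>\<^bsub>multiplier_algebra K X\<^esub>)"
proof -
  interpret galois_modular K A \<Delta> \<phi> \<delta> X \<alpha>
    by (intro galois_modular.intro modular_quantum_group.intro modular_quantum_group_axioms.intro assms)
  obtain f where f: "f \<in> linear_functional K X"
    and F: "\<And>x. x \<in> carrier X \<Longrightarrow> F x = f x \<odot>\<^bsub>X.MX\<^esub> \<one>\<^bsub>X.MX\<^esub>"
    using invariant_functional_exists by blast
  show ?thesis using f F \<phi>X_faithful[OF f F] \<phi>X_invariant[OF f F] by blast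
qed

end
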